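(* Let $\nu$ be a Borel probability measure on $\mathbb{R}^2$, and let $R_\nu$ be its bi-free $R$-transform defined on a product domain $\Omega$. The law $\nu$ is bi-freely infinitely divisible if and only if there exist probability measures $\mu_n$ on $\mathbb{R}^2$ and unbounded positive integers $k_n$ such that $[\mu_n^{(j)}]^{\boxplus k_n}\Rightarrow\nu^{(j)}$ for $j=1,2$ and $R_\nu=\lim_{n\to\infty}k_nR_{\mu_n}$ (pointwise) in $\Omega$.
   Context: For a Borel probability measure $\mu$ on $\mathbb{R}^2$, its marginals are $\mu^{(j)}=\mu\circ\pi_j^{-1}$, $j=1,2$, where $\pi_1(s,t)=s$, $\pi_2(s,t)=t$, and its Cauchy transform is $G_\mu(z,w)=\int_{\mathbb{R}^2}\frac{1}{(z-s)(w-t)}\,d\mu(s,t)$ for $z,w\in\mathbb{C}\setminus\mathbb{R}$. For a probability measure $m$ on $\mathbb{R}$, $G_m(z)=\int_{\mathbb{R}}\frac{1}{z-x}\,dm(x)$, $z\notin\mathbb{R}$. For $\alpha,\beta>0$ the Stolz angle is $\Delta=\Delta_{\alpha,\beta}=\{x+iy\in\mathbb{C}: y<0,\ |x|<-\alpha y,\ y>-\beta\}$, $\overline{\Delta}=\{\bar z:z\in\Delta\}$ is its reflection, and the associated product domain is $\Omega=(\Delta\cup\overline\Delta)\times(\Delta\cup\overline\Delta)$. The one-dimensional $R$-transform $R_m$ of a probability measure $m$ on $\mathbb{R}$ is the holomorphic function on $\Delta\cup\overline\Delta$ (for a sufficiently small Stolz angle $\Delta$) with $1/z+R_m(z)\notin\mathbb{R}$,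 $G_m(1/z+R_m(z))=z$, and $zR_m(z)\to0$ as $z\to0$ in $\Delta\cup\overline\Delta$. The bi-free partial $R$-transform of a probability measure $\mu$ on $\mathbb{R}^2$ is $$R_\mu(z,w)=zR_{\mu^{(1)}}(z)+wR_{\mu^{(2)}}(w)+\left[1-\frac{1}{h_\mu(z,w)}\right],\quad h_\mu(z,w)=\frac{G_\mu\left(1/z+R_{\mu^{(1)}}(z),\,1/w+R_{\mu^{(2)}}(w)\right)}{zw},$$ which is defined and holomorphic on a product domain (with $\Delta$ small enough) on which $R_{\mu^{(1)}},R_{\mu^{(2)}}$ are defined and $h_\mu$ has no zeros; $R_\mu$ also denotes the holomorphic extension of this function to a larger product domain whenever such an extension exists. A probability measure $\nu$ on $\mathbb{R}^2$ with $R$-transform $R_\nu$ on a product domain $\Omega$ is bi-freely infinitely divisible if for each integer $m\ge2$ there exists a probability law $\mu_m$ on $\mathbb{R}^2$ such that $R_\nu=mR_{\mu_m}$ in $\Omega$. $\boxplus$ denotes free additive convolution of probability measures on $\mathbb{R}$, $m^{\boxplus k}$ the $k$-fold free convolution of $m$ with itself, and $\Rightarrow$ weak convergence of measures. *)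

theory Defs
  imports "HOL-Probability.Probability"
begin

definition borel_prob :: "'a::topological_space measure \<Rightarrow> bool" where
  "borel_prob M \<longleftrightarrow> prob_space M \<and> sets M = sets borel"

definition marginal1 :: "(real \<times> real) measure \<Rightarrow> real measure" where
  "marginal1 \<mu> = distr \<mu> borel fst"

definition marginal2 :: "(real \<times> real) measure \<Rightarrow> real measure" where
  "marginal2 \<mu> = distr \<mu> borel snd"

definition cauchy_transform :: "real measure \<Rightarrow> complex \<Rightarrow> complex" where
  "cauchy_transform m z = (LINT x|m. 1 / (z - complex_of_real x))"

definition cauchy_transform2 :: "(real \<times> real) measure \<Rightarrow> complex \<Rightarrow> complex \<Rightarrow> complex" where
  "cauchy_transform2 \<mu> z w =
     (LINT p|\<mu>. 1 / ((z - complex_of_real (fst p)) * (w - complex_of_real (snd p))))"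

definition stolz_angle :: "real \<Rightarrow> real \<Rightarrow> complex set" where
  "stolz_angle \<alpha> \<beta> = {z. Im z < 0 \<and> \<bar>Re z\<bar> < - \<alpha> * Im z \<and> Im z > - \<beta>}"

definition stolz_double :: "real \<Rightarrow> real \<Rightarrow> complex set" where
  "stolz_double \<alpha> \<beta> = stolz_angle \<alpha> \<beta> \<union> cnj ` stolz_angle \<alpha> \<beta>"

definition product_domain :: "real \<Rightarrow> real \<Rightarrow> (complex \<times> complex) set" where
  "product_domain \<alpha> \<beta> = stolz_double \<alpha> \<beta> \<times> stolz_double \<alpha> \<beta>"

text \<open>Holomorphy in two complex variables on an open set: the real Frechet derivative exists at
  every point and is complex linear.\<close>

definition holomorphic2_on :: "(complex \<times> complex \<Rightarrow> complex) \<Rightarrow> (complex \<times> complex) set \<Rightarrow> bool" where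
  "holomorphic2_on f S \<longleftrightarrow>
     (\<forall>p\<in>S. \<exists>a b. (f has_derivative (\<lambda>v. a * fst v + b * snd v)) (at p))"

text \<open>The function \<open>R\<close> is the \<open>R\<close>-transform of \<open>m\<close> on the doubled Stolz angle with parameters
  \<open>\<alpha>\<close>, \<open>\<beta>\<close>. Its values elsewhere are irrelevant; on the doubled Stolz angle the conditions
  determine it.\<close>

definition R_transform_on :: "real measure \<Rightarrow> real \<Rightarrow> real \<Rightarrow> (complex \<Rightarrow> complex) \<Rightarrow> bool" where
  "R_transform_on m \<alpha> \<beta> R \<longleftrightarrow>
     R holomorphic_on stolz_double \<alpha> \<beta> \<and>
     (\<forall>z\<in>stolz_double \<alpha> \<beta>. 1 / z + R z \<notin> \<real> \<and> cauchy_transform m (1 / z + R z) = z) \<and>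
     ((\<lambda>z. z * R z) \<longlongrightarrow> 0) (at 0 within stolz_double \<alpha> \<beta>)"

definition bifree_h ::
  "(real \<times> real) measure \<Rightarrow> (complex \<Rightarrow> complex) \<Rightarrow> (complex \<Rightarrow> complex) \<Rightarrow> complex \<Rightarrow> complex \<Rightarrow> complex" where
  "bifree_h \<mu> R1 R2 z w = cauchy_transform2 \<mu> (1 / z + R1 z) (1 / w + R2 w) / (z * w)"

text \<open>The function \<open>F\<close> is the bi-free partial \<open>R\<close>-transform of \<open>\<mu>\<close> on the product domain with
  parameters \<open>\<alpha>\<close>, \<open>\<beta>\<close>, possibly as the holomorphic extension from a smaller product domain
  (parameters \<open>\<alpha>'\<close>, \<open>\<beta>'\<close>) on which the defining formula makes sense. The smaller domain meets all
  four components of the larger one, so the extension is unique.\<close>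

definition bifree_R_transform_on ::
  "(real \<times> real) measure \<Rightarrow> real \<Rightarrow> real \<Rightarrow> (complex \<times> complex \<Rightarrow> complex) \<Rightarrow> bool" where
  "bifree_R_transform_on \<mu> \<alpha> \<beta> F \<longleftrightarrow>
     holomorphic2_on F (product_domain \<alpha> \<beta>) \<and>
     (\<exists>\<alpha>' \<beta>' R1 R2. 0 < \<alpha>' \<and> \<alpha>' \<le> \<alpha> \<and> 0 < \<beta>' \<and> \<beta>' \<le> \<beta> \<and>
        R_transform_on (marginal1 \<mu>) \<alpha>' \<beta>' R1 \<and> R_transform_on (marginal2 \<mu>) \<alpha>' \<beta>' R2 \<and>
        (\<forall>(z, w)\<in>product_domain \<alpha>' \<beta>'.
           bifree_h \<mu> R1 R2 z w \<noteq> 0 \<and>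
           F (z, w) = z * R1 z + w * R2 w + (1 - 1 / bifree_h \<mu> R1 R2 z w)))"

definition bifree_infinitely_divisible ::
  "(real \<times> real) measure \<Rightarrow> real \<Rightarrow> real \<Rightarrow> (complex \<times> complex \<Rightarrow> complex) \<Rightarrow> bool" where
  "bifree_infinitely_divisible \<nu> \<alpha> \<beta> R\<^sub>\<nu> \<longleftrightarrow>
     bifree_R_transform_on \<nu> \<alpha> \<beta> R\<^sub>\<nu> \<and>
     (\<forall>m::nat. m \<ge> 2 \<longrightarrow>
        (\<exists>\<mu> F. borel_prob \<mu> \<and> bifree_R_transform_on \<mu> \<alpha> \<beta> F \<and>
           (\<forall>p\<in>product_domain \<alpha> \<beta>. R\<^sub>\<nu> p = of_nat m * F p)))"

text \<open>The free additive convolution of arbitrary (not necessarily compactly supported) laws, in its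
  analytic form: the law whose \<open>R\<close>-transform is the sum of the \<open>R\<close>-transforms of the two given
  laws, on a common Stolz angle. Such a law always exists and is unique, since the \<open>R\<close>-transform
  near 0 determines the Cauchy transform.\<close>

definition free_conv :: "real measure \<Rightarrow> real measure \<Rightarrow> real measure" (infixl \<open>\<boxplus>\<close> 65) where
  "m1 \<boxplus> m2 = (THE m. borel_prob m \<and>
     (\<exists>\<alpha> \<beta> R1 R2. 0 < \<alpha> \<and> 0 < \<beta> \<and> R_transform_on m1 \<alpha> \<beta> R1 \<and> R_transform_on m2 \<alpha> \<beta> R2 \<and>
        R_transform_on m \<alpha> \<beta> (\<lambda>z. R1 z + R2 z)))"

text \<open>The point mass at 0 is the neutral element of free convolution, so the value at
  \<open>Suc 0\<close> is \<open>m\<close> for every Borel probability measure \<open>m\<close>.\<close>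

primrec free_conv_power :: "real measure \<Rightarrow> nat \<Rightarrow> real measure" where
  "free_conv_power m 0 = return borel 0"
| "free_conv_power m (Suc k) = m \<boxplus> free_conv_power m k"

end

theory Submission
  imports Defs "HOL-Complex_Analysis.Complex_Analysis"
begin

text \<open>If \<open>\<nu>\<close> is infinitely divisible, the \<open>m\<close>-th roots with \<open>k = m\<close> form the required sequence: letting one variable
  of the bi-free \<open>R\<close>-transform tend to 0 recovers the \<open>R\<close>-transforms of the marginals, so the marginals of
  the roots have the marginals of \<open>\<nu>\<close> as their free convolution powers.

  Conversely, every planar law has bi-free convolution powers of all real exponents \<open>\<kappa> + 1 \<ge> 1\<close>. Their Cauchy
  transform is given explicitly in terms of the subordination functions, the inverses of
  \<open>w - \<kappa> (1 / G w - w)\<close>, and a function of two variables is the Cauchy transform of a planar law as soon as its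
  Poisson-type real part is positive, which for the powers is a covariance inequality. To find an \<open>m\<close>-th root of a limit
  law \<open>\<nu>\<close>, take the powers of \<open>\<mu>\<^sub>n\<close> with exponent \<open>k\<^sub>n div m\<close>. Their \<open>R\<close>-transforms converge to \<open>R\<^sub>\<nu> / m\<close> on a
  fixed product domain, which prevents mass from escaping to infinity, and every weak limit point is the root.\<close>

section \<open>Resolvents and Cauchy transforms\<close>

text \<open>Two obstacles shape the proof. The \<open>F n\<close> are given on one fixed product
  domain, but only as extensions: the R-transforms of the marginals of \<open>\<mu> n\<close> might
  live on Stolz angles that shrink with n. Weak convergence repairs this. The tail functional
  \<open>tB\<close> converges along with the laws, so the R-transforms of the k-fold marginal powers
  exist on one common Stolz angle, and subordination carries this domain back to the marginals.
  Second, \<open>\<mu> n\<close> need not have an m-th root and m need not divide k, so the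
  approximate root of \<nu> is a power of \<open>\<mu> n\<close>; (k div m) / k tends to 1 / m along
  a subsequence.

  For the existence of powers, all laws are built from their transforms. Keeping z and w fixed,
  multiplication of R by \<kappa> + 1 dictates the new evaluation points and the new value of the
  Cauchy transform; it remains to prove that the resulting function comes from a positive measure.
  Since \<open>\<boxplus>\<close> is a definite description, one-dimensional powers need an
  existence proof too; they come from planar powers of laws on the diagonal.\<close>

definition res :: "complex \<Rightarrow> real \<Rightarrow> complex" where
  "res z s = 1 / (z - complex_of_real s)"

lemma res_measurable [measurable]: "res z \<in> borel_measurable borel"
  unfolding res_def by measurable

lemma res_nonzero: "Im z \<noteq> 0 \<Longrightarrow> z - complex_of_real s \<noteq> 0"
  by (metis Im_complex_of_real eq_iff_diff_eq_0)

lemma norm_res_le: "Im z \<noteq> 0 \<Longrightarrow> cmod (res z s) \<le> 1 / \<bar>Im z\<bar>"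
  unfolding res_def norm_divide norm_one
  by (rule divide_left_mono) (use abs_Im_le_cmod[of "z - of_real s"] res_nonzero[of z s] in auto)

lemma cnj_res: "cnj (res z s) = res (cnj z) s"
  by (simp add: res_def)

lemma Im_res: "Im (res z s) = - Im z * (cmod (res z s))\<^sup>2"
  by (cases "z = of_real s") (auto simp: res_def Im_divide norm_divide power_divide cmod_power2)

lemma res_diff: "Im z \<noteq> 0 \<Longrightarrow> Im z' \<noteq> 0 \<Longrightarrow> res z s - res z' s = (z' - z) * res z s * res z' s"
  using res_nonzero[of z s] res_nonzero[of z' s] by (simp add: res_def field_simps)

lemma mult_res: "Im z \<noteq> 0 \<Longrightarrow> z * res z s = 1 + of_real s * res z s"
  using res_nonzero[of z s] by (simp add: res_def field_simps)

lemma (in finite_measure) integrable_bounded: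
  fixes g :: "'a \<Rightarrow> 'b::{banach, second_countable_topology}"
  assumes "g \<in> borel_measurable M" "\<And>x. norm (g x) \<le> B"
  shows "integrable M g"
  using assms by (intro integrable_const_bound[of _ B]) auto

lemma integral_Cauchy_Schwarz:
  fixes f g :: "'a \<Rightarrow> complex"
  assumes [measurable]: "f \<in> borel_measurable M" "g \<in> borel_measurable M"
    and f: "integrable M (\<lambda>x. (cmod (f x))\<^sup>2)" and g: "integrable M (\<lambda>x. (cmod (g x))\<^sup>2)"
  shows "(cmod (LINT x|M. f x * g x))\<^sup>2 \<le> (LINT x|M. (cmod (f x))\<^sup>2) * (LINT x|M. (cmod (g x))\<^sup>2)"
proof -
  define A where "A = (LINT x|M. (cmod (f x))\<^sup>2)"
  define B where "B = (LINT x|M. (cmod (g x))\<^sup>2)"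
  define C where "C = (LINT x|M. cmod (f x) * cmod (g x))"
  have bd: "cmod (f x) * cmod (g x) \<le> (cmod (f x))\<^sup>2 + (cmod (g x))\<^sup>2" for x
  proof -
    have "0 \<le> (cmod (f x) - cmod (g x))\<^sup>2" by simp
    moreover have "0 \<le> cmod (f x) * cmod (g x)" by simp
    ultimately show ?thesis unfolding power2_diff by linarith
  qed
  have fg: "integrable M (\<lambda>x. cmod (f x) * cmod (g x))"
    by (rule Bochner_Integration.integrable_bound[OF Bochner_Integration.integrable_add[OF f g]])
      (use bd in auto)
  have q: "0 \<le> t\<^sup>2 * A - 2 * t * C + B" for t
  proof -
    have "0 \<le> (LINT x|M. (t * cmod (f x) - cmod (g x))\<^sup>2)" by simp
    also have "\<dots> = (LINT x|M. t\<^sup>2 * (cmod (f x))\<^sup>2 - 2 * t * (cmod (f x) * cmod (g x)) + (cmod (g x))\<^sup>2)"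
      by (intro Bochner_Integration.integral_cong refl) (simp add: power2_eq_square algebra_simps)
    also have "\<dots> = t\<^sup>2 * A - 2 * t * C + B"
      using f g fg by (simp add: A_def B_def C_def)
    finally show ?thesis .
  qed
  have A0: "0 \<le> A" by (simp add: A_def)
  have "C\<^sup>2 \<le> A * B"
  proof (cases "A = 0")
    case True
    have "C = 0"
    proof (rule ccontr)
      assume "C \<noteq> 0"
      \<comment> \<open>For A = 0 the quadratic is \<open>B - 2 * t * C\<close>, and this t makes it
        -1.\<close>
      with q[of "(B + 1) / (2 * C)"] True show False by (simp add: field_simps)
    qed
    then show ?thesis using True by simp
  next
    case False
    with A0 have "0 < A" by simp
    with q[of "C / A"] show ?thesis
      by (simp add: field_simps power2_eq_square)
  qed
  moreover have "cmod (LINT x|M. f x * g x) \<le> C"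
    unfolding C_def using integral_norm_bound[of M "\<lambda>x. f x * g x"] by (simp add: norm_mult)
  ultimately show ?thesis
    unfolding A_def[symmetric] B_def[symmetric] by (meson norm_ge_zero order_trans power_mono)
qed

text \<open>In the cone \<open>z * res z s\<close> is bounded, hence so is s times the resolvent,
  which differs from it by 1. For small s the trivial bound |s| / |Im z| is better. The minimum of
  the two is integrable for every law, so no moment is ever assumed.\<close>

lemma norm_res_cone:
  assumes z: "Im z \<noteq> 0" and A: "\<bar>Re z\<bar> \<le> A * \<bar>Im z\<bar>" and B: "B \<le> \<bar>Im z\<bar>" "0 < B"
  shows "cmod (of_real s * res z s) \<le> (2 + A) * min 1 (\<bar>s\<bar> / B)"
proof -
  have A0: "0 \<le> A" using A z by (smt (verit) abs_ge_zero mult_neg_pos zero_less_abs_iff)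
  have "cmod z \<le> \<bar>Re z\<bar> + \<bar>Im z\<bar>" by (rule cmod_le)
  hence "cmod z \<le> (1 + A) * \<bar>Im z\<bar>" using A by (simp add: algebra_simps)
  hence "cmod (z * res z s) \<le> (1 + A) * \<bar>Im z\<bar> * (1 / \<bar>Im z\<bar>)"
    unfolding norm_mult using A0 norm_res_le[OF z] by (intro mult_mono) auto
  hence 1: "cmod (z * res z s) \<le> 1 + A" using z by simp
  have "of_real s * res z s = z * res z s - 1" using mult_res[OF z] by simp
  hence a: "cmod (of_real s * res z s) \<le> 2 + A"
    using norm_triangle_ineq4[of "z * res z s" 1] 1 by simp
  have "1 / \<bar>Im z\<bar> \<le> 1 / B" using B by (intro divide_left_mono) auto
  hence "cmod (res z s) \<le> 1 / B" using norm_res_le[OF z, of s] by simp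
  hence "cmod (of_real s * res z s) \<le> \<bar>s\<bar> * (1 / B)"
    unfolding norm_mult by (intro mult_mono) auto
  also have "\<dots> \<le> (2 + A) * (\<bar>s\<bar> / B)"
    using A0 B mult_right_mono[of 1 "2 + A" "\<bar>s\<bar> / B"] by simp
  finally have b: "cmod (of_real s * res z s) \<le> (2 + A) * (\<bar>s\<bar> / B)" .
  show ?thesis using a b by (simp add: min_def)
qed

text \<open>A random variable rather than a law on the line: the same lemmas then serve a
  one-dimensional law, with f the identity, and either coordinate of a planar law, where functions
  of both coordinates are integrated over one space.\<close>

locale real_rv = prob_space M for M :: "'a measure" +
  fixes f :: "'a \<Rightarrow> real"
  assumes f_measurable [measurable]: "f \<in> borel_measurable M"
begin

definition G :: "complex \<Rightarrow> complex" where
  "G z = (LINT p|M. res z (f p))"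

text \<open>The Nevanlinna part of the reciprocal Cauchy transform. At a point z = 1 / u + R u with
  G z = u it equals - R u.\<close>

definition h :: "complex \<Rightarrow> complex" where
  "h z = 1 / G z - z"

text \<open>The resolvent normalised to mean 1 and then centred. Its covariances are the divided
  differences of \<open>h\<close>, which turns analytic estimates into Cauchy-Schwarz
  inequalities.\<close>

definition x :: "complex \<Rightarrow> 'a \<Rightarrow> complex" where
  "x z p = res z (f p) / G z - 1"

definition V :: "complex \<Rightarrow> real" where
  "V z = (LINT p|M. (cmod (x z p))\<^sup>2)"

lemma integrable_res: "Im z \<noteq> 0 \<Longrightarrow> integrable M (\<lambda>p. res z (f p))"
  by (rule integrable_bounded[where B="1 / \<bar>Im z\<bar>"]) (auto intro: norm_res_le)

text \<open>The weight g lets the lemma cover the planar Cauchy transform in one variable: the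
  resolvent of the other coordinate is the weight. The derivative is verified through an explicit
  remainder bound on the disc of radius |Im z| / 2.\<close>

lemma holomorphic_weighted_G:
  fixes g :: "'a \<Rightarrow> complex"
  assumes [measurable]: "g \<in> borel_measurable M" and g: "\<And>p. cmod (g p) \<le> B"
  shows "(\<lambda>z. LINT p|M. g p * res z (f p)) holomorphic_on {z. Im z \<noteq> 0}"
proof -
  have B0: "0 \<le> B" using g norm_ge_zero order_trans by blast
  have int1: "integrable M (\<lambda>p. g p * res z (f p))" if "Im z \<noteq> 0" for z
    by (rule integrable_bounded[where B="B * (1 / \<bar>Im z\<bar>)"])
      (use that g B0 in \<open>auto simp: norm_mult simp del: times_divide_eq_right intro!: mult_mono norm_res_le\<close>)
  have int2: "integrable M (\<lambda>p. g p * (res z (f p))\<^sup>2)" if "Im z \<noteq> 0" for z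
    by (rule integrable_bounded[where B="B * (1 / \<bar>Im z\<bar>)\<^sup>2"])
      (use that g B0 in \<open>auto simp: norm_mult norm_power simp del: times_divide_eq_right intro!: mult_mono power_mono norm_res_le\<close>)
  have "((\<lambda>z. LINT p|M. g p * res z (f p)) has_field_derivative (LINT p|M. - (g p * (res z (f p))\<^sup>2))) (at z)"
    if z: "Im z \<noteq> 0" for z
  proof -
    let ?F = "\<lambda>z. LINT p|M. g p * res z (f p)" and ?L = "LINT p|M. - (g p * (res z (f p))\<^sup>2)"
    define d where "d = \<bar>Im z\<bar>"
    have d: "0 < d" using z by (simp add: d_def)
    have near: "cmod ((?F z' - ?F z) / (z' - z) - ?L) \<le> B * (1 / d)\<^sup>2 * (2 / d) * cmod (z' - z)"
      if "z' \<noteq> z" "cmod (z' - z) < d / 2" for z'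
    proof -
      have "\<bar>Im z' - Im z\<bar> < d / 2"
        using abs_Im_le_cmod[of "z' - z"] that(2) by simp
      hence im': "\<bar>Im z'\<bar> \<ge> d / 2" unfolding d_def by linarith
      have z': "Im z' \<noteq> 0"
        using im' d by (metis abs_zero half_gt_zero linorder_not_less)
      have eq: "(g p * res z' (f p) - g p * res z (f p)) / (z' - z) + g p * (res z (f p))\<^sup>2
          = g p * (res z (f p))\<^sup>2 * res z' (f p) * (z' - z)" for p
      proof -
        have 1: "res z' (f p) - res z (f p) = (z - z') * res z' (f p) * res z (f p)"
          using res_diff[OF z' z] by simp
        have 2: "res z (f p) - res z' (f p) = (z' - z) * res z (f p) * res z' (f p)"
          by (rule res_diff[OF z z'])
        have "g p * res z' (f p) - g p * res z (f p) = g p * (res z' (f p) - res z (f p))"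
          by (simp add: right_diff_distrib)
        also have "\<dots> = (z' - z) * - (g p * res z' (f p) * res z (f p))"
          unfolding 1 by (simp add: algebra_simps)
        finally have "(g p * res z' (f p) - g p * res z (f p)) / (z' - z) = - (g p * res z' (f p) * res z (f p))"
          using that(1) by simp
        hence "(g p * res z' (f p) - g p * res z (f p)) / (z' - z) + g p * (res z (f p))\<^sup>2
          = g p * res z (f p) * (res z (f p) - res z' (f p))"
          by (simp add: power2_eq_square algebra_simps)
        thus ?thesis unfolding 2 by (simp add: power2_eq_square mult_ac)
      qed
      have "(?F z' - ?F z) / (z' - z) - ?L
        = (LINT p|M. (g p * res z' (f p) - g p * res z (f p)) / (z' - z) + g p * (res z (f p))\<^sup>2)"
        using int1[OF z] int1[OF z'] int2[OF z] by simp
      also have "\<dots> = (LINT p|M. g p * (res z (f p))\<^sup>2 * res z' (f p) * (z' - z))"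
        by (simp only: eq)
      also have "cmod \<dots> \<le> B * (1 / d)\<^sup>2 * (2 / d) * cmod (z' - z)"
      proof (rule order_trans[OF integral_norm_bound])
        have bd: "cmod (g p * (res z (f p))\<^sup>2 * res z' (f p) * (z' - z)) \<le> B * (1 / d)\<^sup>2 * (2 / d) * cmod (z' - z)" for p
        proof -
          have "cmod (res z' (f p)) \<le> 2 / d"
          proof (rule order_trans[OF norm_res_le[OF z']])
            have "1 / \<bar>Im z'\<bar> \<le> 1 / (d / 2)" by (rule divide_left_mono) (use d im' in auto)
            thus "1 / \<bar>Im z'\<bar> \<le> 2 / d" by simp
          qed
          moreover have "cmod (res z (f p)) \<le> 1 / d" using norm_res_le[OF z] by (simp add: d_def)
          ultimately show ?thesis
            unfolding norm_mult norm_power using g[of p] B0 d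
            by (intro mult_mono power_mono) auto
        qed
        have "(LINT p|M. cmod (g p * (res z (f p))\<^sup>2 * res z' (f p) * (z' - z))) \<le> (LINT p|M. B * (1 / d)\<^sup>2 * (2 / d) * cmod (z' - z))"
        proof (rule integral_mono)
          show "integrable M (\<lambda>p. cmod (g p * (res z (f p))\<^sup>2 * res z' (f p) * (z' - z)))"
            by (rule integrable_norm, rule integrable_bounded[OF _ bd]) measurable
        qed (use bd in auto)
        thus "(LINT p|M. cmod (g p * (res z (f p))\<^sup>2 * res z' (f p) * (z' - z))) \<le> B * (1 / d)\<^sup>2 * (2 / d) * cmod (z' - z)"
          by (simp add: prob_space)
      qed
      finally show ?thesis .
    qed
    have "((\<lambda>z'. (?F z' - ?F z) / (z' - z) - ?L) \<longlongrightarrow> 0) (at z)"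
    proof (rule Lim_null_comparison)
      show "\<forall>\<^sub>F z' in at z. cmod ((?F z' - ?F z) / (z' - z) - ?L) \<le> B * (1 / d)\<^sup>2 * (2 / d) * cmod (z' - z)"
        unfolding eventually_at using near d by (intro exI[of _ "d/2"]) (auto simp: dist_norm)
      show "((\<lambda>z'. B * (1 / d)\<^sup>2 * (2 / d) * cmod (z' - z)) \<longlongrightarrow> 0) (at z)"
        by (rule tendsto_eq_intros refl | simp)+
    qed
    thus ?thesis
      unfolding has_field_derivative_iff using Lim_null by blast
  qed
  thus ?thesis
    by (intro holomorphic_onI) (auto simp: field_differentiable_def intro: has_field_derivative_at_within)
qed

lemma G_holomorphic: "G holomorphic_on {z. Im z \<noteq> 0}"
  using holomorphic_weighted_G[of "\<lambda>_. 1" 1] by (simp add: G_def[abs_def])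

lemma G_cnj: "G (cnj z) = cnj (G z)"
  by (simp add: G_def cnj_res[symmetric])

lemma integrable_res_sq: "Im z \<noteq> 0 \<Longrightarrow> integrable M (\<lambda>p. (cmod (res z (f p)))\<^sup>2)"
  by (rule integrable_bounded[where B="(1 / \<bar>Im z\<bar>)\<^sup>2"])
     (auto simp del: power_divide intro: norm_res_le power_mono)

lemma Im_G: "Im z \<noteq> 0 \<Longrightarrow> Im (G z) = - Im z * (LINT p|M. (cmod (res z (f p)))\<^sup>2)"
  unfolding G_def by (subst integral_Im[symmetric]) (auto simp: integrable_res Im_res integrable_res_sq)

lemma G_nonzero:
  assumes z: "Im z \<noteq> 0" shows "G z \<noteq> 0" "Im z * Im (G z) < 0"
proof -
  have "(LINT p|M. (cmod (res z (f p)))\<^sup>2) \<noteq> 0"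
  proof
    assume "(LINT p|M. (cmod (res z (f p)))\<^sup>2) = 0"
    hence "AE p in M. (cmod (res z (f p)))\<^sup>2 = 0"
      by (subst (asm) integral_nonneg_eq_0_iff_AE) (auto simp: integrable_res_sq z)
    hence "AE p in M. False"
      by eventually_elim (use res_nonzero[OF z] in \<open>auto simp: res_def\<close>)
    thus False by simp
  qed
  moreover have "0 \<le> (LINT p|M. (cmod (res z (f p)))\<^sup>2)" by simp
  ultimately have pos: "0 < (LINT p|M. (cmod (res z (f p)))\<^sup>2)" by linarith
  show "Im z * Im (G z) < 0"
    unfolding Im_G[OF z] using z pos by (simp add: mult.assoc[symmetric] zero_less_mult_iff not_real_square_gt_zero[symmetric] mult_less_0_iff)
  thus "G z \<noteq> 0" by auto
qed

lemma norm_G_le: "Im z \<noteq> 0 \<Longrightarrow> cmod (G z) \<le> 1 / \<bar>Im z\<bar>"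
proof -
  assume z: "Im z \<noteq> 0"
  have "cmod (G z) \<le> (LINT p|M. cmod (res z (f p)))" unfolding G_def by (rule integral_norm_bound)
  also have "\<dots> \<le> (LINT p|M. 1 / \<bar>Im z\<bar>)"
    by (intro integral_mono integrable_norm integrable_res z norm_res_le) auto
  finally show ?thesis by (simp add: prob_space)
qed

lemma h_cnj: "h (cnj z) = cnj (h z)"
  by (simp add: h_def G_cnj)

lemma h_holomorphic: "h holomorphic_on {z. Im z \<noteq> 0}"
  unfolding h_def[abs_def] by (intro holomorphic_intros G_holomorphic) (use G_nonzero in auto)

lemma x_measurable [measurable]: "x z \<in> borel_measurable M"
  unfolding x_def[abs_def] by measurable

lemma x_cnj: "x (cnj z) p = cnj (x z p)"
  by (simp add: x_def G_cnj cnj_res)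

lemma x_bounded:
  assumes "Im z \<noteq> 0" obtains B where "\<And>p. cmod (x z p) \<le> B"
proof
  fix p
  have "cmod (x z p) \<le> cmod (res z (f p) / G z) + 1"
    unfolding x_def using norm_triangle_ineq4[of "res z (f p) / G z" 1] by simp
  also have "\<dots> \<le> 1 / \<bar>Im z\<bar> / cmod (G z) + 1"
    unfolding norm_divide by (intro add_right_mono divide_right_mono norm_res_le assms) simp
  finally show "cmod (x z p) \<le> 1 / \<bar>Im z\<bar> / cmod (G z) + 1" .
qed

lemma integrable_x: "Im z \<noteq> 0 \<Longrightarrow> integrable M (x z)"
  by (erule x_bounded, rule integrable_bounded) auto

lemma integrable_x_sq: "Im z \<noteq> 0 \<Longrightarrow> integrable M (\<lambda>p. (cmod (x z p))\<^sup>2)"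
proof -
  assume "Im z \<noteq> 0"
  then obtain B where "\<And>p. cmod (x z p) \<le> B" using x_bounded by blast
  thus ?thesis by (intro integrable_bounded[where B="B\<^sup>2"]) (auto intro: power_mono)
qed

lemma integral_x: "Im z \<noteq> 0 \<Longrightarrow> (LINT p|M. x z p) = 0"
  using G_nonzero[of z] integrable_res[of z] by (simp add: x_def G_def[symmetric] prob_space)

lemma V_nonneg: "0 \<le> V z"
  by (simp add: V_def)

lemma V_cnj: "V (cnj z) = V z"
  by (simp add: V_def x_cnj)

text \<open>In the resolvent identity divided by \<open>G z * G z'\<close>, the integral of the
  product of resolvents is 1 plus the covariance, as x has mean 0.\<close>

lemma h_diff:
  assumes z: "Im z \<noteq> 0" and z': "Im z' \<noteq> 0"
  shows "h z - h z' = (z - z') * (LINT p|M. x z p * x z' p)"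
proof -
  have nz: "G z \<noteq> 0" "G z' \<noteq> 0" using G_nonzero z z' by auto
  have int: "integrable M (\<lambda>p. res z (f p) * res z' (f p))"
    by (rule integrable_bounded[where B="1 / \<bar>Im z\<bar> * (1 / \<bar>Im z'\<bar>)"])
       (use z z' in \<open>auto simp: norm_mult simp del: times_divide_eq_right times_divide_eq_left intro!: mult_mono norm_res_le\<close>)
  have "G z' - G z = (LINT p|M. res z' (f p) - res z (f p))"
    using z z' by (simp add: G_def integrable_res)
  also have "\<dots> = (LINT p|M. (z - z') * (res z (f p) * res z' (f p)))"
    using res_diff[OF z' z] by (simp add: mult_ac)
  finally have *: "G z' - G z = (z - z') * (LINT p|M. res z (f p) * res z' (f p))" by simp
  have "(LINT p|M. x z p * x z' p)
     = (LINT p|M. (res z (f p) * res z' (f p)) / (G z * G z') - x z p - x z' p - 1)"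
    by (intro Bochner_Integration.integral_cong refl) (use nz in \<open>simp add: x_def field_simps\<close>)
  also have "\<dots> = (LINT p|M. res z (f p) * res z' (f p)) / (G z * G z') - 1"
    using int integrable_x[OF z] integrable_x[OF z'] integral_x[OF z] integral_x[OF z'] by (simp add: prob_space)
  finally have "(z - z') * (LINT p|M. x z p * x z' p) = (G z' - G z) / (G z * G z') - (z - z')"
    using * by (simp add: right_diff_distrib)
  also have "\<dots> = h z - h z'" using nz by (simp add: h_def field_simps)
  finally show ?thesis by simp
qed

lemma Im_h:
  assumes z: "Im z \<noteq> 0" shows "Im (h z) = V z * Im z"
proof -
  have z': "Im (cnj z) \<noteq> 0" using z by simp
  have "h z - h (cnj z) = (z - cnj z) * (LINT p|M. x z p * x (cnj z) p)"
    by (rule h_diff[OF z z'])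
  also have "(LINT p|M. x z p * x (cnj z) p) = (LINT p|M. complex_of_real ((cmod (x z p))\<^sup>2))"
    by (simp only: x_cnj complex_norm_square[symmetric])
  also have "\<dots> = of_real (V z)" by (simp only: V_def integral_complex_of_real)
  finally have "Im (h z - h (cnj z)) = Im ((z - cnj z) * of_real (V z))" by simp
  thus ?thesis by (simp add: h_cnj mult.commute)
qed

text \<open>Combined with \<open>h_diff\<close> and \<open>Im_h\<close> this is the Schwarz-Pick
  inequality for \<open>h\<close>: the squared divided difference is at most the product of the two
  ratios Im h / Im z.\<close>

lemma norm_integral_x_mult:
  assumes z: "Im z \<noteq> 0" and z': "Im z' \<noteq> 0"
  shows "(cmod (LINT p|M. x z p * x z' p))\<^sup>2 \<le> V z * V z'"
  unfolding V_def by (intro integral_Cauchy_Schwarz integrable_x_sq assms) auto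

lemma one_plus_x: "Im z \<noteq> 0 \<Longrightarrow> G z * (1 + x z p) = res z (f p)"
  using G_nonzero[of z] by (simp add: x_def)

text \<open>By \<open>Im_res\<close> the squared modulus of the resolvent is linear in its imaginary
  part, so |1 + x|^2 is affine in x. This relation closes the moment computations of
  \<open>covariance_positive\<close>: products of x with its conjugate reduce to degree one.\<close>

lemma norm_one_plus_x_sq:
  assumes z: "Im z \<noteq> 0"
  shows "(cmod (1 + x z p))\<^sup>2 = (1 + V z) * (1 + Re ((1 - \<i> * of_real (Re (G z) / Im (G z))) * x z p))"
proof -
  define g where "g = G z"
  have im: "Im g \<noteq> 0" using G_nonzero[OF z] by (auto simp: g_def)
  hence gn: "g \<noteq> 0" by auto
  have a: "res z (f p) = g * (1 + x z p)" using one_plus_x[OF z] by (simp add: g_def)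
  have "Im (g * (1 + x z p)) = - Im z * (cmod (g * (1 + x z p)))\<^sup>2"
    using Im_res[of z "f p"] unfolding a by simp
  hence 1: "Im (g * (1 + x z p)) = - Im z * (cmod g)\<^sup>2 * (cmod (1 + x z p))\<^sup>2"
    by (simp add: norm_mult power_mult_distrib)
  have "Im (1 / g - z) = V z * Im z" using Im_h[OF z] by (simp add: h_def g_def)
  moreover have "Im (1 / g) = - Im g / (cmod g)\<^sup>2" by (simp add: Im_divide cmod_power2)
  ultimately have "- Im g / (cmod g)\<^sup>2 = (1 + V z) * Im z" by (simp add: algebra_simps)
  hence 2: "- Im g = (1 + V z) * Im z * (cmod g)\<^sup>2" using gn by (simp add: field_simps)
  have 3: "Im (g * (1 + x z p)) = Im g * (1 + Re ((1 - \<i> * of_real (Re g / Im g)) * x z p))"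
    using im by (simp add: algebra_simps)
  have "Im g * ((1 + V z) * (1 + Re ((1 - \<i> * of_real (Re g / Im g)) * x z p))) = (1 + V z) * (- Im z * (cmod g)\<^sup>2 * (cmod (1 + x z p))\<^sup>2)"
    using 1 3 by simp
  also have "\<dots> = - ((1 + V z) * Im z * (cmod g)\<^sup>2) * (cmod (1 + x z p))\<^sup>2" by (simp add: algebra_simps)
  also have "\<dots> = Im g * (cmod (1 + x z p))\<^sup>2" unfolding 2[symmetric] by simp
  finally show ?thesis using im by (simp add: g_def)
qed

text \<open>A truncated first absolute moment at scale B: finite for every law, tending to 0 as B
  grows, and continuous under weak convergence. It carries the quantitative estimates in truncated
  cones.\<close>

definition tB :: "real \<Rightarrow> real" where
  "tB B = (LINT p|M. min 1 (\<bar>f p\<bar> / B))"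

lemma tB_nonneg: "0 < B \<Longrightarrow> 0 \<le> tB B" unfolding tB_def by (auto intro: integral_nonneg)

lemma integrable_tB: "0 < B \<Longrightarrow> integrable M (\<lambda>p. min 1 (\<bar>f p\<bar> / B))"
  by (rule integrable_bounded[where B=1]) auto

lemma tB_tendsto: "(tB \<longlongrightarrow> 0) at_top"
proof -
  have "((\<lambda>B. LINT p|M. min 1 (\<bar>f p\<bar> / B)) \<longlongrightarrow> (LINT p|M. 0)) at_top"
  proof (rule integral_dominated_convergence_at_top[where w="\<lambda>_. 1"])
    show "\<forall>\<^sub>F i in at_top. AE x in M. norm (min 1 (\<bar>f x\<bar> / i)) \<le> 1"
      using eventually_gt_at_top[of 0] by eventually_elim auto
    show "AE x in M. ((\<lambda>i. min 1 (\<bar>f x\<bar> / i)) \<longlongrightarrow> 0) at_top"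
    proof (rule AE_I2)
      fix p
      have "((\<lambda>i. min 1 (\<bar>f p\<bar> / i)) \<longlongrightarrow> min 1 0) at_top"
        by (intro tendsto_intros tendsto_divide_0[OF tendsto_const] filterlim_at_top_imp_at_infinity filterlim_ident)
      thus "((\<lambda>i. min 1 (\<bar>f p\<bar> / i)) \<longlongrightarrow> 0) at_top" by simp
    qed
  qed auto
  thus ?thesis by (simp add: tB_def[abs_def])
qed

lemma integral_cone:
  assumes z: "Im z \<noteq> 0" and A: "\<bar>Re z\<bar> \<le> A * \<bar>Im z\<bar>" and B: "B \<le> \<bar>Im z\<bar>" "0 < B"
  shows "integrable M (\<lambda>p. of_real (f p) * res z (f p))"
    and "(LINT p|M. cmod (of_real (f p) * res z (f p))) \<le> (2 + A) * tB B"
proof -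
  note bd = norm_res_cone[OF assms]
  show int: "integrable M (\<lambda>p. of_real (f p) * res z (f p))"
    by (rule Bochner_Integration.integrable_bound[OF integrable_mult_right[OF integrable_tB[OF B(2)], of "2 + A"]])
       (use bd in \<open>auto intro!: AE_I2 order_trans[OF bd abs_ge_self]\<close>)
  have "(LINT p|M. cmod (of_real (f p) * res z (f p))) \<le> (LINT p|M. (2 + A) * min 1 (\<bar>f p\<bar> / B))"
    by (intro integral_mono integrable_norm int integrable_mult_right integrable_tB B bd)
  thus "(LINT p|M. cmod (of_real (f p) * res z (f p))) \<le> (2 + A) * tB B"
    by (simp add: tB_def)
qed

lemma G_cone:
  assumes z: "Im z \<noteq> 0" and A: "\<bar>Re z\<bar> \<le> A * \<bar>Im z\<bar>" and B: "B \<le> \<bar>Im z\<bar>" "0 < B"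
  shows "cmod (z * G z - 1) \<le> (2 + A) * tB B"
proof -
  have "z * G z - 1 = (LINT p|M. z * res z (f p)) - 1" by (simp add: G_def)
  also have "\<dots> = (LINT p|M. 1 + of_real (f p) * res z (f p)) - 1" by (simp only: mult_res[OF z])
  also have "\<dots> = (LINT p|M. of_real (f p) * res z (f p))"
    using integral_cone(1)[OF assms] by (simp add: prob_space)
  also have "cmod \<dots> \<le> (LINT p|M. cmod (of_real (f p) * res z (f p)))" by (rule integral_norm_bound)
  also have "\<dots> \<le> (2 + A) * tB B" by (rule integral_cone(2)[OF assms])
  finally show ?thesis .
qed

text \<open>G is compared with 1 / z at the level of differences. Once the last factor is below 1, G
  is injective on the truncated cone; once it is at most 1/2, the inverse has a Lipschitz
  bound.\<close>

lemma G_diff_cone: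
  assumes z: "Im z \<noteq> 0" "\<bar>Re z\<bar> \<le> A * \<bar>Im z\<bar>" "B \<le> \<bar>Im z\<bar>"
    and z': "Im z' \<noteq> 0" "\<bar>Re z'\<bar> \<le> A * \<bar>Im z'\<bar>" "B \<le> \<bar>Im z'\<bar>" and B: "0 < B"
  shows "cmod (z * z' * (G z - G z') - (z' - z)) \<le> cmod (z - z') * ((4 + A) * ((2 + A) * tB B))"
proof -
  define u where "u = (\<lambda>p. of_real (f p) * res z (f p))"
  define u' where "u' = (\<lambda>p. of_real (f p) * res z' (f p))"
  have [measurable]: "u \<in> borel_measurable M" "u' \<in> borel_measurable M" unfolding u_def u'_def by measurable
  note c = integral_cone[OF z(1,2,3) B, folded u_def] integral_cone[OF z'(1,2,3) B, folded u'_def]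
  have A0: "0 \<le> A" using z by (smt (verit) abs_ge_zero mult_neg_pos zero_less_abs_iff)
  have ub: "cmod (u p) \<le> 2 + A" for p
    using order_trans[OF norm_res_cone[OF z B, of "f p"] mult_left_mono[of "min 1 (\<bar>f p\<bar> / B)" 1 "2 + A"]] A0
    by (simp add: u_def)
  \<comment> \<open>The product costs 2 + A times |u'|; the total weight 1 + (3 + A) is the factor 4
    + A of the claim.\<close>
  have bd: "cmod (u p + u' p + u p * u' p) \<le> cmod (u p) + (3 + A) * cmod (u' p)" for p
  proof -
    have "cmod (u p * u' p) \<le> (2 + A) * cmod (u' p)" unfolding norm_mult by (intro mult_right_mono ub) auto
    moreover have "cmod (u p + u' p + u p * u' p) \<le> cmod (u p) + cmod (u' p) + cmod (u p * u' p)"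
      by (meson norm_triangle_le order_refl add_mono)
    ultimately show ?thesis by (simp add: algebra_simps)
  qed
  have intb: "integrable M (\<lambda>p. cmod (u p) + (3 + A) * cmod (u' p))" using c by (intro Bochner_Integration.integrable_add integrable_mult_right integrable_norm) auto
  have int: "integrable M (\<lambda>p. u p + u' p + u p * u' p)"
    by (rule Bochner_Integration.integrable_bound[OF intb]) (auto intro!: AE_I2 order_trans[OF bd abs_ge_self])
  have "z * z' * (G z - G z') = (LINT p|M. z * z' * (res z (f p) - res z' (f p)))"
    using z z' by (simp add: G_def integrable_res)
  also have "\<dots> = (LINT p|M. (z' - z) * (1 + (u p + u' p + u p * u' p)))"
  proof (intro Bochner_Integration.integral_cong refl)
    fix p
    have "z * z' * (res z (f p) - res z' (f p)) = (z' - z) * ((z * res z (f p)) * (z' * res z' (f p)))"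
      using res_diff[OF z(1) z'(1)] by simp
    also have "\<dots> = (z' - z) * ((1 + u p) * (1 + u' p))"
      by (simp only: mult_res[OF z(1)] mult_res[OF z'(1)] u_def u'_def)
    finally show "z * z' * (res z (f p) - res z' (f p)) = (z' - z) * (1 + (u p + u' p + u p * u' p))"
      by (simp add: algebra_simps)
  qed
  also have "\<dots> = (z' - z) * (1 + (LINT p|M. u p + u' p + u p * u' p))"
    using int by (subst integral_mult_right_zero, subst Bochner_Integration.integral_add) (auto simp: prob_space)
  finally have "z * z' * (G z - G z') - (z' - z) = (z' - z) * (LINT p|M. u p + u' p + u p * u' p)"
    by (simp add: algebra_simps)
  moreover have "cmod (LINT p|M. u p + u' p + u p * u' p) \<le> (4 + A) * ((2 + A) * tB B)"
  proof -
    have "cmod (LINT p|M. u p + u' p + u p * u' p) \<le> (LINT p|M. cmod (u p + u' p + u p * u' p))" by (rule integral_norm_bound)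
    also have "\<dots> \<le> (LINT p|M. cmod (u p) + (3 + A) * cmod (u' p))"
      by (intro integral_mono integrable_norm int intb bd)
    also have "\<dots> = (LINT p|M. cmod (u p)) + (3 + A) * (LINT p|M. cmod (u' p))" using c by simp
    also have "\<dots> \<le> (2 + A) * tB B + (3 + A) * ((2 + A) * tB B)"
      using c A0 by (intro add_mono mult_left_mono) (auto simp: u_def u'_def)
    finally show ?thesis by (simp add: algebra_simps)
  qed
  ultimately show ?thesis
    by (simp add: norm_mult norm_minus_commute mult_left_mono)
qed

end

section \<open>Stieltjes inversion\<close>

lemma borel_prob_real_rv: "borel_prob m \<Longrightarrow> real_rv m (\<lambda>x. x)"
  unfolding borel_prob_def real_rv_def real_rv_axioms_def
  using measurable_ident_sets by blast

lemma borel_prob_real_distribution: "borel_prob (m :: real measure) \<Longrightarrow> real_distribution m"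
  unfolding borel_prob_def
  by (auto simp: real_distribution_def real_distribution_axioms_def)

lemma cauchy_transform_eq: "borel_prob m \<Longrightarrow> cauchy_transform m = real_rv.G m (\<lambda>x. x)"
  by (intro ext) (simp add: cauchy_transform_def real_rv.G_def[OF borel_prob_real_rv] res_def)

lemma nn_integral_Poisson:
  fixes a b s y :: real
  assumes "a \<le> b" "0 < y"
  shows "(\<integral>\<^sup>+x. ennreal (y / ((x - s)\<^sup>2 + y\<^sup>2)) * indicator {a..b} x \<partial>lborel)
    = ennreal (arctan ((b - s) / y) - arctan ((a - s) / y))"
proof (rule nn_integral_FTC_Icc)
  fix x :: real
  have y2: "0 < y\<^sup>2" using assms by simp
  have "0 < (x - s)\<^sup>2 + y\<^sup>2" by (rule add_nonneg_pos[OF _ y2]) simp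
  moreover have "1 + ((x - s) / y)\<^sup>2 = ((x - s)\<^sup>2 + y\<^sup>2) / y\<^sup>2" using assms by (simp add: field_simps)
  ultimately have "inverse (1 + ((x - s) / y)\<^sup>2) * (1 / y) = y / ((x - s)\<^sup>2 + y\<^sup>2)"
    using assms by (simp add: power2_eq_square)
  moreover have "((\<lambda>x. arctan ((x - s) / y)) has_real_derivative inverse (1 + ((x - s) / y)\<^sup>2) * (1 / y)) (at x)"
    using assms by (intro DERIV_chain2[OF DERIV_arctan]) (auto intro!: derivative_eq_intros)
  ultimately show "((\<lambda>x. arctan ((x - s) / y)) has_real_derivative y / ((x - s)\<^sup>2 + y\<^sup>2)) (at x)" by simp
qed (use assms in auto)

text \<open>On the line Im z = y, minus the imaginary part of the Cauchy transform is a Poisson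
  integral. Integrated over [a, b], with the order of integration exchanged by Tonelli, it becomes
  the mean of the arctan difference, which is therefore determined by the transform.\<close>

lemma integral_arctan_eq:
  assumes m: "borel_prob m" and m': "borel_prob m'"
    and eq: "\<And>z. 0 < Im z \<Longrightarrow> cauchy_transform m z = cauchy_transform m' z"
    and ab: "a \<le> b" and y: "0 < y"
  shows "(LINT s|m. arctan ((b - s) / y) - arctan ((a - s) / y))
       = (LINT s|m'. arctan ((b - s) / y) - arctan ((a - s) / y))"
proof -
  have *: "ennreal (LINT s|m. arctan ((b - s) / y) - arctan ((a - s) / y))
      = (\<integral>\<^sup>+x. ennreal (- Im (cauchy_transform m (Complex x y))) * indicator {a..b} x \<partial>lborel)"
    if m: "borel_prob m" for m
  proof -
    interpret real_rv m "\<lambda>x. x" using m by (rule borel_prob_real_rv)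
    have [measurable_cong]: "sets m = sets borel" using m by (simp add: borel_prob_def)
    interpret pair_sigma_finite lborel m ..
    have mono: "arctan ((a - s) / y) \<le> arctan ((b - s) / y)" for s
      using ab y by (simp add: divide_right_mono arctan_le_iff)
    have bd: "\<bar>arctan ((b - s) / y) - arctan ((a - s) / y)\<bar> \<le> pi" for s
      using arctan_lbound[of "(a - s) / y"] arctan_ubound[of "(a - s) / y"]
        arctan_lbound[of "(b - s) / y"] arctan_ubound[of "(b - s) / y"] by linarith
    have "ennreal (LINT s|m. arctan ((b - s) / y) - arctan ((a - s) / y))
        = (\<integral>\<^sup>+s. ennreal (arctan ((b - s) / y) - arctan ((a - s) / y)) \<partial>m)"
      using mono by (intro nn_integral_eq_integral[symmetric] integrable_bounded[where B=pi])
        (use bd in auto)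
    also have "\<dots> = (\<integral>\<^sup>+s. (\<integral>\<^sup>+x. ennreal (y / ((x - s)\<^sup>2 + y\<^sup>2)) * indicator {a..b} x \<partial>lborel) \<partial>m)"
      by (simp only: nn_integral_Poisson[OF ab y])
    also have "\<dots> = (\<integral>\<^sup>+x. (\<integral>\<^sup>+s. ennreal (y / ((x - s)\<^sup>2 + y\<^sup>2)) * indicator {a..b} x \<partial>m) \<partial>lborel)"
      by (rule Fubini') measurable
    also have "\<dots> = (\<integral>\<^sup>+x. ennreal (- Im (cauchy_transform m (Complex x y))) * indicator {a..b} x \<partial>lborel)"
    proof (intro nn_integral_cong)
      fix x :: real
      have z: "Im (Complex x y) \<noteq> 0" using y by simp
      have res: "y / ((x - s)\<^sup>2 + y\<^sup>2) = y * (cmod (res (Complex x y) s))\<^sup>2" for s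
        by (simp add: res_def norm_divide power_divide cmod_power2)
      have "(\<integral>\<^sup>+s. ennreal (y / ((x - s)\<^sup>2 + y\<^sup>2)) \<partial>m) = ennreal (LINT s|m. y * (cmod (res (Complex x y) s))\<^sup>2)"
        unfolding res using y by (intro nn_integral_eq_integral integrable_mult_right integrable_res_sq z) auto
      also have "(LINT s|m. y * (cmod (res (Complex x y) s))\<^sup>2) = - Im (cauchy_transform m (Complex x y))"
        using Im_G[OF z] by (simp add: cauchy_transform_eq[OF m])
      finally show "(\<integral>\<^sup>+s. ennreal (y / ((x - s)\<^sup>2 + y\<^sup>2)) * indicator {a..b} x \<partial>m)
          = ennreal (- Im (cauchy_transform m (Complex x y))) * indicator {a..b} x"
        by (subst nn_integral_multc) auto
    qed
    finally show ?thesis .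
  qed
  have nonneg: "0 \<le> (LINT s|m. arctan ((b - s) / y) - arctan ((a - s) / y))" for m
    using ab y by (intro Bochner_Integration.integral_nonneg) (simp add: divide_right_mono arctan_le_iff)
  have "ennreal (LINT s|m. arctan ((b - s) / y) - arctan ((a - s) / y))
     = ennreal (LINT s|m'. arctan ((b - s) / y) - arctan ((a - s) / y))"
    unfolding *[OF m] *[OF m'] using y by (intro nn_integral_cong) (simp add: eq)
  with nonneg show ?thesis by simp
qed

lemma arctan_scaled_tendsto:
  fixes b s :: real
  shows "(\<lambda>n. arctan ((b - s) / (1 / real (Suc n)))) \<longlonglongrightarrow> pi / 2 * sgn (b - s)"
proof -
  have lim: "filterlim (\<lambda>n. (b - s) * real (Suc n)) at_top sequentially" if "0 < b - s" for b s :: real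
    by (rule filterlim_tendsto_pos_mult_at_top[OF tendsto_const that])
       (rule filterlim_compose[OF filterlim_real_sequentially filterlim_Suc])
  consider "b = s" | "0 < b - s" | "0 < s - b" by linarith
  thus ?thesis
  proof cases
    case 2
    have "(\<lambda>n. arctan ((b - s) * real (Suc n))) \<longlonglongrightarrow> pi / 2"
      by (rule filterlim_compose[OF tendsto_arctan_at_top lim[OF 2]])
    thus ?thesis using 2 by simp
  next
    case 3
    have "(\<lambda>n. - arctan ((s - b) * real (Suc n))) \<longlonglongrightarrow> - (pi / 2)"
      by (intro tendsto_minus filterlim_compose[OF tendsto_arctan_at_top lim[OF 3]])
    moreover have "- arctan ((s - b) * real (Suc n)) = arctan ((b - s) * real (Suc n))" for n
      by (simp flip: arctan_minus mult_minus_left)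
    ultimately show ?thesis using 3 by simp
  qed auto
qed

lemma (in real_distribution) integral_sgn_diff_tendsto:
  "(\<lambda>n. LINT s|M. arctan ((b - s) / (1 / real (Suc n))) - arctan ((a - s) / (1 / real (Suc n))))
     \<longlonglongrightarrow> (LINT s|M. pi / 2 * sgn (b - s) - pi / 2 * sgn (a - s))"
proof (rule integral_dominated_convergence[where w="\<lambda>_. pi"])
  show "AE x in M. norm (arctan ((b - x) / (1 / real (Suc i))) - arctan ((a - x) / (1 / real (Suc i)))) \<le> pi" for i
  proof (rule AE_I2)
    fix x
    show "norm (arctan ((b - x) / (1 / real (Suc i))) - arctan ((a - x) / (1 / real (Suc i)))) \<le> pi"
      using arctan_lbound[of "(a - x) / (1 / real (Suc i))"] arctan_ubound[of "(a - x) / (1 / real (Suc i))"]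
        arctan_lbound[of "(b - x) / (1 / real (Suc i))"] arctan_ubound[of "(b - x) / (1 / real (Suc i))"]
      unfolding real_norm_def by linarith
  qed
  show "AE x in M. (\<lambda>i. arctan ((b - x) / (1 / real (Suc i))) - arctan ((a - x) / (1 / real (Suc i))))
      \<longlonglongrightarrow> pi / 2 * sgn (b - x) - pi / 2 * sgn (a - x)"
    by (intro AE_I2 tendsto_diff arctan_scaled_tendsto)
qed simp_all

text \<open>As y -> 0 the arctan differences become sgn differences, which give atoms at the end
  points half weight. Approaching b from the right and letting the left end go to minus infinity
  removes this and gives the distribution function exactly.\<close>

lemma (in real_distribution) integral_sgn_tendsto_cdf:
  "(\<lambda>n. LINT s|M. pi / 2 * sgn (b + 1 / real (Suc n) - s) - pi / 2 * sgn (- real n - s)) \<longlonglongrightarrow> pi * cdf M b"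
proof -
  have "(\<lambda>n. LINT s|M. pi / 2 * sgn (b + 1 / real (Suc n) - s) - pi / 2 * sgn (- real n - s))
    \<longlonglongrightarrow> (LINT s|M. pi * indicator {..b} s)"
  proof (rule integral_dominated_convergence[where w="\<lambda>_. pi"])
    have l1: "(\<lambda>n. sgn (- real n - s)) \<longlonglongrightarrow> - 1" for s :: real
    proof (rule tendsto_eventually)
      have "eventually (\<lambda>n. real n > - s) sequentially"
        using eventually_gt_at_top[of "nat \<lceil>- s\<rceil>"] by eventually_elim linarith
      thus "\<forall>\<^sub>F n in sequentially. sgn (- real n - s) = - 1" by eventually_elim (simp add: sgn_if)
    qed
    have l2: "(\<lambda>n. sgn (b + 1 / real (Suc n) - s)) \<longlonglongrightarrow> 2 * indicator {..b} s - 1" for s :: real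
    proof (cases "s \<le> b")
      case True
      have "b + 1 / real (Suc n) - s > 0" for n using True by (smt (verit) of_nat_0_less_iff zero_less_Suc zero_less_divide_1_iff)
      hence "sgn (b + 1 / real (Suc n) - s) = 1" for n by (simp only: sgn_pos)
      thus ?thesis using True by simp
    next
      case False
      hence "eventually (\<lambda>n. 1 / real (Suc n) < s - b) sequentially"
        by (intro order_tendstoD[OF LIMSEQ_inverse_real_of_nat[unfolded inverse_eq_divide]]) simp
      hence "\<forall>\<^sub>F n in sequentially. sgn (b + 1 / real (Suc n) - s) = - 1"
        by eventually_elim (simp add: sgn_if)
      thus ?thesis using False by (intro tendsto_eventually) simp
    qed
    show "AE s in M. (\<lambda>n. pi / 2 * sgn (b + 1 / real (Suc n) - s) - pi / 2 * sgn (- real n - s)) \<longlonglongrightarrow> pi * indicator {..b} s"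
    proof (rule AE_I2)
      fix s
      have "(\<lambda>n. pi / 2 * sgn (b + 1 / real (Suc n) - s) - pi / 2 * sgn (- real n - s))
         \<longlonglongrightarrow> pi / 2 * (2 * indicator {..b} s - 1) - pi / 2 * (- 1)"
        by (intro tendsto_intros l1 l2)
      thus "(\<lambda>n. pi / 2 * sgn (b + 1 / real (Suc n) - s) - pi / 2 * sgn (- real n - s)) \<longlonglongrightarrow> pi * indicator {..b} s"
        by (simp add: algebra_simps)
    qed
    show "AE x in M. norm (pi / 2 * sgn (b + 1 / real (Suc i) - x) - pi / 2 * sgn (- real i - x)) \<le> pi" for i
      by (rule AE_I2) (auto simp: sgn_if)
  qed (simp_all)
  thus ?thesis by (simp add: cdf_def)
qed

lemma cauchy_transform_inject:
  assumes m: "borel_prob m" and m': "borel_prob m'"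
    and eq: "\<And>z. 0 < Im z \<Longrightarrow> cauchy_transform m z = cauchy_transform m' z"
  shows "m = m'"
proof -
  interpret m: real_distribution m using m by (rule borel_prob_real_distribution)
  interpret m': real_distribution m' using m' by (rule borel_prob_real_distribution)
  have sgn_eq: "(LINT s|m. pi / 2 * sgn (b - s) - pi / 2 * sgn (a - s))
      = (LINT s|m'. pi / 2 * sgn (b - s) - pi / 2 * sgn (a - s))" if "a \<le> b" for a b :: real
  proof (rule LIMSEQ_unique[OF m.integral_sgn_diff_tendsto])
    have "(LINT s|m. arctan ((b - s) / (1 / real (Suc n))) - arctan ((a - s) / (1 / real (Suc n))))
        = (LINT s|m'. arctan ((b - s) / (1 / real (Suc n))) - arctan ((a - s) / (1 / real (Suc n))))" for n
      by (rule integral_arctan_eq[OF m m' eq that]) simp_all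
    thus "(\<lambda>n. LINT s|m. arctan ((b - s) / (1 / real (Suc n))) - arctan ((a - s) / (1 / real (Suc n))))
       \<longlonglongrightarrow> (LINT s|m'. pi / 2 * sgn (b - s) - pi / 2 * sgn (a - s))"
      by (simp only: m'.integral_sgn_diff_tendsto)
  qed
  have "cdf m = cdf m'"
  proof
    fix b
    have "eventually (\<lambda>n. (LINT s|m. pi / 2 * sgn (b + 1 / real (Suc n) - s) - pi / 2 * sgn (- real n - s))
        = (LINT s|m'. pi / 2 * sgn (b + 1 / real (Suc n) - s) - pi / 2 * sgn (- real n - s))) sequentially"
      using eventually_gt_at_top[of "nat \<lceil>- b\<rceil>"]
    proof eventually_elim
      case (elim n)
      have "- real n \<le> b" using elim by linarith
      moreover have "0 \<le> 1 / real (Suc n)" by simp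
      ultimately show ?case by (intro sgn_eq) linarith
    qed
    from Lim_transform_eventually[OF m.integral_sgn_tendsto_cdf this]
    have "pi * cdf m b = pi * cdf m' b"
      by (rule LIMSEQ_unique) (rule m'.integral_sgn_tendsto_cdf)
    thus "cdf m b = cdf m' b" by simp
  qed
  thus ?thesis by (rule cdf_unique[OF m.real_distribution_axioms m'.real_distribution_axioms])
qed

section \<open>Stolz angles and R-transforms\<close>

lemma mem_stolz_angle: "z \<in> stolz_angle \<alpha> \<beta> \<longleftrightarrow> Im z < 0 \<and> \<bar>Re z\<bar> < \<alpha> * \<bar>Im z\<bar> \<and> \<bar>Im z\<bar> < \<beta>"
  by (auto simp: stolz_angle_def)

lemma mem_cnj_stolz_angle: "z \<in> cnj ` stolz_angle \<alpha> \<beta> \<longleftrightarrow> 0 < Im z \<and> \<bar>Re z\<bar> < \<alpha> * \<bar>Im z\<bar> \<and> \<bar>Im z\<bar> < \<beta>"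
proof -
  have "z \<in> cnj ` stolz_angle \<alpha> \<beta> \<longleftrightarrow> cnj z \<in> stolz_angle \<alpha> \<beta>"
    by (metis complex_cnj_cnj image_iff)
  thus ?thesis by (simp add: mem_stolz_angle)
qed

lemma mem_stolz_double: "z \<in> stolz_double \<alpha> \<beta> \<longleftrightarrow> Im z \<noteq> 0 \<and> \<bar>Re z\<bar> < \<alpha> * \<bar>Im z\<bar> \<and> \<bar>Im z\<bar> < \<beta>"
  unfolding stolz_double_def Un_iff mem_stolz_angle mem_cnj_stolz_angle by auto

lemma stolz_double_mono: "\<alpha>' \<le> \<alpha> \<Longrightarrow> \<beta>' \<le> \<beta> \<Longrightarrow> stolz_double \<alpha>' \<beta>' \<subseteq> stolz_double \<alpha> \<beta>"
proof
  fix z assume "\<alpha>' \<le> \<alpha>" "\<beta>' \<le> \<beta>" "z \<in> stolz_double \<alpha>' \<beta>'"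
  thus "z \<in> stolz_double \<alpha> \<beta>"
    using mult_right_mono[of \<alpha>' \<alpha> "\<bar>Im z\<bar>"] unfolding mem_stolz_double by linarith
qed

lemma open_convex_stolz_angle: "open (stolz_angle \<alpha> \<beta>)" "convex (stolz_angle \<alpha> \<beta>)"
proof -
  have eq: "stolz_angle \<alpha> \<beta> = {z. inner (Complex 0 1) z < 0} \<inter> ({z. inner (Complex 1 \<alpha>) z < 0} \<inter> ({z. inner (Complex (-1) \<alpha>) z < 0}
     \<inter> {z. inner (Complex 0 (-1)) z < \<beta>}))"
    by (auto simp: stolz_angle_def inner_complex_def abs_less_iff)
  show "open (stolz_angle \<alpha> \<beta>)" unfolding eq by (intro open_Int open_halfspace_lt)
  show "convex (stolz_angle \<alpha> \<beta>)" unfolding eq by (intro convex_Int convex_halfspace_lt)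
qed

lemma open_convex_cnj_stolz_angle: "open (cnj ` stolz_angle \<alpha> \<beta>)" "convex (cnj ` stolz_angle \<alpha> \<beta>)"
proof -
  have eq: "cnj ` stolz_angle \<alpha> \<beta> = {z. inner (Complex 0 (-1)) z < 0} \<inter> ({z. inner (Complex 1 (-\<alpha>)) z < 0} \<inter> ({z. inner (Complex (-1) (-\<alpha>)) z < 0}
     \<inter> {z. inner (Complex 0 1) z < \<beta>}))"
    unfolding set_eq_iff mem_cnj_stolz_angle by (auto simp: inner_complex_def abs_less_iff)
  show "open (cnj ` stolz_angle \<alpha> \<beta>)" unfolding eq by (intro open_Int open_halfspace_lt)
  show "convex (cnj ` stolz_angle \<alpha> \<beta>)" unfolding eq by (intro convex_Int convex_halfspace_lt)
qed

lemma stolz_point: "0 < \<alpha> \<Longrightarrow> 0 < t \<Longrightarrow> t < \<beta> \<Longrightarrow> Complex 0 t \<in> stolz_double \<alpha> \<beta> \<and> Complex 0 (-t) \<in> stolz_double \<alpha> \<beta>"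
  by (auto simp: mem_stolz_double)

text \<open>Inversion maps the Stolz angle into a truncated cone of the same aperture: |z| <= (1 +
  \<alpha>) |Im z| bounds |Im (1 / z)| = |Im z| / |z|^2 from below.\<close>

lemma Im_inverse_stolz:
  assumes z: "z \<in> stolz_double \<alpha> \<beta>" and ab: "0 < \<alpha>"
  shows "Im (1 / z) \<noteq> 0" "\<bar>Re (1 / z)\<bar> \<le> \<alpha> * \<bar>Im (1 / z)\<bar>"
    "1 < (1 + \<alpha>)\<^sup>2 * \<beta> * \<bar>Im (1 / z)\<bar>" "1 \<le> (1 + \<alpha>)\<^sup>2 * \<bar>Im z\<bar> * \<bar>Im (1 / z)\<bar>"
proof -
  have zz: "Im z \<noteq> 0" "\<bar>Re z\<bar> \<le> \<alpha> * \<bar>Im z\<bar>" "\<bar>Im z\<bar> < \<beta>" using z by (auto simp: mem_stolz_double)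
  have n: "0 < cmod z" using zz by auto
  have re: "\<bar>Re (1 / z)\<bar> = \<bar>Re z\<bar> / (cmod z)\<^sup>2" and im: "\<bar>Im (1 / z)\<bar> = \<bar>Im z\<bar> / (cmod z)\<^sup>2"
    by (auto simp: Re_divide Im_divide cmod_power2)
  show "Im (1 / z) \<noteq> 0" using im zz n by auto
  show "\<bar>Re (1 / z)\<bar> \<le> \<alpha> * \<bar>Im (1 / z)\<bar>"
    unfolding re im using zz(2) n by (simp add: divide_right_mono)
  have "cmod z \<le> (1 + \<alpha>) * \<bar>Im z\<bar>" using cmod_le[of z] zz(2) by (simp add: algebra_simps)
  hence "(cmod z)\<^sup>2 \<le> ((1 + \<alpha>) * \<bar>Im z\<bar>)\<^sup>2" by (intro power_mono) auto
  hence "(cmod z)\<^sup>2 \<le> (1 + \<alpha>)\<^sup>2 * \<bar>Im z\<bar> * \<bar>Im z\<bar>" by (simp add: power2_eq_square mult_ac)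
  thus 4: "1 \<le> (1 + \<alpha>)\<^sup>2 * \<bar>Im z\<bar> * \<bar>Im (1 / z)\<bar>"
    unfolding im using n by (simp add: field_simps)
  have "(1 + \<alpha>)\<^sup>2 * \<bar>Im z\<bar> * \<bar>Im (1 / z)\<bar> < (1 + \<alpha>)\<^sup>2 * \<beta> * \<bar>Im (1 / z)\<bar>"
    using zz ab \<open>Im (1 / z) \<noteq> 0\<close> by (intro mult_strict_right_mono mult_strict_left_mono) auto
  with 4 show "1 < (1 + \<alpha>)\<^sup>2 * \<beta> * \<bar>Im (1 / z)\<bar>" by linarith
qed

text \<open>The ball in which the inverse branches are located. Within half the imaginary part of q
  the half-plane is kept, the aperture grows to 2 \<alpha> + 1, and the imaginary part changes by a
  factor between 1/2 and 3/2.\<close>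

lemma cone_cball:
  assumes q: "\<bar>Re q\<bar> \<le> \<alpha> * \<bar>Im q\<bar>" "Im q \<noteq> 0" and w: "w \<in> cball q (\<bar>Im q\<bar> / 2)" and a: "0 \<le> \<alpha>"
  shows "Im w \<noteq> 0" "0 < Im w * Im q" "\<bar>Re w\<bar> \<le> (2 * \<alpha> + 1) * \<bar>Im w\<bar>" "\<bar>Im q\<bar> / 2 \<le> \<bar>Im w\<bar>" "\<bar>Im w\<bar> \<le> 3 / 2 * \<bar>Im q\<bar>"
proof -
  have "cmod (q - w) \<le> \<bar>Im q\<bar> / 2" using w by (simp add: dist_norm)
  hence re: "\<bar>Re q - Re w\<bar> \<le> \<bar>Im q\<bar> / 2" and im: "\<bar>Im q - Im w\<bar> \<le> \<bar>Im q\<bar> / 2"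
    using abs_Re_le_cmod[of "q - w"] abs_Im_le_cmod[of "q - w"] by auto
  show 4: "\<bar>Im q\<bar> / 2 \<le> \<bar>Im w\<bar>" and "\<bar>Im w\<bar> \<le> 3 / 2 * \<bar>Im q\<bar>" using im by linarith+
  show "Im w \<noteq> 0" using 4 q by auto
  show "0 < Im w * Im q" unfolding zero_less_mult_iff using im q(2) by linarith
  have "\<bar>Re w\<bar> \<le> (\<alpha> + 1 / 2) * \<bar>Im q\<bar>" using re q(1) unfolding distrib_right by linarith
  also have "\<dots> \<le> (\<alpha> + 1 / 2) * (2 * \<bar>Im w\<bar>)" using 4 a by (intro mult_left_mono) auto
  finally show "\<bar>Re w\<bar> \<le> (2 * \<alpha> + 1) * \<bar>Im w\<bar>" by (simp add: algebra_simps)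
qed

context real_rv
begin

lemma norm_h_le:
  assumes w: "Im w \<noteq> 0" and e: "cmod (w * G w - 1) \<le> e" "e \<le> 1 / 2"
  shows "cmod (h w) \<le> cmod w * (2 * e)"
proof -
  have w0: "w \<noteq> 0" "G w \<noteq> 0" using w G_nonzero[OF w] by auto
  have "1 = cmod (w * G w - (w * G w - 1))" by simp
  also have "\<dots> \<le> cmod (w * G w) + cmod (w * G w - 1)" by (rule norm_triangle_ineq4)
  finally have half: "1 / 2 \<le> cmod (w * G w)" using e by linarith
  have "h w = w * (- (w * G w - 1) / (w * G w))" using w0 by (simp add: h_def field_simps)
  hence "cmod (h w) = cmod w * (cmod (w * G w - 1) / cmod (w * G w))"
    by (simp only: norm_mult norm_divide norm_minus_cancel)
  also have "\<dots> \<le> cmod w * (e / (1 / 2))"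
    using half e by (intro mult_left_mono frac_le) (auto intro: order_trans[OF norm_ge_zero e(1)])
  finally show ?thesis by (simp add: mult.commute)
qed

text \<open>The choice t = -1 solves 1 / G w = q and so inverts G; the choice t = \<kappa> inverts
  the map \<open>H \<kappa>\<close> of the subordination section. Since \<open>h\<close> is small
  compared to |Im q| on the ball, the map leaves the ball invariant and Brouwer's theorem
  applies.\<close>

lemma cone_fixpoint:
  assumes q: "Im q \<noteq> 0" "\<bar>Re q\<bar> \<le> \<alpha> * \<bar>Im q\<bar>" "0 \<le> \<alpha>" and B: "0 < B" "2 * B \<le> \<bar>Im q\<bar>"
    and \<delta>: "0 < \<delta>" "\<delta> \<le> 1 / 2" and e: "e = (2 + (2 * \<alpha> + 1)) * tB B" "e \<le> 1 / 2"
    and t: "\<bar>t\<bar> * (2 * e * ((2 * \<alpha> + 2) * (3 / 2))) \<le> \<delta>"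
  obtains w where "w \<in> cball q (\<delta> * \<bar>Im q\<bar>)" "w = q + of_real t * h w"
proof -
  have sub: "w \<in> cball q (\<bar>Im q\<bar> / 2)" if "w \<in> cball q (\<delta> * \<bar>Im q\<bar>)" for w
    using that mult_right_mono[OF \<delta>(2), of "\<bar>Im q\<bar>"] by simp
  note c = cone_cball[OF q(2,1) sub q(3)]
  have hb: "cmod (of_real t * h w) \<le> \<delta> * \<bar>Im q\<bar>" if w: "w \<in> cball q (\<delta> * \<bar>Im q\<bar>)" for w
  proof -
    have e0: "0 \<le> e" unfolding e using q B by (simp add: tB_nonneg)
    have "cmod (w * G w - 1) \<le> e"
      unfolding e by (rule G_cone) (use c[OF w] B in linarith)+
    hence "cmod (h w) \<le> cmod w * (2 * e)" using norm_h_le[OF c(1)[OF w]] e by simp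
    also have "\<dots> \<le> ((2 * \<alpha> + 2) * (3 / 2 * \<bar>Im q\<bar>)) * (2 * e)"
    proof (intro mult_right_mono)
      have "cmod w \<le> (2 * \<alpha> + 2) * \<bar>Im w\<bar>" using cmod_le[of w] c(3)[OF w] by (simp add: algebra_simps)
      also have "\<dots> \<le> (2 * \<alpha> + 2) * (3 / 2 * \<bar>Im q\<bar>)" using c(5)[OF w] q by (intro mult_left_mono) auto
      finally show "cmod w \<le> (2 * \<alpha> + 2) * (3 / 2 * \<bar>Im q\<bar>)" .
    qed (use e0 in auto)
    finally have "\<bar>t\<bar> * cmod (h w) \<le> \<bar>t\<bar> * (((2 * \<alpha> + 2) * (3 / 2 * \<bar>Im q\<bar>)) * (2 * e))" by (intro mult_left_mono) auto
    also have "\<dots> = \<bar>t\<bar> * (2 * e * ((2 * \<alpha> + 2) * (3 / 2))) * \<bar>Im q\<bar>" by (simp add: mult_ac)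
    also have "\<dots> \<le> \<delta> * \<bar>Im q\<bar>" by (intro mult_right_mono t) auto
    finally show ?thesis by (simp add: norm_mult)
  qed
  have cont: "continuous_on (cball q (\<delta> * \<bar>Im q\<bar>)) (\<lambda>w. q + of_real t * h w)"
    by (intro continuous_intros continuous_on_subset[OF holomorphic_on_imp_continuous_on[OF h_holomorphic]])
       (use c(1) in auto)
  obtain w where "w \<in> cball q (\<delta> * \<bar>Im q\<bar>)" "q + of_real t * h w = w"
  proof (rule brouwer[OF compact_cball convex_cball _ cont])
    show "cball q (\<delta> * \<bar>Im q\<bar>) \<noteq> {}" using \<delta> mult_nonneg_nonneg[of \<delta> "\<bar>Im q\<bar>"] by (simp add: not_less)
    show "(\<lambda>w. q + of_real t * h w) \<in> cball q (\<delta> * \<bar>Im q\<bar>) \<rightarrow> cball q (\<delta> * \<bar>Im q\<bar>)"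
    proof
      fix w assume "w \<in> cball q (\<delta> * \<bar>Im q\<bar>)"
      from hb[OF this] show "q + of_real t * h w \<in> cball q (\<delta> * \<bar>Im q\<bar>)"
        by (simp add: dist_norm)
    qed
  qed auto
  thus ?thesis using that by metis
qed

lemma G_inj_cone:
  assumes z: "Im z \<noteq> 0" "\<bar>Re z\<bar> \<le> A * \<bar>Im z\<bar>" "B \<le> \<bar>Im z\<bar>"
    and z': "Im z' \<noteq> 0" "\<bar>Re z'\<bar> \<le> A * \<bar>Im z'\<bar>" "B \<le> \<bar>Im z'\<bar>" and B: "0 < B"
    and small: "(4 + A) * ((2 + A) * tB B) < 1" and eq: "G z = G z'"
  shows "z = z'"
proof (rule ccontr)
  assume "z \<noteq> z'"
  hence n: "0 < cmod (z - z')" by simp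
  have "cmod (z - z') \<le> cmod (z - z') * ((4 + A) * ((2 + A) * tB B))"
    using G_diff_cone[OF z z' B] eq by (simp add: norm_minus_commute)
  also have "\<dots> < cmod (z - z') * 1" by (rule mult_strict_left_mono[OF small n])
  finally show False by simp
qed

text \<open>Existence of a preimage comes from \<open>cone_fixpoint\<close>; uniqueness and
  holomorphy come from injectivity of G on an open cone around all the balls, of aperture A slightly
  larger than 2 \<alpha> + 1. The law enters only through \<open>tB B\<close>, so one choice of B
  and \<beta> serves all laws for which this number is small. The bound 1 / (6 A) is what the fixed
  point with radius factor 1/2 requires: twice 1 / (6 A) times 3 A / 2 is 1/2.\<close>

lemma inverse_on_stolz:
  assumes \<alpha>: "0 < \<alpha>" and B: "0 < B" and \<beta>: "0 < \<beta>" "(1 + \<alpha>)\<^sup>2 * \<beta> * (2 * B) \<le> 1" and A: "A = 2 * \<alpha> + 2"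
    and small: "(4 + A) * ((2 + A) * tB B) \<le> 1 / (6 * A)"
  obtains K where "K holomorphic_on stolz_double \<alpha> \<beta>"
    "\<And>z. z \<in> stolz_double \<alpha> \<beta> \<Longrightarrow> G (K z) = z \<and> K z \<in> cball (1 / z) (\<bar>Im (1 / z)\<bar> / 2)"
    "\<And>z w. z \<in> stolz_double \<alpha> \<beta> \<Longrightarrow> w \<in> cball (1 / z) (\<bar>Im (1 / z)\<bar> / 2) \<Longrightarrow> G w = z \<Longrightarrow> w = K z"
proof -
  define V where "V = {z. Im z \<noteq> 0} \<inter> ({z. \<bar>Re z\<bar> < A * \<bar>Im z\<bar>} \<inter> {z. B < \<bar>Im z\<bar>})"
  have t0: "0 \<le> tB B" using B by (rule tB_nonneg)
  have A2: "2 \<le> A" using \<alpha> A by simp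
  have e: "(2 + A) * tB B \<le> 1 / (6 * A)"
  proof -
    have "(2 + A) * tB B * 1 \<le> (2 + A) * tB B * (4 + A)" using t0 A2 by (intro mult_left_mono) auto
    thus ?thesis using small by (simp add: mult_ac)
  qed
  have sm: "1 / (6 * A) \<le> 1 / 12" using A2 by simp
  have small': "(4 + A) * ((2 + A) * tB B) < 1" using small sm by linarith
  have "open V" unfolding V_def
    by (intro open_Int open_Collect_less open_Collect_neq continuous_intros)
  moreover have inj: "inj_on G V"
    unfolding inj_on_def V_def using G_inj_cone[of _ A B, OF _ _ _ _ _ _ B small'] by auto
  moreover have hol: "G holomorphic_on V"
    by (rule holomorphic_on_subset[OF G_holomorphic]) (auto simp: V_def)
  ultimately obtain g where g: "g holomorphic_on (G ` V)" "\<And>z. z \<in> V \<Longrightarrow> g (G z) = z"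
    using holomorphic_has_inverse by metis
  have Vin: "w \<in> V" if z: "z \<in> stolz_double \<alpha> \<beta>" and w: "w \<in> cball (1 / z) (\<bar>Im (1 / z)\<bar> / 2)" for z w
  proof -
    note i = Im_inverse_stolz[OF z \<alpha>]
    note c = cone_cball[OF i(2,1) w less_imp_le[OF \<alpha>]]
    have "(1 + \<alpha>)\<^sup>2 * \<beta> * (2 * B) < (1 + \<alpha>)\<^sup>2 * \<beta> * \<bar>Im (1 / z)\<bar>" using i(3) \<beta> by linarith
    hence "2 * B < \<bar>Im (1 / z)\<bar>" using \<beta> \<alpha> by simp
    hence "B < \<bar>Im w\<bar>" using c(4) by linarith
    moreover have "(2 * \<alpha> + 1) * \<bar>Im w\<bar> < A * \<bar>Im w\<bar>" unfolding A using c(1) by simp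
    hence "\<bar>Re w\<bar> < A * \<bar>Im w\<bar>" using c(3) by linarith
    ultimately show ?thesis using c(1) unfolding V_def by blast
  qed
  have ex: "\<exists>w \<in> cball (1 / z) (\<bar>Im (1 / z)\<bar> / 2). G w = z" if z: "z \<in> stolz_double \<alpha> \<beta>" for z
  proof -
    note i = Im_inverse_stolz[OF z \<alpha>]
    have "(1 + \<alpha>)\<^sup>2 * \<beta> * (2 * B) < (1 + \<alpha>)\<^sup>2 * \<beta> * \<bar>Im (1 / z)\<bar>" using i(3) \<beta> by linarith
    hence 2: "2 * B \<le> \<bar>Im (1 / z)\<bar>" using \<beta> \<alpha> by simp
    have e': "(2 + (2 * \<alpha> + 1)) * tB B \<le> 1 / (6 * A)"
    proof -
      have "(2 + (2 * \<alpha> + 1)) * tB B \<le> (2 + A) * tB B" unfolding A using t0 by (intro mult_right_mono) auto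
      thus ?thesis using e by linarith
    qed
    obtain w where w: "w \<in> cball (1 / z) (1 / 2 * \<bar>Im (1 / z)\<bar>)" "w = 1 / z + of_real (- 1) * h w"
    proof (rule cone_fixpoint[OF i(1,2) _ B 2, where \<delta> = "1 / 2" and t = "- 1"])
      show "(2 + (2 * \<alpha> + 1)) * tB B \<le> 1 / 2" using e' sm by linarith
      have "\<bar>- 1\<bar> * (2 * ((2 + (2 * \<alpha> + 1)) * tB B) * ((2 * \<alpha> + 2) * (3 / 2)))
          \<le> \<bar>- 1\<bar> * (2 * (1 / (6 * A)) * ((2 * \<alpha> + 2) * (3 / 2)))"
        using e' \<alpha> by (intro mult_left_mono mult_right_mono) auto
      also have "\<dots> = 1 / 2" using A \<alpha> by (simp add: field_simps)
      finally show "\<bar>- 1\<bar> * (2 * ((2 + (2 * \<alpha> + 1)) * tB B) * ((2 * \<alpha> + 2) * (3 / 2))) \<le> 1 / 2" .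
    qed (use \<alpha> in auto)
    have "1 / G w = 1 / z" using w(2) by (simp add: h_def algebra_simps)
    hence "G w = z" by (metis div_by_1 divide_divide_eq_right mult_1)
    with w(1) show ?thesis by auto
  qed
  have sub: "stolz_double \<alpha> \<beta> \<subseteq> G ` V" using ex Vin by blast
  show ?thesis
  proof (rule that[of g])
    show "g holomorphic_on stolz_double \<alpha> \<beta>" by (rule holomorphic_on_subset[OF g(1) sub])
    fix z assume z: "z \<in> stolz_double \<alpha> \<beta>"
    obtain w where "w \<in> cball (1 / z) (\<bar>Im (1 / z)\<bar> / 2)" "G w = z" using ex[OF z] by blast
    with g(2)[OF Vin[OF z this(1)]] show "G (g z) = z \<and> g z \<in> cball (1 / z) (\<bar>Im (1 / z)\<bar> / 2)" by auto
    show "w = g z" if "w \<in> cball (1 / z) (\<bar>Im (1 / z)\<bar> / 2)" "G w = z" for w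
      using g(2)[OF Vin[OF z that(1)]] that by auto
  qed
qed

text \<open>The function equals \<open>K z * G (K z) - 1\<close>, which \<open>G_cone\<close> bounds
  at the scale B = |Im (K z)|; this scale tends to infinity as z -> 0.\<close>

lemma inverse_tendsto:
  assumes \<alpha>: "0 < \<alpha>"
    and K: "\<And>z. z \<in> stolz_double \<alpha> \<beta> \<Longrightarrow> G (K z) = z \<and> K z \<in> cball (1 / z) (\<bar>Im (1 / z)\<bar> / 2)"
  shows "((\<lambda>z. z * (K z - 1 / z)) \<longlongrightarrow> 0) (at 0 within stolz_double \<alpha> \<beta>)"
proof (rule Lim_null_comparison)
  have ev: "\<forall>\<^sub>F z in at 0 within stolz_double \<alpha> \<beta>. z \<in> stolz_double \<alpha> \<beta>"
    by (auto simp: eventually_at_filter)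
  note c = cone_cball[OF Im_inverse_stolz(2)[OF _ \<alpha>] Im_inverse_stolz(1)[OF _ \<alpha>]]
  show "\<forall>\<^sub>F z in at 0 within stolz_double \<alpha> \<beta>. cmod (z * (K z - 1 / z)) \<le> (2 + (2 * \<alpha> + 1)) * tB \<bar>Im (K z)\<bar>"
    using ev
  proof eventually_elim
    case (elim z)
    note k = K[OF elim]
    note cc = c[OF elim elim conjunct2[OF k]]
    have "z * (K z - 1 / z) = K z * G (K z) - 1"
      using k elim by (auto simp: mem_stolz_double right_diff_distrib)
    moreover have "cmod (K z * G (K z) - 1) \<le> (2 + (2 * \<alpha> + 1)) * tB \<bar>Im (K z)\<bar>"
      by (rule G_cone) (use cc \<alpha> in auto)
    ultimately show ?case by simp
  qed
  have "filterlim (\<lambda>z. \<bar>Im (K z)\<bar>) at_top (at 0 within stolz_double \<alpha> \<beta>)"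
  proof (rule filterlim_at_top_mono)
    show "filterlim (\<lambda>z. 1 / (2 * (1 + \<alpha>)\<^sup>2) * inverse (cmod z)) at_top (at 0 within stolz_double \<alpha> \<beta>)"
    proof (rule filterlim_tendsto_pos_mult_at_top[OF tendsto_const])
      have "filterlim (\<lambda>z. inverse (cmod z)) at_top (at (0::complex))"
        by (rule filterlim_compose[OF filterlim_inverse_at_top_right])
           (auto simp: filterlim_at eventually_at_filter intro!: tendsto_eq_intros)
      thus "filterlim (\<lambda>z. inverse (cmod z)) at_top (at 0 within stolz_double \<alpha> \<beta>)"
        by (rule filterlim_mono) (auto intro: at_le)
    qed (use \<alpha> in auto)
    show "\<forall>\<^sub>F z in at 0 within stolz_double \<alpha> \<beta>. 1 / (2 * (1 + \<alpha>)\<^sup>2) * inverse (cmod z) \<le> \<bar>Im (K z)\<bar>"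
      using ev
    proof eventually_elim
      case (elim z)
      note cc = c[OF elim elim conjunct2[OF K[OF elim]]]
      have z: "z \<noteq> 0" using elim by (auto simp: mem_stolz_double)
      have "1 \<le> (1 + \<alpha>)\<^sup>2 * \<bar>Im z\<bar> * \<bar>Im (1 / z)\<bar>" by (rule Im_inverse_stolz(4)[OF elim \<alpha>])
      also have "\<dots> \<le> (1 + \<alpha>)\<^sup>2 * cmod z * (2 * \<bar>Im (K z)\<bar>)"
        using cc(4) \<alpha> abs_Im_le_cmod[of z] by (intro mult_mono mult_left_mono) auto
      finally show ?case using z \<alpha> by (simp add: field_simps)
    qed
  qed
  from filterlim_compose[OF tB_tendsto this]
  show "((\<lambda>z. (2 + (2 * \<alpha> + 1)) * tB \<bar>Im (K z)\<bar>) \<longlongrightarrow> 0) (at 0 within stolz_double \<alpha> \<beta>)"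
    using tendsto_mult_right_zero by blast
qed

end

lemma R_transform_on_mono:
  assumes "R_transform_on m \<alpha> \<beta> R" "\<alpha>' \<le> \<alpha>" "\<beta>' \<le> \<beta>"
  shows "R_transform_on m \<alpha>' \<beta>' R"
  using assms(1) stolz_double_mono[OF assms(2,3)] unfolding R_transform_on_def
  by (auto intro: holomorphic_on_subset tendsto_within_subset)

lemma R_transform_on_cong:
  assumes "\<And>z. z \<in> stolz_double \<alpha> \<beta> \<Longrightarrow> R z = R' z"
  shows "R_transform_on m \<alpha> \<beta> R \<longleftrightarrow> R_transform_on m \<alpha> \<beta> R'"
proof -
  have "R holomorphic_on stolz_double \<alpha> \<beta> \<longleftrightarrow> R' holomorphic_on stolz_double \<alpha> \<beta>"
    using assms by (intro holomorphic_cong) auto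
  moreover have "((\<lambda>z. z * R z) \<longlongrightarrow> 0) (at 0 within stolz_double \<alpha> \<beta>) \<longleftrightarrow> ((\<lambda>z. z * R' z) \<longlongrightarrow> 0) (at 0 within stolz_double \<alpha> \<beta>)"
    using assms by (intro tendsto_cong) (auto simp: eventually_at_filter)
  ultimately show ?thesis unfolding R_transform_on_def using assms by auto
qed

lemma R_transform_near_0:
  assumes R: "R_transform_on m \<alpha> \<beta> R" and \<alpha>: "0 < \<alpha>" and \<beta>: "0 < \<beta>" and \<delta>: "0 < \<delta>"
  obtains \<beta>' where "0 < \<beta>'" "\<beta>' \<le> \<beta>" "\<And>z. z \<in> stolz_double \<alpha> \<beta>' \<Longrightarrow> cmod (z * R z) < \<delta>"
proof -
  have "((\<lambda>z. z * R z) \<longlongrightarrow> 0) (at 0 within stolz_double \<alpha> \<beta>)" using R by (simp add: R_transform_on_def)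
  hence "\<forall>\<^sub>F z in at 0 within stolz_double \<alpha> \<beta>. cmod (z * R z) < \<delta>"
    using tendstoD[OF _ \<delta>] by fastforce
  then obtain d where d: "0 < d" "\<And>z. z \<in> stolz_double \<alpha> \<beta> \<Longrightarrow> z \<noteq> 0 \<Longrightarrow> cmod z < d \<Longrightarrow> cmod (z * R z) < \<delta>"
    unfolding eventually_at by (auto simp: dist_norm)
  show ?thesis
  proof (rule that[of "min \<beta> (d / (1 + \<alpha>))"])
    fix z assume z: "z \<in> stolz_double \<alpha> (min \<beta> (d / (1 + \<alpha>)))"
    hence zz: "Im z \<noteq> 0" "\<bar>Re z\<bar> < \<alpha> * \<bar>Im z\<bar>" "\<bar>Im z\<bar> < d / (1 + \<alpha>)" by (auto simp: mem_stolz_double)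
    have "cmod z < \<bar>Im z\<bar> * (1 + \<alpha>)" using cmod_le[of z] zz by (simp add: algebra_simps)
    also have "\<dots> < d" using zz \<alpha> by (simp add: field_simps)
    finally have "cmod z < d" .
    moreover have "z \<in> stolz_double \<alpha> \<beta>" using z by (auto simp: mem_stolz_double)
    ultimately show "cmod (z * R z) < \<delta>" using zz by (intro d) auto
  qed (use d \<alpha> \<beta> in auto)
qed

lemma R_transform_cball:
  assumes R: "R_transform_on m \<alpha> \<beta> R" and \<alpha>: "0 < \<alpha>" and \<beta>: "0 < \<beta>"
  obtains \<beta>' where "0 < \<beta>'" "\<beta>' \<le> \<beta>"
    "\<And>z. z \<in> stolz_double \<alpha> \<beta>' \<Longrightarrow> 1 / z + R z \<in> cball (1 / z) (\<bar>Im (1 / z)\<bar> / 2)"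
proof -
  have "0 < 1 / (2 * (1 + \<alpha>))" using \<alpha> by simp
  from R_transform_near_0[OF R \<alpha> \<beta> this] obtain \<beta>' where b: "0 < \<beta>'" "\<beta>' \<le> \<beta>"
     "\<And>z. z \<in> stolz_double \<alpha> \<beta>' \<Longrightarrow> cmod (z * R z) < 1 / (2 * (1 + \<alpha>))" by blast
  show ?thesis
  proof (rule that[OF b(1,2)])
    fix z assume z: "z \<in> stolz_double \<alpha> \<beta>'"
    note i = Im_inverse_stolz[OF z \<alpha>]
    have z0: "z \<noteq> 0" using z by (auto simp: mem_stolz_double)
    have "cmod (R z) = cmod (z * R z) * cmod (1 / z)" using z0 by (simp add: norm_mult norm_divide)
    also have "\<dots> \<le> 1 / (2 * (1 + \<alpha>)) * ((1 + \<alpha>) * \<bar>Im (1 / z)\<bar>)"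
    proof (rule mult_mono)
      show "cmod (z * R z) \<le> 1 / (2 * (1 + \<alpha>))" using b(3)[OF z] by simp
      show "cmod (1 / z) \<le> (1 + \<alpha>) * \<bar>Im (1 / z)\<bar>"
        using cmod_le[of "1 / z"] i(2) unfolding distrib_right by linarith
    qed (use \<alpha> in auto)
    also have "\<dots> = \<bar>Im (1 / z)\<bar> / 2" using \<alpha> by (simp add: divide_simps)
    finally show "1 / z + R z \<in> cball (1 / z) (\<bar>Im (1 / z)\<bar> / 2)" by (simp add: dist_norm)
  qed
qed

lemma (in real_rv) eventually_tB_small:
  assumes "0 < \<epsilon>" obtains B where "0 < B" "tB B < \<epsilon>"
proof -
  have "\<forall>\<^sub>F B in at_top. tB B < \<epsilon>" by (rule order_tendstoD(2)[OF tB_tendsto assms])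
  with eventually_gt_at_top[of 0] have "\<forall>\<^sub>F B in at_top. 0 < B \<and> tB B < \<epsilon>" by eventually_elim auto
  from eventually_happens[OF this] show ?thesis using that by auto
qed

lemma stolz_bound_exists:
  assumes "0 < (\<alpha>::real)" "0 < B"
  obtains \<beta> where "0 < \<beta>" "(1 + \<alpha>)\<^sup>2 * \<beta> * (2 * B) \<le> 1"
  by (rule that[of "1 / ((1 + \<alpha>)\<^sup>2 * (2 * B))"]) (use assms in auto)

lemma R_transform_Im:
  assumes m: "borel_prob m" and R: "R_transform_on m \<alpha> \<beta> R" and z: "z \<in> stolz_double \<alpha> \<beta>"
  shows "Im (1 / z + R z) \<noteq> 0" "Im (1 / z + R z) * Im z < 0" "real_rv.G m (\<lambda>x. x) (1 / z + R z) = z"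
proof -
  interpret real_rv m "\<lambda>x. x" using m by (rule borel_prob_real_rv)
  show 1: "Im (1 / z + R z) \<noteq> 0" and 2: "G (1 / z + R z) = z"
    using R z unfolding R_transform_on_def cauchy_transform_eq[OF m] by (simp_all add: complex_is_Real_iff)
  show "Im (1 / z + R z) * Im z < 0" using G_nonzero(2)[OF 1] 2 by simp
qed

text \<open>The equation G (1 / z + R z) = z alone does not single out a branch. The condition z R z
  -> 0 forces 1 / z + R z into the ball around 1 / z, hence into a truncated cone on which G is
  injective.\<close>

lemma R_transform_eq_near_0:
  assumes m: "borel_prob m" and R: "R_transform_on m \<alpha> \<beta> R" "0 < \<alpha>" "0 < \<beta>"
    and R': "R_transform_on m \<alpha>' \<beta>' R'" "0 < \<alpha>'" "0 < \<beta>'"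
  obtains \<beta>0 where "0 < \<beta>0" "\<beta>0 \<le> \<beta>" "\<beta>0 \<le> \<beta>'"
    "\<And>z. z \<in> stolz_double (min \<alpha> \<alpha>') \<beta>0 \<Longrightarrow> R z = R' z"
proof -
  define a where "a = min \<alpha> \<alpha>'"
  have a: "0 < a" using R R' by (simp add: a_def)
  have Ra: "R_transform_on m a \<beta> R" "R_transform_on m a \<beta>' R'"
    using R R' by (auto intro: R_transform_on_mono simp: a_def)
  interpret real_rv m "\<lambda>x. x" using m by (rule borel_prob_real_rv)
  obtain b1 where b1: "0 < b1" "b1 \<le> \<beta>" "\<And>z. z \<in> stolz_double a b1 \<Longrightarrow> 1 / z + R z \<in> cball (1 / z) (\<bar>Im (1 / z)\<bar> / 2)"
    using R_transform_cball[OF Ra(1) a R(3)] by blast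
  obtain b2 where b2: "0 < b2" "b2 \<le> \<beta>'" "\<And>z. z \<in> stolz_double a b2 \<Longrightarrow> 1 / z + R' z \<in> cball (1 / z) (\<bar>Im (1 / z)\<bar> / 2)"
    using R_transform_cball[OF Ra(2) a R'(3)] by blast
  define A where "A = 2 * a + 1"
  have A: "0 < (4 + A) * (2 + A)" using a by (simp add: A_def)
  obtain B where B: "0 < B" "tB B < 1 / ((4 + A) * (2 + A))"
    using A by (auto intro: eventually_tB_small[of "1 / ((4 + A) * (2 + A))"])
  hence small: "(4 + A) * ((2 + A) * tB B) < 1" using A by (simp add: field_simps)
  obtain b3 where b3: "0 < b3" "(1 + a)\<^sup>2 * b3 * (2 * B) \<le> 1" using stolz_bound_exists[OF a B(1)] by blast
  define b where "b = min b1 (min b2 b3)"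
  show ?thesis
  proof (rule that[of b])
    fix z assume "z \<in> stolz_double (min \<alpha> \<alpha>') b"
    hence z: "z \<in> stolz_double a b1" "z \<in> stolz_double a b2" "z \<in> stolz_double a b3"
      by (auto simp: mem_stolz_double a_def b_def)
    note i = Im_inverse_stolz[OF z(3) a]
    note c = cone_cball[OF i(2,1) b1(3)[OF z(1)] less_imp_le[OF a]]
    note c' = cone_cball[OF i(2,1) b2(3)[OF z(2)] less_imp_le[OF a]]
    have "(1 + a)\<^sup>2 * b3 * (2 * B) < (1 + a)\<^sup>2 * b3 * \<bar>Im (1 / z)\<bar>" using i(3) b3 by linarith
    hence 2: "B \<le> \<bar>Im (1 / z)\<bar> / 2" using b3 a by simp
    have zz: "z \<in> stolz_double \<alpha> \<beta>" "z \<in> stolz_double \<alpha>' \<beta>'"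
      using z b1 b2 stolz_double_mono[of a \<alpha> b1 \<beta>] stolz_double_mono[of a \<alpha>' b2 \<beta>'] by (auto simp: a_def)
    have "1 / z + R z = 1 / z + R' z"
    proof (rule G_inj_cone[OF c(1) _ _ c'(1) _ _ B(1) small])
      show "G (1 / z + R z) = G (1 / z + R' z)"
        using R_transform_Im(3)[OF m R(1) zz(1)] R_transform_Im(3)[OF m R'(1) zz(2)] by simp
      show "\<bar>Re (1 / z + R z)\<bar> \<le> A * \<bar>Im (1 / z + R z)\<bar>" "\<bar>Re (1 / z + R' z)\<bar> \<le> A * \<bar>Im (1 / z + R' z)\<bar>"
        unfolding A_def by (rule c(3), rule c'(3))
      show "B \<le> \<bar>Im (1 / z + R z)\<bar>" "B \<le> \<bar>Im (1 / z + R' z)\<bar>"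
        by (rule order_trans[OF 2 c(4)], rule order_trans[OF 2 c'(4)])
    qed
    thus "R z = R' z" by simp
  qed (use b1 b2 b3 in \<open>auto simp: b_def\<close>)
qed

text \<open>The image of the lower Stolz angle under 1 / z + R z is open and lies in the upper
  half-plane. Both Cauchy transforms invert the map there, so they agree on the whole half-plane by
  the identity theorem.\<close>

lemma R_transform_inject:
  assumes m: "borel_prob m" and m': "borel_prob m'" and \<alpha>: "0 < \<alpha>" and \<beta>: "0 < \<beta>"
    and R: "R_transform_on m \<alpha> \<beta> R" and R': "R_transform_on m' \<alpha> \<beta> R"
  shows "m = m'"
proof (rule cauchy_transform_inject[OF m m'])
  interpret M: real_rv m "\<lambda>x. x" using m by (rule borel_prob_real_rv)
  interpret M': real_rv m' "\<lambda>x. x" using m' by (rule borel_prob_real_rv)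
  define K where "K z = 1 / z + R z" for z
  define S where "S = K ` stolz_angle \<alpha> \<beta>"
  have sub: "stolz_angle \<alpha> \<beta> \<subseteq> stolz_double \<alpha> \<beta>" by (simp add: stolz_double_def)
  note i = R_transform_Im[OF m R, folded K_def] and i' = R_transform_Im[OF m' R', folded K_def]
  have "K holomorphic_on stolz_angle \<alpha> \<beta>"
    unfolding K_def[abs_def] using R sub
    by (intro holomorphic_intros) (auto simp: R_transform_on_def mem_stolz_angle intro: holomorphic_on_subset)
  moreover have "inj_on K (stolz_angle \<alpha> \<beta>)"
    using i(3) sub by (intro inj_on_inverseI[of _ M.G]) auto
  ultimately have "open S" unfolding S_def
    by (intro open_mapping_thm3) (auto simp: open_convex_stolz_angle)
  moreover have "S \<noteq> {}"
  proof -
    have "Complex 0 (- (\<beta> / 2)) \<in> stolz_angle \<alpha> \<beta>" using \<alpha> \<beta> by (auto simp: mem_stolz_angle)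
    thus ?thesis unfolding S_def by auto
  qed
  moreover have up: "S \<subseteq> {z. 0 < Im z}"
  proof
    fix w assume "w \<in> S"
    then obtain z where z: "z \<in> stolz_angle \<alpha> \<beta>" "w = K z" unfolding S_def by auto
    hence "z \<in> stolz_double \<alpha> \<beta>" using sub by blast
    hence "Im (K z) * Im z < 0" by (rule i(2))
    moreover have "Im z < 0" using z by (simp add: mem_stolz_angle)
    ultimately have "0 < Im (K z)" by (simp add: mult_less_0_iff)
    thus "w \<in> {z. 0 < Im z}" using z by simp
  qed
  moreover have "M.G w = M'.G w" if "w \<in> S" for w
    using that i(3) i'(3) sub unfolding S_def by auto
  moreover have "connected {z. 0 < Im z}" by (simp add: convex_connected convex_halfspace_Im_gt)
  moreover have "open {z. 0 < Im z}" by (simp add: open_halfspace_Im_gt)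
  moreover have "M.G holomorphic_on {z. 0 < Im z}" "M'.G holomorphic_on {z. 0 < Im z}"
    by (auto intro: holomorphic_on_subset[OF M.G_holomorphic] holomorphic_on_subset[OF M'.G_holomorphic])
  ultimately have "M.G z = M'.G z" if "0 < Im z" for z
    using analytic_continuation_open[of S "{z. 0 < Im z}" M.G M'.G z] that by auto
  thus "cauchy_transform m z = cauchy_transform m' z" if "0 < Im z" for z
    using that by (simp add: cauchy_transform_eq[OF m] cauchy_transform_eq[OF m'])
qed

lemma R_transform_inject':
  assumes m: "borel_prob m" and m': "borel_prob m'"
    and R: "R_transform_on m \<alpha> \<beta> R" "0 < \<alpha>" "0 < \<beta>" and R': "R_transform_on m' \<alpha>' \<beta>' R'" "0 < \<alpha>'" "0 < \<beta>'"
    and eq: "\<And>z. z \<in> stolz_double \<alpha>0 \<beta>0 \<Longrightarrow> R z = R' z" "0 < \<alpha>0" "0 < \<beta>0"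
  shows "m = m'"
proof -
  define a where "a = min \<alpha>0 (min \<alpha> \<alpha>')"
  define b where "b = min \<beta>0 (min \<beta> \<beta>')"
  have "R_transform_on m a b R" "R_transform_on m' a b R'"
    using R R' by (auto simp: a_def b_def intro: R_transform_on_mono)
  moreover have "R z = R' z" if "z \<in> stolz_double a b" for z
    using eq(1) that stolz_double_mono[of a \<alpha>0 b \<beta>0] by (auto simp: a_def b_def)
  ultimately have "R_transform_on m a b R" "R_transform_on m' a b R"
    using R_transform_on_cong[of a b R R' m'] by blast+
  thus ?thesis using R R' eq by (intro R_transform_inject[OF m m']) (auto simp: a_def b_def)
qed

lemma weak_conv_G:
  assumes mn: "\<And>n. borel_prob (mn n)" and m: "borel_prob m" and conv: "weak_conv_m mn m" and z: "Im z \<noteq> 0"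
  shows "(\<lambda>n. real_rv.G (mn n) (\<lambda>x. x) z) \<longlonglongrightarrow> real_rv.G m (\<lambda>x. x) z"
  unfolding real_rv.G_def[OF borel_prob_real_rv[OF m]] real_rv.G_def[OF borel_prob_real_rv[OF mn]]
proof (rule weak_conv_imp_integral_bdd_continuous_conv)
  show "real_distribution (mn n)" for n using mn by (rule borel_prob_real_distribution)
  show "real_distribution m" using m by (rule borel_prob_real_distribution)
  show "isCont (res z) x" for x
    unfolding res_def using res_nonzero[OF z] by (intro continuous_intros) auto
  show "cmod (res z x) \<le> 1 / \<bar>Im z\<bar>" for x using norm_res_le[OF z] .
qed (rule conv)

lemma weak_conv_tB:
  assumes mn: "\<And>n. borel_prob (mn n)" and m: "borel_prob m" and conv: "weak_conv_m mn m" and B: "0 < B"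
  shows "(\<lambda>n. real_rv.tB (mn n) (\<lambda>x. x) B) \<longlonglongrightarrow> real_rv.tB m (\<lambda>x. x) B"
  unfolding real_rv.tB_def[OF borel_prob_real_rv[OF m]] real_rv.tB_def[OF borel_prob_real_rv[OF mn]]
proof (rule weak_conv_imp_integral_bdd_continuous_conv)
  show "real_distribution (mn n)" for n using mn by (rule borel_prob_real_distribution)
  show "real_distribution m" using m by (rule borel_prob_real_distribution)
  show "isCont (\<lambda>x. min 1 (\<bar>x\<bar> / B)) x" for x
    using B by (intro continuous_intros) auto
  show "norm (min 1 (\<bar>x\<bar> / B)) \<le> 1" for x using B by auto
qed (rule conv)

text \<open>The scale B is chosen for the limit law. By \<open>weak_conv_tB\<close> the value
  \<open>tB B\<close> is small for all late members as well, so their inverses exist on one common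
  Stolz angle.\<close>

lemma weak_conv_R_transform:
  assumes mn: "\<And>n. borel_prob (mn n)" and m: "borel_prob m" and conv: "weak_conv_m mn m"
    and R: "R_transform_on m \<alpha> \<beta> R" and \<alpha>: "0 < \<alpha>" and \<beta>: "0 < \<beta>"
  obtains \<beta>' N Rn where "0 < \<beta>'" "\<beta>' \<le> \<beta>" "\<And>n. N \<le> n \<Longrightarrow> R_transform_on (mn n) \<alpha> \<beta>' (Rn n)"
    "\<And>z. z \<in> stolz_double \<alpha> \<beta>' \<Longrightarrow> (\<lambda>n. Rn n z) \<longlonglongrightarrow> R z"
proof -
  interpret M: real_rv m "\<lambda>x. x" using m by (rule borel_prob_real_rv)
  interpret Mn: real_rv "mn n" "\<lambda>x. x" for n using mn by (rule borel_prob_real_rv)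
  define A where "A = 2 * \<alpha> + 2"
  have A: "0 < A" "0 < (4 + A) * (2 + A) * (6 * A)" using \<alpha> by (auto simp: A_def)
  obtain B where B: "0 < B" "M.tB B < 1 / ((4 + A) * (2 + A) * (6 * A))"
    using A by (auto intro: M.eventually_tB_small[of "1 / ((4 + A) * (2 + A) * (6 * A))"])
  have "\<forall>\<^sub>F n in sequentially. Mn.tB n B < 1 / ((4 + A) * (2 + A) * (6 * A))"
    by (rule order_tendstoD(2)[OF weak_conv_tB[OF mn m conv B(1)] B(2)])
  then obtain N where N: "\<And>n. N \<le> n \<Longrightarrow> Mn.tB n B < 1 / ((4 + A) * (2 + A) * (6 * A))"
    unfolding eventually_sequentially by blast
  have small: "(4 + A) * ((2 + A) * Mn.tB n B) \<le> 1 / (6 * A)" if "N \<le> n" for n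
  proof -
    have "(4 + A) * (2 + A) * Mn.tB n B \<le> (4 + A) * (2 + A) * (1 / ((4 + A) * (2 + A) * (6 * A)))"
      using N[OF that] A by (intro mult_left_mono) auto
    also have "\<dots> = 1 / (6 * A)" using A by (auto simp: divide_simps)
    finally show ?thesis by (simp only: mult.assoc)
  qed
  obtain b1 where b1: "0 < b1" "b1 \<le> \<beta>" "\<And>z. z \<in> stolz_double \<alpha> b1 \<Longrightarrow> 1 / z + R z \<in> cball (1 / z) (\<bar>Im (1 / z)\<bar> / 2)"
    using R_transform_cball[OF R \<alpha> \<beta>] by blast
  obtain b2 where b2: "0 < b2" "(1 + \<alpha>)\<^sup>2 * b2 * (2 * B) \<le> 1" using stolz_bound_exists[OF \<alpha> B(1)] by blast
  define b where "b = min b1 b2"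
  have b: "0 < b" "b \<le> b1" "b \<le> b2" using b1 b2 by (auto simp: b_def)
  have bB: "(1 + \<alpha>)\<^sup>2 * b * (2 * B) \<le> 1"
  proof -
    have "(1 + \<alpha>)\<^sup>2 * b * (2 * B) \<le> (1 + \<alpha>)\<^sup>2 * b2 * (2 * B)"
      using b B by (intro mult_right_mono mult_left_mono) auto
    thus ?thesis using b2 by linarith
  qed
  have "\<exists>K. K holomorphic_on stolz_double \<alpha> b \<and>
    (\<forall>z \<in> stolz_double \<alpha> b. Mn.G n (K z) = z \<and> K z \<in> cball (1 / z) (\<bar>Im (1 / z)\<bar> / 2))" if "N \<le> n" for n
    using Mn.inverse_on_stolz[OF \<alpha> B(1) b(1) bB A_def small[OF that]] by metis
  then obtain K where K: "\<And>n. N \<le> n \<Longrightarrow> K n holomorphic_on stolz_double \<alpha> b"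
    "\<And>n z. N \<le> n \<Longrightarrow> z \<in> stolz_double \<alpha> b \<Longrightarrow> Mn.G n (K n z) = z \<and> K n z \<in> cball (1 / z) (\<bar>Im (1 / z)\<bar> / 2)"
    by metis
  note cc = cone_cball[OF Im_inverse_stolz(2,1)[OF _ \<alpha>] _ less_imp_le[OF \<alpha>]]
  show ?thesis
  proof (rule that[where N=N])
    show "0 < b" "b \<le> \<beta>" using b b1 by auto
    show "R_transform_on (mn n) \<alpha> b (\<lambda>z. K n z - 1 / z)" if n: "N \<le> n" for n
      unfolding R_transform_on_def cauchy_transform_eq[OF mn]
    proof (intro conjI ballI)
      show "(\<lambda>z. K n z - 1 / z) holomorphic_on stolz_double \<alpha> b"
        by (intro holomorphic_intros K n) (auto simp: mem_stolz_double)
      show "((\<lambda>z. z * (K n z - 1 / z)) \<longlongrightarrow> 0) (at 0 within stolz_double \<alpha> b)"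
        by (rule Mn.inverse_tendsto[OF \<alpha>]) (rule K(2)[OF n])
      fix z assume z: "z \<in> stolz_double \<alpha> b"
      show "Mn.G n (1 / z + (K n z - 1 / z)) = z" using K(2)[OF n z] by simp
      have "Im (K n z) \<noteq> 0" using cc(1)[OF z z conjunct2[OF K(2)[OF n z]]] .
      thus "1 / z + (K n z - 1 / z) \<notin> \<real>" by (simp add: complex_is_Real_iff)
    qed
    fix z assume z: "z \<in> stolz_double \<alpha> b"
    define k where "k = 1 / z + R z"
    have z1: "z \<in> stolz_double \<alpha> b1" "z \<in> stolz_double \<alpha> b2" "z \<in> stolz_double \<alpha> \<beta>"
      using z b b1 by (auto simp: mem_stolz_double)
    have kball: "k \<in> cball (1 / z) (\<bar>Im (1 / z)\<bar> / 2)" using b1(3)[OF z1(1)] by (simp add: k_def)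
    note c = cc[OF z z kball]
    have Gk: "M.G k = z" using R_transform_Im(3)[OF m R z1(3)] by (simp add: k_def)
    have lim: "(\<lambda>n. Mn.G n k) \<longlonglongrightarrow> z" using weak_conv_G[OF mn m conv c(1)] Gk by simp
    have "(1 + \<alpha>)\<^sup>2 * b2 * (2 * B) < (1 + \<alpha>)\<^sup>2 * b2 * \<bar>Im (1 / z)\<bar>" using Im_inverse_stolz(3)[OF z1(2) \<alpha>] b2 by linarith
    hence 2: "B \<le> \<bar>Im (1 / z)\<bar> / 2" using b2 \<alpha> by simp
    define C where "C = cmod (1 / z) + \<bar>Im (1 / z)\<bar> / 2"
    have Cb: "cmod w \<le> C" if "w \<in> cball (1 / z) (\<bar>Im (1 / z)\<bar> / 2)" for w
      using norm_triangle_ineq3[of "1 / z" w] that unfolding C_def mem_cball dist_norm by linarith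
    \<comment> \<open>\<open>G_diff_cone\<close> at k and \<open>K n z\<close>, where G takes the
      value z at the second point: the error is at most half of |K n z - k| and is absorbed into the
      left-hand side.\<close>
    have bd: "cmod (K n z - k) \<le> 2 * (C * C) * cmod (Mn.G n k - z)" if n: "N \<le> n" for n
    proof -
      note kn = K(2)[OF n z]
      note cn = cc[OF z z conjunct2[OF kn]]
      have "cmod (k * K n z * (Mn.G n k - Mn.G n (K n z)) - (K n z - k)) \<le> cmod (k - K n z) * ((4 + (2 * \<alpha> + 1)) * ((2 + (2 * \<alpha> + 1)) * Mn.tB n B))"
        by (rule Mn.G_diff_cone[OF c(1,3) _ cn(1,3) _ B(1)]) (use c cn 2 in auto)
      also have "\<dots> \<le> cmod (k - K n z) * (1 / 2)"
      proof (rule mult_left_mono)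
        have t: "0 \<le> Mn.tB n B" using B by (simp add: Mn.tB_nonneg)
        have "(4 + (2 * \<alpha> + 1)) * ((2 + (2 * \<alpha> + 1)) * Mn.tB n B) \<le> (4 + A) * ((2 + A) * Mn.tB n B)"
          using t \<alpha> unfolding A_def by (intro mult_mono mult_right_mono) auto
        also have "\<dots> \<le> 1 / (6 * A)" by (rule small[OF n])
        also have "\<dots> \<le> 1 / 2" using \<alpha> by (simp add: A_def)
        finally show "(4 + (2 * \<alpha> + 1)) * ((2 + (2 * \<alpha> + 1)) * Mn.tB n B) \<le> 1 / 2" .
      qed auto
      finally have 1: "cmod (k * K n z * (Mn.G n k - z) - (K n z - k)) \<le> cmod (K n z - k) / 2"
        using kn by (simp add: norm_minus_commute)
      have "cmod (K n z - k) \<le> cmod (k * K n z * (Mn.G n k - z)) + cmod (k * K n z * (Mn.G n k - z) - (K n z - k))"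
        using norm_triangle_ineq4[of "k * K n z * (Mn.G n k - z)" "k * K n z * (Mn.G n k - z) - (K n z - k)"] by simp
      with 1 have "cmod (K n z - k) \<le> 2 * cmod (k * K n z * (Mn.G n k - z))" by linarith
      also have "\<dots> \<le> 2 * (C * C * cmod (Mn.G n k - z))"
        unfolding norm_mult using Cb[OF kball] Cb[OF conjunct2[OF kn]] order_trans[OF norm_ge_zero Cb[OF kball]]
        by (intro mult_left_mono mult_right_mono mult_mono) auto
      finally show ?thesis by simp
    qed
    have "(\<lambda>n. K n z - k) \<longlonglongrightarrow> 0"
    proof (rule Lim_null_comparison)
      show "\<forall>\<^sub>F n in sequentially. cmod (K n z - k) \<le> 2 * (C * C) * cmod (Mn.G n k - z)"
        using eventually_ge_at_top[of N] by eventually_elim (rule bd)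
      have "(\<lambda>n. 2 * (C * C) * cmod (Mn.G n k - z)) \<longlonglongrightarrow> 2 * (C * C) * cmod (z - z)"
        by (intro tendsto_intros lim)
      thus "(\<lambda>n. 2 * (C * C) * cmod (Mn.G n k - z)) \<longlonglongrightarrow> 0" by simp
    qed
    hence "(\<lambda>n. (K n z - k) + R z) \<longlonglongrightarrow> 0 + R z" by (intro tendsto_add tendsto_const)
    thus "(\<lambda>n. K n z - 1 / z) \<longlonglongrightarrow> R z" by (simp add: k_def algebra_simps)
  qed
qed

section \<open>Weak compactness on the square\<close>

text \<open>Schoenberg's space-filling curve. The step function reads off the ternary digits 0 and 2 of a point
  of the Cantor set, so the curve has a measurable right inverse on the square. Lifting planar laws along this
  inverse reduces weak compactness in the plane to Helly's selection theorem on the line.\<close>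

definition schoenberg_step :: "real \<Rightarrow> real" where
  "schoenberg_step t = max 0 (min 1 (1 / 2 - cos (pi * t)))"

text \<open>Since 9 = 3^2, the factor c = 1 reads the ternary digits at even indices and c = 3 those
  at odd indices.\<close>

definition schoenberg_sum :: "real \<Rightarrow> real \<Rightarrow> real" where
  "schoenberg_sum c t = (\<Sum>n. schoenberg_step (c * 9 ^ n * t) / 2 ^ Suc n)"

definition schoenberg :: "real \<Rightarrow> real \<times> real" where
  "schoenberg t = (schoenberg_sum 1 t, schoenberg_sum 3 t)"

lemma sums_half_powers: "(\<lambda>n. 1 / 2 ^ Suc n) sums (1::real)"
  using power_half_series by (simp add: power_one_over)

lemma schoenberg_step_bounds: "0 \<le> schoenberg_step t" "schoenberg_step t \<le> 1"
  by (auto simp: schoenberg_step_def)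

lemma summable_schoenberg: "summable (\<lambda>n. schoenberg_step (c * 9 ^ n * t) / 2 ^ Suc n)"
  by (rule summable_comparison_test'[OF sums_summable[OF sums_half_powers], of 0])
     (use schoenberg_step_bounds in \<open>auto simp: divide_right_mono\<close>)

lemma schoenberg_sum_bounds: "0 \<le> schoenberg_sum c t" "schoenberg_sum c t \<le> 1"
proof -
  show "0 \<le> schoenberg_sum c t" unfolding schoenberg_sum_def
    by (rule suminf_nonneg[OF summable_schoenberg]) (simp add: schoenberg_step_bounds)
  have "schoenberg_sum c t \<le> (\<Sum>n. 1 / 2 ^ Suc n)" unfolding schoenberg_sum_def
    by (rule suminf_le[OF _ summable_schoenberg sums_summable[OF sums_half_powers]])
       (simp add: schoenberg_step_bounds divide_right_mono)
  thus "schoenberg_sum c t \<le> 1" using sums_unique[OF sums_half_powers] by simp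
qed

lemma continuous_schoenberg_sum: "continuous_on UNIV (schoenberg_sum c)"
  unfolding schoenberg_sum_def[abs_def]
proof (rule uniform_limit_theorem[OF _ Weierstrass_m_test])
  show "summable (\<lambda>n. 1 / 2 ^ Suc n :: real)" by (rule sums_summable[OF sums_half_powers])
  show "norm (schoenberg_step (c * 9 ^ n * x) / 2 ^ Suc n) \<le> 1 / 2 ^ Suc n" for n x
    using schoenberg_step_bounds by (auto simp: divide_right_mono)
  show "\<forall>\<^sub>F n in sequentially. continuous_on UNIV (\<lambda>x. \<Sum>i<n. schoenberg_step (c * 9 ^ i * x) / 2 ^ Suc i)"
    unfolding schoenberg_step_def by (intro always_eventually allI continuous_intros) auto
qed auto

lemma continuous_schoenberg: "continuous_on UNIV schoenberg"
  unfolding schoenberg_def[abs_def] by (intro continuous_intros continuous_schoenberg_sum)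

lemma schoenberg_in_square: "schoenberg t \<in> {0..1} \<times> {0..1}"
  by (simp add: schoenberg_def schoenberg_sum_bounds)

definition bindigit :: "nat \<Rightarrow> real \<Rightarrow> int" where
  "bindigit n x = \<lfloor>2 ^ Suc n * x\<rfloor> mod 2"

lemma bindigit_01: "bindigit n x \<in> {0, 1}"
  unfolding bindigit_def by auto

text \<open>The partial sums are the dyadic truncations of x. All digits of x = 1 are 0 in this
  encoding, which is why the right inverse of the curve lives on the half-open square.\<close>

lemma bindigit_sums:
  assumes "0 \<le> x" "x < 1"
  shows "(\<lambda>n. real_of_int (bindigit n x) / 2 ^ Suc n) sums x"
proof -
  have partial: "(\<Sum>n<N. real_of_int (bindigit n x) / 2 ^ Suc n) = real_of_int \<lfloor>2 ^ N * x\<rfloor> / 2 ^ N" for N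
  proof (induction N)
    case 0
    have "\<lfloor>x\<rfloor> = 0" using assms by (simp add: floor_eq_iff)
    thus ?case by simp
  next
    case (Suc N)
    have "\<lfloor>2 ^ Suc N * x\<rfloor> div 2 = \<lfloor>(2 ^ Suc N * x) / real_of_int 2\<rfloor>"
      by (rule floor_divide_real_eq_div[symmetric]) simp
    hence "\<lfloor>2 ^ Suc N * x\<rfloor> = 2 * \<lfloor>2 ^ N * x\<rfloor> + bindigit N x"
      unfolding bindigit_def using mult_div_mod_eq[of 2 "\<lfloor>2 ^ Suc N * x\<rfloor>"] by simp
    hence "real_of_int \<lfloor>2 ^ Suc N * x\<rfloor> = 2 * real_of_int \<lfloor>2 ^ N * x\<rfloor> + real_of_int (bindigit N x)"
      by simp
    thus ?case using Suc by (simp add: field_simps)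
  qed
  have "(\<lambda>N. real_of_int \<lfloor>2 ^ N * x\<rfloor> / 2 ^ N) \<longlonglongrightarrow> x"
  proof (rule tendsto_sandwich[OF _ _ _ tendsto_const])
    have "(\<lambda>N. x - (1 / 2) ^ N) \<longlonglongrightarrow> x - 0" by (intro tendsto_intros LIMSEQ_realpow_zero) auto
    thus "(\<lambda>N. x - (1 / 2) ^ N) \<longlonglongrightarrow> x" by simp
    show "\<forall>\<^sub>F N in sequentially. x - (1 / 2) ^ N \<le> real_of_int \<lfloor>2 ^ N * x\<rfloor> / 2 ^ N"
    proof (rule always_eventually, rule allI)
      fix N
      have "2 ^ N * x - 1 \<le> real_of_int \<lfloor>2 ^ N * x\<rfloor>" by linarith
      hence "(2 ^ N * x - 1) / 2 ^ N \<le> real_of_int \<lfloor>2 ^ N * x\<rfloor> / 2 ^ N" by (rule divide_right_mono) simp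
      thus "x - (1 / 2) ^ N \<le> real_of_int \<lfloor>2 ^ N * x\<rfloor> / 2 ^ N"
        by (simp add: diff_divide_distrib power_one_over)
    qed
    show "\<forall>\<^sub>F N in sequentially. real_of_int \<lfloor>2 ^ N * x\<rfloor> / 2 ^ N \<le> x"
    proof (rule always_eventually, rule allI)
      fix N
      have "real_of_int \<lfloor>2 ^ N * x\<rfloor> \<le> 2 ^ N * x" by linarith
      thus "real_of_int \<lfloor>2 ^ N * x\<rfloor> / 2 ^ N \<le> x" by (simp add: field_simps)
    qed
  qed
  thus ?thesis unfolding sums_def partial .
qed

lemma sums_third_powers: "(\<lambda>n. 2 / 3 ^ Suc n) sums (1::real)"
proof -
  have "(\<lambda>n. 2 / 3 * (1 / 3) ^ n) sums (2 / 3 * (1 / (1 - 1 / 3 :: real)))"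
    by (intro sums_mult geometric_sums) auto
  thus ?thesis by (simp add: power_one_over)
qed

lemma ternary_bounds:
  fixes a :: "nat \<Rightarrow> int"
  assumes a: "\<And>n. a n \<in> {0, 1}"
  shows "summable (\<lambda>n. 2 * real_of_int (a n) / 3 ^ Suc n)"
    "0 \<le> (\<Sum>n. 2 * real_of_int (a n) / 3 ^ Suc n)" "(\<Sum>n. 2 * real_of_int (a n) / 3 ^ Suc n) \<le> 1"
proof -
  have bd: "0 \<le> 2 * real_of_int (a n) / 3 ^ Suc n" "2 * real_of_int (a n) / 3 ^ Suc n \<le> 2 / 3 ^ Suc n" for n
    using a[of n] by (auto simp: divide_right_mono)
  show s: "summable (\<lambda>n. 2 * real_of_int (a n) / 3 ^ Suc n)"
    by (rule summable_comparison_test'[OF sums_summable[OF sums_third_powers], of 0])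
       (use bd in \<open>simp only: real_norm_def abs_of_nonneg\<close>)
  show "0 \<le> (\<Sum>n. 2 * real_of_int (a n) / 3 ^ Suc n)" by (rule suminf_nonneg[OF s bd(1)])
  have "(\<Sum>n. 2 * real_of_int (a n) / 3 ^ Suc n) \<le> (\<Sum>n. 2 / 3 ^ Suc n)"
    by (rule suminf_le[OF bd(2) s sums_summable[OF sums_third_powers]])
  thus "(\<Sum>n. 2 * real_of_int (a n) / 3 ^ Suc n) \<le> 1" using sums_unique[OF sums_third_powers] by simp
qed

text \<open>Multiplication by 3^k turns the leading digits 0 and 2 into an even integer, a period of
  cos (pi t). The rest is (2 a_k + \<tau>') / 3 with \<tau>' between 0 and 1: it lies in [0, 1/3] or
  [2/3, 1], where the truncated cosine is constantly 0 or 1.\<close>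

lemma schoenberg_step_ternary:
  fixes a :: "nat \<Rightarrow> int"
  assumes a: "\<And>n. a n \<in> {0, 1}"
  shows "schoenberg_step (3 ^ k * (\<Sum>n. 2 * real_of_int (a n) / 3 ^ Suc n)) = real_of_int (a k)"
proof -
  let ?t = "\<lambda>n. 2 * real_of_int (a n) / 3 ^ Suc n"
  note s = ternary_bounds(1)[of a, OF a]
  define N where "N = (\<Sum>j<k. a j * 3 ^ (k - 1 - j))"
  have N: "3 ^ k * (\<Sum>j<k. ?t j) = 2 * real_of_int N"
  proof -
    have "3 ^ k * ?t j = 2 * real_of_int (a j * 3 ^ (k - 1 - j))" if "j < k" for j
    proof -
      have "k = (k - 1 - j) + Suc j" using that by simp
      hence "(3::real) ^ k = 3 ^ (k - 1 - j) * 3 ^ Suc j" by (metis power_add)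
      thus ?thesis by simp
    qed
    thus ?thesis unfolding N_def of_int_sum sum_distrib_left by (intro sum.cong) auto
  qed
  define \<tau>' where "\<tau>' = (\<Sum>n. 2 * real_of_int (a (n + Suc k)) / 3 ^ Suc n)"
  have \<tau>': "0 \<le> \<tau>'" "\<tau>' \<le> 1"
    unfolding \<tau>'_def using ternary_bounds[of "\<lambda>n. a (n + Suc k)"] a by auto
  have "(\<Sum>n. ?t n) = (\<Sum>n. ?t (n + Suc k)) + (\<Sum>j<Suc k. ?t j)"
    by (rule suminf_split_initial_segment[OF s])
  also have "(\<Sum>n. ?t (n + Suc k)) = (\<Sum>n. 1 / 3 ^ Suc k * (2 * real_of_int (a (n + Suc k)) / 3 ^ Suc n))"
    by (simp add: power_add mult_ac)
  also have "\<dots> = 1 / 3 ^ Suc k * \<tau>'" unfolding \<tau>'_def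
    by (rule suminf_mult) (use ternary_bounds(1)[of "\<lambda>n. a (n + Suc k)"] a in auto)
  finally have "3 ^ k * (\<Sum>n. ?t n) = 3 ^ k * (\<Sum>j<k. ?t j) + (2 * real_of_int (a k) + \<tau>') / 3"
    by (simp add: field_simps)
  hence "cos (pi * (3 ^ k * (\<Sum>n. ?t n))) = cos (pi * ((2 * real_of_int (a k) + \<tau>') / 3) + 2 * pi * real_of_int N)"
    unfolding N by (simp add: algebra_simps)
  also have "\<dots> = cos (pi * ((2 * real_of_int (a k) + \<tau>') / 3))"
    by (simp add: cos_add sin_int_2pin cos_int_2pin)
  finally have c: "cos (pi * (3 ^ k * (\<Sum>n. ?t n))) = cos (pi * ((2 * real_of_int (a k) + \<tau>') / 3))" .
  consider "a k = 0" | "a k = 1" using a[of k] by auto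
  thus ?thesis
  proof cases
    case 1
    have "cos (pi / 3) \<le> cos (pi * (\<tau>' / 3))"
      by (rule cos_monotone_0_pi_le) (use \<tau>' mult_left_mono[OF \<tau>'(2), of pi] in \<open>auto simp: field_simps\<close>)
    thus ?thesis unfolding schoenberg_step_def c using 1 by (simp add: cos_60)
  next
    case 2
    have "cos (pi * ((2 + \<tau>') / 3)) \<le> cos (2 * pi / 3)"
      by (rule cos_monotone_0_pi_le) (use \<tau>' mult_left_mono[OF \<tau>'(2), of pi] mult_nonneg_nonneg[of pi \<tau>'] in \<open>auto simp: field_simps\<close>)
    thus ?thesis unfolding schoenberg_step_def c using 2 by (simp add: cos_120)
  qed
qed

definition interleave :: "real \<times> real \<Rightarrow> nat \<Rightarrow> int" where
  "interleave p n = (if even n then bindigit (n div 2) (fst p) else bindigit (n div 2) (snd p))"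

definition schoenberg_inv :: "real \<times> real \<Rightarrow> real" where
  "schoenberg_inv p = (\<Sum>n. 2 * real_of_int (interleave p n) / 3 ^ Suc n)"

lemma interleave_01: "interleave p n \<in> {0, 1}"
  unfolding interleave_def using bindigit_01 by auto

lemma schoenberg_inv_bounds: "0 \<le> schoenberg_inv p" "schoenberg_inv p \<le> 1"
  unfolding schoenberg_inv_def by (rule ternary_bounds[OF interleave_01])+

lemma fst_borel_real2 [measurable]: "(fst :: real \<times> real \<Rightarrow> real) \<in> borel_measurable borel"
  and snd_borel_real2 [measurable]: "(snd :: real \<times> real \<Rightarrow> real) \<in> borel_measurable borel"
  by (auto intro!: borel_measurable_continuous_onI continuous_intros)

lemma schoenberg_inv_measurable [measurable]: "schoenberg_inv \<in> borel_measurable borel"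
proof -
  have [measurable]: "(\<lambda>p. real_of_int (interleave p n)) \<in> borel_measurable borel" for n
  proof -
    have [measurable]: "(\<lambda>x. real_of_int (bindigit k x)) \<in> borel_measurable borel" for k
      unfolding bindigit_def by measurable
    show ?thesis
      unfolding interleave_def
      by (cases "even n") (simp_all add: measurable_compose[OF fst_borel_real2] measurable_compose[OF snd_borel_real2])
  qed
  thus ?thesis unfolding schoenberg_inv_def[abs_def] by measurable
qed

lemma schoenberg_schoenberg_inv:
  assumes "p \<in> {0..<1} \<times> {0..<1}"
  shows "schoenberg (schoenberg_inv p) = p"
proof -
  obtain x y where p: "p = (x, y)" "0 \<le> x" "x < 1" "0 \<le> y" "y < 1" using assms by (cases p) auto
  have k: "schoenberg_step (3 ^ k * schoenberg_inv p) = real_of_int (interleave p k)" for k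
    unfolding schoenberg_inv_def by (rule schoenberg_step_ternary[OF interleave_01])
  have 9: "(9::real) ^ n = 3 ^ (2 * n)" for n by (simp add: power_mult)
  have "schoenberg_step (1 * 9 ^ n * schoenberg_inv p) = real_of_int (bindigit n x)" for n
    using k[of "2 * n"] by (simp add: 9 interleave_def p)
  moreover have "schoenberg_step (3 * 9 ^ n * schoenberg_inv p) = real_of_int (bindigit n y)" for n
    using k[of "2 * n + 1"] by (simp add: 9 interleave_def p)
  ultimately show ?thesis
    unfolding schoenberg_def schoenberg_sum_def p(1)
    using sums_unique[OF bindigit_sums[OF p(2,3)]] sums_unique[OF bindigit_sums[OF p(4,5)]] by (simp add: p(1))
qed

text \<open>The lifted laws live on [0, 1] and so are tight. The members must sit on the half-open
  square, where the curve has its right inverse; the limit is a law on the closed square, which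
  contains the curve.\<close>

lemma weakly_compact_square:
  fixes M :: "nat \<Rightarrow> (real \<times> real) measure"
  assumes M: "\<And>n. borel_prob (M n)" and supp: "\<And>n. AE p in M n. p \<in> {0..<1} \<times> {0..<1}"
  obtains r \<rho> where "strict_mono (r :: nat \<Rightarrow> nat)" "borel_prob \<rho>" "AE p in \<rho>. p \<in> {0..1} \<times> {0..1}"
    "\<And>f :: real \<times> real \<Rightarrow> complex. continuous_on UNIV f \<Longrightarrow> (\<lambda>n. LINT p|M (r n). f p) \<longlonglongrightarrow> (LINT p|\<rho>. f p)"
proof -
  have sets_M [measurable_cong]: "sets (M n) = sets borel" for n using M by (simp add: borel_prob_def)
  have pM: "prob_space (M n)" for n using M by (simp add: borel_prob_def)
  define M' where "M' n = distr (M n) borel schoenberg_inv" for n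
  have rd: "real_distribution (M' n)" for n
    unfolding M'_def real_distribution_def real_distribution_axioms_def
    by (auto intro!: prob_space.prob_space_distr[OF pM])
  have "tight M'"
    unfolding tight_def
  proof (intro conjI allI impI rd)
    fix \<epsilon> :: real assume "0 < \<epsilon>"
    \<comment> \<open>The left end is -1 because the half-open interval has to contain 0.\<close>
    have "measure (M' n) {- 1<..1} = 1" for n
    proof -
      interpret real_distribution "M' n" by (rule rd)
      have "AE x in M' n. x \<in> {- 1<..1}"
        unfolding M'_def by (subst AE_distr_iff) (auto intro!: AE_I2 order_less_le_trans[OF _ schoenberg_inv_bounds(1)] schoenberg_inv_bounds)
      thus ?thesis using prob_eq_1[of "{- 1<..1}"] by simp
    qed
    thus "\<exists>a b. a < b \<and> (\<forall>n. 1 - \<epsilon> < measure (M' n) {a<..b})"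
      using \<open>0 < \<epsilon>\<close> by (intro exI[of _ "- 1"] exI[of _ 1]) auto
  qed
  from tight_imp_convergent_subsubsequence[OF this strict_mono_id]
  obtain r \<mu> where r: "strict_mono (r :: nat \<Rightarrow> nat)" "real_distribution \<mu>" "weak_conv_m (M' \<circ> id \<circ> r) \<mu>" by blast
  have [measurable_cong]: "sets \<mu> = sets borel" using r(2) by (simp add: real_distribution_def real_distribution_axioms_def)
  have [measurable]: "schoenberg \<in> borel_measurable borel"
    by (rule borel_measurable_continuous_onI[OF continuous_schoenberg])
  define \<rho> where "\<rho> = distr \<mu> borel schoenberg"
  show ?thesis
  proof (rule that[OF r(1)])
    show "borel_prob \<rho>"
    proof -
      interpret real_distribution \<mu> by (rule r(2))
      have "prob_space \<rho>" unfolding \<rho>_def by (rule prob_space_distr) measurable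
      thus ?thesis by (simp add: borel_prob_def \<rho>_def)
    qed
    have "closed ({0..1} \<times> {0..1} :: (real \<times> real) set)" by (intro closed_Times closed_atLeastAtMost)
    hence sq: "{p \<in> space borel. p \<in> {0..1} \<times> {0..1}} \<in> sets (borel :: (real \<times> real) measure)"
      by (simp only: space_borel UNIV_I simp_thms Collect_mem_eq borel_closed)
    have "schoenberg \<in> measurable \<mu> borel" by measurable
    from AE_distr_iff[OF this sq] show "AE p in \<rho>. p \<in> {0..1} \<times> {0..1}"
      unfolding \<rho>_def by (simp only: schoenberg_in_square) simp
    fix f :: "real \<times> real \<Rightarrow> complex" assume f: "continuous_on UNIV f"
    hence [measurable]: "f \<in> borel_measurable borel" by (rule borel_measurable_continuous_onI)
    have "compact (f ` ({0..1} \<times> {0..1}))"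
      by (rule compact_continuous_image[OF continuous_on_subset[OF f]]) (auto intro: compact_Times)
    hence "bounded (f ` ({0..1} \<times> {0..1}))" by (rule compact_imp_bounded)
    then obtain B where B: "\<And>p. p \<in> {0..1} \<times> {0..1} \<Longrightarrow> cmod (f p) \<le> B"
      unfolding bounded_iff by (meson image_eqI)
    have "(\<lambda>n. LINT t|(M' \<circ> id \<circ> r) n. f (schoenberg t)) \<longlonglongrightarrow> (LINT t|\<mu>. f (schoenberg t))"
    proof (rule weak_conv_imp_integral_bdd_continuous_conv[OF _ r(2,3)])
      show "real_distribution ((M' \<circ> id \<circ> r) n)" for n by (simp add: rd)
      have "continuous_on UNIV (\<lambda>t. f (schoenberg t))"
        by (rule continuous_on_compose2[OF f continuous_schoenberg]) auto
      thus "isCont (\<lambda>t. f (schoenberg t)) x" for x by (simp add: continuous_on_eq_continuous_at)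
      show "cmod (f (schoenberg x)) \<le> B" for x by (rule B[OF schoenberg_in_square])
    qed
    moreover have "(LINT t|(M' \<circ> id \<circ> r) n. f (schoenberg t)) = (LINT p|M (r n). f p)" for n
    proof -
      have "(LINT t|M' (r n). f (schoenberg t)) = (LINT p|M (r n). f (schoenberg (schoenberg_inv p)))"
        unfolding M'_def by (rule integral_distr) measurable
      also have "\<dots> = (LINT p|M (r n). f p)"
      proof (rule integral_cong_AE)
        show "AE p in M (r n). f (schoenberg (schoenberg_inv p)) = f p"
          using supp[of "r n"] by eventually_elim (simp only: schoenberg_schoenberg_inv)
      qed measurable
      finally show ?thesis by simp
    qed
    moreover have "(LINT t|\<mu>. f (schoenberg t)) = (LINT p|\<rho>. f p)"
      unfolding \<rho>_def by (rule integral_distr[symmetric]) measurable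
    ultimately show "(\<lambda>n. LINT p|M (r n). f p) \<longlonglongrightarrow> (LINT p|\<rho>. f p)" by simp
  qed
qed

section \<open>Cauchy transforms of planar laws\<close>

definition circ :: "real \<Rightarrow> complex" where
  "circ x = exp (2 * of_real pi * \<i> * of_real x)"

definition poisson_disc :: "complex \<Rightarrow> real \<Rightarrow> real" where
  "poisson_disc u x = (1 - (cmod u)\<^sup>2) / (cmod (circ x - u))\<^sup>2"

abbreviation unit_interval_measure :: "real measure" where
  "unit_interval_measure \<equiv> density lborel (\<lambda>x. ennreal (indicator {0..1} x))"

lemma norm_circ [simp]: "cmod (circ x) = 1"
  by (simp add: circ_def)

lemma continuous_circ: "continuous_on S circ"
  unfolding circ_def[abs_def] by (intro continuous_intros)

lemma circ_neq: "cmod u < 1 \<Longrightarrow> circ x - u \<noteq> 0"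
  using norm_circ[of x] by auto

lemma continuous_poisson_disc: "cmod u < 1 \<Longrightarrow> continuous_on S (poisson_disc u)"
  unfolding poisson_disc_def[abs_def]
  by (intro continuous_intros continuous_circ) (use circ_neq in auto)

lemma poisson_disc_nonneg: "cmod u < 1 \<Longrightarrow> 0 \<le> poisson_disc u x"
  unfolding poisson_disc_def using power_mono[of "cmod u" 1 2] by (intro divide_nonneg_nonneg) auto

lemma poisson_disc_le:
  assumes "cmod u < 1" shows "poisson_disc u x \<le> 1 / (1 - cmod u)\<^sup>2"
  unfolding poisson_disc_def
proof (rule frac_le)
  have "1 - cmod u \<le> cmod (circ x - u)" using norm_triangle_ineq2[of "circ x" u] by simp
  thus "(1 - cmod u)\<^sup>2 \<le> (cmod (circ x - u))\<^sup>2" using assms by (intro power_mono) auto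
qed (use assms in auto)

lemma poisson_disc_0 [simp]: "poisson_disc 0 x = 1"
  by (simp add: poisson_disc_def)

text \<open>The Poisson kernel is the Cauchy kernel plus a term that is holomorphic on the closed
  disc, its only possible pole being the reflection \<open>1 / cnj u\<close>. The second term
  contributes 0 to the integral of a holomorphic function.\<close>

lemma poisson_disc_split:
  assumes "cmod u < 1"
  shows "circ x / (circ x - u) + cnj u * circ x / (1 - cnj u * circ x) = of_real (poisson_disc u x)"
proof -
  define e where "e = circ x"
  have ee: "e * cnj e = 1" using complex_norm_square[of e] by (simp add: e_def)
  hence e0: "e \<noteq> 0" by auto
  have ne: "e - u \<noteq> 0" "cnj e - cnj u \<noteq> 0" using circ_neq[OF assms] by (auto simp: e_def simp flip: complex_cnj_diff)
  have "1 - cnj u * e = e * (cnj e - cnj u)" using ee by (simp add: algebra_simps)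
  hence "cnj u * e / (1 - cnj u * e) = cnj u / (cnj e - cnj u)" using e0 by simp
  hence "e / (e - u) + cnj u * e / (1 - cnj u * e) = (e * (cnj e - cnj u) + cnj u * (e - u)) / ((e - u) * (cnj e - cnj u))"
    using ne by (simp add: add_frac_eq)
  also have "e * (cnj e - cnj u) + cnj u * (e - u) = of_real (1 - (cmod u)\<^sup>2)"
    using ee complex_norm_square[of u] by (simp add: algebra_simps)
  also have "(e - u) * (cnj e - cnj u) = of_real ((cmod (e - u))\<^sup>2)"
    by (simp add: complex_norm_square[symmetric] flip: complex_cnj_diff)
  finally show ?thesis by (simp add: poisson_disc_def e_def)
qed

lemma Poisson_formula_disc:
  assumes F: "F holomorphic_on cball 0 1" and u: "cmod u < 1"
  shows "((\<lambda>x. F (circ x) * of_real (poisson_disc u x)) has_integral F u) {0..1}"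
proof -
  have cp: "circlepath 0 1 x = circ x" "vector_derivative (circlepath 0 1) (at x) = 2 * pi * \<i> * circ x" for x
    unfolding vector_derivative_circlepath by (simp_all add: circlepath circ_def)
  have 1: "((\<lambda>w. F w / (w - u)) has_contour_integral (2 * of_real pi * \<i> * F u)) (circlepath 0 1)"
    by (rule Cauchy_integral_circlepath_simple[OF F]) (use u in simp)
  have "((\<lambda>w. F w * cnj u / (1 - cnj u * w)) has_contour_integral 0) (circlepath 0 1)"
  proof (rule Cauchy_theorem_convex_simple)
    have "1 - cnj u * w \<noteq> 0" if "w \<in> cball 0 1" for w
    proof
      assume "1 - cnj u * w = 0"
      hence "1 = cmod (cnj u * w)" by simp
      also have "\<dots> \<le> cmod u * 1" unfolding norm_mult complex_mod_cnj using that by (intro mult_left_mono) auto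
      finally show False using u by simp
    qed
    thus "(\<lambda>w. F w * cnj u / (1 - cnj u * w)) holomorphic_on cball 0 1"
      by (intro holomorphic_intros F) auto
  qed (auto simp: path_image_circlepath)
  from has_contour_integral_add[OF 1 this]
  have "((\<lambda>x. (F (circ x) / (circ x - u) + F (circ x) * cnj u / (1 - cnj u * circ x)) * (2 * pi * \<i> * circ x))
      has_integral (2 * of_real pi * \<i> * F u)) {0..1}"
    by (simp add: has_contour_integral cp)
  from has_integral_mult_right[OF this, of "1 / (2 * of_real pi * \<i>)"]
  have "((\<lambda>x. 1 / (2 * of_real pi * \<i>) * ((F (circ x) / (circ x - u) + F (circ x) * cnj u / (1 - cnj u * circ x)) * (2 * pi * \<i> * circ x)))
      has_integral F u) {0..1}"
    by simp
  moreover have "1 / (2 * of_real pi * \<i>) * ((F (circ x) / (circ x - u) + F (circ x) * cnj u / (1 - cnj u * circ x)) * (2 * pi * \<i> * circ x))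
     = F (circ x) * of_real (poisson_disc u x)" for x
  proof -
    have "1 / (2 * of_real pi * \<i>) * ((F (circ x) / (circ x - u) + F (circ x) * cnj u / (1 - cnj u * circ x)) * (2 * pi * \<i> * circ x))
      = F (circ x) * (circ x / (circ x - u) + cnj u * circ x / (1 - cnj u * circ x))"
      by (simp add: algebra_simps)
    thus ?thesis by (simp only: poisson_disc_split[OF u])
  qed
  ultimately show ?thesis by simp
qed

lemma prob_space_unit_interval: "prob_space unit_interval_measure"
  by (intro prob_spaceI) (simp add: emeasure_density ennreal_indicator)

lemma Poisson_formula_disc_Re:
  assumes F: "F holomorphic_on cball 0 1" and u: "cmod u < 1"
  shows "(LINT x|unit_interval_measure. Re (F (circ x)) * poisson_disc u x) = Re (F u)"
proof -
  let ?f = "\<lambda>x. F (circ x) * of_real (poisson_disc u x)"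
  have "continuous_on {0..1} ?f"
    by (intro continuous_intros continuous_poisson_disc u continuous_on_compose2[OF holomorphic_on_imp_continuous_on[OF F] continuous_circ]) auto
  hence int: "set_integrable lborel {0..1} ?f" by (rule borel_integrable_atLeastAtMost')
  hence eq: "(LINT x : {0..1} | lborel. ?f x) = F u"
    using set_borel_integral_eq_integral(2) integral_unique[OF Poisson_formula_disc[OF assms]] by metis
  have "Re (F u) = Re (LINT x|lborel. indicator {0..1} x *\<^sub>R ?f x)"
    using eq by (simp add: set_lebesgue_integral_def)
  also have "\<dots> = (LINT x|lborel. indicator {0..1} x * (Re (F (circ x)) * poisson_disc u x))"
    using int unfolding set_integrable_def by (subst integral_Re[symmetric]) auto
  also have "\<dots> = (LINT x|unit_interval_measure. Re (F (circ x)) * poisson_disc u x)"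
  proof (subst integral_density)
    have "continuous_on UNIV (\<lambda>x. Re (F (circ x)) * poisson_disc u x)"
      by (intro continuous_intros continuous_poisson_disc u continuous_on_compose2[OF holomorphic_on_imp_continuous_on[OF F] continuous_circ]) auto
    thus "(\<lambda>x. Re (F (circ x)) * poisson_disc u x) \<in> borel_measurable lborel"
      by (simp add: borel_measurable_continuous_onI)
  qed auto
  finally show ?thesis by simp
qed

lemma AE_unit_interval: "AE x in unit_interval_measure. x \<in> {0..<1}"
proof (subst AE_density)
  show "AE x in lborel. 0 < ennreal (indicator {0..1} x) \<longrightarrow> x \<in> {0..<1::real}"
    using AE_lborel_singleton[of "1::real"] by eventually_elim (auto split: split_indicator_asm)
qed auto

section \<open>The Cayley transform and the Poisson kernel of the half-plane\<close>

definition cayley :: "complex \<Rightarrow> complex" where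
  "cayley u = \<i> * (1 + u) / (1 - u)"

lemma Im_cayley: "Im (cayley u) = (1 - (cmod u)\<^sup>2) / (cmod (1 - u))\<^sup>2"
proof -
  have "Im (\<i> * (1 + u)) * Re (1 - u) - Re (\<i> * (1 + u)) * Im (1 - u) = 1 - (cmod u)\<^sup>2"
    unfolding cmod_power2 by (simp add: power2_eq_square algebra_simps)
  thus ?thesis unfolding cayley_def Im_divide cmod_power2[of "1 - u"] by simp
qed

lemma cayley_Im_pos: "cmod u < 1 \<Longrightarrow> 0 < Im (cayley u)"
proof -
  assume u: "cmod u < 1"
  hence "1 - u \<noteq> 0" by auto
  moreover have "(cmod u)\<^sup>2 < 1" using u by (simp add: power_less_one_iff)
  ultimately show ?thesis unfolding Im_cayley by simp
qed

lemma cayley_holomorphic: "cayley holomorphic_on ball 0 1"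
  unfolding cayley_def[abs_def] by (intro holomorphic_intros) auto

definition uncayley :: "complex \<Rightarrow> complex" where
  "uncayley z = (z - \<i>) / (z + \<i>)"

lemma cayley_uncayley: "0 < Im z \<Longrightarrow> cayley (uncayley z) = z"
proof -
  assume z: "0 < Im z"
  have 1: "z + \<i> \<noteq> 0" using z by (auto simp: complex_eq_iff)
  have 2: "1 + uncayley z = 2 * z / (z + \<i>)" "1 - uncayley z = 2 * \<i> / (z + \<i>)"
    using 1 by (auto simp: uncayley_def field_simps)
  show ?thesis unfolding cayley_def 2 using 1 by simp
qed

lemma norm_uncayley: "0 < Im z \<Longrightarrow> cmod (uncayley z) < 1"
proof -
  assume z: "0 < Im z"
  have "(cmod (z - \<i>))\<^sup>2 < (cmod (z + \<i>))\<^sup>2" using z unfolding cmod_power2 by (simp add: power2_eq_square algebra_simps)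
  hence "cmod (z - \<i>) < cmod (z + \<i>)" by (rule power_less_imp_less_base) simp
  thus ?thesis unfolding uncayley_def norm_divide by (subst divide_less_eq_1_pos) (auto intro: le_less_trans[OF norm_ge_zero])
qed

text \<open>The Poisson kernel of the upper half-plane in the compact coordinate \<open>x \<in> [0, 1]\<close> of the
  extended real line; the boundary point is \<open>tan (pi * (x - 1 / 2))\<close>, and \<open>x = 0\<close>, \<open>x = 1\<close> stand
  for infinity.\<close>

definition half_plane_kernel :: "complex \<Rightarrow> real \<Rightarrow> real" where
  "half_plane_kernel z x = Im z / (cmod (z * of_real (cos (pi * (x - 1 / 2))) - of_real (sin (pi * (x - 1 / 2)))))\<^sup>2"

lemma half_plane_denom:
  assumes "Im z \<noteq> 0" shows "z * of_real (cos t) - of_real (sin t) \<noteq> 0"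
proof
  assume 0: "z * of_real (cos t) - of_real (sin t) = 0"
  hence "Im (z * of_real (cos t) - of_real (sin t)) = 0" by simp
  hence "cos t = 0" using assms by simp
  with 0 have "sin t = 0" by simp
  with \<open>cos t = 0\<close> sin_cos_squared_add[of t] show False by simp
qed

text \<open>Under \<open>cayley\<close> the boundary point \<open>circ x\<close> corresponds to -
  cot (pi x) = tan (pi (x - 1 / 2)); written with sine and cosine, the kernel stays regular at
  infinity.\<close>

lemma half_plane_kernel_eq:
  assumes z: "0 < Im z"
  shows "poisson_disc (uncayley z) x = half_plane_kernel z x"
proof -
  define t where "t = pi * (x - 1 / 2)"
  have zi: "z + \<i> \<noteq> 0" using z by (auto simp: complex_eq_iff)
  have "circ x = exp (\<i> * of_real pi + 2 * (\<i> * of_real t))"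
    unfolding circ_def t_def by (simp add: algebra_simps)
  also have "\<dots> = - (cis t * cis t)"
    by (simp add: exp_add exp_double cis_conv_exp power2_eq_square)
  finally have c: "circ x = - (cis t * cis t)" .
  have cc: "cis t * cis (- t) = 1" by (simp add: cis_mult)
  have "(circ x - uncayley z) * (z + \<i>) = - (cis t * (cis t * (z + \<i>) + cis (- t) * (z - \<i>)))"
    unfolding c uncayley_def using zi cc by (simp add: field_simps)
  also have "cis t * (z + \<i>) + cis (- t) * (z - \<i>) = 2 * (z * of_real (cos t) - of_real (sin t))"
    by (simp add: complex_eq_iff algebra_simps)
  finally have "cmod ((circ x - uncayley z) * (z + \<i>)) = cmod (- (cis t * (2 * (z * of_real (cos t) - of_real (sin t)))))" by simp
  hence "cmod (circ x - uncayley z) * cmod (z + \<i>) = 2 * cmod (z * of_real (cos t) - of_real (sin t))"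
    unfolding norm_mult norm_minus_cancel norm_cis by simp
  hence 1: "cmod (circ x - uncayley z) = 2 * cmod (z * of_real (cos t) - of_real (sin t)) / cmod (z + \<i>)"
    using zi by (simp add: eq_divide_eq)
  have "(cmod (z + \<i>))\<^sup>2 - (cmod (z - \<i>))\<^sup>2 = 4 * Im z"
    unfolding cmod_power2 by (simp add: power2_eq_square algebra_simps)
  moreover have "1 - (cmod (uncayley z))\<^sup>2 = ((cmod (z + \<i>))\<^sup>2 - (cmod (z - \<i>))\<^sup>2) / (cmod (z + \<i>))\<^sup>2"
    unfolding uncayley_def norm_divide power_divide using zi by (simp add: diff_divide_distrib)
  ultimately have 2: "1 - (cmod (uncayley z))\<^sup>2 = 4 * Im z / (cmod (z + \<i>))\<^sup>2" by simp
  show ?thesis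
    unfolding poisson_disc_def half_plane_kernel_def 1 2 t_def[symmetric]
    using zi by (simp add: power_divide power_mult_distrib)
qed

lemma half_plane_kernel_nonneg: "0 < Im z \<Longrightarrow> 0 \<le> half_plane_kernel z x"
  unfolding half_plane_kernel_def by simp

text \<open>With s = tan t the factor cos^2 is 1 / (1 + s^2), the weight that relates the Nevanlinna
  representation to the classical Poisson kernel of the half-plane.\<close>

lemma half_plane_kernel_tan:
  assumes "cos (pi * (x - 1 / 2)) \<noteq> 0" "Im z \<noteq> 0"
  shows "half_plane_kernel z x * (cos (pi * (x - 1 / 2)))\<^sup>2 = - Im (res z (tan (pi * (x - 1 / 2))))"
proof -
  define t where "t = pi * (x - 1 / 2)"
  have c: "cos t \<noteq> 0" using assms by (simp add: t_def)
  have "z * of_real (cos t) - of_real (sin t) = of_real (cos t) * (z - of_real (tan t))"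
    using c by (simp add: tan_def algebra_simps)
  hence "cmod (z * of_real (cos t) - of_real (sin t)) = \<bar>cos t\<bar> * cmod (z - of_real (tan t))" by (simp add: norm_mult)
  thus ?thesis unfolding half_plane_kernel_def Im_res t_def[symmetric] using c
    by (simp add: res_def norm_divide power_mult_distrib power_divide)
qed

lemma half_plane_kernel_imaginary:
  "half_plane_kernel (Complex 0 y) x = y / (y\<^sup>2 * (cos (pi * (x - 1 / 2)))\<^sup>2 + (sin (pi * (x - 1 / 2)))\<^sup>2)"
  by (simp add: half_plane_kernel_def cmod_power2 power_mult_distrib)

abbreviation unit_square_measure :: "(real \<times> real) measure" where
  "unit_square_measure \<equiv> unit_interval_measure \<Otimes>\<^sub>M unit_interval_measure"

lemma sets_unit_square [measurable_cong]: "sets unit_square_measure = sets borel"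
proof -
  have "sets unit_square_measure = sets ((borel :: real measure) \<Otimes>\<^sub>M (borel :: real measure))"
    by (intro sets_pair_measure_cong) auto
  thus ?thesis by (simp only: borel_prod)
qed

text \<open>A holomorphic function with vanishing real part is constant, since its image is not
  open; decay along the imaginary axis makes the constant 0. This recovers complex transforms from
  identities between real parts.\<close>

lemma half_plane_Re_zero:
  assumes f: "f holomorphic_on {z. 0 < Im z}" and Re: "\<And>z. 0 < Im z \<Longrightarrow> Re (f z) = 0"
    and lim: "((\<lambda>y. f (Complex 0 y)) \<longlongrightarrow> 0) at_top" and z: "0 < Im z"
  shows "f z = 0"
proof -
  have op: "open {z. 0 < Im z}" by (simp add: open_halfspace_Im_gt)
  have con: "connected {z. 0 < Im z}" by (simp add: convex_connected convex_halfspace_Im_gt)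
  have "f constant_on {z. 0 < Im z}"
  proof (rule ccontr)
    assume "\<not> f constant_on {z. 0 < Im z}"
    hence "open (f ` {z. 0 < Im z})" by (rule open_mapping_thm[OF f op con op subset_refl])
    moreover have "f z \<in> f ` {z. 0 < Im z}" using z by simp
    ultimately obtain e where e: "0 < e" "ball (f z) e \<subseteq> f ` {z. 0 < Im z}" unfolding open_contains_ball by blast
    have "f z + of_real (e / 2) \<in> ball (f z) e" using e by (simp add: dist_norm)
    then obtain w where "0 < Im w" "f z + of_real (e / 2) = f w" using e(2) by auto
    thus False using Re[of w] Re[OF z] e(1) by (metis add_0 half_gt_zero less_numeral_extra(3) plus_complex.sel(1) Re_complex_of_real)
  qed
  then obtain c where c: "\<And>z. 0 < Im z \<Longrightarrow> f z = c" unfolding constant_on_def by auto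
  have "((\<lambda>y. f (Complex 0 y)) \<longlongrightarrow> c) at_top"
  proof (rule tendsto_eventually)
    show "\<forall>\<^sub>F y in at_top. f (Complex 0 y) = c"
      using eventually_gt_at_top[of 0] by eventually_elim (simp add: c)
  qed
  hence "c = 0" using lim tendsto_unique[of at_top] by (metis trivial_limit_at_top_linorder)
  thus ?thesis using c z by simp
qed

text \<open>The data which characterise the Cauchy transform of a planar law: up to normalisation, the
  only essential condition is the positivity of \<open>\<integral> Im (1 / (\<zeta> - s)) Im (1 / (\<omega> - t)) d\<mu>\<close>,
  written in terms of the transform.\<close>

locale planar_cauchy_data =
  fixes G :: "complex \<Rightarrow> complex \<Rightarrow> complex"
  assumes hol1: "\<And>\<omega>. Im \<omega> \<noteq> 0 \<Longrightarrow> (\<lambda>\<zeta>. G \<zeta> \<omega>) holomorphic_on {\<zeta>. Im \<zeta> \<noteq> 0}"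
    and hol2: "\<And>\<zeta>. Im \<zeta> \<noteq> 0 \<Longrightarrow> (\<lambda>\<omega>. G \<zeta> \<omega>) holomorphic_on {\<omega>. Im \<omega> \<noteq> 0}"
    and cont: "continuous_on ({\<zeta>. Im \<zeta> \<noteq> 0} \<times> {\<omega>. Im \<omega> \<noteq> 0}) (\<lambda>p. G (fst p) (snd p))"
    and G_cnj: "\<And>\<zeta> \<omega>. Im \<zeta> \<noteq> 0 \<Longrightarrow> Im \<omega> \<noteq> 0 \<Longrightarrow> G (cnj \<zeta>) (cnj \<omega>) = cnj (G \<zeta> \<omega>)"
    and positive: "\<And>\<zeta> \<omega>. 0 < Im \<zeta> \<Longrightarrow> 0 < Im \<omega> \<Longrightarrow> Re (G \<zeta> \<omega>) \<le> Re (G \<zeta> (cnj \<omega>))"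
    and decay1: "\<And>\<omega>. Im \<omega> \<noteq> 0 \<Longrightarrow> ((\<lambda>y. G (Complex 0 y) \<omega>) \<longlongrightarrow> 0) at_top"
    and decay2: "\<And>\<zeta>. Im \<zeta> \<noteq> 0 \<Longrightarrow> ((\<lambda>y. G \<zeta> (Complex 0 y)) \<longlongrightarrow> 0) at_top"
    and norm1: "((\<lambda>y. y\<^sup>2 * Re (G (Complex 0 y) (Complex 0 (-y)))) \<longlongrightarrow> 1) at_top"
    and norm2: "((\<lambda>y. y\<^sup>2 * Re (G (Complex 0 y) (Complex 0 y))) \<longlongrightarrow> - 1) at_top"
begin

text \<open>For scalars, Re (a * cnj b - a * b) / 2 = Im a * Im b; so for the transform of a law
  this is the integral of the product of the imaginary parts of the two resolvents.\<close>

definition P :: "complex \<Rightarrow> complex \<Rightarrow> real" where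
  "P \<zeta> \<omega> = Re (G \<zeta> (cnj \<omega>) - G \<zeta> \<omega>) / 2"

lemma P_nonneg: "0 < Im \<zeta> \<Longrightarrow> 0 < Im \<omega> \<Longrightarrow> 0 \<le> P \<zeta> \<omega>"
  using positive[of \<zeta> \<omega>] by (simp add: P_def)

text \<open>The definition is the real part of a function holomorphic in \<zeta>; this form is
  holomorphic in \<omega>. Hence \<open>P\<close> is harmonic in each variable separately.\<close>

lemma P_alt: "Im \<zeta> \<noteq> 0 \<Longrightarrow> Im \<omega> \<noteq> 0 \<Longrightarrow> P \<zeta> \<omega> = Re (G (cnj \<zeta>) \<omega> - G \<zeta> \<omega>) / 2"
  using G_cnj[of \<zeta> "cnj \<omega>"] by (simp add: P_def)

definition D :: "complex \<Rightarrow> complex \<Rightarrow> real" where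
  "D u v = P (cayley u) (cayley v)"

lemma D_nonneg: "cmod u < 1 \<Longrightarrow> cmod v < 1 \<Longrightarrow> 0 \<le> D u v"
  unfolding D_def by (intro P_nonneg cayley_Im_pos)

lemma dilate_cball: "0 < r \<Longrightarrow> r < 1 \<Longrightarrow> cmod u \<le> 1 \<Longrightarrow> cmod (of_real r * u) < 1"
  by (metis abs_of_pos mult_le_cancel_left1 norm_mult norm_of_real order_le_less_trans order_less_imp_le mult.commute mult_left_le norm_ge_zero)

lemma cayley_dilate_holomorphic:
  assumes "0 < r" "r < 1"
  shows "(\<lambda>u. cayley (of_real r * u)) holomorphic_on cball 0 1"
proof -
  have "(\<lambda>u. of_real r * u :: complex) ` cball 0 1 \<subseteq> ball 0 1" using dilate_cball[OF assms] by (auto simp: dist_norm)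
  thus ?thesis
    using holomorphic_on_compose_gen[OF _ cayley_holomorphic, of "\<lambda>u. of_real r * u" "cball 0 1"]
    by (auto simp: o_def intro!: holomorphic_intros)
qed

text \<open>The Poisson formula is applied after a dilation by r < 1, as nothing is known about
  \<open>D\<close> on the boundary circle.\<close>

lemma D_Poisson1:
  assumes r: "0 < r" "r < 1" and u: "cmod u < 1" and v: "cmod v < 1"
  shows "(LINT x|unit_interval_measure. D (of_real r * circ x) v * poisson_disc u x) = D (of_real r * u) v"
proof -
  have v': "0 < Im (cayley v)" using cayley_Im_pos[OF v] .
  have sub: "(\<lambda>u. cayley (of_real r * u)) ` cball 0 1 \<subseteq> {\<zeta>. Im \<zeta> \<noteq> 0}"
    using cayley_Im_pos dilate_cball[OF r] by (force simp: less_imp_neq)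
  have h: "(\<lambda>u. G (cayley (of_real r * u)) w) holomorphic_on cball 0 1" if "Im w \<noteq> 0" for w
    using holomorphic_on_compose_gen[OF cayley_dilate_holomorphic[OF r] hol1[OF that] sub] by (simp add: o_def)
  have "(\<lambda>u. (G (cayley (of_real r * u)) (cnj (cayley v)) - G (cayley (of_real r * u)) (cayley v)) / 2) holomorphic_on cball 0 1"
    using v' by (intro holomorphic_intros h) auto
  from Poisson_formula_disc_Re[OF this u] show ?thesis by (simp add: D_def P_def)
qed

lemma D_Poisson2:
  assumes r: "0 < r" "r < 1" and u: "cmod u < 1" and v: "cmod v < 1"
  shows "(LINT y|unit_interval_measure. D u (of_real r * circ y) * poisson_disc v y) = D u (of_real r * v)"
proof -
  have u': "0 < Im (cayley u)" using cayley_Im_pos[OF u] .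
  have im: "0 < Im (cayley (of_real r * w))" if "cmod w \<le> 1" for w
    by (rule cayley_Im_pos[OF dilate_cball[OF r that]])
  have sub: "(\<lambda>u. cayley (of_real r * u)) ` cball 0 1 \<subseteq> {\<zeta>. Im \<zeta> \<noteq> 0}"
    using im by (force simp: less_imp_neq)
  have h: "(\<lambda>u. G w (cayley (of_real r * u))) holomorphic_on cball 0 1" if "Im w \<noteq> 0" for w
    using holomorphic_on_compose_gen[OF cayley_dilate_holomorphic[OF r] hol2[OF that] sub] by (simp add: o_def)
  have "(\<lambda>v. (G (cnj (cayley u)) (cayley (of_real r * v)) - G (cayley u) (cayley (of_real r * v))) / 2) holomorphic_on cball 0 1"
    using u' by (intro holomorphic_intros h) auto
  from Poisson_formula_disc_Re[OF this v]
  have Pv: "(LINT y|unit_interval_measure. Re (G (cnj (cayley u)) (cayley (of_real r * circ y)) - G (cayley u) (cayley (of_real r * circ y))) / 2 * poisson_disc v y)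
      = Re (G (cnj (cayley u)) (cayley (of_real r * v)) - G (cayley u) (cayley (of_real r * v))) / 2" by simp
  have "Re (G (cnj (cayley u)) (cayley (of_real r * w)) - G (cayley u) (cayley (of_real r * w))) / 2 = D u (of_real r * w)" if "cmod w \<le> 1" for w
    unfolding D_def using im[OF that] u' by (subst P_alt) auto
  note eq = this
  have "D u (of_real r * circ y) = Re (G (cnj (cayley u)) (cayley (of_real r * circ y)) - G (cayley u) (cayley (of_real r * circ y))) / 2" for y
    by (rule eq[symmetric]) simp
  moreover have "D u (of_real r * v) = Re (G (cnj (cayley u)) (cayley (of_real r * v)) - G (cayley u) (cayley (of_real r * v))) / 2"
    by (rule eq[symmetric]) (use v in simp)
  ultimately show ?thesis using Pv by (simp only:)
qed

lemma continuous_D: "continuous_on (ball 0 1 \<times> ball 0 1) (\<lambda>p. D (fst p) (snd p))"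
proof -
  have c: "continuous_on (ball 0 1) cayley" by (rule holomorphic_on_imp_continuous_on[OF cayley_holomorphic])
  have c1: "continuous_on (ball 0 1 \<times> ball 0 1) (\<lambda>p. (cayley (fst p), cayley (snd p)))"
    by (intro continuous_on_Pair continuous_on_compose2[OF c] continuous_intros) auto
  have c2: "continuous_on (ball 0 1 \<times> ball 0 1) (\<lambda>p. (cayley (fst p), cnj (cayley (snd p))))"
    by (intro continuous_on_Pair continuous_on_compose2[OF c] continuous_intros continuous_on_cnj) auto
  have im: "Im (cayley u) \<noteq> 0" if "cmod u < 1" for u using cayley_Im_pos[OF that] by simp
  show ?thesis
    unfolding D_def P_def
    by (intro continuous_intros continuous_on_compose2[OF cont c1, simplified] continuous_on_compose2[OF cont c2, simplified])
       (use im in auto)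
qed

lemma continuous_D_circ:
  assumes r: "0 < r" "r < 1"
  shows "continuous_on UNIV (\<lambda>p. D (of_real r * circ (fst p)) (of_real r * circ (snd p)))"
proof (rule continuous_on_compose2[OF continuous_D, of UNIV "\<lambda>p. (of_real r * circ (fst p), of_real r * circ (snd p))", simplified])
  show "continuous_on UNIV (\<lambda>p. (of_real r * circ (fst p), of_real r * circ (snd p)))"
    by (intro continuous_on_Pair continuous_intros continuous_on_compose2[OF continuous_circ[of UNIV]]) auto
qed (use dilate_cball[OF r] in auto)

lemma D_circ_bounded:
  assumes r: "0 < r" "r < 1"
  obtains B where "\<And>x y. \<bar>D (of_real r * circ x) (of_real r * circ y)\<bar> \<le> B"
proof -
  have "compact (cball 0 r \<times> cball (0::complex) r :: (complex \<times> complex) set)" by (intro compact_Times compact_cball)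
  moreover have "continuous_on (cball 0 r \<times> cball 0 r) (\<lambda>p. D (fst p) (snd p))"
    by (rule continuous_on_subset[OF continuous_D]) (use r in auto)
  ultimately have "bounded ((\<lambda>p. D (fst p) (snd p)) ` (cball 0 r \<times> cball 0 r))"
    by (intro compact_imp_bounded compact_continuous_image)
  then obtain B where B: "\<And>p. p \<in> cball 0 r \<times> cball 0 r \<Longrightarrow> norm (D (fst p) (snd p)) \<le> B"
    unfolding bounded_iff by (meson image_eqI)
  show ?thesis
    by (rule that[of B]) (use B[of "(of_real r * circ _, of_real r * circ _)"] r in \<open>simp add: norm_mult\<close>)
qed

lemma prob_space_unit_square: "prob_space (unit_square_measure)"
proof -
  interpret N: prob_space unit_interval_measure by (rule prob_space_unit_interval)
  interpret pair_prob_space unit_interval_measure unit_interval_measure ..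
  show ?thesis by (rule prob_space_axioms)
qed

lemma D_Poisson:
  assumes r: "0 < r" "r < 1" and u: "cmod u < 1" and v: "cmod v < 1"
  shows "integrable (unit_square_measure)
      (\<lambda>p. D (of_real r * circ (fst p)) (of_real r * circ (snd p)) * (poisson_disc u (fst p) * poisson_disc v (snd p)))" (is "integrable ?N ?f")
    and "(LINT p|unit_square_measure.
      D (of_real r * circ (fst p)) (of_real r * circ (snd p)) * (poisson_disc u (fst p) * poisson_disc v (snd p))) = D (of_real r * u) (of_real r * v)"
proof -
  interpret N: prob_space unit_interval_measure by (rule prob_space_unit_interval)
  interpret N2: prob_space ?N by (rule prob_space_unit_square)
  interpret pair_sigma_finite unit_interval_measure unit_interval_measure ..
  have "continuous_on UNIV ?f"
    by (intro continuous_on_mult continuous_D_circ r continuous_on_compose2[OF continuous_poisson_disc[OF u, of UNIV]]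
        continuous_on_compose2[OF continuous_poisson_disc[OF v, of UNIV]] continuous_intros) auto
  hence [measurable]: "?f \<in> borel_measurable borel" by (rule borel_measurable_continuous_onI)
  obtain B where B: "\<And>x y. \<bar>D (of_real r * circ x) (of_real r * circ y)\<bar> \<le> B"
    using D_circ_bounded[OF r] by blast
  have B0: "0 \<le> B" using B[of 0 0] by linarith
  show int: "integrable ?N ?f"
  proof (rule N2.integrable_bounded[where B="B * (1 / (1 - cmod u)\<^sup>2 * (1 / (1 - cmod v)\<^sup>2))"])
    show "?f \<in> borel_measurable ?N" by measurable
    show "norm (?f p) \<le> B * (1 / (1 - cmod u)\<^sup>2 * (1 / (1 - cmod v)\<^sup>2))" for p
      unfolding real_norm_def abs_mult abs_of_nonneg[OF poisson_disc_nonneg[OF u]] abs_of_nonneg[OF poisson_disc_nonneg[OF v]]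
      using B0 by (intro mult_mono B poisson_disc_le u v poisson_disc_nonneg mult_nonneg_nonneg abs_ge_zero) auto
  qed
  have "(LINT p|?N. ?f p) = (LINT y|unit_interval_measure. (LINT x|unit_interval_measure. ?f (x, y)))"
    using integral_snd[of "\<lambda>x y. ?f (x, y)"] int by (simp add: case_prod_unfold)
  also have "\<dots> = (LINT y|unit_interval_measure. D (of_real r * u) (of_real r * circ y) * poisson_disc v y)"
  proof (intro Bochner_Integration.integral_cong refl)
    fix y
    have "(LINT x|unit_interval_measure. ?f (x, y))
      = (LINT x|unit_interval_measure. D (of_real r * circ x) (of_real r * circ y) * poisson_disc u x * poisson_disc v y)"
      by (simp add: mult.assoc)
    also have "\<dots> = (LINT x|unit_interval_measure. D (of_real r * circ x) (of_real r * circ y) * poisson_disc u x) * poisson_disc v y"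
      by (rule integral_mult_left_zero)
    also have "\<dots> = D (of_real r * u) (of_real r * circ y) * poisson_disc v y"
      by (subst D_Poisson1[OF r u]) (use dilate_cball[OF r] in auto)
    finally show "(LINT x|unit_interval_measure. ?f (x, y)) = D (of_real r * u) (of_real r * circ y) * poisson_disc v y" .
  qed
  also have "\<dots> = D (of_real r * u) (of_real r * v)"
    by (rule D_Poisson2[OF r dilate_cball[OF r] v]) (use u in simp)
  finally show "(LINT p|?N. ?f p) = D (of_real r * u) (of_real r * v)" .
qed

text \<open>A Harnack argument: at a fixed point the Poisson kernels are bounded, so D u u is at
  most a multiple of \<open>D 0 0\<close>, and the normalisation of \<open>G\<close> makes some D u
  u positive. The value \<open>D 0 0\<close> is the total mass by which the boundary densities are
  divided.\<close>

lemma D_0_pos: "0 < D 0 0"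
proof -
  have lim: "((\<lambda>y. y\<^sup>2 * P (Complex 0 y) (Complex 0 y)) \<longlongrightarrow> 1) at_top"
  proof -
    have "((\<lambda>y. (y\<^sup>2 * Re (G (Complex 0 y) (Complex 0 (-y))) - y\<^sup>2 * Re (G (Complex 0 y) (Complex 0 y))) / 2) \<longlongrightarrow> (1 - (- 1)) / 2) at_top"
      by (intro tendsto_intros norm1 norm2) auto
    thus ?thesis by (simp add: P_def complex_cnj right_diff_distrib)
  qed
  have "\<forall>\<^sub>F y in at_top. 0 < y\<^sup>2 * P (Complex 0 y) (Complex 0 y) \<and> 0 < y"
    using order_tendstoD(1)[OF lim, of 0] eventually_gt_at_top[of 0] by (simp add: eventually_conj)
  then obtain y where y: "0 < y\<^sup>2 * P (Complex 0 y) (Complex 0 y)" "0 < y"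
    using eventually_happens by fastforce
  define u where "u = uncayley (Complex 0 y)"
  have u: "cmod u < 1" unfolding u_def using y by (intro norm_uncayley) simp
  have Du: "0 < D u u" unfolding D_def u_def using y by (simp add: cayley_uncayley zero_less_mult_iff)
  \<comment> \<open>Strictly between |u| and 1, so that u = r u' with u' still in the disc.\<close>
  define r where "r = (1 + cmod u) / 2"
  have r: "0 < r" "r < 1" "cmod u < r" using u norm_ge_zero[of u] by (simp_all add: r_def del: norm_ge_zero)
  define u' where "u' = u / of_real r"
  have u': "cmod u' < 1" using r by (simp add: u'_def norm_divide)
  interpret N2: prob_space "unit_square_measure" by (rule prob_space_unit_square)
  define C where "C = 1 / (1 - cmod u')\<^sup>2 * (1 / (1 - cmod u')\<^sup>2)"
  have "D u u = D (of_real r * u') (of_real r * u')" using r by (simp add: u'_def)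
  also have "\<dots> = (LINT p|unit_square_measure.
      D (of_real r * circ (fst p)) (of_real r * circ (snd p)) * (poisson_disc u' (fst p) * poisson_disc u' (snd p)))"
    by (rule D_Poisson(2)[OF r(1,2) u' u', symmetric])
  also have "\<dots> \<le> (LINT p|unit_square_measure.
      D (of_real r * circ (fst p)) (of_real r * circ (snd p)) * (poisson_disc 0 (fst p) * poisson_disc 0 (snd p)) * C)"
  proof (rule integral_mono)
    show "integrable (unit_square_measure) (\<lambda>p. D (of_real r * circ (fst p)) (of_real r * circ (snd p)) * (poisson_disc 0 (fst p) * poisson_disc 0 (snd p)) * C)"
      by (intro integrable_mult_left D_Poisson(1) r) auto
    show "D (of_real r * circ (fst p)) (of_real r * circ (snd p)) * (poisson_disc u' (fst p) * poisson_disc u' (snd p))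
        \<le> D (of_real r * circ (fst p)) (of_real r * circ (snd p)) * (poisson_disc 0 (fst p) * poisson_disc 0 (snd p)) * C" for p
    proof -
      have "poisson_disc u' (fst p) * poisson_disc u' (snd p) \<le> C"
        unfolding C_def using poisson_disc_le[OF u'] poisson_disc_nonneg[OF u'] by (intro mult_mono) auto
      moreover have "0 \<le> D (of_real r * circ (fst p)) (of_real r * circ (snd p))"
        by (intro D_nonneg dilate_cball r) auto
      ultimately show ?thesis by (simp add: mult_left_mono)
    qed
  qed (rule D_Poisson(1)[OF r(1,2) u' u'])
  also have "\<dots> = D 0 0 * C"
    using D_Poisson(2)[OF r(1,2), of 0 0] by simp
  finally have "0 < D 0 0 * C" using Du by simp
  moreover have "0 \<le> D 0 0" by (rule D_nonneg) auto
  ultimately show ?thesis by (metis less_eq_real_def mult_zero_left)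
qed

lemma AE_unit_square: "AE p in unit_square_measure. p \<in> {0..<1} \<times> {0..<1}"
proof -
  interpret N: prob_space unit_interval_measure by (rule prob_space_unit_interval)
  interpret pair_sigma_finite unit_interval_measure unit_interval_measure ..
  have "AE x in unit_interval_measure. AE y in unit_interval_measure. x \<in> {0..<1} \<and> y \<in> {0..<1}"
    using AE_unit_interval
  proof eventually_elim
    case (elim x)
    show ?case using AE_unit_interval by eventually_elim (use elim in simp)
  qed
  hence *: "AE x in unit_interval_measure. AE y in unit_interval_measure. fst (x, y) \<in> {0..<1} \<and> snd (x, y) \<in> {0..<1}" by simp
  have "AE p in unit_square_measure. fst p \<in> {0..<1} \<and> snd p \<in> {0..<1}"
    by (rule AE_pair_measure) (measurable, rule *)
  thus ?thesis by eventually_elim (auto simp: mem_Times_iff)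
qed

text \<open>The Herglotz representation in two variables. The values of \<open>D\<close> on the
  torus of radius r, divided by \<open>D 0 0\<close>, are probability densities by
  \<open>D_Poisson\<close>, and a weak limit for r -> 1 represents \<open>D\<close>.\<close>

lemma disc_boundary_measure:
  obtains \<rho> where "borel_prob \<rho>" "AE p in \<rho>. p \<in> {0..1} \<times> {0..1}"
    "\<And>u v. cmod u < 1 \<Longrightarrow> cmod v < 1 \<Longrightarrow>
      D 0 0 * (LINT p|\<rho>. poisson_disc u (fst p) * poisson_disc v (snd p)) = D u v"
proof -
  interpret N2: prob_space unit_square_measure by (rule prob_space_unit_square)
  define r where "r n = 1 - 1 / (real n + 2)" for n
  have r: "0 < r n" "r n < 1" for n by (auto simp: r_def field_simps)
  have rlim: "r \<longlonglongrightarrow> 1"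
  proof -
    have "(\<lambda>n. 1 - inverse (real (n + 2))) \<longlonglongrightarrow> 1 - 0"
      by (intro tendsto_intros LIMSEQ_ignore_initial_segment[OF lim_inverse_n])
    thus ?thesis by (simp add: r_def[abs_def] inverse_eq_divide add.commute)
  qed
  define d where "d n p = D (of_real (r n) * circ (fst p)) (of_real (r n) * circ (snd p)) / D 0 0" for n p
  define M where "M n = density unit_square_measure (\<lambda>p. ennreal (d n p))" for n
  have d0: "0 \<le> d n p" for n p
    unfolding d_def using D_0_pos by (intro divide_nonneg_pos D_nonneg dilate_cball r) auto
  have d_borel: "d n \<in> borel_measurable borel" for n
    unfolding d_def[abs_def]
    by (intro borel_measurable_continuous_onI continuous_intros continuous_D_circ r) (use D_0_pos in auto)
  have dm [measurable]: "d n \<in> borel_measurable unit_square_measure" for n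
    using d_borel by measurable
  have int_d: "integrable unit_square_measure (\<lambda>p. d n p * (poisson_disc u (fst p) * poisson_disc v (snd p)))"
    "(LINT p|unit_square_measure. d n p * (poisson_disc u (fst p) * poisson_disc v (snd p))) = D (of_real (r n) * u) (of_real (r n) * v) / D 0 0"
    if "cmod u < 1" "cmod v < 1" for n u v
    using D_Poisson[OF r[of n] that] unfolding d_def by (simp_all add: divide_simps)
  have M_prob: "borel_prob (M n)" for n
  proof -
    have int: "integrable unit_square_measure (d n)" "(LINT p|unit_square_measure. d n p) = 1"
      using int_d[of 0 0 n] D_0_pos by auto
    have "emeasure (M n) (space (M n)) = (\<integral>\<^sup>+p. ennreal (d n p) \<partial>unit_square_measure)"
      unfolding M_def space_density
    proof (subst emeasure_density[OF _ sets.top])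
      show "(\<lambda>p. ennreal (d n p)) \<in> borel_measurable unit_square_measure" by measurable
    qed (auto intro!: nn_integral_cong simp del: space_pair_measure)
    also have "\<dots> = ennreal 1" using nn_integral_eq_integral[OF int(1)] d0 int(2) by simp
    finally have "prob_space (M n)" by (intro prob_spaceI) simp
    moreover have "sets (M n) = sets borel" unfolding M_def by (simp only: sets_density sets_unit_square)
    ultimately show ?thesis by (simp add: borel_prob_def)
  qed
  have M_supp: "AE p in M n. p \<in> {0..<1} \<times> {0..<1}" for n
    unfolding M_def by (subst AE_density) (use AE_unit_square in auto)
  obtain s \<rho> where \<rho>: "strict_mono (s :: nat \<Rightarrow> nat)" "borel_prob \<rho>" "AE p in \<rho>. p \<in> {0..1} \<times> {0..1}"
    "\<And>f :: real \<times> real \<Rightarrow> complex. continuous_on UNIV f \<Longrightarrow> (\<lambda>n. LINT p|M (s n). f p) \<longlonglongrightarrow> (LINT p|\<rho>. f p)"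
    by (rule weakly_compact_square[of M, OF M_prob M_supp]) blast
  show ?thesis
  proof (rule that[OF \<rho>(2,3)])
    fix u v :: complex assume u: "cmod u < 1" and v: "cmod v < 1"
    let ?k = "\<lambda>p. poisson_disc u (fst p) * poisson_disc v (snd p)"
    have kc: "continuous_on UNIV ?k"
      by (intro continuous_on_mult continuous_on_compose2[OF continuous_poisson_disc[OF u, of UNIV]]
        continuous_on_compose2[OF continuous_poisson_disc[OF v, of UNIV]] continuous_intros) auto
    hence kb: "?k \<in> borel_measurable borel" by (rule borel_measurable_continuous_onI)
    have "(\<lambda>n. LINT p|M (s n). complex_of_real (?k p)) \<longlonglongrightarrow> (LINT p|\<rho>. complex_of_real (?k p))"
      by (rule \<rho>(4)) (intro continuous_intros kc)
    hence "(\<lambda>n. LINT p|M (s n). ?k p) \<longlonglongrightarrow> (LINT p|\<rho>. ?k p)"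
      unfolding integral_complex_of_real tendsto_of_real_iff .
    moreover have "(LINT p|M n. ?k p) = D (of_real (r n) * u) (of_real (r n) * v) / D 0 0" for n
    proof -
      have "(LINT p|M n. ?k p) = (LINT p|unit_square_measure. d n p *\<^sub>R ?k p)"
        unfolding M_def
      proof (rule integral_density)
        show "?k \<in> borel_measurable unit_square_measure"
          by (subst measurable_cong_sets[OF sets_unit_square refl]) (rule kb)
      qed (rule dm, rule AE_I2, rule d0)
      thus ?thesis using int_d(2)[OF u v] by simp
    qed
    ultimately have 1: "(\<lambda>n. D (of_real (r (s n)) * u) (of_real (r (s n)) * v) / D 0 0) \<longlonglongrightarrow> (LINT p|\<rho>. ?k p)" by simp
    have "(\<lambda>n. (of_real (r n) * u, of_real (r n) * v)) \<longlonglongrightarrow> (of_real 1 * u, of_real 1 * v)"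
      by (intro tendsto_intros rlim)
    hence rl: "(\<lambda>n. (of_real (r n) * u, of_real (r n) * v)) \<longlonglongrightarrow> (u, v)" by simp
    have "(\<lambda>n. D (of_real (r n) * u) (of_real (r n) * v)) \<longlonglongrightarrow> D u v"
      using continuous_on_tendsto_compose[OF continuous_D rl] u v dilate_cball[OF r] by simp
    hence "(\<lambda>n. D (of_real (r n) * u) (of_real (r n) * v) / D 0 0) \<longlonglongrightarrow> D u v / D 0 0"
      by (intro tendsto_divide tendsto_const) (use D_0_pos in auto)
    from LIMSEQ_subseq_LIMSEQ[OF this \<rho>(1)] have "(\<lambda>n. D (of_real (r (s n)) * u) (of_real (r (s n)) * v) / D 0 0) \<longlonglongrightarrow> D u v / D 0 0"
      by (simp add: o_def)
    from LIMSEQ_unique[OF 1 this] have "(LINT p|\<rho>. ?k p) = D u v / D 0 0" .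
    thus "D 0 0 * (LINT p|\<rho>. ?k p) = D u v" using D_0_pos by simp
  qed
qed

end

section \<open>Elementary properties of planar Cauchy transforms\<close>

lemma borel_prob_planar:
  fixes \<mu> :: "(real \<times> real) measure"
  assumes "borel_prob \<mu>"
  shows "real_rv \<mu> fst" "real_rv \<mu> snd"
  using assms unfolding borel_prob_def real_rv_def real_rv_axioms_def
  by (simp_all add: measurable_cong_sets[of \<mu> borel, OF _ refl] fst_borel_real2 snd_borel_real2)

lemma cauchy_transform2_res:
  "cauchy_transform2 \<mu> z w = (LINT p|\<mu>. res z (fst p) * res w (snd p))"
  by (simp add: cauchy_transform2_def res_def)

lemma integrable_res2:
  assumes \<mu>: "borel_prob \<mu>" and z: "Im z \<noteq> 0" and w: "Im w \<noteq> 0"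
  shows "integrable \<mu> (\<lambda>p. res z (fst p) * res w (snd p))"
proof -
  interpret A: real_rv \<mu> fst using borel_prob_planar[OF \<mu>] by simp
  interpret B: real_rv \<mu> snd using borel_prob_planar[OF \<mu>] by simp
  show ?thesis
    by (rule A.integrable_bounded[where B="1 / \<bar>Im z\<bar> * (1 / \<bar>Im w\<bar>)"])
       (use norm_res_le[OF z] norm_res_le[OF w] in \<open>auto simp: norm_mult simp del: times_divide_eq_left times_divide_eq_right intro!: mult_mono\<close>)
qed

lemma norm_cauchy_transform2_le:
  assumes \<mu>: "borel_prob \<mu>" and z: "Im z \<noteq> 0" and w: "Im w \<noteq> 0"
  shows "cmod (cauchy_transform2 \<mu> z w) \<le> 1 / \<bar>Im z\<bar> * (1 / \<bar>Im w\<bar>)"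
proof -
  interpret A: real_rv \<mu> fst using borel_prob_planar[OF \<mu>] by simp
  have "cmod (cauchy_transform2 \<mu> z w) \<le> (LINT p|\<mu>. cmod (res z (fst p) * res w (snd p)))"
    unfolding cauchy_transform2_res by (rule integral_norm_bound)
  also have "\<dots> \<le> (LINT p|\<mu>. 1 / \<bar>Im z\<bar> * (1 / \<bar>Im w\<bar>))"
    by (intro integral_mono integrable_norm integrable_res2[OF \<mu> z w])
       (use norm_res_le[OF z] norm_res_le[OF w] in \<open>auto simp: norm_mult simp del: times_divide_eq_left times_divide_eq_right intro!: mult_mono\<close>)
  finally show ?thesis by (simp add: A.prob_space)
qed

lemma cauchy_transform2_cnj: "cauchy_transform2 \<mu> (cnj z) (cnj w) = cnj (cauchy_transform2 \<mu> z w)"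
  unfolding cauchy_transform2_res Bochner_Integration.integral_cnj[symmetric] by (simp add: cnj_res)

lemma cauchy_transform2_holomorphic:
  assumes \<mu>: "borel_prob \<mu>" and w: "Im w \<noteq> 0"
  shows "(\<lambda>z. cauchy_transform2 \<mu> z w) holomorphic_on {z. Im z \<noteq> 0}"
    "(\<lambda>z. cauchy_transform2 \<mu> w z) holomorphic_on {z. Im z \<noteq> 0}"
proof -
  interpret A: real_rv \<mu> fst using borel_prob_planar[OF \<mu>] by simp
  interpret B: real_rv \<mu> snd using borel_prob_planar[OF \<mu>] by simp
  show "(\<lambda>z. cauchy_transform2 \<mu> z w) holomorphic_on {z. Im z \<noteq> 0}"
    unfolding cauchy_transform2_res mult.commute[of "res _ (fst _)"]
    by (rule A.holomorphic_weighted_G[OF measurable_compose[OF B.f_measurable res_measurable] norm_res_le[OF w]])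
  show "(\<lambda>z. cauchy_transform2 \<mu> w z) holomorphic_on {z. Im z \<noteq> 0}"
    unfolding cauchy_transform2_res
    by (rule B.holomorphic_weighted_G[OF measurable_compose[OF A.f_measurable res_measurable] norm_res_le[OF w]])
qed

lemma tendsto_0_imaginary:
  fixes f :: "complex \<Rightarrow> complex"
  assumes "\<And>z. Im z \<noteq> 0 \<Longrightarrow> cmod (f z) \<le> C / \<bar>Im z\<bar>"
  shows "((\<lambda>y. f (Complex 0 y)) \<longlongrightarrow> 0) at_top"
proof (rule Lim_null_comparison)
  show "\<forall>\<^sub>F y in at_top. cmod (f (Complex 0 y)) \<le> C / y"
    using eventually_gt_at_top[of 0]
  proof eventually_elim
    case (elim y)
    thus ?case using assms[of "Complex 0 y"] by simp
  qed
  show "((\<lambda>y. C / y) \<longlongrightarrow> 0) at_top"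
    by (intro tendsto_divide_0[OF tendsto_const] filterlim_at_top_imp_at_infinity filterlim_ident)
qed

lemma half_plane_kernel_le:
  assumes "0 < Im z" shows "half_plane_kernel z x \<le> 1 / (1 - cmod (uncayley z))\<^sup>2"
  using poisson_disc_le[OF norm_uncayley[OF assms]] by (simp add: half_plane_kernel_eq[OF assms])

lemma half_plane_kernel_measurable [measurable]: "half_plane_kernel z \<in> borel_measurable borel"
  unfolding half_plane_kernel_def[abs_def] by measurable

section \<open>From the boundary measure to a planar law\<close>

context planar_cauchy_data
begin

lemma half_plane_boundary_measure:
  obtains \<rho> where "borel_prob \<rho>"
    "\<And>\<zeta> \<omega>. 0 < Im \<zeta> \<Longrightarrow> 0 < Im \<omega> \<Longrightarrow> integrable \<rho> (\<lambda>p. half_plane_kernel \<zeta> (fst p) * half_plane_kernel \<omega> (snd p))"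
    "\<And>\<zeta> \<omega>. 0 < Im \<zeta> \<Longrightarrow> 0 < Im \<omega> \<Longrightarrow>
      D 0 0 * (LINT p|\<rho>. half_plane_kernel \<zeta> (fst p) * half_plane_kernel \<omega> (snd p)) = P \<zeta> \<omega>"
proof -
  obtain \<rho> where \<rho>: "borel_prob \<rho>" "\<And>u v. cmod u < 1 \<Longrightarrow> cmod v < 1 \<Longrightarrow>
      D 0 0 * (LINT p|\<rho>. poisson_disc u (fst p) * poisson_disc v (snd p)) = D u v"
    by (rule disc_boundary_measure) blast
  interpret A: real_rv \<rho> fst using borel_prob_planar[OF \<rho>(1)] by simp
  interpret B: real_rv \<rho> snd using borel_prob_planar[OF \<rho>(1)] by simp
  show ?thesis
  proof (rule that[OF \<rho>(1)])
    fix \<zeta> \<omega> assume z: "0 < Im \<zeta>" "0 < Im \<omega>"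
    show "integrable \<rho> (\<lambda>p. half_plane_kernel \<zeta> (fst p) * half_plane_kernel \<omega> (snd p))"
    proof (rule A.integrable_bounded[where B="1 / (1 - cmod (uncayley \<zeta>))\<^sup>2 * (1 / (1 - cmod (uncayley \<omega>))\<^sup>2)"])
      show "norm (half_plane_kernel \<zeta> (fst p) * half_plane_kernel \<omega> (snd p)) \<le> 1 / (1 - cmod (uncayley \<zeta>))\<^sup>2 * (1 / (1 - cmod (uncayley \<omega>))\<^sup>2)" for p
        unfolding real_norm_def abs_mult abs_of_nonneg[OF half_plane_kernel_nonneg[OF z(1)]] abs_of_nonneg[OF half_plane_kernel_nonneg[OF z(2)]]
        by (intro mult_mono half_plane_kernel_le half_plane_kernel_nonneg z) auto
    qed measurable
    show "D 0 0 * (LINT p|\<rho>. half_plane_kernel \<zeta> (fst p) * half_plane_kernel \<omega> (snd p)) = P \<zeta> \<omega>"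
      using \<rho>(2)[OF norm_uncayley norm_uncayley, OF z] z
      by (simp add: half_plane_kernel_eq D_def cayley_uncayley)
  qed
qed

lemma tendsto_P: "((\<lambda>y. y\<^sup>2 * P (Complex 0 y) (Complex 0 y)) \<longlongrightarrow> 1) at_top"
proof -
  have "((\<lambda>y. (y\<^sup>2 * Re (G (Complex 0 y) (Complex 0 (-y))) - y\<^sup>2 * Re (G (Complex 0 y) (Complex 0 y))) / 2) \<longlongrightarrow> (1 - (- 1)) / 2) at_top"
    by (intro tendsto_intros norm1 norm2) auto
  thus ?thesis by (simp add: P_def complex_cnj right_diff_distrib)
qed

lemma P_decay1: "((\<lambda>y. P (Complex 0 y) \<i>) \<longlongrightarrow> 0) at_top"
proof -
  have "((\<lambda>y. Re (G (Complex 0 y) (cnj \<i>) - G (Complex 0 y) \<i>) / 2) \<longlongrightarrow> Re (0 - 0) / 2) at_top"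
    by (intro tendsto_intros decay1) auto
  thus ?thesis by (simp add: P_def)
qed

lemma P_decay2: "((\<lambda>y. P \<i> (Complex 0 y)) \<longlongrightarrow> 0) at_top"
proof -
  have "((\<lambda>y. Re (G (cnj \<i>) (Complex 0 y) - G \<i> (Complex 0 y)) / 2) \<longlongrightarrow> Re (0 - 0) / 2) at_top"
    by (intro tendsto_intros decay2) auto
  moreover have "\<forall>\<^sub>F y in at_top. Re (G (cnj \<i>) (Complex 0 y) - G \<i> (Complex 0 y)) / 2 = P \<i> (Complex 0 y)"
    using eventually_gt_at_top[of 0] by eventually_elim (subst P_alt, auto)
  ultimately show ?thesis by (simp cong: filterlim_cong)
qed

lemma half_plane_kernel_\<i>: "half_plane_kernel \<i> x = 1"
  using half_plane_kernel_imaginary[of 1 x] by (simp add: imaginary_unit.code)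

text \<open>Where the cosine vanishes, that is at infinity, the kernel at iy equals y and so
  dominates the indicator for y >= 1, while its integral tends to 0.\<close>

lemma boundary_null:
  assumes \<rho>: "borel_prob \<rho>" and f [measurable]: "f \<in> borel_measurable \<rho>"
    and int: "\<And>y. 0 < y \<Longrightarrow> integrable \<rho> (\<lambda>p. half_plane_kernel (Complex 0 y) (f p))"
    and lim: "((\<lambda>y. LINT p|\<rho>. half_plane_kernel (Complex 0 y) (f p)) \<longlongrightarrow> 0) at_top"
  shows "AE p in \<rho>. cos (pi * (f p - 1 / 2)) \<noteq> 0"
proof -
  interpret prob_space \<rho> using \<rho> by (simp add: borel_prob_def)
  define E where "E = {p \<in> space \<rho>. cos (pi * (f p - 1 / 2)) = 0}"
  have [measurable]: "E \<in> sets \<rho>" unfolding E_def by measurable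
  have "prob E = 0"
  proof (rule ccontr)
    assume "prob E \<noteq> 0"
    hence pos: "0 < prob E" using measure_nonneg[of \<rho> E] by linarith
    have "\<forall>\<^sub>F y in at_top. (LINT p|\<rho>. half_plane_kernel (Complex 0 y) (f p)) < prob E \<and> 1 \<le> y"
      using order_tendstoD(2)[OF lim pos] eventually_ge_at_top[of 1] by (rule eventually_conj)
    then obtain y where y: "(LINT p|\<rho>. half_plane_kernel (Complex 0 y) (f p)) < prob E" "1 \<le> y"
      using eventually_happens by fastforce
    have "prob E = (LINT p|\<rho>. indicator E p)" by simp
    also have "\<dots> \<le> (LINT p|\<rho>. half_plane_kernel (Complex 0 y) (f p))"
    proof (rule integral_mono)
      show "integrable \<rho> (\<lambda>p. half_plane_kernel (Complex 0 y) (f p))" using int y by simp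
      show "indicator E p \<le> half_plane_kernel (Complex 0 y) (f p)" if "p \<in> space \<rho>" for p
      proof (cases "p \<in> E")
        case True
        hence c: "cos (pi * (f p - 1 / 2)) = 0" by (simp add: E_def)
        hence "(sin (pi * (f p - 1 / 2)))\<^sup>2 = 1" using sin_cos_squared_add[of "pi * (f p - 1 / 2)"] by simp
        thus ?thesis using True c y by (simp add: half_plane_kernel_imaginary)
      next
        case False
        thus ?thesis using y half_plane_kernel_nonneg[of "Complex 0 y"] by simp
      qed
      show "integrable \<rho> (indicat_real E)"
        by (rule integrable_bounded[where B=1]) (simp_all add: indicator_def)
    qed
    finally show False using y(1) by linarith
  qed
  hence "AE p in \<rho>. p \<notin> E" by (subst (asm) prob_eq_0) simp_all
  thus ?thesis using AE_space by eventually_elim (simp add: E_def)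
qed

text \<open>With the limit in \<open>imaginary_kernel_limit\<close> this allows monotone convergence
  in the computation of the total mass of the representing law.\<close>

lemma imaginary_kernel_mono:
  assumes "0 < y" "y \<le> y'"
  shows "y * half_plane_kernel (Complex 0 y) x \<le> y' * half_plane_kernel (Complex 0 y') x"
proof -
  define c where "c = (cos (pi * (x - 1 / 2)))\<^sup>2"
  define s where "s = (sin (pi * (x - 1 / 2)))\<^sup>2"
  have cs: "0 \<le> c" "0 \<le> s" "s + c = 1" by (auto simp: c_def s_def)
  have pos: "0 < y\<^sup>2 * c + s" if "0 < y" for y
  proof (cases "c = 0")
    case False
    thus ?thesis using cs that by (intro add_pos_nonneg) auto
  qed (use cs in auto)
  have "y\<^sup>2 / (y\<^sup>2 * c + s) \<le> y'\<^sup>2 / (y'\<^sup>2 * c + s)"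
  proof -
    have "y\<^sup>2 * s \<le> y'\<^sup>2 * s" using assms cs by (intro mult_right_mono power_mono) auto
    hence "y\<^sup>2 * (y'\<^sup>2 * c + s) \<le> y'\<^sup>2 * (y\<^sup>2 * c + s)" by (simp add: algebra_simps)
    thus ?thesis using pos[of y] pos[of y'] assms by (simp add: divide_simps)
  qed
  thus ?thesis unfolding half_plane_kernel_imaginary c_def s_def by (simp add: power2_eq_square)
qed

lemma imaginary_kernel_limit:
  assumes "cos (pi * (x - 1 / 2)) \<noteq> 0"
  shows "(\<lambda>n. real (Suc n) * half_plane_kernel (Complex 0 (real (Suc n))) x) \<longlonglongrightarrow> 1 / (cos (pi * (x - 1 / 2)))\<^sup>2"
proof -
  define c where "c = (cos (pi * (x - 1 / 2)))\<^sup>2"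
  define s where "s = (sin (pi * (x - 1 / 2)))\<^sup>2"
  have c: "0 < c" using assms by (simp add: c_def)
  have "(\<lambda>n. 1 / (c + s * (inverse (real (Suc n)))\<^sup>2)) \<longlonglongrightarrow> 1 / (c + s * 0\<^sup>2)"
    by (intro tendsto_intros LIMSEQ_inverse_real_of_nat) (use c in auto)
  moreover have "1 / (c + s * (inverse (real (Suc n)))\<^sup>2) = real (Suc n) * half_plane_kernel (Complex 0 (real (Suc n))) x" for n
  proof -
    have n: "real (Suc n) \<noteq> 0" by simp
    have "c + s * (inverse (real (Suc n)))\<^sup>2 = ((real (Suc n))\<^sup>2 * c + s) / (real (Suc n))\<^sup>2"
      using n by (simp add: field_simps del: of_nat_Suc)
    thus ?thesis unfolding half_plane_kernel_imaginary c_def s_def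
      by (simp add: power2_eq_square del: of_nat_Suc)
  qed
  ultimately show ?thesis by (simp add: c_def)
qed

text \<open>The boundary measure, which has no mass at infinity, is weighted by \<open>D 0 0\<close>
  over the product of the squared cosines and carried to the plane by the tangent map. That the
  weighted measure has mass 1 follows by monotone convergence from y^2 P(iy, iy) -> 1.\<close>

lemma representation_positive:
  obtains \<nu> where "borel_prob \<nu>"
    "\<And>\<zeta> \<omega>. 0 < Im \<zeta> \<Longrightarrow> 0 < Im \<omega> \<Longrightarrow> (LINT p|\<nu>. Im (res \<zeta> (fst p)) * Im (res \<omega> (snd p))) = P \<zeta> \<omega>"
proof -
  obtain \<rho> where \<rho>: "borel_prob \<rho>"
    and int: "\<And>\<zeta> \<omega>. 0 < Im \<zeta> \<Longrightarrow> 0 < Im \<omega> \<Longrightarrow> integrable \<rho> (\<lambda>p. half_plane_kernel \<zeta> (fst p) * half_plane_kernel \<omega> (snd p))"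
    and eq: "\<And>\<zeta> \<omega>. 0 < Im \<zeta> \<Longrightarrow> 0 < Im \<omega> \<Longrightarrow>
      D 0 0 * (LINT p|\<rho>. half_plane_kernel \<zeta> (fst p) * half_plane_kernel \<omega> (snd p)) = P \<zeta> \<omega>"
    by (rule half_plane_boundary_measure) blast
  interpret A: real_rv \<rho> fst using borel_prob_planar[OF \<rho>] by simp
  interpret B: real_rv \<rho> snd using borel_prob_planar[OF \<rho>] by simp
  have eq': "(LINT p|\<rho>. half_plane_kernel \<zeta> (fst p) * half_plane_kernel \<omega> (snd p)) = P \<zeta> \<omega> / D 0 0" if "0 < Im \<zeta>" "0 < Im \<omega>" for \<zeta> \<omega>
    using eq[OF that] D_0_pos by (simp add: field_simps)
  have null1: "AE p in \<rho>. cos (pi * (fst p - 1 / 2)) \<noteq> 0"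
  proof (rule boundary_null[OF \<rho> A.f_measurable])
    show "integrable \<rho> (\<lambda>p. half_plane_kernel (Complex 0 y) (fst p))" if "0 < y" for y
      using int[of "Complex 0 y" \<i>] that by (simp add: half_plane_kernel_\<i>)
    have "((\<lambda>y. P (Complex 0 y) \<i> / D 0 0) \<longlongrightarrow> 0 / D 0 0) at_top"
      by (intro tendsto_divide P_decay1 tendsto_const) (use D_0_pos in auto)
    moreover have "\<forall>\<^sub>F y in at_top. P (Complex 0 y) \<i> / D 0 0 = (LINT p|\<rho>. half_plane_kernel (Complex 0 y) (fst p))"
      using eventually_gt_at_top[of 0]
    proof eventually_elim
      case (elim y)
      thus ?case using eq'[of "Complex 0 y" \<i>] by (simp add: half_plane_kernel_\<i>)
    qed
    ultimately show "((\<lambda>y. LINT p|\<rho>. half_plane_kernel (Complex 0 y) (fst p)) \<longlongrightarrow> 0) at_top"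
      by (simp cong: filterlim_cong)
  qed
  have null2: "AE p in \<rho>. cos (pi * (snd p - 1 / 2)) \<noteq> 0"
  proof (rule boundary_null[OF \<rho> B.f_measurable])
    show "integrable \<rho> (\<lambda>p. half_plane_kernel (Complex 0 y) (snd p))" if "0 < y" for y
      using int[of \<i> "Complex 0 y"] that by (simp add: half_plane_kernel_\<i>)
    have "((\<lambda>y. P \<i> (Complex 0 y) / D 0 0) \<longlongrightarrow> 0 / D 0 0) at_top"
      by (intro tendsto_divide P_decay2 tendsto_const) (use D_0_pos in auto)
    moreover have "\<forall>\<^sub>F y in at_top. P \<i> (Complex 0 y) / D 0 0 = (LINT p|\<rho>. half_plane_kernel (Complex 0 y) (snd p))"
      using eventually_gt_at_top[of 0]
    proof eventually_elim
      case (elim y)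
      thus ?case using eq'[of \<i> "Complex 0 y"] by (simp add: half_plane_kernel_\<i>)
    qed
    ultimately show "((\<lambda>y. LINT p|\<rho>. half_plane_kernel (Complex 0 y) (snd p)) \<longlongrightarrow> 0) at_top"
      by (simp cong: filterlim_cong)
  qed
  define cc where "cc p = (cos (pi * (fst p - 1 / 2)))\<^sup>2 * (cos (pi * (snd p - 1 / 2)))\<^sup>2" for p :: "real \<times> real"
  define T where "T p = (tan (pi * (fst p - 1 / 2)), tan (pi * (snd p - 1 / 2)))" for p :: "real \<times> real"
  have cc_borel [measurable]: "cc \<in> borel_measurable \<rho>" unfolding cc_def[abs_def] by measurable
  have T_borel: "T \<in> borel_measurable \<rho>" unfolding T_def[abs_def] tan_def by measurable
  define \<sigma> where "\<sigma> = density \<rho> (\<lambda>p. ennreal (D 0 0 / cc p))"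
  define \<nu> where "\<nu> = distr \<sigma> borel T"
  have T_borel' [measurable]: "T \<in> borel_measurable \<sigma>" using T_borel by (simp add: \<sigma>_def)
  define k where "k n x = real (Suc n) * half_plane_kernel (Complex 0 (real (Suc n))) x" for n x
  have k0: "0 \<le> k n x" for n x unfolding k_def by (intro mult_nonneg_nonneg half_plane_kernel_nonneg) auto
  have "(\<integral>\<^sup>+p. ennreal (D 0 0 / cc p) \<partial>\<rho>) = 1"
  proof -
    define F where "F n p = ennreal (D 0 0 * (k n (fst p) * k n (snd p)))" for n and p :: "real \<times> real"
    have Fm: "F n \<in> borel_measurable \<rho>" for n unfolding F_def[abs_def] k_def by measurable
    have inc: "incseq F"
    proof (intro incseq_SucI le_funI)
      fix n p
      have "k n x \<le> k (Suc n) x" for x unfolding k_def by (rule imaginary_kernel_mono) auto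
      thus "F n p \<le> F (Suc n) p" unfolding F_def using k0 D_0_pos
        by (intro ennreal_leI mult_left_mono mult_mono) auto
    qed
    have Fint: "(\<integral>\<^sup>+p. F n p \<partial>\<rho>) = ennreal ((real (Suc n))\<^sup>2 * P (Complex 0 (real (Suc n))) (Complex 0 (real (Suc n))))" for n
    proof -
      have "F n p = ennreal (D 0 0 * (real (Suc n))\<^sup>2 * (half_plane_kernel (Complex 0 (real (Suc n))) (fst p) * half_plane_kernel (Complex 0 (real (Suc n))) (snd p)))" for p
        unfolding F_def k_def by (simp add: power2_eq_square mult_ac del: of_nat_Suc)
      moreover have "(\<integral>\<^sup>+p. ennreal (D 0 0 * (real (Suc n))\<^sup>2 * (half_plane_kernel (Complex 0 (real (Suc n))) (fst p) * half_plane_kernel (Complex 0 (real (Suc n))) (snd p))) \<partial>\<rho>)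
          = ennreal (LINT p|\<rho>. D 0 0 * (real (Suc n))\<^sup>2 * (half_plane_kernel (Complex 0 (real (Suc n))) (fst p) * half_plane_kernel (Complex 0 (real (Suc n))) (snd p)))"
        using D_0_pos by (intro nn_integral_eq_integral integrable_mult_right int AE_I2 mult_nonneg_nonneg half_plane_kernel_nonneg) auto
      moreover have "(LINT p|\<rho>. D 0 0 * (real (Suc n))\<^sup>2 * (half_plane_kernel (Complex 0 (real (Suc n))) (fst p) * half_plane_kernel (Complex 0 (real (Suc n))) (snd p)))
          = (real (Suc n))\<^sup>2 * P (Complex 0 (real (Suc n))) (Complex 0 (real (Suc n)))"
        using eq[of "Complex 0 (real (Suc n))" "Complex 0 (real (Suc n))", symmetric]
        by (simp del: of_nat_Suc)
      ultimately show ?thesis by (simp only:)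
    qed
    have "(\<lambda>n. \<integral>\<^sup>+p. F n p \<partial>\<rho>) \<longlonglongrightarrow> (SUP n. \<integral>\<^sup>+p. F n p \<partial>\<rho>)"
      by (rule LIMSEQ_SUP) (use inc in \<open>auto simp: incseq_def le_fun_def intro!: nn_integral_mono\<close>)
    moreover have "(\<lambda>n. \<integral>\<^sup>+p. F n p \<partial>\<rho>) \<longlonglongrightarrow> ennreal 1"
      unfolding Fint
      by (intro tendsto_ennrealI filterlim_compose[OF tendsto_P] filterlim_compose[OF filterlim_real_sequentially filterlim_Suc])
    ultimately have 1: "(SUP n. \<integral>\<^sup>+p. F n p \<partial>\<rho>) = 1" using LIMSEQ_unique ennreal_1 by metis
    have "(\<integral>\<^sup>+p. ennreal (D 0 0 / cc p) \<partial>\<rho>) = (\<integral>\<^sup>+p. (SUP n. F n p) \<partial>\<rho>)"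
    proof (rule nn_integral_cong_AE)
      show "AE p in \<rho>. ennreal (D 0 0 / cc p) = (SUP n. F n p)"
        using null1 null2
      proof eventually_elim
        case (elim p)
        have "(\<lambda>n. F n p) \<longlonglongrightarrow> ennreal (D 0 0 * (1 / (cos (pi * (fst p - 1 / 2)))\<^sup>2 * (1 / (cos (pi * (snd p - 1 / 2)))\<^sup>2)))"
          unfolding F_def k_def using elim
          by (intro tendsto_ennrealI tendsto_mult tendsto_const imaginary_kernel_limit)
        hence "(\<lambda>n. F n p) \<longlonglongrightarrow> ennreal (D 0 0 / cc p)" by (simp add: cc_def)
        moreover have "(\<lambda>n. F n p) \<longlonglongrightarrow> (SUP n. F n p)"
          by (rule LIMSEQ_SUP) (rule monoI, rule le_funD[OF incseqD[OF inc]], assumption)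
        ultimately show ?case by (rule LIMSEQ_unique)
      qed
    qed
    also have "\<dots> = (SUP n. \<integral>\<^sup>+p. F n p \<partial>\<rho>)"
      by (rule nn_integral_monotone_convergence_SUP[OF inc Fm])
    finally show ?thesis using 1 by simp
  qed
  hence "emeasure \<sigma> (space \<sigma>) = 1"
    unfolding \<sigma>_def space_density
    by (subst emeasure_density[OF _ sets.top]) (auto cong: nn_integral_cong)
  hence "prob_space \<sigma>" by (rule prob_spaceI)
  hence "prob_space \<nu>" unfolding \<nu>_def by (rule prob_space.prob_space_distr) (rule T_borel')
  hence \<nu>: "borel_prob \<nu>" by (simp add: borel_prob_def \<nu>_def)
  show ?thesis
  proof (rule that[OF \<nu>])
    fix \<zeta> \<omega> assume z: "0 < Im \<zeta>" "0 < Im \<omega>"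
    let ?g = "\<lambda>p. Im (res \<zeta> (fst p)) * Im (res \<omega> (snd p))"
    have g [measurable]: "?g \<in> borel_measurable borel" by measurable
    have "(LINT p|\<nu>. ?g p) = (LINT p|\<sigma>. ?g (T p))"
      unfolding \<nu>_def by (rule integral_distr[OF T_borel' g])
    also have "\<dots> = (LINT p|\<rho>. (D 0 0 / cc p) *\<^sub>R ?g (T p))"
      unfolding \<sigma>_def
    proof (rule integral_density)
      show "(\<lambda>p. ?g (T p)) \<in> borel_measurable \<rho>" using measurable_compose[OF T_borel g] by simp
      show "AE p in \<rho>. 0 \<le> D 0 0 / cc p" using D_0_pos by (intro AE_I2) (simp add: cc_def)
    qed measurable
    also have "\<dots> = (LINT p|\<rho>. D 0 0 * (half_plane_kernel \<zeta> (fst p) * half_plane_kernel \<omega> (snd p)))"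
    proof (rule integral_cong_AE)
      show "AE p in \<rho>. (D 0 0 / cc p) *\<^sub>R ?g (T p) = D 0 0 * (half_plane_kernel \<zeta> (fst p) * half_plane_kernel \<omega> (snd p))"
        using null1 null2
      proof eventually_elim
        case (elim p)
        have "?g (T p) = half_plane_kernel \<zeta> (fst p) * half_plane_kernel \<omega> (snd p) * cc p"
        proof -
          have "?g (T p) = (- Im (res \<zeta> (fst (T p)))) * (- Im (res \<omega> (snd (T p))))" by simp
          also have "\<dots> = (half_plane_kernel \<zeta> (fst p) * (cos (pi * (fst p - 1 / 2)))\<^sup>2) * (half_plane_kernel \<omega> (snd p) * (cos (pi * (snd p - 1 / 2)))\<^sup>2)"
            using half_plane_kernel_tan[OF elim(1), of \<zeta>] half_plane_kernel_tan[OF elim(2), of \<omega>] z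
            by (simp add: T_def)
          finally show ?thesis by (simp add: cc_def mult_ac)
        qed
        moreover have "cc p \<noteq> 0" using elim by (simp add: cc_def)
        ultimately show ?case by simp
      qed
      show "(\<lambda>p. (D 0 0 / cc p) *\<^sub>R ?g (T p)) \<in> borel_measurable \<rho>"
        using measurable_compose[OF T_borel g] by measurable
    qed measurable
    also have "\<dots> = P \<zeta> \<omega>" using eq[OF z] by simp
    finally show "(LINT p|\<nu>. ?g p) = P \<zeta> \<omega>" .
  qed
qed

text \<open>The law of \<open>representation_positive\<close> is only known to match
  \<open>G\<close> in the quantity \<open>P\<close>. The difference E of the transforms is removed
  in two steps, each turning a vanishing real part into a vanishing function by
  \<open>half_plane_Re_zero\<close>: first in \<zeta>, then in \<omega>.\<close>

theorem representation:
  obtains \<nu> where "borel_prob \<nu>"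
    "\<And>\<zeta> \<omega>. Im \<zeta> \<noteq> 0 \<Longrightarrow> Im \<omega> \<noteq> 0 \<Longrightarrow> cauchy_transform2 \<nu> \<zeta> \<omega> = G \<zeta> \<omega>"
proof -
  obtain \<nu> where \<nu>: "borel_prob \<nu>"
    "\<And>\<zeta> \<omega>. 0 < Im \<zeta> \<Longrightarrow> 0 < Im \<omega> \<Longrightarrow> (LINT p|\<nu>. Im (res \<zeta> (fst p)) * Im (res \<omega> (snd p))) = P \<zeta> \<omega>"
    by (rule representation_positive) blast
  define E where "E \<zeta> \<omega> = cauchy_transform2 \<nu> \<zeta> \<omega> - G \<zeta> \<omega>" for \<zeta> \<omega>
  have E_cnj: "E (cnj \<zeta>) (cnj \<omega>) = cnj (E \<zeta> \<omega>)" if "Im \<zeta> \<noteq> 0" "Im \<omega> \<noteq> 0" for \<zeta> \<omega>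
    using G_cnj[OF that] by (simp add: E_def cauchy_transform2_cnj)
  have E1: "(\<lambda>z. E z w) holomorphic_on {z. 0 < Im z}" if "Im w \<noteq> 0" for w
    unfolding E_def
    by (intro holomorphic_intros holomorphic_on_subset[OF cauchy_transform2_holomorphic(1)[OF \<nu>(1) that]] holomorphic_on_subset[OF hol1[OF that]]) auto
  have E2: "(\<lambda>z. E w z) holomorphic_on {z. 0 < Im z}" if "Im w \<noteq> 0" for w
    unfolding E_def
    by (intro holomorphic_intros holomorphic_on_subset[OF cauchy_transform2_holomorphic(2)[OF \<nu>(1) that]] holomorphic_on_subset[OF hol2[OF that]]) auto
  have Ed1: "((\<lambda>y. E (Complex 0 y) w) \<longlongrightarrow> 0) at_top" if "Im w \<noteq> 0" for w
  proof -
    have "((\<lambda>y. cauchy_transform2 \<nu> (Complex 0 y) w) \<longlongrightarrow> 0) at_top"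
      by (rule tendsto_0_imaginary[where C = "1 / \<bar>Im w\<bar>"])
         (use norm_cauchy_transform2_le[OF \<nu>(1) _ that] in \<open>simp add: mult.commute\<close>)
    from tendsto_diff[OF this decay1[OF that]] show ?thesis by (simp add: E_def)
  qed
  have Ed2: "((\<lambda>y. E w (Complex 0 y)) \<longlongrightarrow> 0) at_top" if "Im w \<noteq> 0" for w
  proof -
    have "((\<lambda>y. cauchy_transform2 \<nu> w (Complex 0 y)) \<longlongrightarrow> 0) at_top"
      by (rule tendsto_0_imaginary[where C = "1 / \<bar>Im w\<bar>"])
         (use norm_cauchy_transform2_le[OF \<nu>(1) that] in simp)
    from tendsto_diff[OF this decay2[OF that]] show ?thesis by (simp add: E_def)
  qed
  have Re0: "Re (E \<zeta> (cnj \<omega>) - E \<zeta> \<omega>) = 0" if z: "0 < Im \<zeta>" "0 < Im \<omega>" for \<zeta> \<omega>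
  proof -
    have i: "integrable \<nu> (\<lambda>p. res \<zeta> (fst p) * res (cnj \<omega>) (snd p))" "integrable \<nu> (\<lambda>p. res \<zeta> (fst p) * res \<omega> (snd p))"
      using z by (auto intro!: integrable_res2[OF \<nu>(1)])
    have "Re (cauchy_transform2 \<nu> \<zeta> (cnj \<omega>) - cauchy_transform2 \<nu> \<zeta> \<omega>)
        = Re (LINT p|\<nu>. res \<zeta> (fst p) * res (cnj \<omega>) (snd p) - res \<zeta> (fst p) * res \<omega> (snd p))"
      using i by (simp add: cauchy_transform2_res)
    also have "\<dots> = (LINT p|\<nu>. Re (res \<zeta> (fst p) * res (cnj \<omega>) (snd p) - res \<zeta> (fst p) * res \<omega> (snd p)))"
      using i by (intro integral_Re[symmetric]) auto
    also have "\<dots> = (LINT p|\<nu>. 2 * (Im (res \<zeta> (fst p)) * Im (res \<omega> (snd p))))"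
      by (intro Bochner_Integration.integral_cong refl) (simp add: cnj_res[symmetric])
    also have "\<dots> = 2 * P \<zeta> \<omega>" using \<nu>(2)[OF z] by simp
    finally show ?thesis by (simp add: E_def P_def)
  qed
  have eq: "E \<zeta> (cnj \<omega>) = E \<zeta> \<omega>" if z: "0 < Im \<zeta>" "0 < Im \<omega>" for \<zeta> \<omega>
  proof -
    have "E \<zeta> (cnj \<omega>) - E \<zeta> \<omega> = 0"
    proof (rule half_plane_Re_zero[of "\<lambda>z. E z (cnj \<omega>) - E z \<omega>"])
      show "(\<lambda>z. E z (cnj \<omega>) - E z \<omega>) holomorphic_on {z. 0 < Im z}"
        using z by (intro holomorphic_intros E1) auto
      have "((\<lambda>y. E (Complex 0 y) (cnj \<omega>) - E (Complex 0 y) \<omega>) \<longlongrightarrow> 0 - 0) at_top"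
        using z by (intro tendsto_diff Ed1) auto
      thus "((\<lambda>y. E (Complex 0 y) (cnj \<omega>) - E (Complex 0 y) \<omega>) \<longlongrightarrow> 0) at_top" by simp
    qed (use Re0 z in auto)
    thus ?thesis by simp
  qed
  have zero: "E \<zeta> \<omega> = 0" if z: "0 < Im \<zeta>" "0 < Im \<omega>" for \<zeta> \<omega>
  proof (rule half_plane_Re_zero[OF E2 _ Ed2 z(2)])
    \<comment> \<open>By \<open>eq\<close>, the value of E at the conjugate of \<zeta> is the
      conjugate of the value at \<zeta>. Their sum is real but holomorphic in w, so multiplication
      by \<i> gives a function without real part.\<close>
    have "\<i> * (E \<zeta> w + E (cnj \<zeta>) w) = 0" if w: "0 < Im w" for w
    proof (rule half_plane_Re_zero[of "\<lambda>w. \<i> * (E \<zeta> w + E (cnj \<zeta>) w)", OF _ _ _ w])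
      show "(\<lambda>w. \<i> * (E \<zeta> w + E (cnj \<zeta>) w)) holomorphic_on {z. 0 < Im z}"
        using z by (intro holomorphic_intros E2) auto
      have "((\<lambda>y. \<i> * (E \<zeta> (Complex 0 y) + E (cnj \<zeta>) (Complex 0 y))) \<longlongrightarrow> \<i> * (0 + 0)) at_top"
        using z by (intro tendsto_intros Ed2) auto
      thus "((\<lambda>y. \<i> * (E \<zeta> (Complex 0 y) + E (cnj \<zeta>) (Complex 0 y))) \<longlongrightarrow> 0) at_top" by simp
      fix v assume v: "0 < Im v"
      have "E (cnj \<zeta>) v = cnj (E \<zeta> v)" using E_cnj[of \<zeta> "cnj v"] eq[OF z(1) v] z v by simp
      thus "Re (\<i> * (E \<zeta> v + E (cnj \<zeta>) v)) = 0" by simp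
    qed
    moreover have "E (cnj \<zeta>) w = cnj (E \<zeta> w)" if "0 < Im w" for w
      using E_cnj[of \<zeta> "cnj w"] eq[OF z(1) that] z that by simp
    ultimately show "Re (E \<zeta> w) = 0" if "0 < Im w" for w
      using that by (simp add: complex_eq_iff)
  qed (use z in auto)
  show ?thesis
  proof (rule that[OF \<nu>(1)])
    fix \<zeta> \<omega> assume z: "Im \<zeta> \<noteq> 0" "Im \<omega> \<noteq> 0"
    have "E \<zeta> \<omega> = 0"
    proof -
      consider "0 < Im \<zeta>" "0 < Im \<omega>" | "0 < Im \<zeta>" "Im \<omega> < 0" | "Im \<zeta> < 0" "0 < Im \<omega>" | "Im \<zeta> < 0" "Im \<omega> < 0"
        using z by linarith
      thus ?thesis
      proof cases
        case 1 thus ?thesis by (rule zero)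
      next
        case 2 thus ?thesis using eq[of \<zeta> "cnj \<omega>"] zero[of \<zeta> "cnj \<omega>"] by simp
      next
        case 3 thus ?thesis using E_cnj[OF z] eq[of "cnj \<zeta>" \<omega>] zero[of "cnj \<zeta>" \<omega>] by simp
      next
        case 4 thus ?thesis using E_cnj[OF z] zero[of "cnj \<zeta>" "cnj \<omega>"] by simp
      qed
    qed
    thus "cauchy_transform2 \<nu> \<zeta> \<omega> = G \<zeta> \<omega>" by (simp add: E_def)
  qed
qed

end

section \<open>Subordination\<close>

context real_rv
begin

text \<open>At w = 1 / z + R z with G w = z one has h w = - R z, so H \<kappa> w = 1 / z + (\<kappa>
  + 1) R z: the point at which the free power of exponent \<kappa> + 1 must take the value
  z.\<close>

definition H :: "real \<Rightarrow> complex \<Rightarrow> complex" where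
  "H \<kappa> w = w - of_real \<kappa> * h w"

text \<open>Since Im (H \<kappa> w) = (1 - \<kappa> V w) Im w, this is where
  \<open>H \<kappa>\<close> keeps a point in its half-plane.\<close>

definition U :: "real \<Rightarrow> complex set" where
  "U \<kappa> = {w. Im w \<noteq> 0 \<and> \<kappa> * V w < 1}"

lemma Im_H: "Im w \<noteq> 0 \<Longrightarrow> Im (H \<kappa> w) = (1 - \<kappa> * V w) * Im w"
  by (simp add: H_def Im_h algebra_simps)

lemma H_cnj: "H \<kappa> (cnj w) = cnj (H \<kappa> w)"
  by (simp add: H_def h_cnj)

lemma H_holomorphic: "H \<kappa> holomorphic_on {w. Im w \<noteq> 0}"
  unfolding H_def[abs_def] by (intro holomorphic_intros h_holomorphic)

lemma mem_U_iff: "w \<in> U \<kappa> \<longleftrightarrow> Im w \<noteq> 0 \<and> 0 < Im (H \<kappa> w) * Im w"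
proof (cases "Im w = 0")
  case False
  hence "0 < Im w * Im w" by (simp add: zero_less_mult_iff) linarith
  moreover have "Im (H \<kappa> w) * Im w = (1 - \<kappa> * V w) * (Im w * Im w)" using False by (simp add: Im_H)
  moreover have "0 < a * b \<longleftrightarrow> 0 < a" if "0 < b" for a b :: real using that by (simp add: zero_less_mult_iff)
  ultimately have "0 < Im (H \<kappa> w) * Im w \<longleftrightarrow> 0 < 1 - \<kappa> * V w" by metis
  thus ?thesis using False by (simp add: U_def)
qed (simp add: U_def)

lemma U_cnj: "cnj w \<in> U \<kappa> \<longleftrightarrow> w \<in> U \<kappa>"
  by (simp add: U_def V_cnj)

lemma U_Im: "w \<in> U \<kappa> \<Longrightarrow> Im w \<noteq> 0" "w \<in> U \<kappa> \<Longrightarrow> Im (H \<kappa> w) \<noteq> 0"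
  by (auto simp: mem_U_iff)

lemma open_U: "open (U \<kappa>)"
proof -
  have "open ({w. Im w \<noteq> 0} \<inter> (\<lambda>w. Im (H \<kappa> w) * Im w) -` {0<..})"
    by (intro continuous_open_preimage continuous_intros holomorphic_on_imp_continuous_on H_holomorphic open_Collect_neq open_greaterThan)
  also have "{w. Im w \<noteq> 0} \<inter> (\<lambda>w. Im (H \<kappa> w) * Im w) -` {0<..} = U \<kappa>"
    by (auto simp: mem_U_iff)
  finally show ?thesis .
qed

text \<open>Equal values at distinct points force \<kappa> times the covariance of
  \<open>x w\<close> and \<open>x w'\<close> to be 1, but its squared modulus is at most (\<kappa> V
  w) (\<kappa> V w') < 1.\<close>

lemma inj_on_H:
  assumes \<kappa>: "0 \<le> \<kappa>" shows "inj_on (H \<kappa>) (U \<kappa>)"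
proof (rule inj_onI, rule ccontr)
  fix w w' assume w: "w \<in> U \<kappa>" "w' \<in> U \<kappa>" and eq: "H \<kappa> w = H \<kappa> w'" and ne: "w \<noteq> w'"
  define I where "I = (LINT p|M. x w p * x w' p)"
  have im: "Im w \<noteq> 0" "Im w' \<noteq> 0" using w by (auto simp: U_def)
  have "w - w' = of_real \<kappa> * (h w - h w')" using eq by (simp add: H_def algebra_simps)
  also have "\<dots> = (w - w') * (of_real \<kappa> * I)" by (simp add: h_diff[OF im] I_def mult_ac)
  finally have "of_real \<kappa> * I = 1" using ne by simp
  hence "cmod (of_real \<kappa> * I) = 1" by simp
  hence "1 = (\<kappa> * cmod I)\<^sup>2" using \<kappa> by (simp add: norm_mult)
  also have "\<dots> \<le> \<kappa>\<^sup>2 * (V w * V w')"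
    unfolding power_mult_distrib I_def by (intro mult_left_mono norm_integral_x_mult im) auto
  also have "\<dots> = (\<kappa> * V w) * (\<kappa> * V w')" by (simp add: power2_eq_square)
  also have "\<dots> < 1 * 1"
    using w \<kappa> V_nonneg by (intro mult_strict_mono) (auto simp: U_def)
  finally show False by simp
qed

lemma eventually_h_imaginary:
  assumes "0 < \<epsilon>"
  shows "\<forall>\<^sub>F y in at_top. cmod (h (Complex 0 y)) \<le> \<epsilon> * y"
proof -
  define e where "e = min (1 / 2) (\<epsilon> / 2)"
  have "0 < e / 2" using assms by (simp add: e_def)
  hence "\<forall>\<^sub>F y in at_top. tB y < e / 2" by (rule order_tendstoD(2)[OF tB_tendsto])
  thus ?thesis using eventually_gt_at_top[of 0]
  proof eventually_elim
    case (elim y)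
    have "cmod (Complex 0 y * G (Complex 0 y) - 1) \<le> (2 + 0) * tB y"
      by (rule G_cone) (use elim in auto)
    hence "cmod (h (Complex 0 y)) \<le> cmod (Complex 0 y) * (2 * e)"
      by (intro norm_h_le) (use elim in \<open>auto simp: e_def\<close>)
    also have "\<dots> \<le> y * \<epsilon>" using elim by (intro mult_mono) (use assms in \<open>auto simp: e_def cmod_def\<close>)
    finally show ?case by (simp add: mult.commute)
  qed
qed

text \<open>A fixed point of \<open>f w = \<zeta> + \<kappa> h w\<close> is found by truncating \<open>f\<close> radially to a large half-disc.
  It cannot sit at the truncation, because \<open>f\<close> contracts towards \<open>f (\<i> Y)\<close> in the
  pseudo-hyperbolic sense and \<open>f (\<i> Y)\<close> is small compared to \<open>Y\<close>.\<close>

lemma H_surj_upper: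
  assumes \<kappa>: "0 \<le> \<kappa>" and z: "0 < Im \<zeta>"
  obtains w where "0 < Im w" "H \<kappa> w = \<zeta>"
proof -
  define \<sigma> where "\<sigma> = Im \<zeta>"
  define f where "f w = \<zeta> + of_real \<kappa> * h w" for w
  have \<sigma>: "0 < \<sigma>" using z by (simp add: \<sigma>_def)
  have Imf: "Im (f w) = \<sigma> + \<kappa> * V w * Im w" if "0 < Im w" for w
    using that by (simp add: f_def \<sigma>_def Im_h)
  \<comment> \<open>The constant makes \<kappa> |h| at most Y / 4 at the point iY, which also gives
    \<kappa> V <= 1/4 there; the denominator \<kappa> + 1 covers \<kappa> = 0.\<close>
  have "0 < 1 / (4 * (\<kappa> + 1))" using \<kappa> by simp
  from eventually_h_imaginary[OF this] eventually_gt_at_top[of 0]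
  have "\<forall>\<^sub>F y in at_top. cmod (h (Complex 0 y)) \<le> 1 / (4 * (\<kappa> + 1)) * y \<and> 0 < y" by (rule eventually_conj)
  then obtain Y where Y: "cmod (h (Complex 0 Y)) \<le> 1 / (4 * (\<kappa> + 1)) * Y" "0 < Y"
    using eventually_happens by fastforce
  define iY where "iY = Complex 0 Y"
  have kh: "\<kappa> * cmod (h iY) \<le> Y / 4"
  proof -
    have "\<kappa> * cmod (h iY) \<le> (\<kappa> + 1) * (1 / (4 * (\<kappa> + 1)) * Y)"
      using Y \<kappa> unfolding iY_def by (intro mult_mono) auto
    also have "\<dots> = Y / 4" using \<kappa> by (simp add: divide_simps)
    finally show ?thesis .
  qed
  have kV: "\<kappa> * V iY \<le> 1 / 4"
  proof -
    have "\<kappa> * V iY * Y = \<kappa> * Im (h iY)" using Im_h[of iY] Y by (simp add: iY_def)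
    also have "\<dots> \<le> \<kappa> * cmod (h iY)" using \<kappa> abs_Im_le_cmod[of "h iY"] by (intro mult_left_mono) auto
    finally have "\<kappa> * V iY * Y \<le> 1 / 4 * Y" using kh by linarith
    thus ?thesis using Y by simp
  qed
  define S where "S = \<sigma> + cmod \<zeta> + Y"
  \<comment> \<open>At a truncated point the estimates below give ell R <= 11/2 ell S + S with ell >
    1; R = 10 S makes this impossible.\<close>
  define R where "R = 10 * S"
  have S: "0 < S" using \<sigma> Y by (simp add: S_def add_pos_nonneg add_pos_pos)
  have R: "0 < R" using S by (simp add: R_def)
  define C where "C = {u. 0 \<le> Im u} \<inter> cball 0 R"
  \<comment> \<open>q is f in the coordinate u = w - \<i> \<sigma>. As Im (f w) >= \<sigma>, q maps
    into the closed upper half-plane, and scaling back to radius R makes g a self-map of C.\<close>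
  define q where "q u = f (\<i> * of_real \<sigma> + u) - \<i> * of_real \<sigma>" for u
  define g where "g u = of_real (R / max R (cmod (q u))) * q u" for u
  have Imq: "0 \<le> Im (q u)" if "0 \<le> Im u" for u
    using Imf[of "\<i> * of_real \<sigma> + u"] that \<sigma> \<kappa> V_nonneg by (simp add: q_def)
  have "compact C" "convex C" unfolding C_def
    by (auto intro!: closed_Int_compact closed_halfspace_Im_ge convex_Int convex_halfspace_Im_ge)
  moreover have "C \<noteq> {}"
  proof -
    have "0 \<in> C" using R by (simp add: C_def)
    thus ?thesis by blast
  qed
  moreover have qc: "continuous_on C q"
  proof -
    have "continuous_on C (\<lambda>u. h (\<i> * of_real \<sigma> + u))"
      by (rule continuous_on_compose2[OF holomorphic_on_imp_continuous_on[OF h_holomorphic]])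
         (use \<sigma> in \<open>auto simp: C_def intro!: continuous_intros\<close>)
    thus ?thesis unfolding q_def[abs_def] f_def by (intro continuous_intros)
  qed
  moreover have "continuous_on C g"
    unfolding g_def[abs_def] by (intro continuous_intros qc) (use R in auto)
  moreover have "g \<in> C \<rightarrow> C"
  proof
    fix u assume u: "u \<in> C"
    have "cmod (g u) = R / max R (cmod (q u)) * cmod (q u)" using R by (simp only: g_def norm_mult norm_of_real) simp
    also have "\<dots> \<le> R" using R by (simp add: divide_le_eq max_def)
    finally have "cmod (g u) \<le> R" .
    moreover have "0 \<le> Im (g u)" unfolding g_def using R Imq[of u] u by (simp add: C_def)
    ultimately show "g u \<in> C" by (simp add: C_def)
  qed
  ultimately obtain u where u: "u \<in> C" "g u = u" using brouwer by metis
  define w where "w = \<i> * of_real \<sigma> + u"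
  have w: "0 < Im w" using u \<sigma> by (simp add: w_def C_def)
  have "cmod (q u) \<le> R"
  proof (rule ccontr)
    assume "\<not> cmod (q u) \<le> R"
    hence qR: "R < cmod (q u)" by simp
    define ell where "ell = cmod (q u) / R"
    have ell: "1 < ell" using qR R by (simp add: ell_def)
    have "u = of_real (R / cmod (q u)) * q u" using u(2) qR by (simp add: g_def max_def)
    moreover have "of_real ell * (of_real (R / cmod (q u)) * q u) = of_real (ell * (R / cmod (q u))) * q u" by simp
    moreover have "cmod (q u) \<noteq> 0" using qR R by linarith
    hence "ell * (R / cmod (q u)) = 1" using R by (simp add: ell_def del: norm_eq_zero)
    ultimately have qu: "q u = of_real ell * u" by (metis mult_1 of_real_1)
    have "cmod u = cmod (of_real (R / cmod (q u)) * q u)" using \<open>u = of_real (R / cmod (q u)) * q u\<close> by simp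
    also have "\<dots> = \<bar>R / cmod (q u)\<bar> * cmod (q u)" by (simp only: norm_mult norm_of_real)
    also have "\<dots> = R"
    proof -
      have "cmod (q u) \<noteq> 0" using qR R by linarith
      thus ?thesis using R by (simp add: abs_of_pos del: norm_eq_zero)
    qed
    finally have nu: "cmod u = R" .
    have fw: "f w = of_real ell * u + \<i> * of_real \<sigma>" using qu by (simp add: q_def w_def algebra_simps)
    have u0: "0 \<le> Im u" using u by (simp add: C_def)
    have kVw: "\<kappa> * V w \<le> ell"
    proof -
      have "\<kappa> * V w * Im w \<le> Im (f w)" using Imf[OF w] \<sigma> by simp
      also have "\<dots> = ell * Im u + \<sigma>" by (simp add: fw)
      also have "\<dots> \<le> ell * Im w" using ell \<sigma> by (simp add: w_def distrib_left)
      finally show ?thesis using w by simp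
    qed
    have iY: "0 < Im iY" using Y by (simp add: iY_def)
    define I where "I = (LINT p|M. x w p * x iY p)"
    have "cmod (f w - f iY) = cmod (w - iY) * (\<kappa> * cmod I)" (is "_ = ?r")
    proof -
      have "f w - f iY = of_real \<kappa> * (h w - h iY)" by (simp add: f_def algebra_simps)
      also have "h w - h iY = (w - iY) * I" unfolding I_def by (rule h_diff) (use w iY in auto)
      finally show ?thesis using \<kappa> by (simp add: norm_mult mult_ac)
    qed
    \<comment> \<open>The bounds ell for \<kappa> V at w and 1/4 at iY give sqrt ell / 2, and ell >
      1.\<close>
    moreover have "\<kappa> * cmod I \<le> ell / 2"
    proof (rule power2_le_imp_le)
      have "(\<kappa> * cmod I)\<^sup>2 \<le> \<kappa>\<^sup>2 * (V w * V iY)"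
        unfolding power_mult_distrib I_def by (intro mult_left_mono norm_integral_x_mult) (use w iY in auto)
      also have "\<dots> = (\<kappa> * V w) * (\<kappa> * V iY)" by (simp add: power2_eq_square)
      also have "\<dots> \<le> ell * (1 / 4)" using kVw kV \<kappa> ell V_nonneg by (intro mult_mono) auto
      also have "\<dots> \<le> (ell / 2)\<^sup>2" using ell by (simp add: power2_eq_square)
      finally show "(\<kappa> * cmod I)\<^sup>2 \<le> (ell / 2)\<^sup>2" .
    qed (use ell in auto)
    ultimately have 1: "cmod (f w - f iY) \<le> cmod (w - iY) * (ell / 2)"
      using mult_left_mono[of "\<kappa> * cmod I" "ell / 2" "cmod (w - iY)"] by simp
    have "cmod (w - iY) \<le> cmod w + cmod iY" by (rule norm_triangle_ineq4)
    moreover have "cmod w \<le> \<sigma> + R" unfolding w_def using norm_triangle_ineq[of "\<i> * of_real \<sigma>" u] nu \<sigma> by (simp add: norm_mult)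
    moreover have "cmod iY = Y" using Y by (simp add: iY_def cmod_def)
    moreover have "0 \<le> cmod \<zeta>" by simp
    hence "\<sigma> + R + Y \<le> 11 * S" unfolding R_def S_def distrib_left by linarith
    ultimately have 2: "cmod (w - iY) \<le> 11 * S" by linarith
    have "cmod (f iY) \<le> cmod \<zeta> + \<kappa> * cmod (h iY)"
      unfolding f_def using norm_triangle_ineq[of \<zeta> "of_real \<kappa> * h iY"] \<kappa> by (simp add: norm_mult)
    hence 3: "cmod (f iY) \<le> cmod \<zeta> + Y / 4" using kh by linarith
    have "of_real ell * u = (f w - f iY) + f iY - \<i> * of_real \<sigma>" by (simp add: fw)
    hence "cmod (of_real ell * u) \<le> cmod (f w - f iY) + cmod (f iY) + cmod (\<i> * of_real \<sigma>)"
      by (metis norm_triangle_le_diff norm_triangle_ineq add_le_cancel_right order_refl)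
    hence "ell * R \<le> cmod (f w - f iY) + (cmod \<zeta> + Y / 4) + \<sigma>"
      using nu ell \<sigma> 3 by (simp add: norm_mult)
    also have "\<dots> \<le> 11 * S * (ell / 2) + S"
      using 1 mult_right_mono[OF 2, of "ell / 2"] ell Y unfolding S_def by linarith
    finally have "9 / 2 * (ell * S) \<le> S" unfolding R_def by (simp add: algebra_simps)
    moreover have "S \<le> ell * S" using ell S by simp
    ultimately show False using S by linarith
  qed
  hence "q u = u" using u(2) R by (simp add: g_def max_def)
  hence "f w = w" by (simp add: q_def w_def algebra_simps)
  hence "H \<kappa> w = \<zeta>" by (simp add: H_def f_def algebra_simps)
  thus ?thesis using that w by blast
qed

lemma H_image_U:
  assumes \<kappa>: "0 \<le> \<kappa>" shows "H \<kappa> ` U \<kappa> = {z. Im z \<noteq> 0}"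
proof
  show "H \<kappa> ` U \<kappa> \<subseteq> {z. Im z \<noteq> 0}" using U_Im by auto
  show "{z. Im z \<noteq> 0} \<subseteq> H \<kappa> ` U \<kappa>"
  proof
    fix z assume "z \<in> {z. Im z \<noteq> 0}"
    then consider "0 < Im z" | "0 < Im (cnj z)" by fastforce
    thus "z \<in> H \<kappa> ` U \<kappa>"
    proof cases
      case 1
      then obtain w where "0 < Im w" "H \<kappa> w = z" using H_surj_upper[OF \<kappa>] by blast
      with 1 have "w \<in> U \<kappa>" by (simp add: mem_U_iff)
      thus ?thesis using \<open>H \<kappa> w = z\<close> by blast
    next
      case 2
      then obtain w where w: "0 < Im w" "H \<kappa> w = cnj z" using H_surj_upper[OF \<kappa>] by blast
      have "0 < Im (cnj z) * Im w" by (rule mult_pos_pos[OF 2 w(1)])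
      hence "w \<in> U \<kappa>" unfolding mem_U_iff w(2) using w(1) by auto
      hence "cnj w \<in> U \<kappa>" by (simp add: U_cnj)
      moreover have "H \<kappa> (cnj w) = z" using w by (simp add: H_cnj)
      ultimately show ?thesis by blast
    qed
  qed
qed

definition subord :: "real \<Rightarrow> complex \<Rightarrow> complex" where
  "subord \<kappa> = inv_into (U \<kappa>) (H \<kappa>)"

lemma subord:
  assumes \<kappa>: "0 \<le> \<kappa>"
  shows subord_in_U: "Im z \<noteq> 0 \<Longrightarrow> subord \<kappa> z \<in> U \<kappa>"
    and H_subord: "Im z \<noteq> 0 \<Longrightarrow> H \<kappa> (subord \<kappa> z) = z"
    and subord_H: "w \<in> U \<kappa> \<Longrightarrow> subord \<kappa> (H \<kappa> w) = w"
proof -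
  have "z \<in> H \<kappa> ` U \<kappa>" if "Im z \<noteq> 0" using H_image_U[OF \<kappa>] that by auto
  thus "Im z \<noteq> 0 \<Longrightarrow> subord \<kappa> z \<in> U \<kappa>" and "Im z \<noteq> 0 \<Longrightarrow> H \<kappa> (subord \<kappa> z) = z"
    unfolding subord_def by (auto intro: inv_into_into f_inv_into_f)
  show "w \<in> U \<kappa> \<Longrightarrow> subord \<kappa> (H \<kappa> w) = w"
    unfolding subord_def by (rule inv_into_f_f[OF inj_on_H[OF \<kappa>]])
qed

lemma subord_holomorphic:
  assumes \<kappa>: "0 \<le> \<kappa>" shows "subord \<kappa> holomorphic_on {z. Im z \<noteq> 0}"
proof -
  have "H \<kappa> holomorphic_on U \<kappa>" by (rule holomorphic_on_subset[OF H_holomorphic]) (auto simp: U_def)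
  then obtain g where g: "g holomorphic_on (H \<kappa> ` U \<kappa>)" "\<And>w. w \<in> U \<kappa> \<Longrightarrow> g (H \<kappa> w) = w"
    using holomorphic_has_inverse[OF _ open_U inj_on_H[OF \<kappa>]] by metis
  have "g z = subord \<kappa> z" if "z \<in> {z. Im z \<noteq> 0}" for z
    using g(2)[OF subord_in_U[OF \<kappa>]] H_subord[OF \<kappa>] that by auto
  thus ?thesis using g(1) unfolding H_image_U[OF \<kappa>] by (metis holomorphic_cong)
qed

lemma subord_cnj: "0 \<le> \<kappa> \<Longrightarrow> Im z \<noteq> 0 \<Longrightarrow> subord \<kappa> (cnj z) = cnj (subord \<kappa> z)"
  using subord_H[of \<kappa> "cnj (subord \<kappa> z)"] subord_in_U[of \<kappa> z] H_subord[of \<kappa> z] by (simp add: U_cnj H_cnj)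

lemma subord_Im:
  assumes \<kappa>: "0 \<le> \<kappa>" and z: "Im z \<noteq> 0"
  shows "Im (subord \<kappa> z) \<noteq> 0" "0 < Im z * Im (subord \<kappa> z)" "Im z = (1 - \<kappa> * V (subord \<kappa> z)) * Im (subord \<kappa> z)" "\<kappa> * V (subord \<kappa> z) < 1"
  using subord_in_U[OF \<kappa> z] H_subord[OF \<kappa> z] Im_H[of "subord \<kappa> z" \<kappa>] mem_U_iff[of "subord \<kappa> z" \<kappa>]
  by (auto simp: U_def)

text \<open>The fixed point found by \<open>cone_fixpoint\<close> near iy lies in
  \<open>U \<kappa>\<close>, so it is the value of \<open>subord\<close> by injectivity of
  \<open>H \<kappa>\<close>.\<close>

lemma subord_imaginary:
  assumes \<kappa>: "0 \<le> \<kappa>" and \<delta>: "0 < \<delta>" "\<delta> \<le> 1 / 2"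
  shows "\<forall>\<^sub>F y in at_top. cmod (subord \<kappa> (Complex 0 y) - Complex 0 y) \<le> \<delta> * y"
proof -
  define \<epsilon> where "\<epsilon> = min (1 / 2) (\<delta> / (6 * (\<kappa> + 1)))"
  have \<epsilon>: "0 < \<epsilon> / 3" using \<kappa> \<delta> by (simp add: \<epsilon>_def)
  obtain B where B: "0 < B" "tB B < \<epsilon> / 3" by (rule eventually_tB_small[OF \<epsilon>])
  show ?thesis
    using eventually_ge_at_top[of "2 * B"]
  proof eventually_elim
    case (elim y)
    have y: "0 < y" using elim B by linarith
    define q where "q = Complex 0 y"
    obtain w where w: "w \<in> cball q (\<delta> * \<bar>Im q\<bar>)" "w = q + of_real \<kappa> * h w"
    proof (rule cone_fixpoint[of q 0 B \<delta> "(2 + (2 * 0 + 1)) * tB B" \<kappa>])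
      have t: "0 \<le> tB B" using B by (simp add: tB_nonneg)
      have e: "(2 + (2 * 0 + 1)) * tB B \<le> \<epsilon>" using B by simp
      thus "(2 + (2 * 0 + 1)) * tB B \<le> 1 / 2" by (simp add: \<epsilon>_def)
      have "\<bar>\<kappa>\<bar> * (2 * ((2 + (2 * 0 + 1)) * tB B) * ((2 * 0 + 2) * (3 / 2))) = 6 * \<kappa> * ((2 + (2 * 0 + 1)) * tB B)"
        using \<kappa> by simp
      also have "\<dots> \<le> 6 * (\<kappa> + 1) * (\<delta> / (6 * (\<kappa> + 1)))"
        using e \<kappa> t unfolding \<epsilon>_def by (intro mult_mono) auto
      also have "\<dots> = \<delta>" using \<kappa> by simp
      finally show "\<bar>\<kappa>\<bar> * (2 * ((2 + (2 * 0 + 1)) * tB B) * ((2 * 0 + 2) * (3 / 2))) \<le> \<delta>" .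
    qed (use y elim B \<delta> in \<open>auto simp: q_def\<close>)
    have "w \<in> cball q (\<bar>Im q\<bar> / 2)" using w(1) mult_right_mono[OF \<delta>(2), of "\<bar>Im q\<bar>"] by simp
    hence "0 < Im w" using cone_cball(2)[of q 0 w] y by (simp add: q_def zero_less_mult_iff)
    moreover have Hw: "H \<kappa> w = q" using w(2) unfolding H_def by (metis add_diff_cancel_right')
    ultimately have "w \<in> U \<kappa>" using y by (simp add: mem_U_iff q_def)
    hence "subord \<kappa> q = w" using subord_H[OF \<kappa>] Hw by auto
    thus ?case using w(1) y by (simp add: q_def dist_norm norm_minus_commute)
  qed
qed

end

section \<open>Convolution powers\<close>

lemma borel_measurable_cnj [measurable (raw)]:
  "f \<in> borel_measurable M \<Longrightarrow> (\<lambda>x. cnj (f x)) \<in> borel_measurable M"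
  by (rule borel_measurable_continuous_on[OF continuous_on_cnj[OF continuous_on_id]])

lemma (in prob_space) integrable_bounded_mult:
  fixes f g :: "'a \<Rightarrow> complex"
  assumes "f \<in> borel_measurable M" "g \<in> borel_measurable M"
    and f: "\<And>p. cmod (f p) \<le> A" and g: "\<And>p. cmod (g p) \<le> B"
  shows "integrable M (\<lambda>p. f p * g p)" "integrable M (\<lambda>p. f p * cnj (g p))"
proof -
  have A: "0 \<le> A" using f norm_ge_zero order_trans by blast
  show "integrable M (\<lambda>p. f p * g p)" "integrable M (\<lambda>p. f p * cnj (g p))"
    using assms A by (auto intro!: integrable_bounded[where B="A * B"] mult_mono simp: norm_mult)
qed

text \<open>One expectation formula for the polynomials that occur in
  \<open>covariance_positive\<close>. As x and y have mean 0, only the two mixed moments and their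
  conjugates survive; |x|^2 and |y|^2 are eliminated beforehand by the affine relations F1 and
  F2.\<close>

lemma (in prob_space) integral_linear_combination:
  fixes x y :: "'a \<Rightarrow> complex"
  assumes [measurable]: "x \<in> borel_measurable M" "y \<in> borel_measurable M"
    and xb: "\<And>p. cmod (x p) \<le> Bx" and yb: "\<And>p. cmod (y p) \<le> By"
    and "(LINT p|M. x p) = 0" "(LINT p|M. y p) = 0"
  shows "(LINT p|M. a0 + a1 * x p + a2 * cnj (x p) + a3 * y p + a4 * cnj (y p) + a5 * (x p * y p)
      + a6 * (x p * cnj (y p)) + a7 * cnj (x p * y p) + a8 * cnj (x p * cnj (y p)))
    = a0 + a5 * (LINT p|M. x p * y p) + a6 * (LINT p|M. x p * cnj (y p))
      + a7 * cnj (LINT p|M. x p * y p) + a8 * cnj (LINT p|M. x p * cnj (y p))"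
proof -
  have Bx: "0 \<le> Bx" using xb norm_ge_zero order_trans by blast
  have "integrable M x" "integrable M y"
    by (rule integrable_bounded[OF assms(1) xb], rule integrable_bounded[OF assms(2) yb])
  note i = this integrable_bounded_mult[OF assms(1,2) xb yb]
  have i': "integrable M (\<lambda>p. cnj (x p))" "integrable M (\<lambda>p. cnj (y p))"
    "integrable M (\<lambda>p. cnj (x p * y p))" "integrable M (\<lambda>p. cnj (x p * cnj (y p)))"
    using i by (simp_all only: integrable_cnj)
  have e: "(LINT p|M. cnj (x p)) = 0" "(LINT p|M. cnj (y p)) = 0" using assms by simp_all
  show ?thesis
    by (simp add: i i' assms e prob_space del: complex_cnj_mult)
qed

text \<open>Here W is (1 - \<kappa> c) / (1 - \<kappa> d), and the left-hand side is the expression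
  of the positivity claim times e |1 - \<kappa> c|^2. In the notation of
  \<open>covariance_positive\<close>, the two terms multiplied by \<kappa> + 1 are, up to the
  factors f and 2 f, the real part of S E(x cnj g) and E |g|^2. The hypothesis on W removes the only
  quotient; what remains is a polynomial identity in real and imaginary parts.\<close>

lemma covariance_identity:
  fixes c d W p q :: complex and \<kappa> e \<epsilon> \<delta> Y :: real
  assumes q: "q = 1 + \<i> * of_real \<epsilon>" and p: "p = 1 + \<i> * of_real \<delta>" and Y: "Y = 2 * e - 1"
    and W: "(1 - of_real \<kappa> * d) * W = 1 - of_real \<kappa> * c"
  shows "e * Re (q * cnj p * ((1 + d) * cnj (1 - of_real \<kappa> * c) * W) + q * p * ((1 + c) * cnj (1 - of_real \<kappa> * c)))
    = (cmod (1 + c))\<^sup>2 * (1 - \<kappa> * Y) + (\<kappa> + 1) * (Re (q * (d - cnj c) * ((1 + c) + of_real e * cnj p * (W - 1)))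
      + (Y + (cmod c)\<^sup>2 + Re (q * (of_real e * (p * c + cnj p * d) - c - d - c * cnj c - c * d))))"
proof -
  have "((1 + d) * cnj (1 - of_real \<kappa> * c) - (of_real \<kappa> + 1) * (d - cnj c)) * W
      = (1 + cnj c) * ((1 - of_real \<kappa> * d) * W)"
    by (simp add: algebra_simps)
  also have "\<dots> = (1 + cnj c) * (1 - of_real \<kappa> * c)" by (simp only: W)
  finally have 1: "(1 + d) * cnj (1 - of_real \<kappa> * c) * W
      = (of_real \<kappa> + 1) * (d - cnj c) * W + (1 + cnj c) * (1 - of_real \<kappa> * c)"
    by (simp add: algebra_simps)
  have 2: "q * cnj p * ((1 + d) * cnj (1 - of_real \<kappa> * c) * W)
     = (of_real \<kappa> + 1) * (q * (d - cnj c) * (cnj p * W)) + q * cnj p * ((1 + cnj c) * (1 - of_real \<kappa> * c))"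
    unfolding 1 by (simp add: algebra_simps)
  have 3: "q * (d - cnj c) * ((1 + c) + of_real e * cnj p * (W - 1))
     = of_real e * (q * (d - cnj c) * (cnj p * W)) + q * (d - cnj c) * ((1 + c) - of_real e * cnj p)"
    by (simp add: algebra_simps)
  define T where "T = Re (q * (d - cnj c) * (cnj p * W))"
  have R2: "Re (q * cnj p * ((1 + d) * cnj (1 - of_real \<kappa> * c) * W)) = (\<kappa> + 1) * T + Re (q * cnj p * ((1 + cnj c) * (1 - of_real \<kappa> * c)))"
    unfolding 2 T_def by (simp add: distrib_right)
  have R3: "Re (q * (d - cnj c) * ((1 + c) + of_real e * cnj p * (W - 1))) = e * T + Re (q * (d - cnj c) * ((1 + c) - of_real e * cnj p))"
    unfolding 3 T_def by simp
  obtain c1 c2 where c: "c = Complex c1 c2" by (cases c)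
  obtain d1 d2 where d: "d = Complex d1 d2" by (cases d)
  have "e * (Re (q * cnj p * ((1 + cnj c) * (1 - of_real \<kappa> * c))) + Re (q * p * ((1 + c) * cnj (1 - of_real \<kappa> * c))))
    = (cmod (1 + c))\<^sup>2 * (1 - \<kappa> * Y) + (\<kappa> + 1) * (Re (q * (d - cnj c) * ((1 + c) - of_real e * cnj p))
      + (Y + (cmod c)\<^sup>2 + Re (q * (of_real e * (p * c + cnj p * d) - c - d - c * cnj c - c * d))))"
    unfolding cmod_power2 p q Y c d by (simp add: power2_eq_square) algebra
  thus ?thesis unfolding plus_complex.sel(1) R2 R3 by (simp add: algebra_simps)
qed

text \<open>The positivity of the convolution powers. With \<open>g = (1 + x) (y - c)\<close> and \<open>k = S x + g\<close>, the
  expression is a positive multiple of \<open>(1 + X) (1 - \<kappa> Y) |1 + c|\<^sup>2 + (\<kappa> + 1) (E |k|\<^sup>2 - X |S|\<^sup>2)\<close>, where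
  \<open>S = (1 - \<kappa> Y) (1 + c) + \<kappa> E (k cnj y)\<close>. The Cauchy-Schwarz inequality bounds \<open>|S|\<^sup>2\<close> by
  \<open>(1 - \<kappa> Y) |1 + c|\<^sup>2 + \<kappa> E |k|\<^sup>2\<close>, and what remains has the nonnegative factor \<open>1 - \<kappa> X\<close>.\<close>

lemma (in prob_space) covariance_positive:
  fixes x y :: "'a \<Rightarrow> complex" and \<kappa> \<epsilon> \<delta> X Y :: real
  assumes xm [measurable]: "x \<in> borel_measurable M" and ym [measurable]: "y \<in> borel_measurable M"
    and xb: "\<And>p. cmod (x p) \<le> Bx" and yb: "\<And>p. cmod (y p) \<le> By"
    and x0: "(LINT p|M. x p) = 0" and y0: "(LINT p|M. y p) = 0"
    and X: "X = (LINT p|M. (cmod (x p))\<^sup>2)" and Y: "Y = (LINT p|M. (cmod (y p))\<^sup>2)"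
    and c: "c = (LINT p|M. x p * y p)" and d: "d = (LINT p|M. x p * cnj (y p))"
    and q: "q = 1 + \<i> * of_real \<epsilon>" and r: "r = 1 + \<i> * of_real \<delta>"
    and F1: "\<And>p. (cmod (1 + x p))\<^sup>2 = (1 + X) * (1 + Re (q * x p))"
    and F2: "\<And>p. (cmod (1 + y p))\<^sup>2 = (1 + Y) * (1 + Re (r * y p))"
    and \<kappa>: "0 < \<kappa>" "\<kappa> * X < 1" "\<kappa> * Y < 1"
  shows "cmod (of_real \<kappa> * c) < 1" "cmod (of_real \<kappa> * d) < 1"
    "0 \<le> Re (q * cnj r * ((1 + d) / (1 - of_real \<kappa> * d)) + q * r * ((1 + c) / (1 - of_real \<kappa> * c)))"
proof -
  have Bx: "0 \<le> Bx" using xb norm_ge_zero order_trans by blast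
  have By: "0 \<le> By" using yb norm_ge_zero order_trans by blast
  have X0: "0 \<le> X" and Y0: "0 \<le> Y" by (simp_all add: X Y)
  have bounded_sq: "integrable M (\<lambda>p. (cmod (f p))\<^sup>2)" if "f \<in> borel_measurable M" "\<And>p. cmod (f p) \<le> B" for f :: "'a \<Rightarrow> complex" and B
    using that by (intro integrable_bounded[where B="B\<^sup>2"]) (auto intro: power_mono)
  have xsq: "integrable M (\<lambda>p. (cmod (x p))\<^sup>2)" and ysq: "integrable M (\<lambda>p. (cmod (y p))\<^sup>2)"
    by (rule bounded_sq[OF xm xb], rule bounded_sq[OF ym yb])
  have lt: "cmod (of_real \<kappa> * v) < 1" if "(cmod v)\<^sup>2 \<le> X * Y" for v
  proof -
    have "(cmod (of_real \<kappa> * v))\<^sup>2 = \<kappa>\<^sup>2 * (cmod v)\<^sup>2" by (simp add: norm_mult power_mult_distrib)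
    also have "\<dots> \<le> \<kappa>\<^sup>2 * (X * Y)" by (intro mult_left_mono that) auto
    also have "\<dots> = (\<kappa> * X) * (\<kappa> * Y)" by (simp add: power2_eq_square)
    also have "\<dots> < 1 * 1" using \<kappa> X0 Y0 by (intro mult_strict_mono) auto
    finally show ?thesis by (simp add: power_less_one_iff)
  qed
  show kc: "cmod (of_real \<kappa> * c) < 1"
    by (rule lt) (unfold c X Y, rule integral_Cauchy_Schwarz[OF xm ym xsq ysq])
  have "(cmod (LINT p|M. x p * cnj (y p)))\<^sup>2 \<le> (LINT p|M. (cmod (x p))\<^sup>2) * (LINT p|M. (cmod (cnj (y p)))\<^sup>2)"
    by (rule integral_Cauchy_Schwarz) (use xsq ysq in auto)
  thus kd: "cmod (of_real \<kappa> * d) < 1" by (intro lt) (simp add: d X Y)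
  have C0: "1 - of_real \<kappa> * c \<noteq> 0" and D0: "1 - of_real \<kappa> * d \<noteq> 0" using kc kd by auto
  define e where "e = (1 + Y) / 2"
  define f where "f = (1 + X) / 2"
  have Ye: "Y = 2 * e - 1" and Xf: "X = 2 * f - 1" and e: "0 < e" using Y0 by (simp_all add: e_def f_def field_simps)
  define W where "W = (1 - of_real \<kappa> * c) / (1 - of_real \<kappa> * d)"
  have W: "(1 - of_real \<kappa> * d) * W = 1 - of_real \<kappa> * c" using D0 by (simp add: W_def)
  define S where "S = (1 + c) + of_real e * cnj r * (W - 1)"
  define g where "g p = (1 + x p) * (y p - c)" for p
  have gm [measurable]: "g \<in> borel_measurable M" unfolding g_def[abs_def] by measurable
  have gb: "cmod (g p) \<le> (1 + Bx) * (By + cmod c)" for p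
    unfolding g_def norm_mult
    using norm_triangle_ineq[of 1 "x p"] norm_triangle_ineq4[of "y p" c] xb[of p] yb[of p] Bx By by (intro mult_mono) auto
  have gsq: "integrable M (\<lambda>p. (cmod (g p))\<^sup>2)" by (rule bounded_sq[OF gm gb])
  have xx: "x p * cnj (x p) = of_real f * (2 + q * x p + cnj (q * x p)) - 1 - x p - cnj (x p)" for p
  proof -
    have "of_real ((cmod (1 + x p))\<^sup>2) = complex_of_real ((1 + X) * (1 + Re (q * x p)))" by (simp only: F1)
    hence "(1 + x p) * cnj (1 + x p) = of_real (1 + X) * (1 + of_real (Re (q * x p)))" by (simp only: complex_norm_square) simp
    also have "of_real (1 + X) * (1 + of_real (Re (q * x p))) = of_real f * (2 + (q * x p + cnj (q * x p)))"
      unfolding complex_add_cnj Xf by (simp add: algebra_simps)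
    finally show ?thesis by (simp add: algebra_simps)
  qed
  have yy: "y p * cnj (y p) = of_real e * (2 + r * y p + cnj (r * y p)) - 1 - y p - cnj (y p)" for p
  proof -
    have "of_real ((cmod (1 + y p))\<^sup>2) = complex_of_real ((1 + Y) * (1 + Re (r * y p)))" by (simp only: F2)
    hence "(1 + y p) * cnj (1 + y p) = of_real (1 + Y) * (1 + of_real (Re (r * y p)))" by (simp only: complex_norm_square) simp
    also have "of_real (1 + Y) * (1 + of_real (Re (r * y p))) = of_real e * (2 + (r * y p + cnj (r * y p)))"
      unfolding complex_add_cnj Ye by (simp add: algebra_simps)
    finally show ?thesis by (simp add: algebra_simps)
  qed
  note lin = integral_linear_combination[OF xm ym xb yb x0 y0, folded c d]
  have I1: "(LINT p|M. x p * cnj (g p)) = of_real f * q * (d - cnj c)"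
  proof -
    have "x p * cnj (g p) = - cnj c * of_real X + (- of_real f * cnj c * q) * x p + (cnj c - of_real f * cnj c * cnj q) * cnj (x p) + 0 * y p + of_real X * cnj (y p)
       + 0 * (x p * y p) + of_real f * q * (x p * cnj (y p)) + (of_real f * cnj q - 1) * cnj (x p * y p) + 0 * cnj (x p * cnj (y p))" for p
    proof -
      have "x p * cnj (g p) = (x p + x p * cnj (x p)) * (cnj (y p) - cnj c)" by (simp add: g_def algebra_simps)
      also have "\<dots> = (x p + (of_real f * (2 + q * x p + cnj (q * x p)) - 1 - x p - cnj (x p))) * (cnj (y p) - cnj c)"
        by (simp only: xx)
      finally show ?thesis by (simp add: Xf algebra_simps)
    qed
    hence "(LINT p|M. x p * cnj (g p)) = - cnj c * of_real X + 0 * c + of_real f * q * d + (of_real f * cnj q - 1) * cnj c + 0 * cnj d"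
      by (simp only: lin)
    also have "\<dots> = of_real f * q * (d - cnj c)" unfolding q Xf by (simp add: algebra_simps)
    finally show ?thesis .
  qed
  define v where "v = of_real e * r - 1 - cnj c"
  have gy: "(y p - c) * cnj (y p) = of_real Y + (of_real e * r - 1) * y p + cnj v * cnj (y p)" for p
  proof -
    have "(y p - c) * cnj (y p) = y p * cnj (y p) - c * cnj (y p)" by (simp add: algebra_simps)
    also have "\<dots> = of_real e * (2 + r * y p + cnj (r * y p)) - 1 - y p - cnj (y p) - c * cnj (y p)" by (simp only: yy)
    finally show ?thesis by (simp add: v_def Ye algebra_simps)
  qed
  have I2: "(LINT p|M. g p * cnj (y p)) = of_real Y + (of_real e * r - 1) * c + cnj v * d"
  proof -
    have "g p * cnj (y p) = of_real Y + of_real Y * x p + 0 * cnj (x p) + (of_real e * r - 1) * y p + cnj v * cnj (y p)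
       + (of_real e * r - 1) * (x p * y p) + cnj v * (x p * cnj (y p)) + 0 * cnj (x p * y p) + 0 * cnj (x p * cnj (y p))" for p
    proof -
      have "g p * cnj (y p) = (1 + x p) * ((y p - c) * cnj (y p))" by (simp add: g_def mult.assoc)
      thus ?thesis unfolding gy by (simp add: algebra_simps)
    qed
    thus ?thesis by (simp only: lin) simp
  qed
  define n where "n = of_real Y + c * cnj c"
  have I3: "complex_of_real (LINT p|M. (cmod (g p))\<^sup>2) = of_real (2 * f) * (n + of_real (Re (q * (v * c + cnj v * d))))"
  proof -
    have yc: "(y p - c) * cnj (y p - c) = n + v * y p + cnj v * cnj (y p)" for p
    proof -
      have "(y p - c) * cnj (y p - c) = (y p - c) * cnj (y p) - cnj c * y p + c * cnj c" by (simp add: algebra_simps)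
      thus ?thesis unfolding gy by (simp add: n_def v_def algebra_simps)
    qed
    have xc: "(1 + x p) * cnj (1 + x p) = of_real f * (2 + q * x p + cnj (q * x p))" for p
    proof -
      have "(1 + x p) * cnj (1 + x p) = 1 + x p + cnj (x p) + x p * cnj (x p)" by (simp add: algebra_simps)
      thus ?thesis unfolding xx by (simp add: algebra_simps)
    qed
    have cn: "cnj n = n" by (simp add: n_def mult.commute)
    have "complex_of_real ((cmod (g p))\<^sup>2) = 2 * of_real f * n + of_real f * q * n * x p + of_real f * cnj q * n * cnj (x p) + 2 * of_real f * v * y p + 2 * of_real f * cnj v * cnj (y p)
       + of_real f * q * v * (x p * y p) + of_real f * q * cnj v * (x p * cnj (y p)) + of_real f * cnj q * cnj v * cnj (x p * y p) + of_real f * cnj q * v * cnj (x p * cnj (y p))" for p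
    proof -
      have "complex_of_real ((cmod (g p))\<^sup>2) = ((1 + x p) * cnj (1 + x p)) * ((y p - c) * cnj (y p - c))"
        by (simp only: complex_norm_square g_def complex_cnj_mult mult_ac)
      thus ?thesis unfolding xc yc by (simp add: algebra_simps)
    qed
    hence "complex_of_real (LINT p|M. (cmod (g p))\<^sup>2) = 2 * of_real f * n + of_real f * q * v * c + of_real f * q * cnj v * d + of_real f * cnj q * cnj v * cnj c + of_real f * cnj q * v * cnj d"
      by (simp only: integral_complex_of_real[symmetric] lin)
    also have "\<dots> = of_real f * (2 * n + (q * (v * c + cnj v * d) + cnj (q * (v * c + cnj v * d))))"
      by (simp add: algebra_simps)
    also have "\<dots> = of_real (2 * f) * (n + of_real (Re (q * (v * c + cnj v * d))))"
      unfolding complex_add_cnj by (simp add: algebra_simps)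
    finally show ?thesis .
  qed
  define K where "K = Y + (cmod c)\<^sup>2 + Re (q * (of_real e * (r * c + cnj r * d) - c - d - c * cnj c - c * d))"
  have g2: "(LINT p|M. (cmod (g p))\<^sup>2) = 2 * f * K"
  proof -
    have "v * c + cnj v * d = of_real e * (r * c + cnj r * d) - c - d - c * cnj c - c * d"
      by (simp add: v_def algebra_simps)
    moreover have "n = of_real (Y + (cmod c)\<^sup>2)" by (simp add: n_def complex_norm_square[symmetric])
    ultimately have "complex_of_real (LINT p|M. (cmod (g p))\<^sup>2) = of_real (2 * f * K)"
      using I3 by (simp add: K_def)
    thus ?thesis using of_real_eq_iff by blast
  qed
  define k where "k p = x p * S + g p" for p
  have km [measurable]: "k \<in> borel_measurable M" unfolding k_def[abs_def] by measurable
  have kb: "cmod (k p) \<le> Bx * cmod S + (1 + Bx) * (By + cmod c)" for p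
    unfolding k_def by (rule norm_triangle_le, rule add_mono[OF _ gb]) (simp add: norm_mult xb mult_right_mono)
  have ksq: "integrable M (\<lambda>p. (cmod (k p))\<^sup>2)" by (rule bounded_sq[OF km kb])
  define N where "N = (LINT p|M. (cmod (k p))\<^sup>2)"
  have N0: "0 \<le> N" by (simp add: N_def)
  have xg: "integrable M (\<lambda>p. x p * cnj (g p))"
    by (rule integrable_bounded_mult(2)[OF xm gm xb gb])
  have N: "N = X * (cmod S)\<^sup>2 + 2 * Re (S * (of_real f * q * (d - cnj c))) + 2 * f * K"
  proof -
    have "(cmod (k p))\<^sup>2 = (cmod S)\<^sup>2 * (cmod (x p))\<^sup>2 + 2 * Re (S * (x p * cnj (g p))) + (cmod (g p))\<^sup>2" for p
    proof -
      have "(cmod (k p))\<^sup>2 = (cmod (x p * S))\<^sup>2 + (cmod (g p))\<^sup>2 + 2 * Re (x p * S * cnj (g p))"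
        unfolding k_def cmod_power2 by (simp add: power2_eq_square algebra_simps)
      thus ?thesis by (simp add: norm_mult power_mult_distrib mult_ac)
    qed
    hence "N = (LINT p|M. (cmod S)\<^sup>2 * (cmod (x p))\<^sup>2 + 2 * Re (S * (x p * cnj (g p))) + (cmod (g p))\<^sup>2)" by (simp only: N_def)
    also have "\<dots> = (cmod S)\<^sup>2 * X + 2 * (LINT p|M. Re (S * (x p * cnj (g p)))) + 2 * f * K"
    proof -
      define R where "R p = Re (S * (x p * cnj (g p)))" for p
      have "integrable M R" unfolding R_def[abs_def] by (intro integrable_Re integrable_mult_right xg)
      thus ?thesis using xsq gsq unfolding R_def[symmetric] by (simp add: X g2)
    qed
    also have "(LINT p|M. Re (S * (x p * cnj (g p)))) = Re (S * (LINT p|M. x p * cnj (g p)))"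
      using xg by (subst integral_Re) auto
    finally show ?thesis by (simp only: I1 mult.commute[of X])
  qed
  \<comment> \<open>k itself contains S. Solving for S expresses it through the mean of
    \<open>k * cnj y\<close>, to which Cauchy-Schwarz applies.\<close>
  have Seq: "S = (1 - of_real (\<kappa> * Y)) * (1 + c) + of_real \<kappa> * (LINT p|M. k p * cnj (y p))"
  proof -
    note i = integrable_bounded_mult(2)[OF xm ym xb yb] integrable_bounded_mult(2)[OF gm ym gb yb]
    have "k p * cnj (y p) = S * (x p * cnj (y p)) + g p * cnj (y p)" for p by (simp add: k_def algebra_simps)
    hence ky: "(LINT p|M. k p * cnj (y p)) = S * d + (of_real Y + (of_real e * r - 1) * c + cnj v * d)"
      using i by (simp add: d I2)
    have "(1 - of_real \<kappa> * d) * S = (1 - of_real \<kappa> * d) * (1 + c) + of_real e * cnj r * ((1 - of_real \<kappa> * d) * W - (1 - of_real \<kappa> * d))"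
      unfolding S_def by (simp add: algebra_simps)
    also have "\<dots> = (1 - of_real \<kappa> * d) * (1 + c) + of_real e * cnj r * (of_real \<kappa> * (d - c))"
      unfolding W by (simp add: algebra_simps)
    also have "\<dots> = (1 - of_real (\<kappa> * Y)) * (1 + c) + of_real \<kappa> * (of_real Y + (of_real e * r - 1) * c + cnj v * d)"
      unfolding v_def r Ye by (simp add: algebra_simps)
    finally show ?thesis unfolding ky by (simp add: algebra_simps)
  qed
  have S_le: "(cmod S)\<^sup>2 \<le> (1 - \<kappa> * Y) * (cmod (1 + c))\<^sup>2 + \<kappa> * N"
  proof -
    define \<theta> where "\<theta> = sqrt (\<kappa> * Y)"
    define s where "s = sqrt (\<kappa> * N)"
    have th: "0 \<le> \<theta>" "\<theta>\<^sup>2 = \<kappa> * Y" using \<kappa> Y0 by (auto simp: \<theta>_def)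
    have s: "0 \<le> s" "s\<^sup>2 = \<kappa> * N" using \<kappa> N0 by (auto simp: s_def)
    have "(cmod (LINT p|M. k p * cnj (y p)))\<^sup>2 \<le> (LINT p|M. (cmod (k p))\<^sup>2) * (LINT p|M. (cmod (cnj (y p)))\<^sup>2)"
      by (rule integral_Cauchy_Schwarz) (use ksq ysq in auto)
    hence "(cmod (LINT p|M. k p * cnj (y p)))\<^sup>2 \<le> N * Y" by (simp add: N_def Y)
    hence "(\<kappa> * cmod (LINT p|M. k p * cnj (y p)))\<^sup>2 \<le> (\<theta> * s)\<^sup>2"
      unfolding power_mult_distrib th s using \<kappa> mult_left_mono[of "(cmod (LINT p|M. k p * cnj (y p)))\<^sup>2" "N * Y" "\<kappa>\<^sup>2"]
      by (simp add: power2_eq_square mult_ac)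
    hence 1: "\<kappa> * cmod (LINT p|M. k p * cnj (y p)) \<le> \<theta> * s" by (rule power2_le_imp_le) (use th s in simp)
    have "cmod S \<le> cmod ((1 - of_real (\<kappa> * Y)) * (1 + c)) + cmod (of_real \<kappa> * (LINT p|M. k p * cnj (y p)))"
      by (subst Seq) (rule norm_triangle_ineq)
    also have "cmod ((1 - of_real (\<kappa> * Y)) * (1 + c)) = (1 - \<kappa> * Y) * cmod (1 + c)"
    proof -
      have "1 - of_real (\<kappa> * Y) = complex_of_real (1 - \<kappa> * Y)" by simp
      thus ?thesis using \<kappa> by (simp only: norm_mult norm_of_real abs_of_pos diff_gt_0_iff_gt)
    qed
    also have "cmod (of_real \<kappa> * (LINT p|M. k p * cnj (y p))) = \<kappa> * cmod (LINT p|M. k p * cnj (y p))" using \<kappa> by (simp add: norm_mult)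
    finally have "cmod S \<le> (1 - \<theta>\<^sup>2) * cmod (1 + c) + \<theta> * s" using 1 th by simp
    hence "(cmod S)\<^sup>2 \<le> ((1 - \<theta>\<^sup>2) * cmod (1 + c) + \<theta> * s)\<^sup>2" by (rule power_mono) simp
    \<comment> \<open>Cauchy-Schwarz with the weights 1 - \<theta>^2 and \<theta>^2, as an identity
      that displays the defect.\<close>
    also have "\<dots> = (1 - \<theta>\<^sup>2) * (cmod (1 + c))\<^sup>2 + s\<^sup>2 - (1 - \<theta>\<^sup>2) * (\<theta> * cmod (1 + c) - s)\<^sup>2"
      by algebra
    also have "\<dots> \<le> (1 - \<theta>\<^sup>2) * (cmod (1 + c))\<^sup>2 + s\<^sup>2"
      using \<kappa> th by simp
    finally show ?thesis using th s by simp
  qed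
  have main: "0 \<le> (1 + X) * ((cmod (1 + c))\<^sup>2 * (1 - \<kappa> * Y) + (\<kappa> + 1) * (Re (q * (d - cnj c) * S) + K))"
  proof -
    define A where "A = (cmod (1 + c))\<^sup>2 * (1 - \<kappa> * Y)"
    have A0: "0 \<le> A" unfolding A_def using \<kappa> by simp
    have "(1 + X) * (Re (q * (d - cnj c) * S) + K) = N - X * (cmod S)\<^sup>2"
      unfolding N f_def by (simp add: field_simps)
    moreover have "(1 + X) * (A + (\<kappa> + 1) * T) = (1 + X) * A + (\<kappa> + 1) * ((1 + X) * T)" for T by algebra
    ultimately have eq: "(1 + X) * (A + (\<kappa> + 1) * (Re (q * (d - cnj c) * S) + K)) = (1 + X) * A + (\<kappa> + 1) * (N - X * (cmod S)\<^sup>2)"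
      by presburger
    have "X * (cmod S)\<^sup>2 \<le> X * (A + \<kappa> * N)" using S_le X0 by (intro mult_left_mono) (auto simp: A_def mult.commute)
    hence "(1 + X) * A + (\<kappa> + 1) * (N - X * (A + \<kappa> * N)) \<le> (1 + X) * A + (\<kappa> + 1) * (N - X * (cmod S)\<^sup>2)"
      using \<kappa> by (intro add_left_mono mult_left_mono) auto
    moreover have "(1 + X) * A + (\<kappa> + 1) * (N - X * (A + \<kappa> * N)) = (1 - \<kappa> * X) * (A + (\<kappa> + 1) * N)" by algebra
    moreover have "0 \<le> (1 - \<kappa> * X) * (A + (\<kappa> + 1) * N)" using \<kappa> A0 N0 by (intro mult_nonneg_nonneg add_nonneg_nonneg) auto
    ultimately show ?thesis unfolding A_def[symmetric] eq by linarith
  qed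
  have "(1 + X) * (e * Re (q * cnj r * ((1 + d) * cnj (1 - of_real \<kappa> * c) * W) + q * r * ((1 + c) * cnj (1 - of_real \<kappa> * c))))
     \<ge> 0"
    unfolding covariance_identity[OF q r Ye W] using main by (simp add: S_def K_def)
  hence pos: "0 \<le> Re (q * cnj r * ((1 + d) * cnj (1 - of_real \<kappa> * c) * W) + q * r * ((1 + c) * cnj (1 - of_real \<kappa> * c)))"
    using X0 e by (simp add: zero_le_mult_iff)
  \<comment> \<open>The positive factor |C|^2 turns the quotients of the claim into the products in
    \<open>pos\<close>.\<close>
  define C where "C = 1 - of_real \<kappa> * c"
  have CC: "C \<noteq> 0" using C0 by (simp add: C_def)
  define v' where "v' = (1 + d) / (1 - of_real \<kappa> * d)"
  define w' where "w' = (1 + c) / C"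
  have f1: "(1 + d) * cnj C * W = (C * cnj C) * v'" by (simp add: W_def C_def v'_def)
  have f2: "(1 + c) * cnj C = (C * cnj C) * w'" using CC by (simp add: w'_def)
  have sum: "q * cnj r * ((1 + d) * cnj C * W) + q * r * ((1 + c) * cnj C) = (C * cnj C) * (q * cnj r * v' + q * r * w')"
    unfolding f1 f2 distrib_left by (simp only: mult_ac)
  have "Re ((C * cnj C) * z) = (cmod C)\<^sup>2 * Re z" for z
    unfolding complex_norm_square[symmetric] by simp
  hence "0 \<le> (cmod C)\<^sup>2 * Re (q * cnj r * v' + q * r * w')"
    using pos unfolding C_def[symmetric] sum by metis
  moreover have "0 < (cmod C)\<^sup>2" using CC by simp
  ultimately have "0 \<le> Re (q * cnj r * v' + q * r * w')" by (meson mult_pos_neg not_le)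
  thus "0 \<le> Re (q * cnj r * ((1 + d) / (1 - of_real \<kappa> * d)) + q * r * ((1 + c) / (1 - of_real \<kappa> * c)))"
    unfolding v'_def w'_def C_def .
qed

lemma continuous_cauchy_transform2:
  assumes \<mu>: "borel_prob \<mu>"
  shows "continuous_on ({z. Im z \<noteq> 0} \<times> {w. Im w \<noteq> 0}) (\<lambda>p. cauchy_transform2 \<mu> (fst p) (snd p))"
proof (rule continuous_on_sequentiallyI)
  interpret A: real_rv \<mu> fst using borel_prob_planar[OF \<mu>] by simp
  interpret B: real_rv \<mu> snd using borel_prob_planar[OF \<mu>] by simp
  fix u :: "nat \<Rightarrow> complex \<times> complex" and a
  assume u: "\<forall>n. u n \<in> {z. Im z \<noteq> 0} \<times> {w. Im w \<noteq> 0}" and a: "a \<in> {z. Im z \<noteq> 0} \<times> {w. Im w \<noteq> 0}" and lim: "u \<longlonglongrightarrow> a"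
  have un: "Im (fst (u n)) \<noteq> 0" "Im (snd (u n)) \<noteq> 0" for n using u by (auto simp: mem_Times_iff)
  have an: "Im (fst a) \<noteq> 0" "Im (snd a) \<noteq> 0" using a by (auto simp: mem_Times_iff)
  have bounded: "\<exists>C. \<forall>n. 1 / \<bar>Im (v n)\<bar> \<le> C" if "v \<longlonglongrightarrow> b" "Im b \<noteq> 0" for v :: "nat \<Rightarrow> complex" and b
  proof -
    have "(\<lambda>n. 1 / \<bar>Im (v n)\<bar>) \<longlonglongrightarrow> 1 / \<bar>Im b\<bar>" by (intro tendsto_intros that) (use that in auto)
    hence "Bseq (\<lambda>n. 1 / \<bar>Im (v n)\<bar>)" by (intro convergent_imp_Bseq convergentI)
    then obtain C where "\<And>n. norm (1 / \<bar>Im (v n)\<bar>) \<le> C" by (auto simp: Bseq_def)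
    thus ?thesis by (intro exI[of _ C]) (simp add: abs_le_iff)
  qed
  obtain C1 where C1: "\<And>n. 1 / \<bar>Im (fst (u n))\<bar> \<le> C1" using bounded[OF tendsto_fst[OF lim] an(1)] by blast
  obtain C2 where C2: "\<And>n. 1 / \<bar>Im (snd (u n))\<bar> \<le> C2" using bounded[OF tendsto_snd[OF lim] an(2)] by blast
  show "(\<lambda>n. cauchy_transform2 \<mu> (fst (u n)) (snd (u n))) \<longlonglongrightarrow> cauchy_transform2 \<mu> (fst a) (snd a)"
    unfolding cauchy_transform2_res
  proof (rule integral_dominated_convergence[where w="\<lambda>_. C1 * C2"])
    show "AE p in \<mu>. cmod (res (fst (u n)) (fst p) * res (snd (u n)) (snd p)) \<le> C1 * C2" for n
      unfolding norm_mult
      using order_trans[OF norm_res_le[OF un(1)] C1] order_trans[OF norm_res_le[OF un(2)] C2]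
      by (intro AE_I2 mult_mono) (auto intro: order_trans[OF norm_ge_zero])
    show "AE p in \<mu>. (\<lambda>n. res (fst (u n)) (fst p) * res (snd (u n)) (snd p)) \<longlonglongrightarrow> res (fst a) (fst p) * res (snd a) (snd p)"
      unfolding res_def using an by (intro AE_I2 tendsto_intros lim) (auto dest: res_nonzero)
  qed auto
qed

text \<open>Reduces the asymptotics of G at the subordinated point to those of the ratio subord z /
  z.\<close>

lemma (in real_rv) G_subord_eq:
  assumes \<kappa>: "0 < \<kappa>" and z: "Im z \<noteq> 0"
  shows "z * G (subord \<kappa> z) = of_real \<kappa> / (of_real (1 + \<kappa>) * (subord \<kappa> z / z) - 1)"
proof -
  have k: "0 \<le> \<kappa>" using \<kappa> by simp
  define w where "w = subord \<kappa> z"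
  have w: "Im w \<noteq> 0" "G w \<noteq> 0" using subord_Im(1)[OF k z] G_nonzero(1)[of w] by (auto simp: w_def)
  have z0: "z \<noteq> 0" using z by auto
  have "w - of_real \<kappa> * (1 / G w - w) = z" using H_subord[OF k z] by (simp add: H_def h_def w_def)
  hence eq: "of_real \<kappa> / G w = of_real (1 + \<kappa>) * w - z" by (simp add: algebra_simps)
  hence "of_real \<kappa> / (z * G w) = of_real (1 + \<kappa>) * (w / z) - 1" using z0 by (simp add: field_simps)
  hence "of_real \<kappa> / (of_real (1 + \<kappa>) * (w / z) - 1) = of_real \<kappa> / (of_real \<kappa> / (z * G w))" by simp
  also have "\<dots> = z * G w" using \<kappa> by simp
  finally show ?thesis by (simp add: w_def)
qed

lemma (in real_rv) subord_ratio_tendsto: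
  assumes \<kappa>: "0 \<le> \<kappa>"
  shows "((\<lambda>y. subord \<kappa> (Complex 0 y) / Complex 0 y) \<longlongrightarrow> 1) at_top"
proof (rule tendstoI)
  fix e :: real assume e: "0 < e"
  define \<delta> where "\<delta> = min (1 / 2) (e / 2)"
  have \<delta>: "0 < \<delta>" "\<delta> \<le> 1 / 2" "\<delta> < e" using e by (auto simp: \<delta>_def)
  show "\<forall>\<^sub>F y in at_top. dist (subord \<kappa> (Complex 0 y) / Complex 0 y) 1 < e"
    using subord_imaginary[OF \<kappa> \<delta>(1,2)] eventually_gt_at_top[of 0]
  proof eventually_elim
    case (elim y)
    have q: "Complex 0 y \<noteq> 0" "cmod (Complex 0 y) = y" using elim by (auto simp: complex_eq_iff cmod_def)
    have "subord \<kappa> (Complex 0 y) / Complex 0 y - 1 = (subord \<kappa> (Complex 0 y) - Complex 0 y) / Complex 0 y"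
      using q by (simp add: diff_divide_distrib)
    hence "dist (subord \<kappa> (Complex 0 y) / Complex 0 y) 1 = cmod (subord \<kappa> (Complex 0 y) - Complex 0 y) / y"
      by (simp only: dist_norm norm_divide q(2))
    also have "\<dots> \<le> \<delta>" using elim by (simp add: divide_le_eq)
    finally show ?case using \<delta> by simp
  qed
qed

lemma (in real_rv) G_subord_tendsto:
  assumes \<kappa>: "0 < \<kappa>"
  shows "((\<lambda>y. Complex 0 y * G (subord \<kappa> (Complex 0 y))) \<longlongrightarrow> 1) at_top"
proof -
  have "((\<lambda>y. of_real \<kappa> / (of_real (1 + \<kappa>) * (subord \<kappa> (Complex 0 y) / Complex 0 y) - 1)) \<longlongrightarrow> of_real \<kappa> / (of_real (1 + \<kappa>) * 1 - 1)) at_top"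
    by (intro tendsto_intros subord_ratio_tendsto) (use \<kappa> in auto)
  moreover have "\<forall>\<^sub>F y in at_top. of_real \<kappa> / (of_real (1 + \<kappa>) * (subord \<kappa> (Complex 0 y) / Complex 0 y) - 1)
      = Complex 0 y * G (subord \<kappa> (Complex 0 y))"
    using eventually_gt_at_top[of 0]
  proof eventually_elim
    case (elim y)
    thus ?case using G_subord_eq[OF \<kappa>, of "Complex 0 y"] by simp
  qed
  ultimately have "((\<lambda>y. Complex 0 y * G (subord \<kappa> (Complex 0 y))) \<longlongrightarrow> of_real \<kappa> / (of_real (1 + \<kappa>) * 1 - 1)) at_top"
    by (rule Lim_transform_eventually)
  thus ?thesis using \<kappa> by simp
qed

text \<open>The relation Im z = (1 - \<kappa> V) Im (subord z) lets V be read off from the ratio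
  subord z / z, which tends to 1.\<close>

lemma (in real_rv) V_subord_tendsto:
  assumes \<kappa>: "0 < \<kappa>"
  shows "((\<lambda>y. V (subord \<kappa> (Complex 0 y))) \<longlongrightarrow> 0) at_top"
proof -
  have "((\<lambda>y. (1 - 1 / Re (subord \<kappa> (Complex 0 y) / Complex 0 y)) / \<kappa>) \<longlongrightarrow> (1 - 1 / Re 1) / \<kappa>) at_top"
    by (intro tendsto_intros subord_ratio_tendsto) (use \<kappa> in auto)
  moreover have "\<forall>\<^sub>F y in at_top. (1 - 1 / Re (subord \<kappa> (Complex 0 y) / Complex 0 y)) / \<kappa> = V (subord \<kappa> (Complex 0 y))"
    using eventually_gt_at_top[of 0]
  proof eventually_elim
    case (elim y)
    define w where "w = subord \<kappa> (Complex 0 y)"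
    have w: "y = (1 - \<kappa> * V w) * Im w" "Im w \<noteq> 0" using subord_Im(3,1)[of \<kappa> "Complex 0 y"] elim \<kappa> by (auto simp: w_def)
    have "Re (w / Complex 0 y) = Im w / y" using elim by (simp add: Re_divide power2_eq_square)
    moreover have "y / Im w = 1 - \<kappa> * V w" using w by (metis nonzero_mult_div_cancel_right)
    ultimately have "1 - 1 / Re (w / Complex 0 y) = \<kappa> * V w" by simp
    thus ?case using \<kappa> by (simp add: w_def)
  qed
  ultimately have "((\<lambda>y. V (subord \<kappa> (Complex 0 y))) \<longlongrightarrow> (1 - 1 / Re 1) / \<kappa>) at_top"
    by (rule Lim_transform_eventually)
  thus ?thesis by simp
qed

lemma (in real_rv) norm_G_subord_le:
  assumes \<kappa>: "0 \<le> \<kappa>" and z: "Im z \<noteq> 0"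
  shows "cmod (G (subord \<kappa> z)) \<le> 1 / \<bar>Im z\<bar>"
proof -
  note s = subord_Im[OF \<kappa> z]
  have "\<bar>Im z\<bar> = (1 - \<kappa> * V (subord \<kappa> z)) * \<bar>Im (subord \<kappa> z)\<bar>"
    using s by (subst s(3)) (simp add: abs_mult)
  also have "\<dots> \<le> 1 * \<bar>Im (subord \<kappa> z)\<bar>" using \<kappa> V_nonneg by (intro mult_right_mono) auto
  finally have "1 / \<bar>Im (subord \<kappa> z)\<bar> \<le> 1 / \<bar>Im z\<bar>" using z by (intro divide_left_mono) auto
  thus ?thesis using norm_G_le[OF s(1)] by linarith
qed

section \<open>The transform of a bi-free convolution power\<close>

locale planar_law =
  fixes \<mu> :: "(real \<times> real) measure"
  assumes borel_prob: "borel_prob \<mu>"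

sublocale planar_law \<subseteq> A: real_rv \<mu> fst
  using borel_prob_planar[OF borel_prob] by simp

sublocale planar_law \<subseteq> B: real_rv \<mu> snd
  using borel_prob_planar[OF borel_prob] by simp

context planar_law
begin

text \<open>By \<open>cauchy_transform2_cov\<close>, 1 + cov is the planar transform divided by the
  product of the marginal ones; at the points 1 / z + R1 z and 1 / w + R2 w it is
  \<open>bifree_h\<close>.\<close>

definition cov :: "complex \<Rightarrow> complex \<Rightarrow> complex" where
  "cov w1 w2 = (LINT p|\<mu>. A.x w1 p * B.x w2 p)"

lemma cauchy_transform2_cov:
  assumes w: "Im w1 \<noteq> 0" "Im w2 \<noteq> 0"
  shows "cauchy_transform2 \<mu> w1 w2 = A.G w1 * B.G w2 * (1 + cov w1 w2)"
proof -
  obtain B1 where B1: "\<And>p. cmod (A.x w1 p) \<le> B1" using A.x_bounded[OF w(1)] by blast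
  obtain B2 where B2: "\<And>p. cmod (B.x w2 p) \<le> B2" using B.x_bounded[OF w(2)] by blast
  have int: "integrable \<mu> (\<lambda>p. A.x w1 p * B.x w2 p)"
    by (rule A.integrable_bounded_mult(1)[OF A.x_measurable B.x_measurable B1 B2])
  have "cauchy_transform2 \<mu> w1 w2 = (LINT p|\<mu>. (A.G w1 * B.G w2) * (1 + A.x w1 p + B.x w2 p + A.x w1 p * B.x w2 p))"
    unfolding cauchy_transform2_res
  proof (intro Bochner_Integration.integral_cong refl)
    fix p
    have "res w1 (fst p) * res w2 (snd p) = (A.G w1 * (1 + A.x w1 p)) * (B.G w2 * (1 + B.x w2 p))"
      using A.one_plus_x[OF w(1)] B.one_plus_x[OF w(2)] by simp
    thus "res w1 (fst p) * res w2 (snd p) = (A.G w1 * B.G w2) * (1 + A.x w1 p + B.x w2 p + A.x w1 p * B.x w2 p)"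
      by (simp add: algebra_simps)
  qed
  also have "\<dots> = A.G w1 * B.G w2 * (1 + cov w1 w2)"
    using int A.integrable_x[OF w(1)] B.integrable_x[OF w(2)] A.integral_x[OF w(1)] B.integral_x[OF w(2)]
    by (simp add: cov_def A.prob_space)
  finally show ?thesis .
qed

lemma norm_cov: "Im w1 \<noteq> 0 \<Longrightarrow> Im w2 \<noteq> 0 \<Longrightarrow> (cmod (cov w1 w2))\<^sup>2 \<le> A.V w1 * B.V w2"
  unfolding cov_def A.V_def B.V_def
  by (intro integral_Cauchy_Schwarz A.integrable_x_sq B.integrable_x_sq) auto

text \<open>Using \<kappa> V < 1 in the first variable leaves a bound that depends on the second
  alone. With the mirrored \<open>norm_cov_sqrt'\<close> it yields the decay of
  \<open>power_transform\<close> in each variable separately.\<close>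

lemma norm_cov_sqrt:
  assumes \<kappa>: "0 \<le> \<kappa>" and w: "w1 \<in> A.U \<kappa>" "w2 \<in> B.U \<kappa>"
  shows "\<kappa> * cmod (cov w1 w2) \<le> sqrt (\<kappa> * B.V w2)" "sqrt (\<kappa> * B.V w2) < 1"
proof -
  have "(\<kappa> * cmod (cov w1 w2))\<^sup>2 \<le> \<kappa>\<^sup>2 * (A.V w1 * B.V w2)"
    unfolding power_mult_distrib using norm_cov w by (intro mult_left_mono) (auto simp: A.U_def B.U_def)
  also have "\<dots> = (\<kappa> * A.V w1) * (\<kappa> * B.V w2)" by (simp add: power2_eq_square)
  also have "\<dots> \<le> 1 * (\<kappa> * B.V w2)" using w \<kappa> B.V_nonneg by (intro mult_right_mono) (auto simp: A.U_def)
  finally show "\<kappa> * cmod (cov w1 w2) \<le> sqrt (\<kappa> * B.V w2)" by (intro real_le_rsqrt) simp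
  show "sqrt (\<kappa> * B.V w2) < 1" using w by (simp add: B.U_def)
qed

lemma norm_cov_sqrt':
  assumes \<kappa>: "0 \<le> \<kappa>" and w: "w1 \<in> A.U \<kappa>" "w2 \<in> B.U \<kappa>"
  shows "\<kappa> * cmod (cov w1 w2) \<le> sqrt (\<kappa> * A.V w1)" "sqrt (\<kappa> * A.V w1) < 1"
proof -
  have "(\<kappa> * cmod (cov w1 w2))\<^sup>2 \<le> \<kappa>\<^sup>2 * (A.V w1 * B.V w2)"
    unfolding power_mult_distrib using norm_cov w by (intro mult_left_mono) (auto simp: A.U_def B.U_def)
  also have "\<dots> = (\<kappa> * A.V w1) * (\<kappa> * B.V w2)" by (simp add: power2_eq_square)
  also have "\<dots> \<le> (\<kappa> * A.V w1) * 1" using w \<kappa> A.V_nonneg by (intro mult_left_mono) (auto simp: B.U_def)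
  finally show "\<kappa> * cmod (cov w1 w2) \<le> sqrt (\<kappa> * A.V w1)" by (intro real_le_rsqrt) simp
  show "sqrt (\<kappa> * A.V w1) < 1" using w by (simp add: A.U_def)
qed

lemma cov_denom: "0 \<le> \<kappa> \<Longrightarrow> w1 \<in> A.U \<kappa> \<Longrightarrow> w2 \<in> B.U \<kappa> \<Longrightarrow> 1 - of_real \<kappa> * cov w1 w2 \<noteq> 0"
proof
  assume a: "0 \<le> \<kappa>" "w1 \<in> A.U \<kappa>" "w2 \<in> B.U \<kappa>" and "1 - of_real \<kappa> * cov w1 w2 = 0"
  hence "cmod (of_real \<kappa> * cov w1 w2) = 1" by (metis eq_iff_diff_eq_0 norm_one)
  hence "\<kappa> * cmod (cov w1 w2) = 1" using a by (simp add: norm_mult)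
  thus False using norm_cov_sqrt[OF a] by simp
qed

lemma cov_cnj: "cov (cnj w1) (cnj w2) = cnj (cov w1 w2)"
  by (simp add: cov_def A.x_cnj B.x_cnj flip: complex_cnj_mult)

text \<open>For fixed z and w the term 1 - 1 / h of the R-transform has to be multiplied by \<kappa>
  + 1, which means h' = h / (\<kappa> + 1 - \<kappa> h); for h = 1 + c the denominator is 1 -
  \<kappa> c. The maps \<open>H\<close> move the evaluation points, so their inverses appear as
  arguments.\<close>

definition power_transform :: "real \<Rightarrow> complex \<Rightarrow> complex \<Rightarrow> complex" where
  "power_transform \<kappa> \<zeta> \<omega> = cauchy_transform2 \<mu> (A.subord \<kappa> \<zeta>) (B.subord \<kappa> \<omega>)
     / (1 - of_real \<kappa> * cov (A.subord \<kappa> \<zeta>) (B.subord \<kappa> \<omega>))"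

lemma power_transform_cov:
  assumes \<kappa>: "0 \<le> \<kappa>" and z: "Im \<zeta> \<noteq> 0" "Im \<omega> \<noteq> 0"
  shows "power_transform \<kappa> \<zeta> \<omega> = A.G (A.subord \<kappa> \<zeta>) * B.G (B.subord \<kappa> \<omega>)
    * ((1 + cov (A.subord \<kappa> \<zeta>) (B.subord \<kappa> \<omega>)) / (1 - of_real \<kappa> * cov (A.subord \<kappa> \<zeta>) (B.subord \<kappa> \<omega>)))"
  unfolding power_transform_def using A.subord_Im(1)[OF \<kappa> z(1)] B.subord_Im(1)[OF \<kappa> z(2)]
  by (simp add: cauchy_transform2_cov)

lemma norm_power_transform_factor:
  assumes "0 < \<kappa>" "\<kappa> * cmod c \<le> \<theta>" "\<theta> < 1"
  shows "cmod ((1 + c) / (1 - of_real \<kappa> * c)) \<le> (1 + 1 / \<kappa>) / (1 - \<theta>)"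
  unfolding norm_divide
proof (rule frac_le)
  have "\<kappa> * cmod c \<le> 1" using assms by linarith
  hence "cmod c \<le> 1 / \<kappa>" using assms by (simp add: field_simps)
  thus "cmod (1 + c) \<le> 1 + 1 / \<kappa>" using norm_triangle_ineq[of 1 c] by simp
  have "1 - \<theta> \<le> 1 - cmod (of_real \<kappa> * c)" using assms by (simp add: norm_mult)
  also have "\<dots> \<le> cmod (1 - of_real \<kappa> * c)" using norm_triangle_ineq2[of 1 "of_real \<kappa> * c"] by simp
  finally show "1 - \<theta> \<le> cmod (1 - of_real \<kappa> * c)" .
qed (use assms in auto)

lemma power_transform_positive:
  assumes \<kappa>: "0 < \<kappa>" and z: "0 < Im \<zeta>" "0 < Im \<omega>"
  shows "Re (power_transform \<kappa> \<zeta> \<omega>) \<le> Re (power_transform \<kappa> \<zeta> (cnj \<omega>))"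
proof -
  have k: "0 \<le> \<kappa>" using \<kappa> by simp
  define w1 where "w1 = A.subord \<kappa> \<zeta>"
  define w2 where "w2 = B.subord \<kappa> \<omega>"
  have w1: "Im w1 \<noteq> 0" "0 < Im w1" "\<kappa> * A.V w1 < 1" using A.subord_Im[OF k, of \<zeta>] z by (auto simp: w1_def zero_less_mult_iff)
  have w2: "Im w2 \<noteq> 0" "0 < Im w2" "\<kappa> * B.V w2 < 1" using B.subord_Im[OF k, of \<omega>] z by (auto simp: w2_def zero_less_mult_iff)
  define a where "a = A.G w1"
  define b where "b = B.G w2"
  have a: "Im a < 0" using A.G_nonzero(2)[OF w1(1)] w1(2) by (simp add: a_def mult_less_0_iff)
  have b: "Im b < 0" using B.G_nonzero(2)[OF w2(1)] w2(2) by (simp add: b_def mult_less_0_iff)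
  \<comment> \<open>Dividing out the imaginary part: a = \<i> (Im a) q, and likewise b with r. Thus
    a * b and a * cnj b become real multiples of q * r and q * cnj r, and q, r have the form that
    \<open>norm_one_plus_x_sq\<close> provides.\<close>
  define q where "q = 1 + \<i> * of_real (- (Re a / Im a))"
  define r where "r = 1 + \<i> * of_real (- (Re b / Im b))"
  have aq: "a = \<i> * of_real (Im a) * q" unfolding q_def using a by (simp add: complex_eq_iff)
  have br: "b = \<i> * of_real (Im b) * r" unfolding r_def using b by (simp add: complex_eq_iff)
  obtain B1 where B1: "\<And>p. cmod (A.x w1 p) \<le> B1" using A.x_bounded[OF w1(1)] by blast
  obtain B2 where B2: "\<And>p. cmod (B.x w2 p) \<le> B2" using B.x_bounded[OF w2(1)] by blast
  define c where "c = cov w1 w2"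
  define d where "d = cov w1 (cnj w2)"
  have c': "c = (LINT p|\<mu>. A.x w1 p * B.x w2 p)" by (simp add: c_def cov_def)
  have d': "d = (LINT p|\<mu>. A.x w1 p * cnj (B.x w2 p))" by (simp add: d_def cov_def B.x_cnj)
  have F1: "(cmod (1 + A.x w1 p))\<^sup>2 = (1 + A.V w1) * (1 + Re (q * A.x w1 p))" for p
    using A.norm_one_plus_x_sq[OF w1(1)] by (simp add: q_def a_def)
  have F2: "(cmod (1 + B.x w2 p))\<^sup>2 = (1 + B.V w2) * (1 + Re (r * B.x w2 p))" for p
    using B.norm_one_plus_x_sq[OF w2(1)] by (simp add: r_def b_def)
  have "0 \<le> Re (q * cnj r * ((1 + d) / (1 - of_real \<kappa> * d)) + q * r * ((1 + c) / (1 - of_real \<kappa> * c)))"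
    by (rule A.covariance_positive(3)[OF A.x_measurable B.x_measurable B1 B2 A.integral_x[OF w1(1)] B.integral_x[OF w2(1)]
        A.V_def B.V_def c' d' q_def r_def F1 F2 \<kappa> w1(3) w2(3)])
  note nn = this
  define v where "v = (1 + d) / (1 - of_real \<kappa> * d)"
  define w where "w = (1 + c) / (1 - of_real \<kappa> * c)"
  have p1: "power_transform \<kappa> \<zeta> \<omega> = a * b * w"
    using power_transform_cov[OF k, of \<zeta> \<omega>] z by (simp add: a_def b_def c_def w_def w1_def w2_def)
  have p2: "power_transform \<kappa> \<zeta> (cnj \<omega>) = a * cnj b * v"
    using power_transform_cov[OF k, of \<zeta> "cnj \<omega>"] z by (simp add: a_def b_def d_def v_def w1_def w2_def B.subord_cnj[OF k] B.G_cnj)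
  have "a * cnj b * v - a * b * w = (\<i> * of_real (Im a) * q) * cnj (\<i> * of_real (Im b) * r) * v - (\<i> * of_real (Im a) * q) * (\<i> * of_real (Im b) * r) * w"
    by (simp only: aq[symmetric] br[symmetric])
  also have "\<dots> = of_real (Im a * Im b) * (q * cnj r * v + q * r * w)" by (simp add: algebra_simps)
  finally have "Re (a * cnj b * v - a * b * w) = Re (of_real (Im a * Im b) * (q * cnj r * v + q * r * w))" by simp
  also have "\<dots> = Im a * Im b * Re (q * cnj r * v + q * r * w)" by (simp only: Re_complex_of_real Im_complex_of_real times_complex.sel mult_zero_left diff_0_right)
  finally have "Re (power_transform \<kappa> \<zeta> (cnj \<omega>) - power_transform \<kappa> \<zeta> \<omega>) = Im a * Im b * Re (q * cnj r * v + q * r * w)"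
    by (simp only: p1 p2)
  moreover have "0 < Im a * Im b" using a b by (simp add: mult_neg_neg)
  ultimately have "0 \<le> Re (power_transform \<kappa> \<zeta> (cnj \<omega>) - power_transform \<kappa> \<zeta> \<omega>)"
    using mult_nonneg_nonneg[OF less_imp_le nn] unfolding v_def w_def by metis
  thus ?thesis by simp
qed

lemma power_transform_bound1:
  assumes \<kappa>: "0 < \<kappa>" and \<omega>: "Im \<omega> \<noteq> 0"
  obtains C where "\<And>\<zeta>. Im \<zeta> \<noteq> 0 \<Longrightarrow> cmod (power_transform \<kappa> \<zeta> \<omega>) \<le> C / \<bar>Im \<zeta>\<bar>"
proof -
  have k: "0 \<le> \<kappa>" using \<kappa> by simp
  define w2 where "w2 = B.subord \<kappa> \<omega>"
  define L where "L = (1 + 1 / \<kappa>) / (1 - sqrt (\<kappa> * B.V w2))"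
  have w2: "w2 \<in> B.U \<kappa>" using B.subord_in_U[OF k \<omega>] by (simp add: w2_def)
  show ?thesis
  proof (rule that[of "cmod (B.G w2) * L"])
    fix \<zeta> assume z: "Im \<zeta> \<noteq> 0"
    define w1 where "w1 = A.subord \<kappa> \<zeta>"
    have w1: "w1 \<in> A.U \<kappa>" using A.subord_in_U[OF k z] by (simp add: w1_def)
    have "cmod (power_transform \<kappa> \<zeta> \<omega>) = cmod (A.G w1) * cmod (B.G w2) * cmod ((1 + cov w1 w2) / (1 - of_real \<kappa> * cov w1 w2))"
      by (simp only: power_transform_cov[OF k z \<omega>] norm_mult w1_def w2_def)
    also have "\<dots> \<le> (1 / \<bar>Im \<zeta>\<bar>) * cmod (B.G w2) * L"
      unfolding L_def w1_def
      by (intro mult_mono A.norm_G_subord_le[OF k z] norm_power_transform_factor[OF \<kappa>] norm_cov_sqrt[OF k w1 w2, unfolded w1_def]) auto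
    finally show "cmod (power_transform \<kappa> \<zeta> \<omega>) \<le> cmod (B.G w2) * L / \<bar>Im \<zeta>\<bar>" by simp
  qed
qed

lemma power_transform_bound2:
  assumes \<kappa>: "0 < \<kappa>" and \<zeta>: "Im \<zeta> \<noteq> 0"
  obtains C where "\<And>\<omega>. Im \<omega> \<noteq> 0 \<Longrightarrow> cmod (power_transform \<kappa> \<zeta> \<omega>) \<le> C / \<bar>Im \<omega>\<bar>"
proof -
  have k: "0 \<le> \<kappa>" using \<kappa> by simp
  define w1 where "w1 = A.subord \<kappa> \<zeta>"
  define L where "L = (1 + 1 / \<kappa>) / (1 - sqrt (\<kappa> * A.V w1))"
  have w1: "w1 \<in> A.U \<kappa>" using A.subord_in_U[OF k \<zeta>] by (simp add: w1_def)
  show ?thesis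
  proof (rule that[of "cmod (A.G w1) * L"])
    fix \<omega> assume z: "Im \<omega> \<noteq> 0"
    define w2 where "w2 = B.subord \<kappa> \<omega>"
    have w2: "w2 \<in> B.U \<kappa>" using B.subord_in_U[OF k z] by (simp add: w2_def)
    have "cmod (power_transform \<kappa> \<zeta> \<omega>) = cmod (A.G w1) * cmod (B.G w2) * cmod ((1 + cov w1 w2) / (1 - of_real \<kappa> * cov w1 w2))"
      by (simp only: power_transform_cov[OF k \<zeta> z] norm_mult w1_def w2_def)
    also have "\<dots> \<le> cmod (A.G w1) * (1 / \<bar>Im \<omega>\<bar>) * L"
      unfolding L_def w2_def
      by (intro mult_mono B.norm_G_subord_le[OF k z] norm_power_transform_factor[OF \<kappa>] norm_cov_sqrt'[OF k w1 w2, unfolded w2_def]) auto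
    finally show "cmod (power_transform \<kappa> \<zeta> \<omega>) \<le> cmod (A.G w1) * L / \<bar>Im \<omega>\<bar>" by simp
  qed
qed

text \<open>The denominator is written with Cauchy transforms in place of \<open>cov\<close>, so
  that holomorphy and continuity are inherited from them.\<close>

lemma power_transform_quotient:
  assumes \<kappa>: "0 \<le> \<kappa>" and z: "Im \<zeta> \<noteq> 0" "Im \<omega> \<noteq> 0"
  defines "w1 \<equiv> A.subord \<kappa> \<zeta>" and "w2 \<equiv> B.subord \<kappa> \<omega>"
  shows "of_real (\<kappa> + 1) - of_real \<kappa> * (cauchy_transform2 \<mu> w1 w2 / (A.G w1 * B.G w2)) \<noteq> 0"
    "power_transform \<kappa> \<zeta> \<omega> = cauchy_transform2 \<mu> w1 w2 / (of_real (\<kappa> + 1) - of_real \<kappa> * (cauchy_transform2 \<mu> w1 w2 / (A.G w1 * B.G w2)))"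
proof -
  have w: "w1 \<in> A.U \<kappa>" "w2 \<in> B.U \<kappa>" unfolding w1_def w2_def by (rule A.subord_in_U[OF \<kappa> z(1)], rule B.subord_in_U[OF \<kappa> z(2)])
  hence im: "Im w1 \<noteq> 0" "Im w2 \<noteq> 0" by (auto simp: A.U_def B.U_def)
  have "cauchy_transform2 \<mu> w1 w2 / (A.G w1 * B.G w2) = 1 + cov w1 w2"
    using A.G_nonzero(1)[OF im(1)] B.G_nonzero(1)[OF im(2)] by (simp add: cauchy_transform2_cov[OF im])
  hence eq: "of_real (\<kappa> + 1) - of_real \<kappa> * (cauchy_transform2 \<mu> w1 w2 / (A.G w1 * B.G w2)) = 1 - of_real \<kappa> * cov w1 w2"
    by (simp add: algebra_simps)
  show "of_real (\<kappa> + 1) - of_real \<kappa> * (cauchy_transform2 \<mu> w1 w2 / (A.G w1 * B.G w2)) \<noteq> 0"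
    unfolding eq by (rule cov_denom[OF \<kappa> w])
  show "power_transform \<kappa> \<zeta> \<omega> = cauchy_transform2 \<mu> w1 w2 / (of_real (\<kappa> + 1) - of_real \<kappa> * (cauchy_transform2 \<mu> w1 w2 / (A.G w1 * B.G w2)))"
    unfolding eq by (simp add: power_transform_def w1_def w2_def)
qed

lemma planar_cauchy_data_power:
  assumes \<kappa>: "0 < \<kappa>"
  shows "planar_cauchy_data (power_transform \<kappa>)"
proof
  have k: "0 \<le> \<kappa>" using \<kappa> by simp
  note sA = A.subord_Im(1)[OF k] and sB = B.subord_Im(1)[OF k]
  have hA: "A.subord \<kappa> holomorphic_on {z. Im z \<noteq> 0}" and hB: "B.subord \<kappa> holomorphic_on {z. Im z \<noteq> 0}"
    by (rule A.subord_holomorphic[OF k], rule B.subord_holomorphic[OF k])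
  have imA: "A.subord \<kappa> ` {z. Im z \<noteq> 0} \<subseteq> {z. Im z \<noteq> 0}" and imB: "B.subord \<kappa> ` {z. Im z \<noteq> 0} \<subseteq> {z. Im z \<noteq> 0}"
    using sA sB by auto
  have GA: "(\<lambda>z. A.G (A.subord \<kappa> z)) holomorphic_on {z. Im z \<noteq> 0}" and GB: "(\<lambda>z. B.G (B.subord \<kappa> z)) holomorphic_on {z. Im z \<noteq> 0}"
    using holomorphic_on_compose_gen[OF hA A.G_holomorphic imA] holomorphic_on_compose_gen[OF hB B.G_holomorphic imB] by (simp_all add: o_def)
  have G0: "Im \<zeta> \<noteq> 0 \<Longrightarrow> A.G (A.subord \<kappa> \<zeta>) \<noteq> 0" "Im \<zeta> \<noteq> 0 \<Longrightarrow> B.G (B.subord \<kappa> \<zeta>) \<noteq> 0" for \<zeta>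
    using A.G_nonzero(1) B.G_nonzero(1) sA sB by auto
  note q = power_transform_quotient[OF k]
  {
    fix \<omega> assume w: "Im \<omega> \<noteq> 0"
    have c: "(\<lambda>z. cauchy_transform2 \<mu> (A.subord \<kappa> z) (B.subord \<kappa> \<omega>)) holomorphic_on {z. Im z \<noteq> 0}"
      using holomorphic_on_compose_gen[OF hA cauchy_transform2_holomorphic(1)[OF borel_prob sB[OF w]] imA] by (simp add: o_def)
    have "(\<lambda>\<zeta>. cauchy_transform2 \<mu> (A.subord \<kappa> \<zeta>) (B.subord \<kappa> \<omega>) / (of_real (\<kappa> + 1) - of_real \<kappa> *
       (cauchy_transform2 \<mu> (A.subord \<kappa> \<zeta>) (B.subord \<kappa> \<omega>) / (A.G (A.subord \<kappa> \<zeta>) * B.G (B.subord \<kappa> \<omega>))))) holomorphic_on {\<zeta>. Im \<zeta> \<noteq> 0}"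
      by (intro holomorphic_intros c GA) (use G0 w q(1)[OF _ w] in auto)
    thus "(\<lambda>\<zeta>. power_transform \<kappa> \<zeta> \<omega>) holomorphic_on {\<zeta>. Im \<zeta> \<noteq> 0}"
      by (rule holomorphic_transform) (use q(2)[OF _ w] in auto)
    have "\<exists>C. \<forall>\<zeta>. Im \<zeta> \<noteq> 0 \<longrightarrow> cmod (power_transform \<kappa> \<zeta> \<omega>) \<le> C / \<bar>Im \<zeta>\<bar>"
      by (rule power_transform_bound1[OF \<kappa> w]) blast
    then obtain C where "\<And>\<zeta>. Im \<zeta> \<noteq> 0 \<Longrightarrow> cmod (power_transform \<kappa> \<zeta> \<omega>) \<le> C / \<bar>Im \<zeta>\<bar>" by blast
    thus "((\<lambda>y. power_transform \<kappa> (Complex 0 y) \<omega>) \<longlongrightarrow> 0) at_top"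
      by (rule tendsto_0_imaginary)
  }
  {
    fix \<zeta> assume w: "Im \<zeta> \<noteq> 0"
    have c: "(\<lambda>z. cauchy_transform2 \<mu> (A.subord \<kappa> \<zeta>) (B.subord \<kappa> z)) holomorphic_on {z. Im z \<noteq> 0}"
      using holomorphic_on_compose_gen[OF hB cauchy_transform2_holomorphic(2)[OF borel_prob sA[OF w]] imB] by (simp add: o_def)
    have "(\<lambda>\<omega>. cauchy_transform2 \<mu> (A.subord \<kappa> \<zeta>) (B.subord \<kappa> \<omega>) / (of_real (\<kappa> + 1) - of_real \<kappa> *
       (cauchy_transform2 \<mu> (A.subord \<kappa> \<zeta>) (B.subord \<kappa> \<omega>) / (A.G (A.subord \<kappa> \<zeta>) * B.G (B.subord \<kappa> \<omega>))))) holomorphic_on {\<omega>. Im \<omega> \<noteq> 0}"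
      by (intro holomorphic_intros c GB) (use G0 w q(1)[OF w] in auto)
    thus "(\<lambda>\<omega>. power_transform \<kappa> \<zeta> \<omega>) holomorphic_on {\<omega>. Im \<omega> \<noteq> 0}"
      by (rule holomorphic_transform) (use q(2)[OF w] in auto)
    have "\<exists>C. \<forall>\<omega>. Im \<omega> \<noteq> 0 \<longrightarrow> cmod (power_transform \<kappa> \<zeta> \<omega>) \<le> C / \<bar>Im \<omega>\<bar>"
      by (rule power_transform_bound2[OF \<kappa> w]) blast
    then obtain C where "\<And>\<omega>. Im \<omega> \<noteq> 0 \<Longrightarrow> cmod (power_transform \<kappa> \<zeta> \<omega>) \<le> C / \<bar>Im \<omega>\<bar>" by blast
    thus "((\<lambda>y. power_transform \<kappa> \<zeta> (Complex 0 y)) \<longlongrightarrow> 0) at_top"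
      by (rule tendsto_0_imaginary)
  }
  show "continuous_on ({\<zeta>. Im \<zeta> \<noteq> 0} \<times> {\<omega>. Im \<omega> \<noteq> 0}) (\<lambda>p. power_transform \<kappa> (fst p) (snd p))"
  proof -
    let ?S = "{\<zeta>. Im \<zeta> \<noteq> 0} \<times> {\<omega>. Im \<omega> \<noteq> 0}"
    have f: "continuous_on ?S (\<lambda>p. F (fst p))" if "F holomorphic_on {z. Im z \<noteq> 0}" for F :: "complex \<Rightarrow> complex"
      by (rule continuous_on_compose2[OF holomorphic_on_imp_continuous_on[OF that]]) (auto intro!: continuous_intros)
    have s: "continuous_on ?S (\<lambda>p. F (snd p))" if "F holomorphic_on {z. Im z \<noteq> 0}" for F :: "complex \<Rightarrow> complex"
      by (rule continuous_on_compose2[OF holomorphic_on_imp_continuous_on[OF that]]) (auto intro!: continuous_intros)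
    have c: "continuous_on ?S (\<lambda>p. cauchy_transform2 \<mu> (A.subord \<kappa> (fst p)) (B.subord \<kappa> (snd p)))"
    proof -
      have "continuous_on ?S (\<lambda>p. (\<lambda>p. cauchy_transform2 \<mu> (fst p) (snd p)) (A.subord \<kappa> (fst p), B.subord \<kappa> (snd p)))"
        by (rule continuous_on_compose2[OF continuous_cauchy_transform2[OF borel_prob] continuous_on_Pair[OF f[OF hA] s[OF hB]]])
          (use sA sB in force)
      thus ?thesis by (simp only: fst_conv snd_conv)
    qed
    have "continuous_on ?S (\<lambda>p. cauchy_transform2 \<mu> (A.subord \<kappa> (fst p)) (B.subord \<kappa> (snd p)) / (of_real (\<kappa> + 1) - of_real \<kappa> *
       (cauchy_transform2 \<mu> (A.subord \<kappa> (fst p)) (B.subord \<kappa> (snd p)) / (A.G (A.subord \<kappa> (fst p)) * B.G (B.subord \<kappa> (snd p))))))"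
      by (intro continuous_intros c f[OF GA] s[OF GB]) (use G0 q(1) in auto)
    thus ?thesis
    proof (rule continuous_on_eq)
      fix p assume "p \<in> ?S"
      hence "Im (fst p) \<noteq> 0" "Im (snd p) \<noteq> 0" by auto
      from q(2)[OF this, symmetric] show "cauchy_transform2 \<mu> (A.subord \<kappa> (fst p)) (B.subord \<kappa> (snd p)) / (of_real (\<kappa> + 1) - of_real \<kappa> *
       (cauchy_transform2 \<mu> (A.subord \<kappa> (fst p)) (B.subord \<kappa> (snd p)) / (A.G (A.subord \<kappa> (fst p)) * B.G (B.subord \<kappa> (snd p))))) = power_transform \<kappa> (fst p) (snd p)" .
    qed
  qed
  show "power_transform \<kappa> (cnj \<zeta>) (cnj \<omega>) = cnj (power_transform \<kappa> \<zeta> \<omega>)" if "Im \<zeta> \<noteq> 0" "Im \<omega> \<noteq> 0" for \<zeta> \<omega>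
    using that by (simp add: power_transform_def A.subord_cnj[OF k] B.subord_cnj[OF k] cauchy_transform2_cnj cov_cnj)
  show "Re (power_transform \<kappa> \<zeta> \<omega>) \<le> Re (power_transform \<kappa> \<zeta> (cnj \<omega>))" if "0 < Im \<zeta>" "0 < Im \<omega>" for \<zeta> \<omega>
    by (rule power_transform_positive[OF \<kappa> that])
  define w1 where "w1 y = A.subord \<kappa> (Complex 0 y)" for y
  define w2 where "w2 y = B.subord \<kappa> (Complex 0 y)" for y
  have VV: "((\<lambda>y. sqrt (A.V (w1 y) * B.V (w2 y))) \<longlongrightarrow> 0) at_top"
  proof -
    have "((\<lambda>y. sqrt (A.V (w1 y) * B.V (w2 y))) \<longlongrightarrow> sqrt (0 * 0)) at_top"
      unfolding w1_def w2_def by (intro tendsto_intros A.V_subord_tendsto B.V_subord_tendsto \<kappa>)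
    thus ?thesis by simp
  qed
  have cov0: "((\<lambda>y. cov (w1 y) (w2 y)) \<longlongrightarrow> 0) at_top" "((\<lambda>y. cov (w1 y) (cnj (w2 y))) \<longlongrightarrow> 0) at_top"
  proof -
    show "((\<lambda>y. cov (w1 y) (w2 y)) \<longlongrightarrow> 0) at_top"
    proof (rule Lim_null_comparison[OF _ VV])
      show "\<forall>\<^sub>F y in at_top. cmod (cov (w1 y) (w2 y)) \<le> sqrt (A.V (w1 y) * B.V (w2 y))"
        using eventually_gt_at_top[of 0]
      proof eventually_elim
        case (elim y)
        thus ?case using norm_cov[of "w1 y" "w2 y"] sA[of "Complex 0 y"] sB[of "Complex 0 y"] by (intro real_le_rsqrt) (simp add: w1_def w2_def)
      qed
    qed
    show "((\<lambda>y. cov (w1 y) (cnj (w2 y))) \<longlongrightarrow> 0) at_top"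
    proof (rule Lim_null_comparison[OF _ VV])
      show "\<forall>\<^sub>F y in at_top. cmod (cov (w1 y) (cnj (w2 y))) \<le> sqrt (A.V (w1 y) * B.V (w2 y))"
        using eventually_gt_at_top[of 0]
      proof eventually_elim
        case (elim y)
        thus ?case using norm_cov[of "w1 y" "cnj (w2 y)"] sA[of "Complex 0 y"] sB[of "Complex 0 y"] by (intro real_le_rsqrt) (simp add: w1_def w2_def B.V_cnj)
      qed
    qed
  qed
  have lA: "((\<lambda>y. Complex 0 y * A.G (w1 y)) \<longlongrightarrow> 1) at_top" and lB: "((\<lambda>y. Complex 0 y * B.G (w2 y)) \<longlongrightarrow> 1) at_top"
    unfolding w1_def w2_def by (rule A.G_subord_tendsto[OF \<kappa>], rule B.G_subord_tendsto[OF \<kappa>])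
  show "((\<lambda>y. y\<^sup>2 * Re (power_transform \<kappa> (Complex 0 y) (Complex 0 (- y)))) \<longlongrightarrow> 1) at_top"
  proof -
    have "((\<lambda>y. Re ((Complex 0 y * A.G (w1 y)) * cnj (Complex 0 y * B.G (w2 y)) *
      ((1 + cov (w1 y) (cnj (w2 y))) / (1 - of_real \<kappa> * cov (w1 y) (cnj (w2 y)))))) \<longlongrightarrow> Re (1 * cnj 1 * ((1 + 0) / (1 - of_real \<kappa> * 0)))) at_top"
      by (intro tendsto_intros lA lB cov0) auto
    hence "((\<lambda>y. Re ((Complex 0 y * A.G (w1 y)) * cnj (Complex 0 y * B.G (w2 y)) *
      ((1 + cov (w1 y) (cnj (w2 y))) / (1 - of_real \<kappa> * cov (w1 y) (cnj (w2 y)))))) \<longlongrightarrow> 1) at_top" by simp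
    moreover have "\<forall>\<^sub>F y in at_top. Re ((Complex 0 y * A.G (w1 y)) * cnj (Complex 0 y * B.G (w2 y)) *
      ((1 + cov (w1 y) (cnj (w2 y))) / (1 - of_real \<kappa> * cov (w1 y) (cnj (w2 y))))) = y\<^sup>2 * Re (power_transform \<kappa> (Complex 0 y) (Complex 0 (- y)))"
      using eventually_gt_at_top[of 0]
    proof eventually_elim
      case (elim y)
      have c: "Complex 0 (- y) = cnj (Complex 0 y)" by (simp add: complex_cnj)
      have w2c: "B.subord \<kappa> (Complex 0 (- y)) = cnj (w2 y)" unfolding c w2_def by (rule B.subord_cnj[OF k]) (use elim in simp)
      have "power_transform \<kappa> (Complex 0 y) (Complex 0 (- y)) = A.G (w1 y) * cnj (B.G (w2 y)) * ((1 + cov (w1 y) (cnj (w2 y))) / (1 - of_real \<kappa> * cov (w1 y) (cnj (w2 y))))"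
        using power_transform_cov[OF k, of "Complex 0 y" "Complex 0 (- y)"] elim by (simp add: w2c B.G_cnj w1_def)
      moreover have "Complex 0 y * cnj (Complex 0 y) = of_real (y\<^sup>2)" by (simp add: complex_eq_iff power2_eq_square)
      moreover have "(u * a) * cnj (u * b) * v = (u * cnj u) * (a * cnj b * v)" for u a b v by (simp only: complex_cnj_mult mult_ac)
      ultimately have "(Complex 0 y * A.G (w1 y)) * cnj (Complex 0 y * B.G (w2 y)) *
         ((1 + cov (w1 y) (cnj (w2 y))) / (1 - of_real \<kappa> * cov (w1 y) (cnj (w2 y)))) = of_real (y\<^sup>2) * power_transform \<kappa> (Complex 0 y) (Complex 0 (- y))"
        by (simp only:)
      thus ?case by simp
    qed
    ultimately show ?thesis by (rule Lim_transform_eventually)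
  qed
  show "((\<lambda>y. y\<^sup>2 * Re (power_transform \<kappa> (Complex 0 y) (Complex 0 y))) \<longlongrightarrow> - 1) at_top"
  proof -
    have "((\<lambda>y. - Re ((Complex 0 y * A.G (w1 y)) * (Complex 0 y * B.G (w2 y)) *
      ((1 + cov (w1 y) (w2 y)) / (1 - of_real \<kappa> * cov (w1 y) (w2 y))))) \<longlongrightarrow> - Re (1 * 1 * ((1 + 0) / (1 - of_real \<kappa> * 0)))) at_top"
      by (intro tendsto_intros lA lB cov0) auto
    hence "((\<lambda>y. - Re ((Complex 0 y * A.G (w1 y)) * (Complex 0 y * B.G (w2 y)) *
      ((1 + cov (w1 y) (w2 y)) / (1 - of_real \<kappa> * cov (w1 y) (w2 y))))) \<longlongrightarrow> - 1) at_top" by simp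
    moreover have "\<forall>\<^sub>F y in at_top. - Re ((Complex 0 y * A.G (w1 y)) * (Complex 0 y * B.G (w2 y)) *
      ((1 + cov (w1 y) (w2 y)) / (1 - of_real \<kappa> * cov (w1 y) (w2 y)))) = y\<^sup>2 * Re (power_transform \<kappa> (Complex 0 y) (Complex 0 y))"
      using eventually_gt_at_top[of 0]
    proof eventually_elim
      case (elim y)
      define v where "v = (1 + cov (w1 y) (w2 y)) / (1 - of_real \<kappa> * cov (w1 y) (w2 y))"
      have pt: "power_transform \<kappa> (Complex 0 y) (Complex 0 y) = A.G (w1 y) * B.G (w2 y) * v"
        using power_transform_cov[OF k, of "Complex 0 y" "Complex 0 y"] elim by (simp add: w1_def w2_def v_def)
      have sq: "Complex 0 y * Complex 0 y = of_real (- (y\<^sup>2))" by (simp add: complex_eq_iff power2_eq_square)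
      have "(Complex 0 y * A.G (w1 y)) * (Complex 0 y * B.G (w2 y)) * v = (Complex 0 y * Complex 0 y) * (A.G (w1 y) * B.G (w2 y) * v)"
        by (simp only: mult_ac)
      also have "\<dots> = of_real (- (y\<^sup>2)) * power_transform \<kappa> (Complex 0 y) (Complex 0 y)" by (simp only: sq pt)
      finally have "(Complex 0 y * A.G (w1 y)) * (Complex 0 y * B.G (w2 y)) *
         ((1 + cov (w1 y) (w2 y)) / (1 - of_real \<kappa> * cov (w1 y) (w2 y))) = of_real (- (y\<^sup>2)) * power_transform \<kappa> (Complex 0 y) (Complex 0 y)"
        by (simp only: v_def)
      thus ?case by simp
    qed
    ultimately show ?thesis by (rule Lim_transform_eventually)
  qed
qed

end

section \<open>Marginals, limits in one variable and existence of the powers\<close>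

lemma borel_prob_marginal:
  assumes "borel_prob \<mu>" shows "borel_prob (marginal1 \<mu>)" "borel_prob (marginal2 \<mu>)"
proof -
  interpret planar_law \<mu> using assms by (rule planar_law.intro)
  show "borel_prob (marginal1 \<mu>)" "borel_prob (marginal2 \<mu>)"
    unfolding borel_prob_def marginal1_def marginal2_def
    by (auto intro!: A.prob_space_distr)
qed

lemma G_marginal:
  assumes "borel_prob \<mu>"
  shows "real_rv.G (marginal1 \<mu>) (\<lambda>x. x) z = real_rv.G \<mu> fst z" "real_rv.G (marginal2 \<mu>) (\<lambda>x. x) z = real_rv.G \<mu> snd z"
proof -
  interpret planar_law \<mu> using assms by (rule planar_law.intro)
  interpret M1: real_rv "marginal1 \<mu>" "\<lambda>x. x" by (rule borel_prob_real_rv[OF borel_prob_marginal(1)[OF assms]])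
  interpret M2: real_rv "marginal2 \<mu>" "\<lambda>x. x" by (rule borel_prob_real_rv[OF borel_prob_marginal(2)[OF assms]])
  have "M1.G z = (LINT x|distr \<mu> borel fst. res z x)" unfolding M1.G_def by (simp only: marginal1_def)
  also have "\<dots> = A.G z" unfolding A.G_def by (rule integral_distr) measurable
  finally show "M1.G z = A.G z" .
  have "M2.G z = (LINT x|distr \<mu> borel snd. res z x)" unfolding M2.G_def by (simp only: marginal2_def)
  also have "\<dots> = B.G z" unfolding B.G_def by (rule integral_distr) measurable
  finally show "M2.G z = B.G z" .
qed

context planar_law
begin

text \<open>By \<open>mult_res\<close>, \<omega> times the second resolvent is 1 plus a term of
  small mean in a truncated cone; so the planar transform recovers the marginal one as \<omega>
  tends to infinity.\<close>

lemma cauchy_transform2_cone2: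
  assumes z: "Im \<zeta> \<noteq> 0" and w: "Im \<omega> \<noteq> 0" "\<bar>Re \<omega>\<bar> \<le> A * \<bar>Im \<omega>\<bar>" "B \<le> \<bar>Im \<omega>\<bar>" "0 < B"
  shows "cmod (\<omega> * cauchy_transform2 \<mu> \<zeta> \<omega> - A.G \<zeta>) \<le> 1 / \<bar>Im \<zeta>\<bar> * ((2 + A) * B.tB B)"
proof -
  note c = B.integral_cone[OF w]
  have meas: "(\<lambda>p. res \<zeta> (fst p) * (of_real (snd p) * res \<omega> (snd p))) \<in> borel_measurable \<mu>" by measurable
  have bd: "cmod (res \<zeta> (fst p) * (of_real (snd p) * res \<omega> (snd p))) \<le> 1 / \<bar>Im \<zeta>\<bar> * cmod (of_real (snd p) * res \<omega> (snd p))" for p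
    unfolding norm_mult[of "res \<zeta> (fst p)"] by (intro mult_right_mono norm_res_le z) simp
  have int: "integrable \<mu> (\<lambda>p. res \<zeta> (fst p) * (of_real (snd p) * res \<omega> (snd p)))"
    by (rule Bochner_Integration.integrable_bound[OF integrable_mult_right[OF integrable_norm[OF c(1)], of "1 / \<bar>Im \<zeta>\<bar>"] meas])
       (use bd in \<open>auto intro!: AE_I2 order_trans[OF bd abs_ge_self]\<close>)
  have "\<omega> * cauchy_transform2 \<mu> \<zeta> \<omega> - A.G \<zeta> = (LINT p|\<mu>. \<omega> * (res \<zeta> (fst p) * res \<omega> (snd p))) - (LINT p|\<mu>. res \<zeta> (fst p))"
    by (simp add: cauchy_transform2_res A.G_def)
  also have "\<dots> = (LINT p|\<mu>. \<omega> * (res \<zeta> (fst p) * res \<omega> (snd p)) - res \<zeta> (fst p))"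
    by (intro Bochner_Integration.integral_diff[symmetric] integrable_mult_right integrable_res2[OF borel_prob z w(1)] A.integrable_res z)
  also have "\<dots> = (LINT p|\<mu>. res \<zeta> (fst p) * (of_real (snd p) * res \<omega> (snd p)))"
  proof (intro Bochner_Integration.integral_cong refl)
    fix p
    have "\<omega> * (res \<zeta> (fst p) * res \<omega> (snd p)) = res \<zeta> (fst p) * (\<omega> * res \<omega> (snd p))" by simp
    thus "\<omega> * (res \<zeta> (fst p) * res \<omega> (snd p)) - res \<zeta> (fst p) = res \<zeta> (fst p) * (of_real (snd p) * res \<omega> (snd p))"
      unfolding mult_res[OF w(1)] by (simp add: algebra_simps)
  qed
  also have "cmod \<dots> \<le> (LINT p|\<mu>. cmod (res \<zeta> (fst p) * (of_real (snd p) * res \<omega> (snd p))))" by (rule integral_norm_bound)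
  also have "\<dots> \<le> (LINT p|\<mu>. 1 / \<bar>Im \<zeta>\<bar> * cmod (of_real (snd p) * res \<omega> (snd p)))"
    by (intro integral_mono integrable_norm int integrable_mult_right c(1) bd)
  also have "\<dots> = 1 / \<bar>Im \<zeta>\<bar> * (LINT p|\<mu>. cmod (of_real (snd p) * res \<omega> (snd p)))" by simp
  also have "\<dots> \<le> 1 / \<bar>Im \<zeta>\<bar> * ((2 + A) * B.tB B)" by (intro mult_left_mono c(2)) auto
  finally show ?thesis .
qed

end

text \<open>Exchanging the coordinates carries the estimate for the second variable over to the
  first.\<close>

lemma planar_law_swap:
  assumes "borel_prob \<mu>"
  shows "borel_prob (distr \<mu> borel prod.swap)"
    "cauchy_transform2 (distr \<mu> borel prod.swap) z w = cauchy_transform2 \<mu> w z"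
    "real_rv.G (distr \<mu> borel prod.swap) fst = real_rv.G \<mu> snd"
    "real_rv.G (distr \<mu> borel prod.swap) snd = real_rv.G \<mu> fst"
    "real_rv.tB (distr \<mu> borel prod.swap) snd = real_rv.tB \<mu> fst"
proof -
  interpret planar_law \<mu> using assms by (rule planar_law.intro)
  have sw: "prod.swap = (\<lambda>p :: real \<times> real. (snd p, fst p))" by auto
  have sets: "sets \<mu> = sets borel" using assms by (simp add: borel_prob_def)
  note [measurable_cong] = sets
  have m: "(\<lambda>p. (snd p, fst p)) \<in> borel_measurable \<mu>" by measurable
  show b: "borel_prob (distr \<mu> borel prod.swap)"
    unfolding borel_prob_def sw using A.prob_space_distr[OF m] by simp
  interpret S: planar_law "distr \<mu> borel prod.swap" using b by (rule planar_law.intro)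
  show "cauchy_transform2 (distr \<mu> borel prod.swap) z w = cauchy_transform2 \<mu> w z"
    unfolding cauchy_transform2_res sw by (subst integral_distr[OF m]) (measurable, simp add: mult.commute)
  have i: "(LINT p|distr \<mu> borel prod.swap. f p) = (LINT p|\<mu>. f (snd p, fst p))" if "f \<in> borel_measurable \<mu>"
    for f :: "real \<times> real \<Rightarrow> 'b :: {banach, second_countable_topology}"
    unfolding sw using integral_distr[OF m, of f] that measurable_cong_sets[OF sets refl] by blast
  show "S.A.G = B.G" by (intro ext, unfold S.A.G_def B.G_def, rule i[THEN trans]) measurable
  show "S.B.G = A.G" by (intro ext, unfold S.B.G_def A.G_def, rule i[THEN trans]) measurable
  show "S.B.tB = A.tB" by (intro ext, unfold S.B.tB_def A.tB_def, rule i[THEN trans]) measurable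
qed

lemma (in planar_law) cauchy_transform2_cone1:
  assumes z: "Im \<zeta> \<noteq> 0" and w: "Im \<omega> \<noteq> 0" "\<bar>Re \<omega>\<bar> \<le> A * \<bar>Im \<omega>\<bar>" "B \<le> \<bar>Im \<omega>\<bar>" "0 < B"
  shows "cmod (\<omega> * cauchy_transform2 \<mu> \<omega> \<zeta> - B.G \<zeta>) \<le> 1 / \<bar>Im \<zeta>\<bar> * ((2 + A) * A.tB B)"
proof -
  interpret S: planar_law "distr \<mu> borel prod.swap" using planar_law_swap(1)[OF borel_prob] by (rule planar_law.intro)
  show ?thesis
    using S.cauchy_transform2_cone2[OF assms] by (simp add: planar_law_swap[OF borel_prob])
qed

lemma (in planar_law) cauchy_transform2_tendsto:
  assumes z: "Im \<zeta> \<noteq> 0"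
  shows "((\<lambda>v. Complex 0 v * cauchy_transform2 \<mu> \<zeta> (Complex 0 v)) \<longlongrightarrow> A.G \<zeta>) at_top"
    "((\<lambda>v. Complex 0 v * cauchy_transform2 \<mu> (Complex 0 v) \<zeta>) \<longlongrightarrow> B.G \<zeta>) at_top"
proof -
  have l: "((\<lambda>v. 1 / \<bar>Im \<zeta>\<bar> * ((2 + 0) * t v)) \<longlongrightarrow> 0) at_top" if "(t \<longlongrightarrow> 0) at_top" for t :: "real \<Rightarrow> real"
    using that by (intro tendsto_mult_right_zero)
  show "((\<lambda>v. Complex 0 v * cauchy_transform2 \<mu> \<zeta> (Complex 0 v)) \<longlongrightarrow> A.G \<zeta>) at_top"
  proof (rule LIM_zero_cancel, rule Lim_null_comparison[OF _ l[OF B.tB_tendsto]])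
    show "\<forall>\<^sub>F v in at_top. cmod (Complex 0 v * cauchy_transform2 \<mu> \<zeta> (Complex 0 v) - A.G \<zeta>) \<le> 1 / \<bar>Im \<zeta>\<bar> * ((2 + 0) * B.tB v)"
      using eventually_gt_at_top[of 0] by eventually_elim (rule cauchy_transform2_cone2[OF z], auto)
  qed
  show "((\<lambda>v. Complex 0 v * cauchy_transform2 \<mu> (Complex 0 v) \<zeta>) \<longlongrightarrow> B.G \<zeta>) at_top"
  proof (rule LIM_zero_cancel, rule Lim_null_comparison[OF _ l[OF A.tB_tendsto]])
    show "\<forall>\<^sub>F v in at_top. cmod (Complex 0 v * cauchy_transform2 \<mu> (Complex 0 v) \<zeta> - B.G \<zeta>) \<le> 1 / \<bar>Im \<zeta>\<bar> * ((2 + 0) * A.tB v)"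
      using eventually_gt_at_top[of 0] by eventually_elim (rule cauchy_transform2_cone1[OF z], auto)
  qed
qed

lemma (in planar_law) power_transform_tendsto:
  assumes \<kappa>: "0 < \<kappa>" and z: "Im \<zeta> \<noteq> 0"
  shows "((\<lambda>v. Complex 0 v * power_transform \<kappa> \<zeta> (Complex 0 v)) \<longlongrightarrow> A.G (A.subord \<kappa> \<zeta>)) at_top"
    "((\<lambda>v. Complex 0 v * power_transform \<kappa> (Complex 0 v) \<zeta>) \<longlongrightarrow> B.G (B.subord \<kappa> \<zeta>)) at_top"
proof -
  have k: "0 \<le> \<kappa>" using \<kappa> by simp
  note sA = A.subord_Im(1)[OF k] and sB = B.subord_Im(1)[OF k]
  show "((\<lambda>v. Complex 0 v * power_transform \<kappa> \<zeta> (Complex 0 v)) \<longlongrightarrow> A.G (A.subord \<kappa> \<zeta>)) at_top"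
  proof -
    define w where "w = A.subord \<kappa> \<zeta>"
    define w2 where "w2 v = B.subord \<kappa> (Complex 0 v)" for v
    have "((\<lambda>v. sqrt (A.V w * B.V (w2 v))) \<longlongrightarrow> sqrt (A.V w * 0)) at_top"
      unfolding w2_def by (intro tendsto_intros B.V_subord_tendsto \<kappa>)
    hence VV: "((\<lambda>v. sqrt (A.V w * B.V (w2 v))) \<longlongrightarrow> 0) at_top" by simp
    have c0: "((\<lambda>v. cov w (w2 v)) \<longlongrightarrow> 0) at_top"
    proof (rule Lim_null_comparison[OF _ VV])
      show "\<forall>\<^sub>F v in at_top. cmod (cov w (w2 v)) \<le> sqrt (A.V w * B.V (w2 v))"
        using eventually_gt_at_top[of 0]
      proof eventually_elim
        case (elim v)
        thus ?case using norm_cov[of w "w2 v"] sA[OF z] sB[of "Complex 0 v"] by (intro real_le_rsqrt) (simp add: w_def w2_def)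
      qed
    qed
    have "((\<lambda>v. A.G w * (Complex 0 v * B.G (w2 v)) * ((1 + cov w (w2 v)) / (1 - of_real \<kappa> * cov w (w2 v)))) \<longlongrightarrow> A.G w * 1 * ((1 + 0) / (1 - of_real \<kappa> * 0))) at_top"
      by (intro tendsto_intros c0 B.G_subord_tendsto[OF \<kappa>, folded w2_def]) auto
    moreover have "\<forall>\<^sub>F v in at_top. A.G w * (Complex 0 v * B.G (w2 v)) * ((1 + cov w (w2 v)) / (1 - of_real \<kappa> * cov w (w2 v))) = Complex 0 v * power_transform \<kappa> \<zeta> (Complex 0 v)"
      using eventually_gt_at_top[of 0]
    proof eventually_elim
      case (elim v)
      have "power_transform \<kappa> \<zeta> (Complex 0 v) = A.G w * B.G (w2 v) * ((1 + cov w (w2 v)) / (1 - of_real \<kappa> * cov w (w2 v)))"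
        using power_transform_cov[OF k z, of "Complex 0 v"] elim by (simp add: w_def w2_def)
      thus ?case by (simp add: mult_ac)
    qed
    ultimately have "((\<lambda>v. Complex 0 v * power_transform \<kappa> \<zeta> (Complex 0 v)) \<longlongrightarrow> A.G w * 1 * ((1 + 0) / (1 - of_real \<kappa> * 0))) at_top"
      by (rule Lim_transform_eventually)
    thus ?thesis by (simp add: w_def)
  qed
  show "((\<lambda>v. Complex 0 v * power_transform \<kappa> (Complex 0 v) \<zeta>) \<longlongrightarrow> B.G (B.subord \<kappa> \<zeta>)) at_top"
  proof -
    define w where "w = B.subord \<kappa> \<zeta>"
    define w1 where "w1 v = A.subord \<kappa> (Complex 0 v)" for v
    have "((\<lambda>v. sqrt (A.V (w1 v) * B.V w)) \<longlongrightarrow> sqrt (0 * B.V w)) at_top"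
      unfolding w1_def by (intro tendsto_intros A.V_subord_tendsto \<kappa>)
    hence VV: "((\<lambda>v. sqrt (A.V (w1 v) * B.V w)) \<longlongrightarrow> 0) at_top" by simp
    have c0: "((\<lambda>v. cov (w1 v) w) \<longlongrightarrow> 0) at_top"
    proof (rule Lim_null_comparison[OF _ VV])
      show "\<forall>\<^sub>F v in at_top. cmod (cov (w1 v) w) \<le> sqrt (A.V (w1 v) * B.V w)"
        using eventually_gt_at_top[of 0]
      proof eventually_elim
        case (elim v)
        thus ?case using norm_cov[of "w1 v" w] sB[OF z] sA[of "Complex 0 v"] by (intro real_le_rsqrt) (simp add: w_def w1_def)
      qed
    qed
    have "((\<lambda>v. (Complex 0 v * A.G (w1 v)) * B.G w * ((1 + cov (w1 v) w) / (1 - of_real \<kappa> * cov (w1 v) w))) \<longlongrightarrow> 1 * B.G w * ((1 + 0) / (1 - of_real \<kappa> * 0))) at_top"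
      by (intro tendsto_intros c0 A.G_subord_tendsto[OF \<kappa>, folded w1_def]) auto
    moreover have "\<forall>\<^sub>F v in at_top. (Complex 0 v * A.G (w1 v)) * B.G w * ((1 + cov (w1 v) w) / (1 - of_real \<kappa> * cov (w1 v) w)) = Complex 0 v * power_transform \<kappa> (Complex 0 v) \<zeta>"
      using eventually_gt_at_top[of 0]
    proof eventually_elim
      case (elim v)
      have "power_transform \<kappa> (Complex 0 v) \<zeta> = A.G (w1 v) * B.G w * ((1 + cov (w1 v) w) / (1 - of_real \<kappa> * cov (w1 v) w))"
        using power_transform_cov[OF k _ z, of "Complex 0 v"] elim by (simp add: w_def w1_def)
      thus ?case by (simp add: mult_ac)
    qed
    ultimately have "((\<lambda>v. Complex 0 v * power_transform \<kappa> (Complex 0 v) \<zeta>) \<longlongrightarrow> 1 * B.G w * ((1 + 0) / (1 - of_real \<kappa> * 0))) at_top"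
      by (rule Lim_transform_eventually)
    thus ?thesis by (simp add: w_def)
  qed
qed

text \<open>The bi-free convolution power of real exponent \<open>\<kappa> + 1 \<ge> 1\<close>.\<close>

theorem (in planar_law) planar_power:
  assumes \<kappa>: "0 \<le> \<kappa>"
  obtains \<nu> where "borel_prob \<nu>"
    "\<And>w1 w2. w1 \<in> A.U \<kappa> \<Longrightarrow> w2 \<in> B.U \<kappa> \<Longrightarrow> cauchy_transform2 \<nu> (A.H \<kappa> w1) (B.H \<kappa> w2) *
       (of_real (\<kappa> + 1) - of_real \<kappa> * (cauchy_transform2 \<mu> w1 w2 / (A.G w1 * B.G w2))) = cauchy_transform2 \<mu> w1 w2"
    "\<And>w. w \<in> A.U \<kappa> \<Longrightarrow> real_rv.G \<nu> fst (A.H \<kappa> w) = A.G w"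
    "\<And>w. w \<in> B.U \<kappa> \<Longrightarrow> real_rv.G \<nu> snd (B.H \<kappa> w) = B.G w"
proof (cases "\<kappa> = 0")
  case True
  \<comment> \<open>The exponent 1 is the law itself; it is treated apart because
    \<open>planar_cauchy_data_power\<close> is proved for \<kappa> > 0.\<close>
  have "A.H 0 w = w" "B.H 0 w = w" for w by (simp_all add: A.H_def B.H_def)
  thus ?thesis using that[OF borel_prob] True by simp
next
  case False
  hence k: "0 < \<kappa>" using \<kappa> by simp
  interpret P: planar_cauchy_data "power_transform \<kappa>" by (rule planar_cauchy_data_power[OF k])
  obtain \<nu> where \<nu>: "borel_prob \<nu>"
    "\<And>\<zeta> \<omega>. Im \<zeta> \<noteq> 0 \<Longrightarrow> Im \<omega> \<noteq> 0 \<Longrightarrow> cauchy_transform2 \<nu> \<zeta> \<omega> = power_transform \<kappa> \<zeta> \<omega>"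
    by (rule P.representation) blast
  interpret N: planar_law \<nu> using \<nu>(1) by (rule planar_law.intro)
  show ?thesis
  proof (rule that[OF \<nu>(1)])
    fix w1 w2 assume w: "w1 \<in> A.U \<kappa>" "w2 \<in> B.U \<kappa>"
    have im: "Im (A.H \<kappa> w1) \<noteq> 0" "Im (B.H \<kappa> w2) \<noteq> 0" using A.U_Im(2)[OF w(1)] B.U_Im(2)[OF w(2)] by auto
    show "cauchy_transform2 \<nu> (A.H \<kappa> w1) (B.H \<kappa> w2) *
       (of_real (\<kappa> + 1) - of_real \<kappa> * (cauchy_transform2 \<mu> w1 w2 / (A.G w1 * B.G w2))) = cauchy_transform2 \<mu> w1 w2"
      using power_transform_quotient[OF \<kappa> im] unfolding \<nu>(2)[OF im] A.subord_H[OF \<kappa> w(1)] B.subord_H[OF \<kappa> w(2)]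
      by (metis nonzero_divide_eq_eq)
  next
    fix w assume w: "w \<in> A.U \<kappa>"
    have im: "Im (A.H \<kappa> w) \<noteq> 0" using A.U_Im(2)[OF w] .
    have ev: "\<forall>\<^sub>F v in at_top. Complex 0 v * power_transform \<kappa> (A.H \<kappa> w) (Complex 0 v) = Complex 0 v * cauchy_transform2 \<nu> (A.H \<kappa> w) (Complex 0 v)"
      using eventually_gt_at_top[of 0] by eventually_elim (subst \<nu>(2)[OF im], auto)
    have "((\<lambda>v. Complex 0 v * cauchy_transform2 \<nu> (A.H \<kappa> w) (Complex 0 v)) \<longlongrightarrow> A.G (A.subord \<kappa> (A.H \<kappa> w))) at_top"
      by (rule Lim_transform_eventually[OF power_transform_tendsto(1)[OF k im] ev])
    from tendsto_unique[OF _ this N.cauchy_transform2_tendsto(1)[OF im]]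
    show "real_rv.G \<nu> fst (A.H \<kappa> w) = A.G w" by (simp add: A.subord_H[OF \<kappa> w])
  next
    fix w assume w: "w \<in> B.U \<kappa>"
    have im: "Im (B.H \<kappa> w) \<noteq> 0" using B.U_Im(2)[OF w] .
    have ev: "\<forall>\<^sub>F v in at_top. Complex 0 v * power_transform \<kappa> (Complex 0 v) (B.H \<kappa> w) = Complex 0 v * cauchy_transform2 \<nu> (Complex 0 v) (B.H \<kappa> w)"
      using eventually_gt_at_top[of 0] by eventually_elim (subst \<nu>(2)[OF _ im], auto)
    have "((\<lambda>v. Complex 0 v * cauchy_transform2 \<nu> (Complex 0 v) (B.H \<kappa> w)) \<longlongrightarrow> B.G (B.subord \<kappa> (B.H \<kappa> w))) at_top"
      by (rule Lim_transform_eventually[OF power_transform_tendsto(2)[OF k im] ev])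
    from tendsto_unique[OF _ this N.cauchy_transform2_tendsto(2)[OF im]]
    show "real_rv.G \<nu> snd (B.H \<kappa> w) = B.G w" by (simp add: B.subord_H[OF \<kappa> w])
  qed
qed

text \<open>The one-dimensional power is the first marginal of the planar power of the law placed on
  the diagonal.\<close>

lemma line_power:
  assumes m: "borel_prob m" and \<kappa>: "0 \<le> \<kappa>"
  obtains m' where "borel_prob m'"
    "\<And>w. w \<in> real_rv.U m (\<lambda>x. x) \<kappa> \<Longrightarrow> real_rv.G m' (\<lambda>x. x) (real_rv.H m (\<lambda>x. x) \<kappa> w) = real_rv.G m (\<lambda>x. x) w"
proof -
  interpret M: real_rv m "\<lambda>x. x" by (rule borel_prob_real_rv[OF m])
  define \<mu> where "\<mu> = distr m borel (\<lambda>s. (s, s))"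
  have [measurable_cong]: "sets m = sets borel" using m by (simp add: borel_prob_def)
  have meas: "(\<lambda>s::real. (s, s)) \<in> borel_measurable m" by measurable
  have b: "borel_prob \<mu>" using M.prob_space_distr[OF meas] by (simp add: borel_prob_def \<mu>_def)
  interpret planar_law \<mu> using b by (rule planar_law.intro)
  have G: "A.G = M.G"
    by (intro ext, unfold A.G_def M.G_def, unfold \<mu>_def, rule integral_distr[OF meas, THEN trans])
      (auto intro: measurable_compose[OF fst_borel_real2])
  have h: "A.h = M.h" by (simp add: A.h_def[abs_def] M.h_def[abs_def] G)
  have H: "A.H = M.H" by (simp add: A.H_def[abs_def] M.H_def[abs_def] h)
  have U: "A.U \<kappa> = M.U \<kappa>" by (simp add: set_eq_iff A.mem_U_iff M.mem_U_iff H)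
  show ?thesis
  proof (rule planar_power[OF \<kappa>])
    fix \<nu> :: "(real \<times> real) measure"
    assume \<nu>: "borel_prob \<nu>" and G1: "\<And>w. w \<in> A.U \<kappa> \<Longrightarrow> real_rv.G \<nu> fst (A.H \<kappa> w) = A.G w"
    show thesis
    proof (rule that[OF borel_prob_marginal(1)[OF \<nu>]])
      fix w assume "w \<in> M.U \<kappa>"
      thus "real_rv.G (marginal1 \<nu>) (\<lambda>x. x) (M.H \<kappa> w) = M.G w"
        unfolding G_marginal(1)[OF \<nu>] using G1[of w] by (simp add: G H U)
    qed
  qed
qed

section \<open>Free convolution powers\<close>

text \<open>For w = 1 / z + R z the point H k w is 1 / z + (k + 1) R z, so the power relation says
  that the R-transform of m' is (k + 1) R.\<close>

lemma R_transform_power: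
  assumes m: "borel_prob m" and m': "borel_prob m'" and R: "R_transform_on m \<alpha> \<beta> R" and \<alpha>: "0 < \<alpha>" and \<beta>: "0 < \<beta>"
    and power: "\<And>w. w \<in> real_rv.U m (\<lambda>x. x) (real k) \<Longrightarrow>
      real_rv.G m' (\<lambda>x. x) (real_rv.H m (\<lambda>x. x) (real k) w) = real_rv.G m (\<lambda>x. x) w"
  obtains \<beta>' where "0 < \<beta>'" "\<beta>' \<le> \<beta>" "R_transform_on m' \<alpha> \<beta>' (\<lambda>z. of_nat (Suc k) * R z)"
proof -
  interpret M: real_rv m "\<lambda>x. x" by (rule borel_prob_real_rv[OF m])
  \<comment> \<open>Small enough that all points 1 / z + j R z with j <= k + 1 stay in the ball
    around 1 / z; then w and H w lie in one half-plane, which puts w into \<open>U\<close>.\<close>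
  define \<delta> where "\<delta> = 1 / (2 * (1 + \<alpha>) * real (Suc k))"
  have \<delta>: "0 < \<delta>" using \<alpha> by (simp add: \<delta>_def)
  obtain \<beta>' where b: "0 < \<beta>'" "\<beta>' \<le> \<beta>" and near: "\<And>z. z \<in> stolz_double \<alpha> \<beta>' \<Longrightarrow> cmod (z * R z) < \<delta>"
    by (rule R_transform_near_0[OF R \<alpha> \<beta> \<delta>]) blast
  have R': "R_transform_on m \<alpha> \<beta>' R" by (rule R_transform_on_mono[OF R order_refl b(2)])
  have in_ball: "1 / z + of_nat j * R z \<in> cball (1 / z) (\<bar>Im (1 / z)\<bar> / 2)" if z: "z \<in> stolz_double \<alpha> \<beta>'" and j: "j \<le> Suc k" for z j
  proof -
    note c = Im_inverse_stolz[OF z \<alpha>]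
    have z0: "z \<noteq> 0" using z by (auto simp: mem_stolz_double)
    have "cmod (1 / z) \<le> \<bar>Re (1 / z)\<bar> + \<bar>Im (1 / z)\<bar>" by (rule cmod_le)
    also have "\<dots> \<le> (1 + \<alpha>) * \<bar>Im (1 / z)\<bar>" using c(2) by (simp add: algebra_simps)
    finally have iz: "cmod (1 / z) \<le> (1 + \<alpha>) * \<bar>Im (1 / z)\<bar>" .
    have "of_nat j * R z = of_nat j * ((1 / z) * (z * R z))" using z0 by simp
    hence "cmod (of_nat j * R z) = real j * (cmod (1 / z) * cmod (z * R z))" by (simp only: norm_mult norm_of_nat)
    also have "\<dots> \<le> real (Suc k) * (((1 + \<alpha>) * \<bar>Im (1 / z)\<bar>) * \<delta>)"
      using near[OF z] iz \<alpha> j by (intro mult_mono) auto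
    also have "\<dots> = \<bar>Im (1 / z)\<bar> / 2"
    proof -
      have "real (Suc k) * (((1 + \<alpha>) * i) * \<delta>) = i / 2" for i
      proof -
        have "2 * (1 + \<alpha>) * real (Suc k) \<noteq> 0" using \<alpha> by simp
        thus ?thesis unfolding \<delta>_def by (simp add: divide_simps del: of_nat_Suc)
      qed
      thus ?thesis .
    qed
    finally show ?thesis by (simp add: dist_norm)
  qed
  have "R_transform_on m' \<alpha> \<beta>' (\<lambda>z. of_nat (Suc k) * R z)"
    unfolding R_transform_on_def
  proof (intro conjI ballI)
    show "(\<lambda>z. of_nat (Suc k) * R z) holomorphic_on stolz_double \<alpha> \<beta>'"
      using R' unfolding R_transform_on_def by (intro holomorphic_intros) auto
    have "((\<lambda>z. of_nat (Suc k) * (z * R z)) \<longlongrightarrow> of_nat (Suc k) * 0) (at 0 within stolz_double \<alpha> \<beta>')"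
      using R' unfolding R_transform_on_def by (intro tendsto_intros) auto
    thus "((\<lambda>z. z * (of_nat (Suc k) * R z)) \<longlongrightarrow> 0) (at 0 within stolz_double \<alpha> \<beta>')"
      by (simp only: mult.left_commute mult_zero_right)
  next
    fix z assume z: "z \<in> stolz_double \<alpha> \<beta>'"
    note c = Im_inverse_stolz[OF z \<alpha>]
    have z0: "z \<noteq> 0" using z by (auto simp: mem_stolz_double)
    define w \<zeta> where "w = 1 / z + R z" and "\<zeta> = 1 / z + of_nat (Suc k) * R z"
    have w: "w \<in> cball (1 / z) (\<bar>Im (1 / z)\<bar> / 2)" using in_ball[OF z, of 1] by (simp add: w_def)
    have \<zeta>: "\<zeta> \<in> cball (1 / z) (\<bar>Im (1 / z)\<bar> / 2)" unfolding \<zeta>_def by (rule in_ball[OF z order_refl])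
    note cw = cone_cball[OF c(2,1) w less_imp_le[OF \<alpha>]] and c\<zeta> = cone_cball[OF c(2,1) \<zeta> less_imp_le[OF \<alpha>]]
    have G: "M.G w = z" using R_transform_Im(3)[OF m R' z] by (simp add: w_def)
    have H: "M.H (real k) w = \<zeta>" by (simp add: M.H_def M.h_def G) (simp add: w_def \<zeta>_def algebra_simps)
    have "0 < Im \<zeta> * Im w" using cw(2) c\<zeta>(2) by (auto simp: zero_less_mult_iff)
    hence "w \<in> M.U (real k)" using cw(1) by (simp add: M.mem_U_iff H)
    from power[OF this] have "real_rv.G m' (\<lambda>x. x) \<zeta> = z" by (simp add: H G)
    thus "cauchy_transform m' (1 / z + of_nat (Suc k) * R z) = z"
      unfolding cauchy_transform_eq[OF m'] \<zeta>_def .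
    show "1 / z + of_nat (Suc k) * R z \<notin> \<real>"
      using c\<zeta>(1) unfolding \<zeta>_def complex_is_Real_iff .
  qed
  with b show thesis by (rule that)
qed

text \<open>Near 0 any candidate for the definite description has the same R-transform as m, because
  the R-transforms of the two factors are unique there; \<open>R_transform_inject\<close> identifies
  it with m.\<close>

lemma free_conv_eq:
  assumes m: "borel_prob m" "borel_prob m1" "borel_prob m2" and \<alpha>: "0 < \<alpha>" and \<beta>: "0 < \<beta>"
    and R: "R_transform_on m1 \<alpha> \<beta> R1" "R_transform_on m2 \<alpha> \<beta> R2" "R_transform_on m \<alpha> \<beta> (\<lambda>z. R1 z + R2 z)"
  shows "m1 \<boxplus> m2 = m"
  unfolding free_conv_def
proof (rule the_equality, intro conjI exI)
  show "borel_prob m" "0 < \<alpha>" "0 < \<beta>" by fact+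
  show "R_transform_on m1 \<alpha> \<beta> R1" "R_transform_on m2 \<alpha> \<beta> R2" "R_transform_on m \<alpha> \<beta> (\<lambda>z. R1 z + R2 z)" by fact+
next
  fix m' assume "borel_prob m' \<and> (\<exists>\<alpha> \<beta> R1 R2. 0 < \<alpha> \<and> 0 < \<beta> \<and> R_transform_on m1 \<alpha> \<beta> R1 \<and> R_transform_on m2 \<alpha> \<beta> R2 \<and>
        R_transform_on m' \<alpha> \<beta> (\<lambda>z. R1 z + R2 z))"
  then obtain \<alpha>' \<beta>' R1' R2' where m': "borel_prob m'" and \<alpha>': "0 < \<alpha>'" and \<beta>': "0 < \<beta>'"
    and R': "R_transform_on m1 \<alpha>' \<beta>' R1'" "R_transform_on m2 \<alpha>' \<beta>' R2'" "R_transform_on m' \<alpha>' \<beta>' (\<lambda>z. R1' z + R2' z)"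
    by blast
  obtain b1 where b1: "0 < b1" "b1 \<le> \<beta>" "b1 \<le> \<beta>'" and e1: "\<And>z. z \<in> stolz_double (min \<alpha> \<alpha>') b1 \<Longrightarrow> R1 z = R1' z"
    by (rule R_transform_eq_near_0[OF m(2) R(1) \<alpha> \<beta> R'(1) \<alpha>' \<beta>']) blast
  obtain b2 where b2: "0 < b2" "b2 \<le> \<beta>" "b2 \<le> \<beta>'" and e2: "\<And>z. z \<in> stolz_double (min \<alpha> \<alpha>') b2 \<Longrightarrow> R2 z = R2' z"
    by (rule R_transform_eq_near_0[OF m(3) R(2) \<alpha> \<beta> R'(2) \<alpha>' \<beta>']) blast
  let ?a = "min \<alpha> \<alpha>'" let ?b = "min b1 b2"
  have ab: "0 < ?a" "0 < ?b" "?a \<le> \<alpha>" "?a \<le> \<alpha>'" "?b \<le> \<beta>" "?b \<le> \<beta>'" using \<alpha> \<alpha>' b1 b2 by auto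
  have "R1 z + R2 z = R1' z + R2' z" if "z \<in> stolz_double ?a ?b" for z

  proof -
    have "z \<in> stolz_double ?a b1" "z \<in> stolz_double ?a b2"
      using that stolz_double_mono[of ?a ?a ?b b1] stolz_double_mono[of ?a ?a ?b b2] by auto
    thus ?thesis using e1[of z] e2[of z] by simp
  qed
  hence "R_transform_on m' ?a ?b (\<lambda>z. R1 z + R2 z)"
    using R_transform_on_mono[OF R'(3) ab(4,6)] R_transform_on_cong[of ?a ?b "\<lambda>z. R1 z + R2 z" "\<lambda>z. R1' z + R2' z" m'] by blast
  thus "m' = m"
    by (rule R_transform_inject[OF m' m(1) ab(1,2) _ R_transform_on_mono[OF R(3) ab(3,5)]])
qed

lemma R_transform_on_return_0: "R_transform_on (return borel 0) \<alpha> \<beta> (\<lambda>_. 0)"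
  unfolding R_transform_on_def
proof (intro conjI ballI)
  fix z assume z: "z \<in> stolz_double \<alpha> \<beta>"
  hence i: "Im z \<noteq> 0" by (simp add: mem_stolz_double)
  thus "1 / z + 0 \<notin> \<real>" by (simp add: complex_is_Real_iff Im_divide)
  show "cauchy_transform (return borel 0) (1 / z + 0) = z"
    unfolding cauchy_transform_def by (subst integral_return) (auto simp: i)
qed auto

text \<open>The index is shifted: k + 1 factors belong to \<kappa> = k. The law for the next
  exponent comes from \<open>line_power\<close>, and \<open>free_conv_eq\<close> identifies it with
  the value of \<open>\<boxplus>\<close>.\<close>

lemma free_conv_power_Suc:
  assumes m: "borel_prob m" and R: "R_transform_on m \<alpha> \<beta> R" and \<alpha>: "0 < \<alpha>" and \<beta>: "0 < \<beta>"
  shows "borel_prob (free_conv_power m (Suc k))"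
    and "w \<in> real_rv.U m (\<lambda>x. x) (real k) \<Longrightarrow>
      real_rv.G (free_conv_power m (Suc k)) (\<lambda>x. x) (real_rv.H m (\<lambda>x. x) (real k) w) = real_rv.G m (\<lambda>x. x) w"
proof -
  have "borel_prob (free_conv_power m (Suc k)) \<and> (\<forall>w. w \<in> real_rv.U m (\<lambda>x. x) (real k) \<longrightarrow>
      real_rv.G (free_conv_power m (Suc k)) (\<lambda>x. x) (real_rv.H m (\<lambda>x. x) (real k) w) = real_rv.G m (\<lambda>x. x) w)"
  proof (induction k)
    case 0
    interpret M: real_rv m "\<lambda>x. x" by (rule borel_prob_real_rv[OF m])
    have b: "borel_prob (return borel (0::real))" by (simp add: borel_prob_def prob_space_return)
    have "free_conv_power m (Suc 0) = m"
      unfolding free_conv_power.simps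
      by (rule free_conv_eq[OF m m b \<alpha> \<beta> R R_transform_on_return_0]) (simp add: R)
    thus ?case by (simp add: m M.H_def)
  next
    case (Suc k)
    obtain b1 where b1: "0 < b1" "b1 \<le> \<beta>" and R1: "R_transform_on (free_conv_power m (Suc k)) \<alpha> b1 (\<lambda>z. of_nat (Suc k) * R z)"
      by (rule R_transform_power[OF m _ R \<alpha> \<beta>, of "free_conv_power m (Suc k)" k]) (use Suc.IH in blast)+
    obtain m' where m': "borel_prob m'" and p: "\<And>w. w \<in> real_rv.U m (\<lambda>x. x) (real (Suc k)) \<Longrightarrow>
      real_rv.G m' (\<lambda>x. x) (real_rv.H m (\<lambda>x. x) (real (Suc k)) w) = real_rv.G m (\<lambda>x. x) w"
      by (rule line_power[OF m, of "real (Suc k)"]) (simp, blast)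
    obtain b2 where b2: "0 < b2" "b2 \<le> \<beta>" and R2: "R_transform_on m' \<alpha> b2 (\<lambda>z. of_nat (Suc (Suc k)) * R z)"
      by (rule R_transform_power[OF m m' R \<alpha> \<beta>, of "Suc k"]) (use p in blast)+
    have b: "0 < min b1 b2" "min b1 b2 \<le> \<beta>" "min b1 b2 \<le> b1" "min b1 b2 \<le> b2" using b1 b2 by auto
    have "R_transform_on m' \<alpha> (min b1 b2) (\<lambda>z. R z + of_nat (Suc k) * R z)"
      using R_transform_on_mono[OF R2 order_refl b(4)] by (simp add: algebra_simps)
    hence "m \<boxplus> free_conv_power m (Suc k) = m'"
      using Suc.IH by (intro free_conv_eq[OF m' m _ \<alpha> b(1) R_transform_on_mono[OF R order_refl b(2)] R_transform_on_mono[OF R1 order_refl b(3)]]) auto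
    hence "free_conv_power m (Suc (Suc k)) = m'" by simp
    thus ?case using m' p by auto
  qed
  thus "borel_prob (free_conv_power m (Suc k))"
    and "w \<in> real_rv.U m (\<lambda>x. x) (real k) \<Longrightarrow>
      real_rv.G (free_conv_power m (Suc k)) (\<lambda>x. x) (real_rv.H m (\<lambda>x. x) (real k) w) = real_rv.G m (\<lambda>x. x) w"
    by blast+
qed

section \<open>The bi-free R-transform near the axes\<close>

lemma holomorphic2_on_slices:
  assumes "holomorphic2_on F S"
  shows "(\<And>z. z \<in> A \<Longrightarrow> (z, w) \<in> S) \<Longrightarrow> (\<lambda>z. F (z, w)) holomorphic_on A"
    and "(\<And>z. z \<in> A \<Longrightarrow> (w, z) \<in> S) \<Longrightarrow> (\<lambda>z. F (w, z)) holomorphic_on A"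
proof -
  assume A: "\<And>z. z \<in> A \<Longrightarrow> (z, w) \<in> S"
  show "(\<lambda>z. F (z, w)) holomorphic_on A"
    unfolding holomorphic_on_def
  proof
    fix z assume "z \<in> A"
    then obtain a b where "(F has_derivative (\<lambda>v. a * fst v + b * snd v)) (at (z, w))"
      using A assms unfolding holomorphic2_on_def by blast
    moreover have "((\<lambda>z. (z, w)) has_derivative (\<lambda>v. (v, 0))) (at z within A)"
      by (auto intro!: derivative_eq_intros)
    ultimately have "((\<lambda>z. F (z, w)) has_derivative (\<lambda>v. a * fst (v, 0::complex) + b * snd (v, 0::complex))) (at z within A)"
      by (rule has_derivative_compose[rotated])
    thus "(\<lambda>z. F (z, w)) field_differentiable at z within A"
      unfolding field_differentiable_def has_field_derivative_def by (auto intro!: exI[of _ a])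
  qed
next
  assume A: "\<And>z. z \<in> A \<Longrightarrow> (w, z) \<in> S"
  show "(\<lambda>z. F (w, z)) holomorphic_on A"
    unfolding holomorphic_on_def
  proof
    fix z assume "z \<in> A"
    then obtain a b where "(F has_derivative (\<lambda>v. a * fst v + b * snd v)) (at (w, z))"
      using A assms unfolding holomorphic2_on_def by blast
    moreover have "((\<lambda>z. (w, z)) has_derivative (\<lambda>v. (0, v))) (at z within A)"
      by (auto intro!: derivative_eq_intros)
    ultimately have "((\<lambda>z. F (w, z)) has_derivative (\<lambda>v. a * fst (0::complex, v) + b * snd (0::complex, v))) (at z within A)"
      by (rule has_derivative_compose[rotated])
    thus "(\<lambda>z. F (w, z)) field_differentiable at z within A"
      unfolding field_differentiable_def has_field_derivative_def by (auto intro!: exI[of _ b])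
  qed
qed

lemma stolz_double_identity:
  assumes f: "f holomorphic_on stolz_double \<alpha> \<beta>" and ab: "0 < a" "a \<le> \<alpha>" "0 < b" "b \<le> \<beta>"
    and eq: "\<And>z. z \<in> stolz_double a b \<Longrightarrow> f z = c" and z: "z \<in> stolz_double \<alpha> \<beta>"
  shows "f z = c"
proof -
  have key: "f z = c" if S: "open S" "convex S" "S \<subseteq> stolz_double \<alpha> \<beta>" "z \<in> S" and T: "open T" "T \<subseteq> S" "T \<noteq> {}" "T \<subseteq> stolz_double a b" for S T
  proof -
    show ?thesis
    proof (rule analytic_continuation_open[of T S f "\<lambda>_. c"])
      show "connected S" by (rule convex_connected[OF S(2)])
      show "f holomorphic_on S" by (rule holomorphic_on_subset[OF f S(3)])
    qed (use S T eq in auto)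
  qed
  have sub: "stolz_angle a b \<subseteq> stolz_angle \<alpha> \<beta>" "cnj ` stolz_angle a b \<subseteq> cnj ` stolz_angle \<alpha> \<beta>"
    using stolz_double_mono[OF ab(2,4)] by (auto simp: stolz_double_def mem_stolz_angle mem_cnj_stolz_angle)
  have ne: "Complex 0 (- (b / 2)) \<in> stolz_angle a b" using ab by (simp add: mem_stolz_angle)
  from z show ?thesis unfolding stolz_double_def
  proof
    assume "z \<in> stolz_angle \<alpha> \<beta>"
    thus ?thesis
      by (intro key[of "stolz_angle \<alpha> \<beta>" "stolz_angle a b"]) (use sub ne open_convex_stolz_angle in \<open>auto simp: stolz_double_def\<close>)
  next
    assume "z \<in> cnj ` stolz_angle \<alpha> \<beta>"
    thus ?thesis
      by (intro key[of "cnj ` stolz_angle \<alpha> \<beta>" "cnj ` stolz_angle a b"]) (use sub ne open_convex_cnj_stolz_angle in \<open>auto simp: stolz_double_def\<close>)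
  qed
qed

lemma stolz_double_identity2:
  assumes f: "\<And>w. w \<in> stolz_double \<alpha> \<beta> \<Longrightarrow> (\<lambda>z. f z w) holomorphic_on stolz_double \<alpha> \<beta>"
    "\<And>z. z \<in> stolz_double \<alpha> \<beta> \<Longrightarrow> f z holomorphic_on stolz_double \<alpha> \<beta>"
    and ab: "0 < a" "a \<le> \<alpha>" "0 < b" "b \<le> \<beta>"
    and eq: "\<And>z w. z \<in> stolz_double a b \<Longrightarrow> w \<in> stolz_double a b \<Longrightarrow> f z w = c"
    and zw: "z \<in> stolz_double \<alpha> \<beta>" "w \<in> stolz_double \<alpha> \<beta>"
  shows "f z w = c"
proof -
  have "f z w' = c" if w': "w' \<in> stolz_double a b" for w'
    by (rule stolz_double_identity[OF f(1) ab _ zw(1)]) (use stolz_double_mono[OF ab(2,4)] w' eq in auto)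
  from stolz_double_identity[OF f(2)[OF zw(1)] ab this zw(2)] show ?thesis .
qed

text \<open>As t -> 0 the point 1 / (it) + R (it) goes to infinity in a cone. There the planar
  transform times this point tends to the marginal transform, whose value is z, while it times the
  point tends to 1.\<close>

lemma (in planar_law) bifree_h_tendsto:
  assumes ab: "0 < \<alpha>" "0 < \<beta>" and R: "R_transform_on (marginal1 \<mu>) \<alpha> \<beta> R1" "R_transform_on (marginal2 \<mu>) \<alpha> \<beta> R2"
    and z: "z \<in> stolz_double \<alpha> \<beta>"
  shows "((\<lambda>t. bifree_h \<mu> R1 R2 z (Complex 0 t)) \<longlongrightarrow> 1) (at_right 0)"
    and "((\<lambda>t. bifree_h \<mu> R1 R2 (Complex 0 t) z) \<longlongrightarrow> 1) (at_right 0)"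
    and "((\<lambda>t. Complex 0 t * R1 (Complex 0 t)) \<longlongrightarrow> 0) (at_right 0)"
    and "((\<lambda>t. Complex 0 t * R2 (Complex 0 t)) \<longlongrightarrow> 0) (at_right 0)"
proof -
  have z0: "z \<noteq> 0" using z by (auto simp: mem_stolz_double)
  have fl: "filterlim (\<lambda>t. 1 / (2 * t)) at_top (at_right (0::real))" by real_asymp
  have st: "\<forall>\<^sub>F t in at_right 0. Complex 0 t \<in> stolz_double \<alpha> b" if "0 < b" for b
    using eventually_at_right_less[of 0] eventually_at_right_real[OF that]
    by eventually_elim (use ab stolz_point in auto)
  have C0: "filterlim (\<lambda>t. Complex 0 t) (at 0 within stolz_double \<alpha> \<beta>) (at_right 0)"
    unfolding filterlim_at
  proof
    show "\<forall>\<^sub>F t in at_right 0. Complex 0 t \<in> stolz_double \<alpha> \<beta> \<and> Complex 0 t \<noteq> 0"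
      using st[OF ab(2)] by eventually_elim (auto simp: mem_stolz_double complex_eq_iff)
    have "((\<lambda>t. Complex 0 t) \<longlongrightarrow> Complex 0 0) (at_right 0)" by (intro tendsto_intros)
    thus "((\<lambda>t. Complex 0 t) \<longlongrightarrow> 0) (at_right 0)" by (simp add: zero_complex.code)
  qed
  have zR: "((\<lambda>t. Complex 0 t * Q (Complex 0 t)) \<longlongrightarrow> 0) (at_right 0)" if "R_transform_on m \<alpha> \<beta> Q" for m Q
    using that unfolding R_transform_on_def by (intro filterlim_compose[OF _ C0]) blast
  show zR12: "((\<lambda>t. Complex 0 t * R1 (Complex 0 t)) \<longlongrightarrow> 0) (at_right 0)" "((\<lambda>t. Complex 0 t * R2 (Complex 0 t)) \<longlongrightarrow> 0) (at_right 0)"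
    using R zR by blast+
  \<comment> \<open>T stands for the planar transform in the variable that goes to infinity, so that
    both axes are covered by one argument.\<close>
  have key: "((\<lambda>t. T (1 / Complex 0 t + Q (Complex 0 t)) / (z * Complex 0 t)) \<longlongrightarrow> 1) (at_right 0)"
    if Q: "R_transform_on m \<alpha> \<beta> Q"
      and bd: "\<And>\<omega> A B. Im \<omega> \<noteq> 0 \<Longrightarrow> \<bar>Re \<omega>\<bar> \<le> A * \<bar>Im \<omega>\<bar> \<Longrightarrow> B \<le> \<bar>Im \<omega>\<bar> \<Longrightarrow> 0 < B \<Longrightarrow> cmod (\<omega> * T \<omega> - z) \<le> D * ((2 + A) * tb B)"
      and tb: "(tb \<longlongrightarrow> 0) at_top" for m Q T D and tb :: "real \<Rightarrow> real"
  proof -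
    define K where "K t = 1 / Complex 0 t + Q (Complex 0 t)" for t
    obtain b where b: "0 < b" "b \<le> \<beta>" and cb: "\<And>z. z \<in> stolz_double \<alpha> b \<Longrightarrow> 1 / z + Q z \<in> cball (1 / z) (\<bar>Im (1 / z)\<bar> / 2)"
      by (rule R_transform_cball[OF Q ab]) blast
    have "((\<lambda>t. D * ((2 + (2 * \<alpha> + 1)) * tb (1 / (2 * t)))) \<longlongrightarrow> 0) (at_right 0)"
      by (intro tendsto_mult_right_zero filterlim_compose[OF tb fl])
    moreover have "\<forall>\<^sub>F t in at_right 0. cmod (K t * T (K t) - z) \<le> D * ((2 + (2 * \<alpha> + 1)) * tb (1 / (2 * t)))"
      using st[OF b(1)] eventually_at_right_less[of 0]
    proof eventually_elim
      case (elim t)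
      note i = Im_inverse_stolz[OF elim(1) ab(1)]
      have im: "\<bar>Im (1 / Complex 0 t)\<bar> = 1 / t" using elim(2) by (simp add: Im_divide power2_eq_square)
      note c = cone_cball[OF i(2,1) cb[OF elim(1)] less_imp_le[OF ab(1)], folded K_def]
      show ?case by (rule bd[OF c(1,3)]) (use c(4) im elim(2) in \<open>auto simp: field_simps\<close>)
    qed
    ultimately have "((\<lambda>t. K t * T (K t) - z) \<longlongrightarrow> 0) (at_right 0)" by (rule Lim_null_comparison[rotated])
    hence KT: "((\<lambda>t. K t * T (K t)) \<longlongrightarrow> z) (at_right 0)" by (rule LIM_zero_cancel)
    have "((\<lambda>t. (K t * T (K t)) / (z * (1 + Complex 0 t * Q (Complex 0 t)))) \<longlongrightarrow> z / (z * (1 + 0))) (at_right 0)"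
      by (intro tendsto_intros KT zR[OF Q]) (use z0 in auto)
    moreover have "\<forall>\<^sub>F t in at_right 0. (K t * T (K t)) / (z * (1 + Complex 0 t * Q (Complex 0 t))) = T (K t) / (z * Complex 0 t)"
      using st[OF b(1)] eventually_at_right_less[of 0]
    proof eventually_elim
      case (elim t)
      note i = Im_inverse_stolz[OF elim(1) ab(1)]
      note c = cone_cball[OF i(2,1) cb[OF elim(1)] less_imp_le[OF ab(1)], folded K_def]
      have t0: "Complex 0 t \<noteq> 0" using elim(2) by (simp add: complex_eq_iff)
      have K0: "K t \<noteq> 0" using c(1) by auto
      have "1 + Complex 0 t * Q (Complex 0 t) = Complex 0 t * K t" using t0 by (simp add: K_def field_simps)
      thus ?case using K0 by simp
    qed
    ultimately show ?thesis using z0 by (auto simp: K_def intro: Lim_transform_eventually)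
  qed
  have im: "Im (1 / z + R1 z) \<noteq> 0" "Im (1 / z + R2 z) \<noteq> 0"
    using R_transform_Im(1)[OF borel_prob_marginal(1)[OF borel_prob] R(1) z] R_transform_Im(1)[OF borel_prob_marginal(2)[OF borel_prob] R(2) z] by auto
  have G: "A.G (1 / z + R1 z) = z" "B.G (1 / z + R2 z) = z"
    using R_transform_Im(3)[OF borel_prob_marginal(1)[OF borel_prob] R(1) z] R_transform_Im(3)[OF borel_prob_marginal(2)[OF borel_prob] R(2) z]
    unfolding G_marginal[OF borel_prob] by auto
  show "((\<lambda>t. bifree_h \<mu> R1 R2 z (Complex 0 t)) \<longlongrightarrow> 1) (at_right 0)"
    unfolding bifree_h_def
    by (rule key[OF R(2) cauchy_transform2_cone2[OF im(1), unfolded G] B.tB_tendsto])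
  have "((\<lambda>t. cauchy_transform2 \<mu> (1 / Complex 0 t + R1 (Complex 0 t)) (1 / z + R2 z) / (z * Complex 0 t)) \<longlongrightarrow> 1) (at_right 0)"
    by (rule key[OF R(1) cauchy_transform2_cone1[OF im(2), unfolded G] A.tB_tendsto])
  thus "((\<lambda>t. bifree_h \<mu> R1 R2 (Complex 0 t) z) \<longlongrightarrow> 1) (at_right 0)"
    unfolding bifree_h_def by (simp add: mult.commute)
qed

text \<open>The mixed term 1 - 1 / h and one of the marginal terms vanish at the axis. This is how
  the planar R-transform determines those of the marginals.\<close>

lemma bifree_R_transform_limits:
  assumes \<mu>: "borel_prob \<mu>" and ab: "0 < \<alpha>" "0 < \<beta>" and R: "R_transform_on (marginal1 \<mu>) \<alpha> \<beta> R1" "R_transform_on (marginal2 \<mu>) \<alpha> \<beta> R2"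
    and F: "\<And>z w. z \<in> stolz_double \<alpha> \<beta> \<Longrightarrow> w \<in> stolz_double \<alpha> \<beta> \<Longrightarrow>
      F (z, w) = z * R1 z + w * R2 w + (1 - 1 / bifree_h \<mu> R1 R2 z w)"
    and z: "z \<in> stolz_double \<alpha> \<beta>"
  shows "((\<lambda>t. F (z, Complex 0 t)) \<longlongrightarrow> z * R1 z) (at_right 0)" "((\<lambda>t. F (Complex 0 t, z)) \<longlongrightarrow> z * R2 z) (at_right 0)"
proof -
  interpret planar_law \<mu> using \<mu> by (rule planar_law.intro)
  have st: "\<forall>\<^sub>F t in at_right 0. Complex 0 t \<in> stolz_double \<alpha> \<beta>"
    using eventually_at_right_less[of 0] eventually_at_right_real[OF ab(2)]
    by eventually_elim (use ab stolz_point in auto)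
  note l = bifree_h_tendsto[OF ab R z]
  have "((\<lambda>t. z * R1 z + Complex 0 t * R2 (Complex 0 t) + (1 - 1 / bifree_h \<mu> R1 R2 z (Complex 0 t))) \<longlongrightarrow> z * R1 z + 0 + (1 - 1 / 1)) (at_right 0)"
    by (intro tendsto_intros l) auto
  hence "((\<lambda>t. F (z, Complex 0 t)) \<longlongrightarrow> z * R1 z + 0 + (1 - 1 / 1)) (at_right 0)"
    by (rule Lim_transform_eventually) (use st in eventually_elim, use F z in auto)
  thus "((\<lambda>t. F (z, Complex 0 t)) \<longlongrightarrow> z * R1 z) (at_right 0)" by simp
  have "((\<lambda>t. Complex 0 t * R1 (Complex 0 t) + z * R2 z + (1 - 1 / bifree_h \<mu> R1 R2 (Complex 0 t) z)) \<longlongrightarrow> 0 + z * R2 z + (1 - 1 / 1)) (at_right 0)"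
    by (intro tendsto_intros l) auto
  hence "((\<lambda>t. F (Complex 0 t, z)) \<longlongrightarrow> 0 + z * R2 z + (1 - 1 / 1)) (at_right 0)"
    by (rule Lim_transform_eventually) (use st in eventually_elim, use F z in auto)
  thus "((\<lambda>t. F (Complex 0 t, z)) \<longlongrightarrow> z * R2 z) (at_right 0)" by simp
qed

lemma bifree_R_transform_onE:
  assumes "bifree_R_transform_on \<mu> \<alpha> \<beta> F"
  obtains a b R1 R2 where "0 < a" "a \<le> \<alpha>" "0 < b" "b \<le> \<beta>"
    "R_transform_on (marginal1 \<mu>) a b R1" "R_transform_on (marginal2 \<mu>) a b R2"
    "\<And>z w. z \<in> stolz_double a b \<Longrightarrow> w \<in> stolz_double a b \<Longrightarrow> bifree_h \<mu> R1 R2 z w \<noteq> 0 \<and>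
      F (z, w) = z * R1 z + w * R2 w + (1 - 1 / bifree_h \<mu> R1 R2 z w)"
  using assms unfolding bifree_R_transform_on_def product_domain_def by (fastforce simp: split_beta)

lemma free_conv_power_marginals:
  assumes \<mu>: "borel_prob \<mu>" and \<nu>: "borel_prob \<nu>" and ab: "0 < \<alpha>" "0 < \<beta>"
    and F: "bifree_R_transform_on \<mu> \<alpha> \<beta> F" and R: "bifree_R_transform_on \<nu> \<alpha> \<beta> R"
    and eq: "\<And>p. p \<in> product_domain \<alpha> \<beta> \<Longrightarrow> R p = of_nat (Suc k) * F p"
  shows "free_conv_power (marginal1 \<mu>) (Suc k) = marginal1 \<nu>" "free_conv_power (marginal2 \<mu>) (Suc k) = marginal2 \<nu>"
proof -
  obtain a1 b1 Q1 Q2 where 1: "0 < a1" "a1 \<le> \<alpha>" "0 < b1" "b1 \<le> \<beta>"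
    "R_transform_on (marginal1 \<mu>) a1 b1 Q1" "R_transform_on (marginal2 \<mu>) a1 b1 Q2"
    and F': "\<And>z w. z \<in> stolz_double a1 b1 \<Longrightarrow> w \<in> stolz_double a1 b1 \<Longrightarrow> bifree_h \<mu> Q1 Q2 z w \<noteq> 0 \<and>
      F (z, w) = z * Q1 z + w * Q2 w + (1 - 1 / bifree_h \<mu> Q1 Q2 z w)"
    using F by (rule bifree_R_transform_onE) blast
  obtain a2 b2 R1 R2 where 2: "0 < a2" "a2 \<le> \<alpha>" "0 < b2" "b2 \<le> \<beta>"
    "R_transform_on (marginal1 \<nu>) a2 b2 R1" "R_transform_on (marginal2 \<nu>) a2 b2 R2"
    and R': "\<And>z w. z \<in> stolz_double a2 b2 \<Longrightarrow> w \<in> stolz_double a2 b2 \<Longrightarrow> bifree_h \<nu> R1 R2 z w \<noteq> 0 \<and>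
      R (z, w) = z * R1 z + w * R2 w + (1 - 1 / bifree_h \<nu> R1 R2 z w)"
    using R by (rule bifree_R_transform_onE) blast
  define a b where "a = min a1 a2" and "b = min b1 b2"
  have a: "0 < a" "a \<le> a1" "a \<le> a2" and b: "0 < b" "b \<le> b1" "b \<le> b2" using 1 2 by (auto simp: a_def b_def)
  have sub: "z \<in> stolz_double a1 b1 \<and> z \<in> stolz_double a2 b2 \<and> z \<in> stolz_double \<alpha> \<beta>" if "z \<in> stolz_double a b" for z
    using that stolz_double_mono[of a a1 b b1] stolz_double_mono[of a a2 b b2] stolz_double_mono[of a1 \<alpha> b1 \<beta>] a b 1 by auto
  have Q: "R_transform_on (marginal1 \<mu>) a b Q1" "R_transform_on (marginal2 \<mu>) a b Q2"
    using 1(5,6) a b by (auto intro: R_transform_on_mono)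
  have RR: "R_transform_on (marginal1 \<nu>) a b R1" "R_transform_on (marginal2 \<nu>) a b R2"
    using 2(5,6) a b by (auto intro: R_transform_on_mono)
  note mb = borel_prob_marginal[OF \<mu>] and nb = borel_prob_marginal[OF \<nu>]
  have st: "\<forall>\<^sub>F t in at_right 0. Complex 0 t \<in> stolz_double a b"
    using eventually_at_right_less[of 0] eventually_at_right_real[OF b(1)]
    by eventually_elim (use a b stolz_point in auto)
  have nt: "at_right (0::real) \<noteq> bot" by simp
  {
    fix z assume z: "z \<in> stolz_double a b"
    hence z0: "z \<noteq> 0" by (auto simp: mem_stolz_double)
    have lF: "((\<lambda>t. F (z, Complex 0 t)) \<longlongrightarrow> z * Q1 z) (at_right 0)" "((\<lambda>t. F (Complex 0 t, z)) \<longlongrightarrow> z * Q2 z) (at_right 0)"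
      by (rule bifree_R_transform_limits[OF \<mu> a(1) b(1) Q _ z]; use F' sub in blast)+
    have lR: "((\<lambda>t. R (z, Complex 0 t)) \<longlongrightarrow> z * R1 z) (at_right 0)" "((\<lambda>t. R (Complex 0 t, z)) \<longlongrightarrow> z * R2 z) (at_right 0)"
      by (rule bifree_R_transform_limits[OF \<nu> a(1) b(1) RR _ z]; use R' sub in blast)+
    have "((\<lambda>t. R (z, Complex 0 t)) \<longlongrightarrow> of_nat (Suc k) * (z * Q1 z)) (at_right 0)"
      by (rule Lim_transform_eventually[OF tendsto_mult_left[OF lF(1)]])
         (use st in eventually_elim, use sub z eq in \<open>auto simp: product_domain_def\<close>)
    from tendsto_unique[OF nt this lR(1)] have e1: "R1 z = of_nat (Suc k) * Q1 z" using z0 by auto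
    have "((\<lambda>t. R (Complex 0 t, z)) \<longlongrightarrow> of_nat (Suc k) * (z * Q2 z)) (at_right 0)"
      by (rule Lim_transform_eventually[OF tendsto_mult_left[OF lF(2)]])
         (use st in eventually_elim, use sub z eq in \<open>auto simp: product_domain_def\<close>)
    from tendsto_unique[OF nt this lR(2)] have "R2 z = of_nat (Suc k) * Q2 z" using z0 by auto
    note e1 this
  } note e = this
  note f1 = free_conv_power_Suc[OF mb(1) Q(1) a(1) b(1), where k = k] and f2 = free_conv_power_Suc[OF mb(2) Q(2) a(1) b(1), where k = k]
  obtain c1 where c1: "0 < c1" "R_transform_on (free_conv_power (marginal1 \<mu>) (Suc k)) a c1 (\<lambda>z. of_nat (Suc k) * Q1 z)"
    by (rule R_transform_power[OF mb(1) f1(1) Q(1) a(1) b(1) f1(2)]) blast+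
  obtain c2 where c2: "0 < c2" "R_transform_on (free_conv_power (marginal2 \<mu>) (Suc k)) a c2 (\<lambda>z. of_nat (Suc k) * Q2 z)"
    by (rule R_transform_power[OF mb(2) f2(1) Q(2) a(1) b(1) f2(2)]) blast+
  show "free_conv_power (marginal1 \<mu>) (Suc k) = marginal1 \<nu>"
    by (rule R_transform_inject'[OF f1(1) nb(1) c1(2) a(1) c1(1) RR(1) a(1) b(1) _ a(1) b(1)]) (simp add: e)
  show "free_conv_power (marginal2 \<mu>) (Suc k) = marginal2 \<nu>"
    by (rule R_transform_inject'[OF f2(1) nb(2) c2(2) a(1) c2(1) RR(2) a(1) b(1) _ a(1) b(1)]) (simp add: e)
qed

lemma weak_conv_m_const: "weak_conv_m (\<lambda>n. M) M"
  by (simp add: weak_conv_m_def weak_conv_def)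

lemma bifree_infinitely_divisible_limit:
  assumes \<nu>: "borel_prob \<nu>" and ab: "0 < \<alpha>" "0 < \<beta>"
    and id: "bifree_infinitely_divisible \<nu> \<alpha> \<beta> R"
  shows "\<exists>(\<mu> :: nat \<Rightarrow> (real \<times> real) measure) (k :: nat \<Rightarrow> nat).
       (\<forall>n. borel_prob (\<mu> n)) \<and> (\<forall>n. 0 < k n) \<and> \<not> bdd_above (range k) \<and>
       weak_conv_m (\<lambda>n. free_conv_power (marginal1 (\<mu> n)) (k n)) (marginal1 \<nu>) \<and>
       weak_conv_m (\<lambda>n. free_conv_power (marginal2 (\<mu> n)) (k n)) (marginal2 \<nu>) \<and>
       (\<exists>F :: nat \<Rightarrow> complex \<times> complex \<Rightarrow> complex.
          (\<forall>n. bifree_R_transform_on (\<mu> n) \<alpha> \<beta> (F n)) \<and>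
          (\<forall>p\<in>product_domain \<alpha> \<beta>. (\<lambda>n. of_nat (k n) * F n p) \<longlonglongrightarrow> R p))"
proof -
  have R: "bifree_R_transform_on \<nu> \<alpha> \<beta> R" using id by (simp add: bifree_infinitely_divisible_def)
  \<comment> \<open>The definition provides roots of order at least 2, so the sequence starts
    there.\<close>
  have "\<exists>\<mu> F. borel_prob \<mu> \<and> bifree_R_transform_on \<mu> \<alpha> \<beta> F \<and>
           (\<forall>p\<in>product_domain \<alpha> \<beta>. R p = of_nat (Suc (Suc n)) * F p)" for n
    using id unfolding bifree_infinitely_divisible_def by (metis Suc_le_mono le0 numeral_2_eq_2)
  then obtain \<mu> F where \<mu>: "\<And>n. borel_prob (\<mu> n)" and F: "\<And>n. bifree_R_transform_on (\<mu> n) \<alpha> \<beta> (F n)"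
    and eq: "\<And>n p. p \<in> product_domain \<alpha> \<beta> \<Longrightarrow> R p = of_nat (Suc (Suc n)) * F n p"
    by metis
  have m: "free_conv_power (marginal1 (\<mu> n)) (Suc (Suc n)) = marginal1 \<nu>" "free_conv_power (marginal2 (\<mu> n)) (Suc (Suc n)) = marginal2 \<nu>" for n
    by (rule free_conv_power_marginals[OF \<mu> \<nu> ab F R eq]; assumption)+
  have "\<not> bdd_above (range (\<lambda>n. Suc (Suc n)))"
  proof
    assume "bdd_above (range (\<lambda>n. Suc (Suc n)))"
    then obtain M where "\<And>n. Suc (Suc n) \<le> M" by (auto simp: bdd_above_def)
    from this[of M] show False by simp
  qed
  moreover have "(\<lambda>n. of_nat (Suc (Suc n)) * F n p) \<longlonglongrightarrow> R p" if "p \<in> product_domain \<alpha> \<beta>" for p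
    using eq[OF that] by (auto simp del: of_nat_Suc intro!: tendsto_eventually)
  ultimately show ?thesis
    using \<mu> F by (intro exI[of _ \<mu>] exI[of _ "\<lambda>n. Suc (Suc n)"] conjI exI[of _ F]) (auto simp only: m weak_conv_m_const)
qed

section \<open>Limit theorem\<close>

text \<open>The Lipschitz constant is independent of the law; hence evaluation points that vary with
  n can be replaced by their limit. \<open>norm_cauchy_transform2_diff\<close> does the same in two
  variables.\<close>

lemma (in real_rv) norm_G_diff:
  assumes z: "Im z \<noteq> 0" "Im z' \<noteq> 0"
  shows "cmod (G z - G z') \<le> cmod (z - z') * (1 / \<bar>Im z\<bar> * (1 / \<bar>Im z'\<bar>))"
proof -
  have i: "integrable M (\<lambda>p. res z (f p))" "integrable M (\<lambda>p. res z' (f p))" using z integrable_res by auto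
  have "cmod (G z - G z') = cmod (LINT p|M. res z (f p) - res z' (f p))" using i by (simp add: G_def)
  also have "\<dots> \<le> (LINT p|M. cmod (res z (f p) - res z' (f p)))" by (rule integral_norm_bound)
  also have "\<dots> \<le> (LINT p|M. cmod (z - z') * (1 / \<bar>Im z\<bar> * (1 / \<bar>Im z'\<bar>)))"
  proof (intro integral_mono)
    show "integrable M (\<lambda>p. cmod (res z (f p) - res z' (f p)))" using i by auto
    fix p
    show "cmod (res z (f p) - res z' (f p)) \<le> cmod (z - z') * (1 / \<bar>Im z\<bar> * (1 / \<bar>Im z'\<bar>))"
      unfolding res_diff[OF z] norm_mult mult.assoc norm_minus_commute[of z' z]
      by (intro mult_left_mono mult_mono norm_res_le z) auto
  qed auto
  finally show ?thesis by (simp add: prob_space)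
qed

lemma (in planar_law) norm_cauchy_transform2_diff:
  assumes z: "Im z \<noteq> 0" "Im z' \<noteq> 0" and w: "Im w \<noteq> 0" "Im w' \<noteq> 0"
  shows "cmod (cauchy_transform2 \<mu> z w - cauchy_transform2 \<mu> z' w') \<le>
    cmod (z - z') * (1 / \<bar>Im z\<bar> * (1 / \<bar>Im z'\<bar>) * (1 / \<bar>Im w\<bar>)) + cmod (w - w') * (1 / \<bar>Im z'\<bar> * (1 / \<bar>Im w\<bar> * (1 / \<bar>Im w'\<bar>)))"
    (is "_ \<le> ?B")
proof -
  have i: "integrable \<mu> (\<lambda>p. res z (fst p) * res w (snd p))" "integrable \<mu> (\<lambda>p. res z' (fst p) * res w' (snd p))"
    using z w integrable_res2[OF borel_prob] by auto
  have "cmod (cauchy_transform2 \<mu> z w - cauchy_transform2 \<mu> z' w') = cmod (LINT p|\<mu>. res z (fst p) * res w (snd p) - res z' (fst p) * res w' (snd p))"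
    using i by (simp add: cauchy_transform2_res)
  also have "\<dots> \<le> (LINT p|\<mu>. cmod (res z (fst p) * res w (snd p) - res z' (fst p) * res w' (snd p)))" by (rule integral_norm_bound)
  also have "\<dots> \<le> (LINT p|\<mu>. ?B)"
  proof (intro integral_mono)
    show "integrable \<mu> (\<lambda>p. cmod (res z (fst p) * res w (snd p) - res z' (fst p) * res w' (snd p)))" using i by auto
    fix p
    have "res z (fst p) * res w (snd p) - res z' (fst p) * res w' (snd p)
      = (res z (fst p) - res z' (fst p)) * res w (snd p) + res z' (fst p) * (res w (snd p) - res w' (snd p))"
      by (simp add: algebra_simps)
    also have "\<dots> = (z' - z) * (res z (fst p) * res z' (fst p) * res w (snd p)) + (w' - w) * (res z' (fst p) * (res w (snd p) * res w' (snd p)))"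
      unfolding res_diff[OF z] res_diff[OF w] by (simp add: mult_ac)
    also have "cmod \<dots> \<le> cmod ((z' - z) * (res z (fst p) * res z' (fst p) * res w (snd p))) + cmod ((w' - w) * (res z' (fst p) * (res w (snd p) * res w' (snd p))))"
      by (rule norm_triangle_ineq)
    also have "\<dots> \<le> ?B"
      unfolding norm_mult norm_minus_commute[of z' z] norm_minus_commute[of w' w]
      by (intro add_mono mult_left_mono mult_mono norm_res_le z w) auto
    finally show "cmod (res z (fst p) * res w (snd p) - res z' (fst p) * res w' (snd p)) \<le> ?B" .
  qed auto
  finally show ?thesis by (simp add: A.prob_space)
qed

text \<open>The resolvent in the coordinate \<open>x = 1 / 2 + arctan s / \<pi>\<close>; it extends continuously by 0 to the points at infinity.\<close>

definition cres :: "complex \<Rightarrow> real \<Rightarrow> complex" where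
  "cres z x = of_real (cos (pi * (x - 1 / 2))) / (z * of_real (cos (pi * (x - 1 / 2))) - of_real (sin (pi * (x - 1 / 2))))"

lemma continuous_cres: "Im z \<noteq> 0 \<Longrightarrow> continuous_on S (cres z)"
  unfolding cres_def[abs_def] using half_plane_denom[of z] by (intro continuous_intros) auto

lemma cres_measurable [measurable]: "cres z \<in> borel_measurable borel"
  unfolding cres_def[abs_def] by measurable

lemma cres_tan: "cos (pi * (x - 1 / 2)) \<noteq> 0 \<Longrightarrow> cres z x = res z (tan (pi * (x - 1 / 2)))"
proof -
  assume c: "cos (pi * (x - 1 / 2)) \<noteq> 0"
  define a b where "a = complex_of_real (cos (pi * (x - 1 / 2)))" and "b = complex_of_real (sin (pi * (x - 1 / 2)))"
  have "a \<noteq> 0" using c by (simp add: a_def)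
  hence "a / (z * a - b) = 1 / (z - b / a)" by (simp add: divide_simps)
  thus ?thesis by (simp add: cres_def res_def tan_def a_def b_def)
qed

lemma cres_arctan: "cres z (1 / 2 + arctan s / pi) = res z s"
proof -
  have "pi * (1 / 2 + arctan s / pi - 1 / 2) = arctan s" by simp
  thus ?thesis using cres_tan[of "1 / 2 + arctan s / pi" z] by (simp add: tan_arctan)
qed

lemma norm_cres_cone:
  assumes z: "Im z \<noteq> 0" and A: "\<bar>Re z\<bar> \<le> A * \<bar>Im z\<bar>" shows "cmod (z * cres z x) \<le> 3 + A"
proof (cases "cos (pi * (x - 1 / 2)) = 0")
  case True
  have "0 \<le> A" using A z by (smt (verit) abs_ge_zero mult_neg_pos zero_less_abs_iff)
  thus ?thesis using True by (simp add: cres_def)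
next
  case False
  define s where "s = tan (pi * (x - 1 / 2))"
  have A0: "0 \<le> A" using A z by (smt (verit) abs_ge_zero mult_neg_pos zero_less_abs_iff)
  have "cmod (of_real s * res z s) \<le> (2 + A) * min 1 (\<bar>s\<bar> / \<bar>Im z\<bar>)"
    by (rule norm_res_cone[OF z A]) (use z in auto)
  also have "\<dots> \<le> (2 + A) * 1" using A0 by (intro mult_left_mono) auto
  finally have "cmod (1 + of_real s * res z s) \<le> 1 + (2 + A)"
    using norm_triangle_ineq[of 1 "of_real s * res z s"] by simp
  thus ?thesis unfolding cres_tan[OF False] s_def[symmetric] mult_res[OF z] by simp
qed

text \<open>At finite points w times the resolvent tends to 1, and at infinity \<open>cres\<close>
  vanishes; so the limit of the integrals is the mass of the finite points. The value 1 leaves no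
  mass at infinity.\<close>

lemma no_mass_at_infinity:
  assumes \<rho>: "borel_prob \<rho>" and f [measurable]: "f \<in> borel_measurable \<rho>"
    and w: "\<And>j. Im (w j) \<noteq> 0" "\<And>j. \<bar>Re (w j)\<bar> \<le> A * \<bar>Im (w j)\<bar>" "filterlim (\<lambda>j. \<bar>Im (w j)\<bar>) at_top sequentially"
    and lim: "(\<lambda>j. w j * (LINT p|\<rho>. cres (w j) (f p))) \<longlonglongrightarrow> 1"
  shows "AE p in \<rho>. cos (pi * (f p - 1 / 2)) \<noteq> 0"
proof -
  interpret prob_space \<rho> using \<rho> by (simp add: borel_prob_def)
  define E where "E = {p \<in> space \<rho>. cos (pi * (f p - 1 / 2)) \<noteq> 0}"
  have [measurable]: "E \<in> sets \<rho>" unfolding E_def by measurable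
  have "(\<lambda>j. LINT p|\<rho>. w j * cres (w j) (f p)) \<longlonglongrightarrow> (LINT p|\<rho>. of_real (indicator E p))"
  proof (rule integral_dominated_convergence[where w="\<lambda>_. 3 + A"])
    show "AE p in \<rho>. cmod (w j * cres (w j) (f p)) \<le> 3 + A" for j
      using norm_cres_cone[OF w(1,2)] by simp
    show "AE p in \<rho>. (\<lambda>j. w j * cres (w j) (f p)) \<longlonglongrightarrow> of_real (indicator E p)"
    proof (rule AE_I2)
      fix p assume p: "p \<in> space \<rho>"
      show "(\<lambda>j. w j * cres (w j) (f p)) \<longlonglongrightarrow> of_real (indicator E p)"
      proof (cases "p \<in> E")
        case False
        thus ?thesis using p by (simp add: E_def cres_def)
      next
        case True
        define s where "s = tan (pi * (f p - 1 / 2))"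
        have "(\<lambda>j. \<bar>s\<bar> * inverse \<bar>Im (w j)\<bar>) \<longlonglongrightarrow> \<bar>s\<bar> * 0"
          by (intro tendsto_intros tendsto_inverse_0_at_top w(3))
        hence "(\<lambda>j. of_real s * res (w j) s) \<longlonglongrightarrow> 0"
          by (rule Lim_null_comparison[rotated, OF tendsto_eq_rhs])
             (use norm_res_le[OF w(1)] in \<open>auto simp: norm_mult inverse_eq_divide simp del: times_divide_eq_right intro!: always_eventually mult_left_mono\<close>)
        hence "(\<lambda>j. 1 + of_real s * res (w j) s) \<longlonglongrightarrow> 1 + 0" by (intro tendsto_intros)
        thus ?thesis using True cres_tan[of "f p"] by (simp add: E_def s_def mult_res[OF w(1)])
      qed
    qed
  qed auto
  hence "(\<lambda>j. w j * (LINT p|\<rho>. cres (w j) (f p))) \<longlonglongrightarrow> of_real (prob E)" by simp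
  from LIMSEQ_unique[OF this lim] have "prob E = 1" by (metis of_real_eq_1_iff)
  hence "AE p in \<rho>. p \<in> E" by (rule AE_prob_1)
  thus ?thesis by eventually_elim (simp add: E_def)
qed

text \<open>The compactified laws always have a weak limit point. On Z the inverse transforms
  \<zeta>1, \<zeta>2 of the laws converge to K1, K2, so the equation G (\<zeta> z) = z passes to the
  limit; the points u j, at which K1 and K2 behave like 1 / z near infinity, exclude mass at
  infinity.\<close>

theorem planar_laws_compact:
  fixes \<nu> :: "nat \<Rightarrow> (real \<times> real) measure"
  assumes \<nu>: "\<And>n. borel_prob (\<nu> n)"
    and Im_z1: "\<And>n z. z \<in> Z \<Longrightarrow> Im (\<zeta>1 n z) \<noteq> 0" and Im_K1: "\<And>z. z \<in> Z \<Longrightarrow> Im (K1 z) \<noteq> 0"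
    and lim1: "\<And>z. z \<in> Z \<Longrightarrow> (\<lambda>n. \<zeta>1 n z) \<longlonglongrightarrow> K1 z"
    and G1: "\<And>n z. z \<in> Z \<Longrightarrow> real_rv.G (\<nu> n) fst (\<zeta>1 n z) = z"
    and Im_z2: "\<And>n z. z \<in> Z \<Longrightarrow> Im (\<zeta>2 n z) \<noteq> 0" and Im_K2: "\<And>z. z \<in> Z \<Longrightarrow> Im (K2 z) \<noteq> 0"
    and lim2: "\<And>z. z \<in> Z \<Longrightarrow> (\<lambda>n. \<zeta>2 n z) \<longlonglongrightarrow> K2 z"
    and G2: "\<And>n z. z \<in> Z \<Longrightarrow> real_rv.G (\<nu> n) snd (\<zeta>2 n z) = z"
    and u: "\<And>j. u j \<in> Z"
    and cone1: "\<And>j. \<bar>Re (K1 (u j))\<bar> \<le> A * \<bar>Im (K1 (u j))\<bar>" "filterlim (\<lambda>j. \<bar>Im (K1 (u j))\<bar>) at_top sequentially" "(\<lambda>j. K1 (u j) * u j) \<longlonglongrightarrow> 1"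
    and cone2: "\<And>j. \<bar>Re (K2 (u j))\<bar> \<le> A * \<bar>Im (K2 (u j))\<bar>" "filterlim (\<lambda>j. \<bar>Im (K2 (u j))\<bar>) at_top sequentially" "(\<lambda>j. K2 (u j) * u j) \<longlonglongrightarrow> 1"
  obtains r :: "nat \<Rightarrow> nat" and \<nu>' where "strict_mono r" "borel_prob \<nu>'"
    "\<And>z. z \<in> Z \<Longrightarrow> real_rv.G \<nu>' fst (K1 z) = z" "\<And>z. z \<in> Z \<Longrightarrow> real_rv.G \<nu>' snd (K2 z) = z"
    "\<And>z w. z \<in> Z \<Longrightarrow> w \<in> Z \<Longrightarrow> (\<lambda>n. cauchy_transform2 (\<nu> (r n)) (\<zeta>1 (r n) z) (\<zeta>2 (r n) w)) \<longlonglongrightarrow> cauchy_transform2 \<nu>' (K1 z) (K2 w)"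
proof -
  interpret N: planar_law "\<nu> n" for n using \<nu> by (rule planar_law.intro)
  define c where "c s = 1 / 2 + arctan s / pi" for s
  define S where "S p = (c (fst p), c (snd p))" for p
  have c01: "c s \<in> {0..<1}" for s
    using arctan_ubound[of s] arctan_lbound[of s] pi_gt_zero by (simp add: c_def field_simps)
  have [measurable]: "c \<in> borel_measurable borel" unfolding c_def[abs_def] by measurable
  have S_borel: "S \<in> borel_measurable borel" unfolding S_def[abs_def] by measurable
  have sets: "sets (\<nu> n) = sets borel" for n using \<nu> by (simp add: borel_prob_def)
  have S_meas: "S \<in> borel_measurable (\<nu> n)" for n using S_borel measurable_cong_sets[OF sets refl] by blast
  define M where "M n = distr (\<nu> n) borel S" for n
  have M: "borel_prob (M n)" for n
    using N.A.prob_space_distr[OF S_meas] by (simp add: borel_prob_def M_def)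
  have supp: "AE p in M n. p \<in> {0..<1} \<times> {0..<1}" for n
    unfolding M_def
  proof (subst AE_distr_iff[OF S_meas])
    have "{0..<1} \<times> {0..<1} \<in> sets (borel \<Otimes>\<^sub>M borel :: (real \<times> real) measure)" by (intro pair_measureI) auto
    hence "{0..<1} \<times> {0..<1} \<in> sets (borel :: (real \<times> real) measure)" by (simp only: borel_prod)
    thus "{p \<in> space borel. p \<in> {0..<1 :: real} \<times> {0..<1 :: real}} \<in> sets borel" by (simp only: space_borel UNIV_I simp_thms Collect_mem_eq)
    show "AE p in \<nu> n. S p \<in> {0..<1} \<times> {0..<1}" using c01 by (simp add: S_def)
  qed
  have int_M: "(LINT p|M n. f p) = (LINT p|\<nu> n. f (S p))" if "continuous_on UNIV f" for f :: "real \<times> real \<Rightarrow> complex" and n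
    unfolding M_def by (rule integral_distr[OF S_meas borel_measurable_continuous_onI[OF that]])
  obtain r \<rho> where r: "strict_mono (r :: nat \<Rightarrow> nat)" and \<rho>: "borel_prob \<rho>"
    and lim: "\<And>f :: real \<times> real \<Rightarrow> complex. continuous_on UNIV f \<Longrightarrow> (\<lambda>n. LINT p|M (r n). f p) \<longlonglongrightarrow> (LINT p|\<rho>. f p)"
    by (rule weakly_compact_square[of M, OF M supp]) blast
  interpret R: planar_law \<rho> using \<rho> by (rule planar_law.intro)
  have cont1: "continuous_on UNIV (\<lambda>p. cres a (fst p))" "continuous_on UNIV (\<lambda>p. cres a (snd p))" if "Im a \<noteq> 0" for a
    by (rule continuous_on_compose2[OF continuous_cres[OF that, of UNIV] continuous_on_fst[OF continuous_on_id]]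
          continuous_on_compose2[OF continuous_cres[OF that, of UNIV] continuous_on_snd[OF continuous_on_id]]; simp)+
  have c_res: "cres a (c s) = res a s" for a s by (simp add: c_def cres_arctan)
  have limG: "(\<lambda>n. N.A.G (r n) a) \<longlonglongrightarrow> (LINT p|\<rho>. cres a (fst p))" "(\<lambda>n. N.B.G (r n) a) \<longlonglongrightarrow> (LINT p|\<rho>. cres a (snd p))" if "Im a \<noteq> 0" for a
    using lim[OF cont1(1)[OF that]] lim[OF cont1(2)[OF that]]
    by (simp_all add: int_M[OF cont1(1)[OF that]] int_M[OF cont1(2)[OF that]] S_def c_res N.A.G_def N.B.G_def)
  have lim2D: "(\<lambda>n. cauchy_transform2 (\<nu> (r n)) a b) \<longlonglongrightarrow> (LINT p|\<rho>. cres a (fst p) * cres b (snd p))" if "Im a \<noteq> 0" "Im b \<noteq> 0" for a b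
  proof -
    have "continuous_on UNIV (\<lambda>p. cres a (fst p) * cres b (snd p))" by (intro continuous_intros cont1 that)
    from lim[OF this] show ?thesis by (simp add: int_M[OF \<open>continuous_on UNIV (\<lambda>p. cres a (fst p) * cres b (snd p))\<close>] S_def c_res cauchy_transform2_res)
  qed
  have Im_lim: "(\<lambda>n. 1 / \<bar>Im (\<zeta> (r n))\<bar>) \<longlonglongrightarrow> 1 / \<bar>Im k\<bar>" "(\<lambda>n. cmod (\<zeta> (r n) - k)) \<longlonglongrightarrow> 0" if "\<zeta> \<longlonglongrightarrow> k" "Im k \<noteq> 0" for \<zeta> k
  proof -
    have l: "(\<lambda>n. \<zeta> (r n)) \<longlonglongrightarrow> k" using LIMSEQ_subseq_LIMSEQ[OF that(1) r] by (simp add: o_def)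
    show "(\<lambda>n. 1 / \<bar>Im (\<zeta> (r n))\<bar>) \<longlonglongrightarrow> 1 / \<bar>Im k\<bar>" using that(2) by (intro tendsto_intros l) auto
    have "(\<lambda>n. cmod (\<zeta> (r n) - k)) \<longlonglongrightarrow> cmod (k - k)" by (intro tendsto_intros l)
    thus "(\<lambda>n. cmod (\<zeta> (r n) - k)) \<longlonglongrightarrow> 0" by simp
  qed
  have eq1: "(LINT p|\<rho>. cres (K1 z) (fst p)) = z" if z: "z \<in> Z" for z
  proof -
    note l = Im_lim[OF lim1[OF z] Im_K1[OF z]]
    have "(\<lambda>n. cmod (\<zeta>1 (r n) z - K1 z) * (1 / \<bar>Im (\<zeta>1 (r n) z)\<bar> * (1 / \<bar>Im (K1 z)\<bar>))) \<longlonglongrightarrow> 0 * (1 / \<bar>Im (K1 z)\<bar> * (1 / \<bar>Im (K1 z)\<bar>))"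
      by (intro tendsto_intros l)
    hence "(\<lambda>n. cmod (\<zeta>1 (r n) z - K1 z) * (1 / \<bar>Im (\<zeta>1 (r n) z)\<bar> * (1 / \<bar>Im (K1 z)\<bar>))) \<longlonglongrightarrow> 0" by simp
    hence "(\<lambda>n. N.A.G (r n) (\<zeta>1 (r n) z) - N.A.G (r n) (K1 z)) \<longlonglongrightarrow> 0"
      by (rule Lim_null_comparison[rotated]) (intro always_eventually allI N.A.norm_G_diff Im_z1[OF z] Im_K1[OF z])
    from tendsto_add[OF this limG(1)[OF Im_K1[OF z]]] show ?thesis by (simp add: G1[OF z] LIMSEQ_const_iff)
  qed
  have eq2: "(LINT p|\<rho>. cres (K2 z) (snd p)) = z" if z: "z \<in> Z" for z
  proof -
    note l = Im_lim[OF lim2[OF z] Im_K2[OF z]]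
    have "(\<lambda>n. cmod (\<zeta>2 (r n) z - K2 z) * (1 / \<bar>Im (\<zeta>2 (r n) z)\<bar> * (1 / \<bar>Im (K2 z)\<bar>))) \<longlonglongrightarrow> 0 * (1 / \<bar>Im (K2 z)\<bar> * (1 / \<bar>Im (K2 z)\<bar>))"
      by (intro tendsto_intros l)
    hence "(\<lambda>n. cmod (\<zeta>2 (r n) z - K2 z) * (1 / \<bar>Im (\<zeta>2 (r n) z)\<bar> * (1 / \<bar>Im (K2 z)\<bar>))) \<longlonglongrightarrow> 0" by simp
    hence "(\<lambda>n. N.B.G (r n) (\<zeta>2 (r n) z) - N.B.G (r n) (K2 z)) \<longlonglongrightarrow> 0"
      by (rule Lim_null_comparison[rotated]) (intro always_eventually allI N.B.norm_G_diff Im_z2[OF z] Im_K2[OF z])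
    from tendsto_add[OF this limG(2)[OF Im_K2[OF z]]] show ?thesis by (simp add: G2[OF z] LIMSEQ_const_iff)
  qed
  have null1: "AE p in \<rho>. cos (pi * (fst p - 1 / 2)) \<noteq> 0"
    by (rule no_mass_at_infinity[OF \<rho> R.A.f_measurable Im_K1[OF u] cone1(1,2)]) (simp add: eq1[OF u] cone1(3))
  have null2: "AE p in \<rho>. cos (pi * (snd p - 1 / 2)) \<noteq> 0"
    by (rule no_mass_at_infinity[OF \<rho> R.B.f_measurable Im_K2[OF u] cone2(1,2)]) (simp add: eq2[OF u] cone2(3))
  define T where "T p = (tan (pi * (fst p - 1 / 2)), tan (pi * (snd p - 1 / 2)))" for p :: "real \<times> real"
  have T: "T \<in> borel_measurable \<rho>" unfolding T_def[abs_def] tan_def by measurable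
  define \<nu>' where "\<nu>' = distr \<rho> borel T"
  have \<nu>': "borel_prob \<nu>'" using R.A.prob_space_distr[OF T] by (simp add: borel_prob_def \<nu>'_def)
  interpret N': planar_law \<nu>' using \<nu>' by (rule planar_law.intro)
  have int_T: "(LINT p|\<nu>'. f p) = (LINT p|\<rho>. f (T p))" if "f \<in> borel_measurable borel" for f :: "real \<times> real \<Rightarrow> complex"
    unfolding \<nu>'_def by (rule integral_distr[OF T that])
  have G1': "N'.A.G a = (LINT p|\<rho>. cres a (fst p))" for a
  proof -
    have "N'.A.G a = (LINT p|\<rho>. res a (fst (T p)))" unfolding N'.A.G_def by (rule int_T) measurable
    also have "\<dots> = (LINT p|\<rho>. cres a (fst p))"
    proof (rule integral_cong_AE)
      show "AE p in \<rho>. res a (fst (T p)) = cres a (fst p)" using null1 by eventually_elim (simp add: T_def cres_tan)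
    qed (use T in measurable)
    finally show ?thesis .
  qed
  have G2': "N'.B.G a = (LINT p|\<rho>. cres a (snd p))" for a
  proof -
    have "N'.B.G a = (LINT p|\<rho>. res a (snd (T p)))" unfolding N'.B.G_def by (rule int_T) measurable
    also have "\<dots> = (LINT p|\<rho>. cres a (snd p))"
    proof (rule integral_cong_AE)
      show "AE p in \<rho>. res a (snd (T p)) = cres a (snd p)" using null2 by eventually_elim (simp add: T_def cres_tan)
    qed (use T in measurable)
    finally show ?thesis .
  qed
  have C': "cauchy_transform2 \<nu>' a b = (LINT p|\<rho>. cres a (fst p) * cres b (snd p))" for a b
  proof -
    have "cauchy_transform2 \<nu>' a b = (LINT p|\<rho>. res a (fst (T p)) * res b (snd (T p)))" unfolding cauchy_transform2_res by (rule int_T) measurable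
    also have "\<dots> = (LINT p|\<rho>. cres a (fst p) * cres b (snd p))"
    proof (rule integral_cong_AE)
      show "AE p in \<rho>. res a (fst (T p)) * res b (snd (T p)) = cres a (fst p) * cres b (snd p)"
        using null1 null2 by eventually_elim (simp add: T_def cres_tan)
    qed (use T in measurable)
    finally show ?thesis .
  qed
  show thesis
  proof (rule that[OF r \<nu>'])
    fix z assume z: "z \<in> Z"
    show "N'.A.G (K1 z) = z" "N'.B.G (K2 z) = z" using eq1[OF z] eq2[OF z] by (simp_all add: G1' G2')
  next
    fix z w assume z: "z \<in> Z" and w: "w \<in> Z"
    note l1 = Im_lim[OF lim1[OF z] Im_K1[OF z]] and l2 = Im_lim[OF lim2[OF w] Im_K2[OF w]]
    let ?D = "\<lambda>n. cmod (\<zeta>1 (r n) z - K1 z) * (1 / \<bar>Im (\<zeta>1 (r n) z)\<bar> * (1 / \<bar>Im (K1 z)\<bar>) * (1 / \<bar>Im (\<zeta>2 (r n) w)\<bar>))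
      + cmod (\<zeta>2 (r n) w - K2 w) * (1 / \<bar>Im (K1 z)\<bar> * (1 / \<bar>Im (\<zeta>2 (r n) w)\<bar> * (1 / \<bar>Im (K2 w)\<bar>)))"
    have "?D \<longlonglongrightarrow> 0 * (1 / \<bar>Im (K1 z)\<bar> * (1 / \<bar>Im (K1 z)\<bar>) * (1 / \<bar>Im (K2 w)\<bar>)) + 0 * (1 / \<bar>Im (K1 z)\<bar> * (1 / \<bar>Im (K2 w)\<bar> * (1 / \<bar>Im (K2 w)\<bar>)))"
      by (intro tendsto_intros l1 l2)
    hence "?D \<longlonglongrightarrow> 0" by simp
    hence "(\<lambda>n. cauchy_transform2 (\<nu> (r n)) (\<zeta>1 (r n) z) (\<zeta>2 (r n) w) - cauchy_transform2 (\<nu> (r n)) (K1 z) (K2 w)) \<longlonglongrightarrow> 0"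
      by (rule Lim_null_comparison[rotated])
         (intro always_eventually allI N.norm_cauchy_transform2_diff Im_z1[OF z] Im_K1[OF z] Im_z2[OF w] Im_K2[OF w])
    from tendsto_add[OF this lim2D[OF Im_K1[OF z] Im_K2[OF w]]]
    show "(\<lambda>n. cauchy_transform2 (\<nu> (r n)) (\<zeta>1 (r n) z) (\<zeta>2 (r n) w)) \<longlonglongrightarrow> cauchy_transform2 \<nu>' (K1 z) (K2 w)"
      by (simp add: C')
  qed
qed

text \<open>Yields R-transforms of the roots on a domain common to all late n. By weak convergence
  the k-fold powers have R-transforms Rn on a common Stolz angle; the point subordinated to 1 / z +
  Rn z is 1 / z + Rn z / k, and the transform of the root takes the value z there.\<close>

lemma free_conv_root_R_transform:
  assumes m: "\<And>n. borel_prob (mn n)" "borel_prob m" and Q: "\<And>n. \<exists>a b Q. 0 < a \<and> 0 < b \<and> R_transform_on (mn n) a b Q"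
    and k: "\<And>n. 0 < k n" and conv: "weak_conv_m (\<lambda>n. free_conv_power (mn n) (k n)) m"
    and R: "R_transform_on m \<alpha> \<beta> R" and ab: "0 < \<alpha>" "0 < \<beta>"
  obtains \<beta>' N L where "0 < \<beta>'" "\<beta>' \<le> \<beta>" "\<And>n. N \<le> n \<Longrightarrow> R_transform_on (mn n) \<alpha> \<beta>' (L n)"
    "\<And>n z. N \<le> n \<Longrightarrow> z \<in> stolz_double \<alpha> \<beta>' \<Longrightarrow> Im (1 / z + of_nat (k n) * L n z) * Im z < 0"
    "\<And>z. z \<in> stolz_double \<alpha> \<beta>' \<Longrightarrow> (\<lambda>n. of_nat (k n) * L n z) \<longlonglongrightarrow> R z"
proof -
  have kS: "k n = Suc (k n - 1)" for n using k[of n] by simp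
  have p: "borel_prob (free_conv_power (mn n) (k n))" for n
    using Q[of n] free_conv_power_Suc(1)[OF m(1)] kS by metis
  have rel: "real_rv.G (free_conv_power (mn n) (k n)) (\<lambda>x. x) (real_rv.H (mn n) (\<lambda>x. x) (real (k n - 1)) w) = real_rv.G (mn n) (\<lambda>x. x) w"
    if "w \<in> real_rv.U (mn n) (\<lambda>x. x) (real (k n - 1))" for n w
  proof -
    obtain a b Q' where q: "R_transform_on (mn n) a b Q'" "0 < a" "0 < b" using Q by blast
    show ?thesis using free_conv_power_Suc(2)[OF m(1) q that] kS[of n] by simp
  qed
  obtain \<beta>' N Rn where b: "0 < \<beta>'" "\<beta>' \<le> \<beta>" and Rn: "\<And>n. N \<le> n \<Longrightarrow> R_transform_on (free_conv_power (mn n) (k n)) \<alpha> \<beta>' (Rn n)"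
    and lim: "\<And>z. z \<in> stolz_double \<alpha> \<beta>' \<Longrightarrow> (\<lambda>n. Rn n z) \<longlonglongrightarrow> R z"
    by (rule weak_conv_R_transform[OF p m(2) conv R ab]) blast
  define L where "L n z = Rn n z / of_nat (k n)" for n z
  have kL: "of_nat (k n) * L n z = Rn n z" for n z using k[of n] by (simp add: L_def)
  show thesis
  proof (rule that[OF b])
    fix n assume n: "N \<le> n"
    interpret M: real_rv "mn n" "\<lambda>x. x" by (rule borel_prob_real_rv[OF m(1)])
    show "R_transform_on (mn n) \<alpha> \<beta>' (L n)" unfolding R_transform_on_def
    proof (intro conjI ballI)
      have "(\<lambda>z. Rn n z / of_nat (k n)) holomorphic_on stolz_double \<alpha> \<beta>'"
        using Rn[OF n] k[of n] unfolding R_transform_on_def by (intro holomorphic_intros) auto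
      thus "L n holomorphic_on stolz_double \<alpha> \<beta>'" by (simp add: L_def[abs_def])
      have "((\<lambda>z. (z * Rn n z) / of_nat (k n)) \<longlongrightarrow> 0 / of_nat (k n)) (at 0 within stolz_double \<alpha> \<beta>')"
        using Rn[OF n] k[of n] unfolding R_transform_on_def by (intro tendsto_intros) auto
      thus "((\<lambda>z. z * L n z) \<longlongrightarrow> 0) (at 0 within stolz_double \<alpha> \<beta>')" by (simp add: L_def)
    next
      fix z assume z: "z \<in> stolz_double \<alpha> \<beta>'"
      note i = R_transform_Im[OF p Rn[OF n] z]
      define w where "w = M.subord (real (k n - 1)) (1 / z + Rn n z)"
      have wU: "w \<in> M.U (real (k n - 1))" unfolding w_def by (rule M.subord_in_U[OF _ i(1)]) simp
      have Hw: "M.H (real (k n - 1)) w = 1 / z + Rn n z" unfolding w_def by (rule M.H_subord[OF _ i(1)]) simp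
      have G: "M.G w = z" using rel[OF wU] unfolding Hw i(3) by (rule sym)
      \<comment> \<open>As G w = z, the left-hand side of \<open>Hw\<close> is k w - (k - 1) /
        z.\<close>
      have "w * of_nat (k n) = 1 / z * of_nat (k n) + Rn n z"
        using Hw kS[of n] G k[of n] by (simp add: M.H_def M.h_def algebra_simps of_nat_diff)
      hence w: "w = 1 / z + L n z" using k[of n] by (simp add: L_def field_simps)
      show "1 / z + L n z \<notin> \<real>" using M.U_Im(1)[OF wU] unfolding w complex_is_Real_iff .
      show "cauchy_transform (mn n) (1 / z + L n z) = z" unfolding cauchy_transform_eq[OF m(1)] using G w by simp
    qed
    fix z assume z: "z \<in> stolz_double \<alpha> \<beta>'"
    show "Im (1 / z + of_nat (k n) * L n z) * Im z < 0" unfolding kL using R_transform_Im(2)[OF p Rn[OF n] z] .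
  next
    fix z assume z: "z \<in> stolz_double \<alpha> \<beta>'"
    show "(\<lambda>n. of_nat (k n) * L n z) \<longlonglongrightarrow> R z" unfolding kL by (rule lim[OF z])
  qed
qed

text \<open>The point is a convex combination of 1 / z and 1 / z + w, which both lie in the
  half-plane opposite to z.\<close>

lemma Im_convex_inverse:
  assumes z: "Im z \<noteq> 0" and w: "Im (1 / z + w) * Im z < 0" and t: "0 \<le> t" "t \<le> 1"
  shows "Im (1 / z + of_real t * w) * Im z < 0"
proof -
  have "Im (1 / z) * Im z = - (Im z)\<^sup>2 / ((Re z)\<^sup>2 + (Im z)\<^sup>2)" by (simp add: Im_divide power2_eq_square)
  moreover have "0 < (Im z)\<^sup>2 / ((Re z)\<^sup>2 + (Im z)\<^sup>2)"
    using z by (intro divide_pos_pos add_nonneg_pos) auto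
  ultimately have i: "Im (1 / z) * Im z < 0" by simp
  have e: "Im (1 / z + of_real t * w) * Im z = (1 - t) * (Im (1 / z) * Im z) + t * (Im (1 / z + w) * Im z)"
    by (simp add: algebra_simps)
  show ?thesis
  proof (cases "t = 0")
    case True thus ?thesis using i by simp
  next
    case False
    hence "t * (Im (1 / z + w) * Im z) < 0" using w t by (simp add: mult_less_0_iff)
    moreover have "(1 - t) * (Im (1 / z) * Im z) \<le> 0" by (rule mult_nonneg_nonpos[OF _ less_imp_le[OF i]]) (use t in simp)
    ultimately show ?thesis unfolding e by simp
  qed
qed

text \<open>The half-plane condition is assumed for the k-th point only; convexity gives it for all
  smaller positive exponents, so the domain does not shrink with the exponent.\<close>

lemma (in real_rv) power_point:
  assumes z: "Im z \<noteq> 0" and G: "G (1 / z + L) = z" and k: "Im (1 / z + of_nat k * L) * Im z < 0" and j: "Suc j \<le> k"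
  shows "Im (1 / z + of_nat (Suc j) * L) * Im z < 0" "1 / z + L \<in> U (real j)" "H (real j) (1 / z + L) = 1 / z + of_nat (Suc j) * L"
proof -
  have k0: "real k \<noteq> 0" using j by simp
  have sc: "Im (1 / z + of_nat i * L) * Im z < 0" if "i \<le> k" for i
  proof -
    have "of_nat i * L = of_real (real i / real k) * (of_nat k * L)" using k0 by simp
    moreover have "0 \<le> real i / real k" "real i / real k \<le> 1" using that j by auto
    ultimately show ?thesis using Im_convex_inverse[OF z k] by metis
  qed
  show 1: "Im (1 / z + of_nat (Suc j) * L) * Im z < 0" by (rule sc[OF j])
  have 2: "Im (1 / z + L) * Im z < 0" using sc[of 1] j by simp
  show 3: "H (real j) (1 / z + L) = 1 / z + of_nat (Suc j) * L"
    by (simp add: H_def h_def G) (simp add: algebra_simps)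
  have "0 < Im (1 / z + of_nat (Suc j) * L) * Im (1 / z + L)"
    using 1 2 by (auto simp only: mult_less_0_iff zero_less_mult_iff)
  moreover have "Im (1 / z + L) \<noteq> 0" using 2 by (metis mult_zero_left less_irrefl)
  ultimately show "1 / z + L \<in> U (real j)" unfolding mem_U_iff 3 by blast
qed

text \<open>The defining formula links F and h only on some smaller domain. As a product equal to 1,
  without division by h, the relation is one between functions holomorphic in each variable on the
  whole domain; it extends by the identity theorem and then shows that h has no zeros.\<close>

lemma bifree_h_extend:
  assumes \<mu>: "borel_prob \<mu>" and F: "bifree_R_transform_on \<mu> \<alpha> \<beta> F" and ab: "0 < a" "a \<le> \<alpha>" "0 < b" "b \<le> \<beta>"
    and L: "R_transform_on (marginal1 \<mu>) a b L1" "R_transform_on (marginal2 \<mu>) a b L2"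
    and zw: "z \<in> stolz_double a b" "w \<in> stolz_double a b"
  shows "(1 + z * L1 z + w * L2 w - F (z, w)) * bifree_h \<mu> L1 L2 z w = 1"
proof -
  obtain a1 b1 Q1 Q2 where 1: "0 < a1" "a1 \<le> \<alpha>" "0 < b1" "b1 \<le> \<beta>"
    and Q: "R_transform_on (marginal1 \<mu>) a1 b1 Q1" "R_transform_on (marginal2 \<mu>) a1 b1 Q2"
    and F': "\<And>z w. z \<in> stolz_double a1 b1 \<Longrightarrow> w \<in> stolz_double a1 b1 \<Longrightarrow> bifree_h \<mu> Q1 Q2 z w \<noteq> 0 \<and>
      F (z, w) = z * Q1 z + w * Q2 w + (1 - 1 / bifree_h \<mu> Q1 Q2 z w)"
    using F by (rule bifree_R_transform_onE) blast
  note mb = borel_prob_marginal[OF \<mu>]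
  obtain c1 where c1: "0 < c1" "c1 \<le> b" "c1 \<le> b1" and e1: "\<And>z. z \<in> stolz_double (min a a1) c1 \<Longrightarrow> L1 z = Q1 z"
    by (rule R_transform_eq_near_0[OF mb(1) L(1) ab(1,3) Q(1) 1(1,3)]) blast
  obtain c2 where c2: "0 < c2" "c2 \<le> b" "c2 \<le> b1" and e2: "\<And>z. z \<in> stolz_double (min a a1) c2 \<Longrightarrow> L2 z = Q2 z"
    by (rule R_transform_eq_near_0[OF mb(2) L(2) ab(1,3) Q(2) 1(1,3)]) blast
  define a0 c where "a0 = min a a1" and "c = min c1 c2"
  have ac: "0 < a0" "a0 \<le> a" "a0 \<le> a1" "0 < c" "c \<le> b" "c \<le> b1" "c \<le> c1" "c \<le> c2" using ab 1 c1 c2 by (auto simp: a0_def c_def)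
  let ?f = "\<lambda>z w. (1 + z * L1 z + w * L2 w - F (z, w)) * bifree_h \<mu> L1 L2 z w"
  have F2: "holomorphic2_on F (product_domain \<alpha> \<beta>)" using F by (simp add: bifree_R_transform_on_def)
  have sub: "stolz_double a b \<subseteq> stolz_double \<alpha> \<beta>" by (rule stolz_double_mono[OF ab(2,4)])
  have hL: "L1 holomorphic_on stolz_double a b" "L2 holomorphic_on stolz_double a b" using L by (auto simp: R_transform_on_def)
  have nz: "z \<noteq> 0" if "z \<in> stolz_double a b" for z using that by (auto simp: mem_stolz_double)
  have im: "(\<lambda>z. 1 / z + L1 z) ` stolz_double a b \<subseteq> {z. Im z \<noteq> 0}" "(\<lambda>z. 1 / z + L2 z) ` stolz_double a b \<subseteq> {z. Im z \<noteq> 0}"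
    using R_transform_Im(1)[OF mb(1) L(1)] R_transform_Im(1)[OF mb(2) L(2)] by auto
  have hK: "(\<lambda>z. 1 / z + L1 z) holomorphic_on stolz_double a b" "(\<lambda>z. 1 / z + L2 z) holomorphic_on stolz_double a b"
    using nz by (auto intro!: holomorphic_intros hL)
  show ?thesis
  proof (rule stolz_double_identity2[of a b ?f a0 c 1 z w])
    fix w assume w: "w \<in> stolz_double a b"
    have Iw: "Im (1 / w + L2 w) \<noteq> 0" "Im (1 / w + L1 w) \<noteq> 0" using im w by auto
    have "(\<lambda>z. cauchy_transform2 \<mu> (1 / z + L1 z) (1 / w + L2 w)) holomorphic_on stolz_double a b"
      using holomorphic_on_compose_gen[OF hK(1) cauchy_transform2_holomorphic(1)[OF \<mu> Iw(1)] im(1)] by (simp add: o_def)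
    thus "(\<lambda>z. ?f z w) holomorphic_on stolz_double a b"
      unfolding bifree_h_def using sub w nz
      by (intro holomorphic_intros hL holomorphic2_on_slices(1)[OF F2]) (auto simp: product_domain_def)
    have "(\<lambda>z. cauchy_transform2 \<mu> (1 / w + L1 w) (1 / z + L2 z)) holomorphic_on stolz_double a b"
      using holomorphic_on_compose_gen[OF hK(2) cauchy_transform2_holomorphic(2)[OF \<mu> Iw(2)] im(2)] by (simp add: o_def)
    thus "?f w holomorphic_on stolz_double a b"
      unfolding bifree_h_def using sub w nz
      by (intro holomorphic_intros hL holomorphic2_on_slices(2)[OF F2]) (auto simp: product_domain_def)
  next
    fix z w assume z: "z \<in> stolz_double a0 c" and w: "w \<in> stolz_double a0 c"
    have in1: "z \<in> stolz_double a1 b1" "w \<in> stolz_double a1 b1" using z w stolz_double_mono[OF ac(3,6)] by auto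
    have "z \<in> stolz_double (min a a1) c1" "w \<in> stolz_double (min a a1) c2"
      using z w stolz_double_mono[OF order_refl ac(7), of a0] stolz_double_mono[OF order_refl ac(8), of a0] by (auto simp: a0_def)
    hence e: "L1 z = Q1 z" "L2 w = Q2 w" using e1 e2 by auto
    have h: "bifree_h \<mu> L1 L2 z w = bifree_h \<mu> Q1 Q2 z w" by (simp add: bifree_h_def e)
    show "?f z w = 1" using F'[OF in1] unfolding h e by simp
  qed (use ac zw in auto)
qed

text \<open>The exponents are merely unbounded; the limit argument needs a subsequence along which
  they tend to infinity.\<close>

lemma strict_mono_unbounded:
  assumes "\<not> bdd_above (range (k :: nat \<Rightarrow> nat))"
  obtains s where "strict_mono s" "\<And>n. n \<le> k (s n)"
proof -
  have big: "\<exists>j>N. n \<le> k j" for N n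
  proof (rule ccontr)
    assume "\<not> (\<exists>j>N. n \<le> k j)"
    hence "k j \<le> max n (Max (k ` {..N}))" for j
      by (cases "j \<le> N") (auto simp: not_le le_max_iff_disj intro: less_imp_le)
    thus False using assms by (auto simp: bdd_above_def)
  qed
  have "\<exists>s. \<forall>n. n \<le> k (s n) \<and> s n < s (Suc n)"
    by (rule dependent_nat_choice) (use big in blast)+
  thus thesis using that by (auto simp: strict_mono_Suc_iff)
qed

lemma weak_conv_m_subseq: "weak_conv_m M m \<Longrightarrow> strict_mono s \<Longrightarrow> weak_conv_m (\<lambda>n. M (s n)) m"
  unfolding weak_conv_m_def weak_conv_def using LIMSEQ_subseq_LIMSEQ by (fastforce simp: o_def)

lemma div_ratio_tendsto:
  assumes k: "filterlim (k :: nat \<Rightarrow> nat) at_top sequentially" and m: "0 < m"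
  shows "(\<lambda>n. real (k n div m) / real (k n)) \<longlonglongrightarrow> 1 / real m"
proof -
  have "(\<lambda>n. inverse (real (k n))) \<longlonglongrightarrow> 0"
    by (intro tendsto_inverse_0_at_top filterlim_compose[OF filterlim_real_sequentially k])
  moreover have "\<forall>\<^sub>F n in sequentially. norm (real (k n div m) / real (k n) - 1 / real m) \<le> inverse (real (k n))"
    using eventually_compose_filterlim[OF eventually_gt_at_top[of 0] k]
  proof eventually_elim
    case (elim n)
    have "real (k n) = real (k n div m) * real m + real (k n mod m)"
      by (metis of_nat_add of_nat_mult div_mult_mod_eq)
    hence "real (k n div m) / real (k n) - 1 / real m = - (real (k n mod m) / real m * inverse (real (k n)))"
      using elim m by (simp add: field_simps)
    moreover have "real (k n mod m) / real m * inverse (real (k n)) \<le> 1 * inverse (real (k n))"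
      using m by (intro mult_right_mono) (simp_all add: less_imp_le)
    ultimately show ?case by simp
  qed
  ultimately have "(\<lambda>n. real (k n div m) / real (k n) - 1 / real m) \<longlonglongrightarrow> 0" by (rule Lim_null_comparison[rotated])
  thus ?thesis by (rule LIM_zero_cancel)
qed

text \<open>The approximate roots \<sigma> are powers of order k div m, and their h-relations pass
  to the limit in product form. The limit law has the marginal R-transforms R1 / m and R2 / m on a
  small domain, while R / m is already holomorphic on the large one, as the definition of an
  extension requires.\<close>

lemma limit_law_root:
  assumes \<nu>: "borel_prob \<nu>" and ab: "0 < \<alpha>" "0 < \<beta>" and R: "bifree_R_transform_on \<nu> \<alpha> \<beta> R" and m: "0 < m"
    and \<mu>: "\<And>n. borel_prob (\<mu> n)" and k: "filterlim k at_top sequentially" "\<And>n. m \<le> k n"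
    and conv1: "weak_conv_m (\<lambda>n. free_conv_power (marginal1 (\<mu> n)) (k n)) (marginal1 \<nu>)"
    and conv2: "weak_conv_m (\<lambda>n. free_conv_power (marginal2 (\<mu> n)) (k n)) (marginal2 \<nu>)"
    and F: "\<And>n. bifree_R_transform_on (\<mu> n) \<alpha> \<beta> (F n)"
    and lim: "\<And>p. p \<in> product_domain \<alpha> \<beta> \<Longrightarrow> (\<lambda>n. of_nat (k n) * F n p) \<longlonglongrightarrow> R p"
  obtains \<nu>' where "borel_prob \<nu>'" "bifree_R_transform_on \<nu>' \<alpha> \<beta> (\<lambda>p. R p / of_nat m)"
proof -
  obtain a b0 R1 R2 where a: "0 < a" "a \<le> \<alpha>" "0 < b0" "b0 \<le> \<beta>"
    and R12: "R_transform_on (marginal1 \<nu>) a b0 R1" "R_transform_on (marginal2 \<nu>) a b0 R2"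
    and R': "\<And>z w. z \<in> stolz_double a b0 \<Longrightarrow> w \<in> stolz_double a b0 \<Longrightarrow> bifree_h \<nu> R1 R2 z w \<noteq> 0 \<and>
      R (z, w) = z * R1 z + w * R2 w + (1 - 1 / bifree_h \<nu> R1 R2 z w)"
    using R by (rule bifree_R_transform_onE) blast
  note mb = borel_prob_marginal[OF \<mu>] and nb = borel_prob_marginal[OF \<nu>]
  have k0: "0 < k n" for n using k(2)[of n] m by simp
  have Q: "\<exists>a b Q. 0 < a \<and> 0 < b \<and> R_transform_on (marginal1 (\<mu> n)) a b Q" "\<exists>a b Q. 0 < a \<and> 0 < b \<and> R_transform_on (marginal2 (\<mu> n)) a b Q" for n
    using F[of n] by (rule bifree_R_transform_onE; blast)+
  obtain b1 N1 L1 where b1: "0 < b1" "b1 \<le> b0" and L1: "\<And>n. N1 \<le> n \<Longrightarrow> R_transform_on (marginal1 (\<mu> n)) a b1 (L1 n)"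
    and I1: "\<And>n z. N1 \<le> n \<Longrightarrow> z \<in> stolz_double a b1 \<Longrightarrow> Im (1 / z + of_nat (k n) * L1 n z) * Im z < 0"
    and l1: "\<And>z. z \<in> stolz_double a b1 \<Longrightarrow> (\<lambda>n. of_nat (k n) * L1 n z) \<longlonglongrightarrow> R1 z"
    by (rule free_conv_root_R_transform[OF mb(1) nb(1) Q(1) k0 conv1 R12(1) a(1,3)]) blast
  obtain b2 N2 L2 where b2: "0 < b2" "b2 \<le> b0" and L2: "\<And>n. N2 \<le> n \<Longrightarrow> R_transform_on (marginal2 (\<mu> n)) a b2 (L2 n)"
    and I2: "\<And>n z. N2 \<le> n \<Longrightarrow> z \<in> stolz_double a b2 \<Longrightarrow> Im (1 / z + of_nat (k n) * L2 n z) * Im z < 0"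
    and l2: "\<And>z. z \<in> stolz_double a b2 \<Longrightarrow> (\<lambda>n. of_nat (k n) * L2 n z) \<longlonglongrightarrow> R2 z"
    by (rule free_conv_root_R_transform[OF mb(2) nb(2) Q(2) k0 conv2 R12(2) a(1,3)]) blast
  define b where "b = min b1 b2"
  have b: "0 < b" "b \<le> b1" "b \<le> b2" "b \<le> b0" "b \<le> \<beta>" using b1 b2 a by (auto simp: b_def)
  define Z where "Z = stolz_double a b"
  have Z: "z \<in> stolz_double a b1" "z \<in> stolz_double a b2" "z \<in> stolz_double a b0" "z \<in> stolz_double \<alpha> \<beta>" "Im z \<noteq> 0" "z \<noteq> 0" if "z \<in> Z" for z
  proof -
    have z: "z \<in> stolz_double a b" using that by (simp add: Z_def)
    show "z \<in> stolz_double a b1" "z \<in> stolz_double a b2" "z \<in> stolz_double a b0" "z \<in> stolz_double \<alpha> \<beta>"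
      using z stolz_double_mono[OF order_refl b(2), of a] stolz_double_mono[OF order_refl b(3), of a]
        stolz_double_mono[OF order_refl b(4), of a] stolz_double_mono[OF a(2) b(5)] by blast+
    show "Im z \<noteq> 0" using z by (simp add: mem_stolz_double)
    thus "z \<noteq> 0" by auto
  qed
  define N where "N = max N1 N2"
  define i where "i n = n + N" for n :: nat
  have i: "N1 \<le> i n" "N2 \<le> i n" for n by (auto simp: i_def N_def)
  have shift: "(\<lambda>n. f (i n)) \<longlonglongrightarrow> l" if "f \<longlonglongrightarrow> l" for f :: "nat \<Rightarrow> 'c :: topological_space" and l
    unfolding i_def by (rule LIMSEQ_ignore_initial_segment[OF that])
  \<comment> \<open>\<open>planar_power\<close> with parameter \<kappa> gives the exponent \<kappa>
    + 1, hence the predecessor; m <= k makes the exponent positive.\<close>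
  define j where "j n = k (i n) div m - 1" for n
  have j: "Suc (j n) = k (i n) div m" for n using k(2)[of "i n"] m div_greater_zero_iff[of "k (i n)" m] by (simp add: j_def)
  have jk: "Suc (j n) \<le> k (i n)" for n unfolding j by simp
  have ratio: "(\<lambda>n. real (Suc (j n)) / real (k (i n))) \<longlonglongrightarrow> 1 / real m"
    unfolding j by (rule shift[OF div_ratio_tendsto[OF k(1) m]])
  hence ratioc: "(\<lambda>n. of_real (real (Suc (j n)) / real (k (i n)))) \<longlonglongrightarrow> (of_real (1 / real m) :: complex)" by (rule tendsto_of_real)
  have scale: "of_nat (Suc (j n)) * x = of_real (real (Suc (j n)) / real (k (i n))) * (of_nat (k (i n)) * x)" for n and x :: complex
    using k0[of "i n"] by simp
  interpret P: planar_law "\<mu> n" for n using \<mu> by (rule planar_law.intro)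
  have "\<exists>\<sigma>. borel_prob \<sigma> \<and>
      (\<forall>w1 w2. w1 \<in> P.A.U (i n) (real (j n)) \<longrightarrow> w2 \<in> P.B.U (i n) (real (j n)) \<longrightarrow>
        cauchy_transform2 \<sigma> (P.A.H (i n) (real (j n)) w1) (P.B.H (i n) (real (j n)) w2) *
        (of_real (real (j n) + 1) - of_real (real (j n)) * (cauchy_transform2 (\<mu> (i n)) w1 w2 / (P.A.G (i n) w1 * P.B.G (i n) w2))) = cauchy_transform2 (\<mu> (i n)) w1 w2) \<and>
      (\<forall>w. w \<in> P.A.U (i n) (real (j n)) \<longrightarrow> real_rv.G \<sigma> fst (P.A.H (i n) (real (j n)) w) = P.A.G (i n) w) \<and>
      (\<forall>w. w \<in> P.B.U (i n) (real (j n)) \<longrightarrow> real_rv.G \<sigma> snd (P.B.H (i n) (real (j n)) w) = P.B.G (i n) w)" for n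
    by (rule P.planar_power[of "real (j n)" "i n"]) (simp, blast)
  then obtain \<sigma> where \<sigma>: "\<And>n. borel_prob (\<sigma> n)"
    and pw: "\<And>n w1 w2. w1 \<in> P.A.U (i n) (real (j n)) \<Longrightarrow> w2 \<in> P.B.U (i n) (real (j n)) \<Longrightarrow>
        cauchy_transform2 (\<sigma> n) (P.A.H (i n) (real (j n)) w1) (P.B.H (i n) (real (j n)) w2) *
        (of_real (real (j n) + 1) - of_real (real (j n)) * (cauchy_transform2 (\<mu> (i n)) w1 w2 / (P.A.G (i n) w1 * P.B.G (i n) w2))) = cauchy_transform2 (\<mu> (i n)) w1 w2"
    and pG1: "\<And>n w. w \<in> P.A.U (i n) (real (j n)) \<Longrightarrow> real_rv.G (\<sigma> n) fst (P.A.H (i n) (real (j n)) w) = P.A.G (i n) w"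
    and pG2: "\<And>n w. w \<in> P.B.U (i n) (real (j n)) \<Longrightarrow> real_rv.G (\<sigma> n) snd (P.B.H (i n) (real (j n)) w) = P.B.G (i n) w"
    by metis
  define \<zeta>1 where "\<zeta>1 n z = 1 / z + of_nat (Suc (j n)) * L1 (i n) z" for n z
  define \<zeta>2 where "\<zeta>2 n z = 1 / z + of_nat (Suc (j n)) * L2 (i n) z" for n z
  define K1 where "K1 z = 1 / z + R1 z / of_nat m" for z
  define K2 where "K2 z = 1 / z + R2 z / of_nat m" for z
  have G1: "P.A.G (i n) (1 / z + L1 (i n) z) = z" if z: "z \<in> Z" for n z
    using R_transform_Im(3)[OF mb(1) L1[OF i(1)] Z(1)[OF z]] G_marginal(1)[OF \<mu>] by simp
  have G2: "P.B.G (i n) (1 / z + L2 (i n) z) = z" if z: "z \<in> Z" for n z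
    using R_transform_Im(3)[OF mb(2) L2[OF i(2)] Z(2)[OF z]] G_marginal(2)[OF \<mu>] by simp
  note pt1 = P.A.power_point[OF Z(5) G1 I1[OF i(1) Z(1)] jk, folded \<zeta>1_def]
  note pt2 = P.B.power_point[OF Z(5) G2 I2[OF i(2) Z(2)] jk, folded \<zeta>2_def]
  \<comment> \<open>This is 1 / h - 1 for the law \<open>\<mu> (i n)\<close>: passing to the power
    multiplies it by j + 1, and the hypotheses control its product with k.\<close>
  define \<epsilon> where "\<epsilon> n z w = z * L1 (i n) z + w * L2 (i n) w - F (i n) (z, w)" for n z w
  have g: "cauchy_transform2 (\<sigma> n) (\<zeta>1 n z) (\<zeta>2 n w) / (z * w) * (1 + of_nat (Suc (j n)) * \<epsilon> n z w) = 1" if z: "z \<in> Z" and w: "w \<in> Z" for n z w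
  proof -
    define h where "h = bifree_h (\<mu> (i n)) (L1 (i n)) (L2 (i n)) z w"
    have "(1 + z * L1 (i n) z + w * L2 (i n) w - F (i n) (z, w)) * h = 1" unfolding h_def
      by (rule bifree_h_extend[OF \<mu> F a(1,2) b(1,5) R_transform_on_mono[OF L1[OF i(1)] order_refl b(2)] R_transform_on_mono[OF L2[OF i(2)] order_refl b(3)]])
         (use z w in \<open>auto simp: Z_def\<close>)
    hence eh: "(1 + \<epsilon> n z w) * h = 1" by (simp add: \<epsilon>_def algebra_simps)
    have ct: "cauchy_transform2 (\<mu> (i n)) (1 / z + L1 (i n) z) (1 / w + L2 (i n) w) = h * (z * w)"
      using Z(6)[OF z] Z(6)[OF w] by (simp add: h_def bifree_h_def)
    define q where "q = cauchy_transform2 (\<sigma> n) (\<zeta>1 n z) (\<zeta>2 n w) / (z * w)"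
    have cq: "cauchy_transform2 (\<sigma> n) (\<zeta>1 n z) (\<zeta>2 n w) = q * (z * w)"
      using Z(6)[OF z] Z(6)[OF w] by (simp add: q_def)
    have "q * (z * w) * (of_real (real (j n) + 1) - of_real (real (j n)) * (h * (z * w) / (z * w))) = h * (z * w)"
      using pw[OF pt1(2)[OF z z z, of n] pt2(2)[OF w w w, of n]] unfolding pt1(3)[OF z z z] pt2(3)[OF w w w] G1[OF z] G2[OF w] ct cq .
    hence *: "q * (z * w) * (of_nat (j n) + 1 - of_nat (j n) * (h * (z * w) / (z * w))) = h * (z * w)"
      by (simp only: of_real_add of_real_of_nat_eq of_real_1)
    have **: "z * w \<noteq> 0" using Z(6)[OF z] Z(6)[OF w] by simp
    have "q * (1 + (J + 1) * e) = 1" if "q * c * (J + 1 - J * (h * c / c)) = h * c" "c \<noteq> 0" "(1 + e) * h = 1" for J c e :: complex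
    proof -
      have "(q * (J + 1 - J * h)) * c = h * c" using that(1,2) by (simp add: mult.assoc mult.commute[of c])
      hence qh: "q * (J + 1 - J * h) = h" using that(2) by simp
      have "q * (1 + (J + 1) * e) = (q * (J + 1 - J * h)) * (1 + e) + q * J * ((1 + e) * h - 1)" by (simp add: algebra_simps)
      also have "\<dots> = h * (1 + e)" unfolding qh that(3) by simp
      also have "\<dots> = 1" using that(3) by (simp only: mult.commute)
      finally show ?thesis .
    qed
    from this[OF * ** eh] have "q * (1 + (of_nat (j n) + 1) * \<epsilon> n z w) = 1" .
    thus ?thesis by (simp add: q_def add.commute)
  qed
  have \<epsilon>_lim: "(\<lambda>n. of_nat (Suc (j n)) * \<epsilon> n z w) \<longlonglongrightarrow> (z * R1 z + w * R2 w - R (z, w)) / of_nat m" if z: "z \<in> Z" and w: "w \<in> Z" for z w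
  proof -
    have "(\<lambda>n. of_real (real (Suc (j n)) / real (k (i n))) *
        (z * (of_nat (k (i n)) * L1 (i n) z) + w * (of_nat (k (i n)) * L2 (i n) w) - of_nat (k (i n)) * F (i n) (z, w))) \<longlonglongrightarrow>
        of_real (1 / real m) * (z * R1 z + w * R2 w - R (z, w))"
      using Z(4)[OF z] Z(4)[OF w]
      by (intro tendsto_intros ratioc shift[OF l1[OF Z(1)[OF z]]] shift[OF l2[OF Z(2)[OF w]]] shift[OF lim]) (simp add: product_domain_def)
    moreover have eq: "of_nat (Suc (j n)) * \<epsilon> n z w = of_real (real (Suc (j n)) / real (k (i n))) *
        (z * (of_nat (k (i n)) * L1 (i n) z) + w * (of_nat (k (i n)) * L2 (i n) w) - of_nat (k (i n)) * F (i n) (z, w))" for n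
      unfolding scale \<epsilon>_def by (rule arg_cong[where f = "\<lambda>x. _ * x"]) (simp add: algebra_simps)
    ultimately show ?thesis unfolding eq by simp
  qed
  have \<zeta>1_lim: "(\<lambda>n. \<zeta>1 n z) \<longlonglongrightarrow> K1 z" if z: "z \<in> Z" for z
  proof -
    have "(\<lambda>n. 1 / z + of_real (real (Suc (j n)) / real (k (i n))) * (of_nat (k (i n)) * L1 (i n) z)) \<longlonglongrightarrow> 1 / z + of_real (1 / real m) * R1 z"
      by (intro tendsto_intros ratioc shift[OF l1[OF Z(1)[OF z]]])
    thus ?thesis unfolding \<zeta>1_def scale by (simp add: K1_def)
  qed
  have \<zeta>2_lim: "(\<lambda>n. \<zeta>2 n z) \<longlonglongrightarrow> K2 z" if z: "z \<in> Z" for z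
  proof -
    have "(\<lambda>n. 1 / z + of_real (real (Suc (j n)) / real (k (i n))) * (of_nat (k (i n)) * L2 (i n) z)) \<longlonglongrightarrow> 1 / z + of_real (1 / real m) * R2 z"
      by (intro tendsto_intros ratioc shift[OF l2[OF Z(2)[OF z]]])
    thus ?thesis unfolding \<zeta>2_def scale by (simp add: K2_def)
  qed
  have m1: "0 \<le> 1 / real m" "1 / real m \<le> 1" using m by auto
  have Im_K: "Im (K1 z) \<noteq> 0" "Im (K2 z) \<noteq> 0" if z: "z \<in> Z" for z
    using Im_convex_inverse[OF Z(5)[OF z] R_transform_Im(2)[OF nb(1) R12(1) Z(3)[OF z]] m1]
      Im_convex_inverse[OF Z(5)[OF z] R_transform_Im(2)[OF nb(2) R12(2) Z(3)[OF z]] m1]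
    by (auto simp: K1_def K2_def)
  obtain c1 where c1: "0 < c1" "c1 \<le> b0" and cb1: "\<And>z. z \<in> stolz_double a c1 \<Longrightarrow> 1 / z + R1 z \<in> cball (1 / z) (\<bar>Im (1 / z)\<bar> / 2)"
    by (rule R_transform_cball[OF R12(1) a(1,3)]) blast
  obtain c2 where c2: "0 < c2" "c2 \<le> b0" and cb2: "\<And>z. z \<in> stolz_double a c2 \<Longrightarrow> 1 / z + R2 z \<in> cball (1 / z) (\<bar>Im (1 / z)\<bar> / 2)"
    by (rule R_transform_cball[OF R12(2) a(1,3)]) blast
  define c where "c = min b (min c1 c2)"
  have c: "0 < c" "c \<le> b" "c \<le> c1" "c \<le> c2" using b c1 c2 by (auto simp: c_def)
  \<comment> \<open>Points of the imaginary axis tending to 0, close enough to 0 for the ball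
    condition of both marginals.\<close>
  define u where "u n = Complex 0 (c / real (n + 2))" for n
  have u_pos: "0 < c / real (n + 2)" "c / real (n + 2) < c" for n
    using c(1) divide_strict_left_mono[of 1 "real (n + 2)" c] by simp_all
  have uc: "u n \<in> stolz_double a c" for n unfolding u_def using stolz_point[OF a(1) u_pos] by blast
  have u: "u n \<in> Z" "u n \<in> stolz_double a c1" "u n \<in> stolz_double a c2" for n
    using uc[of n] stolz_double_mono[OF order_refl c(2), of a] stolz_double_mono[OF order_refl c(3), of a] stolz_double_mono[OF order_refl c(4), of a]
    unfolding Z_def by auto
  have Iu: "\<bar>Im (1 / u n)\<bar> = real (n + 2) / c" for n
    using c(1) by (simp add: u_def Im_divide power2_eq_square)
  have scaled_cball: "1 / z + x / of_nat m \<in> cball (1 / z) r" if "1 / z + x \<in> cball (1 / z) r" for z x :: complex and r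
  proof -
    have "cmod x / real m \<le> cmod x" using m by (simp add: divide_le_eq mult_le_cancel_left1)
    thus ?thesis using that by (simp add: dist_norm norm_divide)
  qed
  have K1_cb: "K1 (u n) \<in> cball (1 / u n) (\<bar>Im (1 / u n)\<bar> / 2)" for n unfolding K1_def by (rule scaled_cball[OF cb1[OF u(2)]])
  have K2_cb: "K2 (u n) \<in> cball (1 / u n) (\<bar>Im (1 / u n)\<bar> / 2)" for n unfolding K2_def by (rule scaled_cball[OF cb2[OF u(3)]])
  note cc1 = cone_cball[OF Im_inverse_stolz(2,1)[OF uc a(1)] K1_cb less_imp_le[OF a(1)]]
  note cc2 = cone_cball[OF Im_inverse_stolz(2,1)[OF uc a(1)] K2_cb less_imp_le[OF a(1)]]
  have top: "filterlim (\<lambda>n. real (n + 2) / c / 2) at_top sequentially" using c(1) by real_asymp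
  have top1: "filterlim (\<lambda>n. \<bar>Im (K1 (u n))\<bar>) at_top sequentially"
    by (rule filterlim_at_top_mono[OF top]) (use cc1(4) Iu in auto)
  have top2: "filterlim (\<lambda>n. \<bar>Im (K2 (u n))\<bar>) at_top sequentially"
    by (rule filterlim_at_top_mono[OF top]) (use cc2(4) Iu in auto)
  have u0: "filterlim u (at 0 within stolz_double a b0) sequentially"
    unfolding filterlim_at
  proof
    show "\<forall>\<^sub>F n in sequentially. u n \<in> stolz_double a b0 \<and> u n \<noteq> 0"
      using Z(3,6)[OF u(1)] by simp
    have "(\<lambda>n. c / real (n + 2)) \<longlonglongrightarrow> 0" by real_asymp
    hence "u \<longlonglongrightarrow> Complex 0 0" unfolding u_def by (intro tendsto_intros)
    thus "u \<longlonglongrightarrow> 0" by (simp add: zero_complex.code)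
  qed
  have Ku: "(\<lambda>n. (1 / u n + Q (u n) / of_nat m) * u n) \<longlonglongrightarrow> 1" if "R_transform_on M' a b0 Q" for Q M'
  proof -
    have "(\<lambda>n. 1 + (u n * Q (u n)) / of_nat m) \<longlonglongrightarrow> 1 + 0 / of_nat m"
      using that m unfolding R_transform_on_def by (intro tendsto_intros filterlim_compose[OF _ u0]) auto
    moreover have "(1 / u n + Q (u n) / of_nat m) * u n = 1 + (u n * Q (u n)) / of_nat m" for n
      using Z(6)[OF u(1), of n] unfolding distrib_right by (simp add: mult.commute)
    ultimately show ?thesis by simp
  qed
  obtain r \<nu>' where r: "strict_mono r" and \<nu>': "borel_prob \<nu>'"
    and N1: "\<And>z. z \<in> Z \<Longrightarrow> real_rv.G \<nu>' fst (K1 z) = z" and N2: "\<And>z. z \<in> Z \<Longrightarrow> real_rv.G \<nu>' snd (K2 z) = z"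
    and N12: "\<And>z w. z \<in> Z \<Longrightarrow> w \<in> Z \<Longrightarrow> (\<lambda>n. cauchy_transform2 (\<sigma> (r n)) (\<zeta>1 (r n) z) (\<zeta>2 (r n) w)) \<longlonglongrightarrow> cauchy_transform2 \<nu>' (K1 z) (K2 w)"
  proof (rule planar_laws_compact[of \<sigma> Z \<zeta>1 K1 \<zeta>2 K2 u "2 * a + 1"])
    show "borel_prob (\<sigma> n)" for n by (rule \<sigma>)
    fix n z assume z: "z \<in> Z"
    show "Im (\<zeta>1 n z) \<noteq> 0" "Im (\<zeta>2 n z) \<noteq> 0" using pt1(1)[OF z z z, of n] pt2(1)[OF z z z, of n] by auto
    show "real_rv.G (\<sigma> n) fst (\<zeta>1 n z) = z" using pG1[OF pt1(2)[OF z z z]] unfolding pt1(3)[OF z z z] G1[OF z] .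
    show "real_rv.G (\<sigma> n) snd (\<zeta>2 n z) = z" using pG2[OF pt2(2)[OF z z z]] unfolding pt2(3)[OF z z z] G2[OF z] .
  next
    show "(\<lambda>j. K1 (u j) * u j) \<longlonglongrightarrow> 1" "(\<lambda>j. K2 (u j) * u j) \<longlonglongrightarrow> 1"
      using Ku[OF R12(1)] Ku[OF R12(2)] by (simp_all add: K1_def K2_def)
  qed (use \<zeta>1_lim \<zeta>2_lim Im_K u(1) cc1(3) cc2(3) top1 top2 in blast)+
  note nb' = borel_prob_marginal[OF \<nu>']
  have RT: "R_transform_on M a b (\<lambda>z. Q z / of_nat m)"
    if M: "borel_prob M" and Q: "R_transform_on M' a b0 Q" and K: "\<And>z. z \<in> Z \<Longrightarrow> Im (1 / z + Q z / of_nat m) \<noteq> 0 \<and> real_rv.G M (\<lambda>x. x) (1 / z + Q z / of_nat m) = z" for M M' Q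
  proof -
    have Q': "R_transform_on M' a b Q" by (rule R_transform_on_mono[OF Q order_refl b(4)])
    show ?thesis unfolding R_transform_on_def
    proof (intro conjI ballI)
      show "(\<lambda>z. Q z / of_nat m) holomorphic_on stolz_double a b"
        using Q' m unfolding R_transform_on_def by (intro holomorphic_intros) auto
      have "((\<lambda>z. (z * Q z) / of_nat m) \<longlongrightarrow> 0 / of_nat m) (at 0 within stolz_double a b)"
        using Q' m unfolding R_transform_on_def by (intro tendsto_intros) auto
      thus "((\<lambda>z. z * (Q z / of_nat m)) \<longlongrightarrow> 0) (at 0 within stolz_double a b)" by simp
      fix z assume "z \<in> stolz_double a b"
      hence z: "z \<in> Z" by (simp add: Z_def)
      show "1 / z + Q z / of_nat m \<notin> \<real>" using K[OF z] by (simp add: complex_is_Real_iff)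
      show "cauchy_transform M (1 / z + Q z / of_nat m) = z" using K[OF z] by (simp add: cauchy_transform_eq[OF M])
    qed
  qed
  have T1: "R_transform_on (marginal1 \<nu>') a b (\<lambda>z. R1 z / of_nat m)"
    by (rule RT[OF nb'(1) R12(1)]) (use Im_K(1) N1 in \<open>auto simp: K1_def G_marginal[OF \<nu>']\<close>)
  have T2: "R_transform_on (marginal2 \<nu>') a b (\<lambda>z. R2 z / of_nat m)"
    by (rule RT[OF nb'(2) R12(2)]) (use Im_K(2) N2 in \<open>auto simp: K2_def G_marginal[OF \<nu>']\<close>)
  \<comment> \<open>The product form survives the limit and yields that h is nonzero, which the
    definition of the R-transform demands.\<close>
  have h1: "bifree_h \<nu>' (\<lambda>z. R1 z / of_nat m) (\<lambda>z. R2 z / of_nat m) z w * (1 + (z * R1 z + w * R2 w - R (z, w)) / of_nat m) = 1"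
    if z: "z \<in> Z" and w: "w \<in> Z" for z w
  proof -
    have "(\<lambda>n. cauchy_transform2 (\<sigma> (r n)) (\<zeta>1 (r n) z) (\<zeta>2 (r n) w) / (z * w) * (1 + of_nat (Suc (j (r n))) * \<epsilon> (r n) z w)) \<longlonglongrightarrow>
        cauchy_transform2 \<nu>' (K1 z) (K2 w) / (z * w) * (1 + (z * R1 z + w * R2 w - R (z, w)) / of_nat m)"
      by (intro tendsto_mult tendsto_divide tendsto_add tendsto_const N12[OF z w] LIMSEQ_subseq_LIMSEQ[OF \<epsilon>_lim[OF z w] r, unfolded o_def])
         (use Z(6)[OF z] Z(6)[OF w] in simp)
    thus ?thesis unfolding g[OF z w] by (simp add: LIMSEQ_const_iff bifree_h_def K1_def K2_def)
  qed
  have "bifree_R_transform_on \<nu>' \<alpha> \<beta> (\<lambda>p. R p / of_nat m)"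
    unfolding bifree_R_transform_on_def
  proof (rule conjI, unfold holomorphic2_on_def, rule ballI)
    fix p assume "p \<in> product_domain \<alpha> \<beta>"
    then obtain d e where "(R has_derivative (\<lambda>v. d * fst v + e * snd v)) (at p)"
      using R unfolding bifree_R_transform_on_def holomorphic2_on_def by blast
    hence "((\<lambda>p. R p * (1 / of_nat m)) has_derivative (\<lambda>v. (d * fst v + e * snd v) * (1 / of_nat m))) (at p)"
      by (rule has_derivative_mult_left)
    thus "\<exists>d e. ((\<lambda>p. R p / of_nat m) has_derivative (\<lambda>v. d * fst v + e * snd v)) (at p)"
      by (intro exI[of _ "d / of_nat m"] exI[of _ "e / of_nat m"]) (simp add: add_divide_distrib)
  next
    have "\<forall>(z, w)\<in>product_domain a b. bifree_h \<nu>' (\<lambda>z. R1 z / of_nat m) (\<lambda>z. R2 z / of_nat m) z w \<noteq> 0 \<and>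
      R (z, w) / of_nat m = z * (R1 z / of_nat m) + w * (R2 w / of_nat m) + (1 - 1 / bifree_h \<nu>' (\<lambda>z. R1 z / of_nat m) (\<lambda>z. R2 z / of_nat m) z w)"
    proof clarify
      fix z w assume "(z, w) \<in> product_domain a b"
      hence zw: "z \<in> Z" "w \<in> Z" by (auto simp: product_domain_def Z_def)
      define h where "h = bifree_h \<nu>' (\<lambda>z. R1 z / of_nat m) (\<lambda>z. R2 z / of_nat m) z w"
      have hh: "h * (1 + (z * R1 z + w * R2 w - R (z, w)) / of_nat m) = 1" using h1[OF zw] by (simp add: h_def)
      hence h0: "h \<noteq> 0" by auto
      have "1 / h = 1 + (z * R1 z + w * R2 w - R (z, w)) / of_nat m"
        unfolding nonzero_divide_eq_eq[OF h0] by (subst mult.commute) (rule hh[symmetric])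
      hence "R (z, w) / of_nat m = z * (R1 z / of_nat m) + w * (R2 w / of_nat m) + (1 - 1 / h)"
        by (simp add: add_divide_distrib diff_divide_distrib)
      with h0 show "bifree_h \<nu>' (\<lambda>z. R1 z / of_nat m) (\<lambda>z. R2 z / of_nat m) z w \<noteq> 0 \<and>
        R (z, w) / of_nat m = z * (R1 z / of_nat m) + w * (R2 w / of_nat m) + (1 - 1 / bifree_h \<nu>' (\<lambda>z. R1 z / of_nat m) (\<lambda>z. R2 z / of_nat m) z w)"
        by (simp add: h_def)
    qed
    note 1 = conjI[OF a(1) conjI[OF a(2) conjI[OF b(1) conjI[OF b(5) conjI[OF T1 conjI[OF T2 this]]]]]]
    show "\<exists>\<alpha>' \<beta>' R1 R2. 0 < \<alpha>' \<and> \<alpha>' \<le> \<alpha> \<and> 0 < \<beta>' \<and> \<beta>' \<le> \<beta> \<and>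
        R_transform_on (marginal1 \<nu>') \<alpha>' \<beta>' R1 \<and> R_transform_on (marginal2 \<nu>') \<alpha>' \<beta>' R2 \<and>
        (\<forall>(z, w)\<in>product_domain \<alpha>' \<beta>'. bifree_h \<nu>' R1 R2 z w \<noteq> 0 \<and>
           R (z, w) / of_nat m = z * R1 z + w * R2 w + (1 - 1 / bifree_h \<nu>' R1 R2 z w))"
      by (rule exI, rule exI, rule exI, rule exI) (rule 1)
  qed
  with \<nu>' show thesis by (rule that)
qed

theorem theorem3p9:
  fixes \<nu> :: "(real \<times> real) measure" and \<alpha> \<beta> :: real
    and R\<^sub>\<nu> :: "complex \<times> complex \<Rightarrow> complex"
  assumes "borel_prob \<nu>" and "0 < \<alpha>" and "0 < \<beta>"
    and "bifree_R_transform_on \<nu> \<alpha> \<beta> R\<^sub>\<nu>"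
  shows "bifree_infinitely_divisible \<nu> \<alpha> \<beta> R\<^sub>\<nu> \<longleftrightarrow>
    (\<exists>(\<mu> :: nat \<Rightarrow> (real \<times> real) measure) (k :: nat \<Rightarrow> nat).
       (\<forall>n. borel_prob (\<mu> n)) \<and>
       (\<forall>n. 0 < k n) \<and> \<not> bdd_above (range k) \<and>
       weak_conv_m (\<lambda>n. free_conv_power (marginal1 (\<mu> n)) (k n)) (marginal1 \<nu>) \<and>
       weak_conv_m (\<lambda>n. free_conv_power (marginal2 (\<mu> n)) (k n)) (marginal2 \<nu>) \<and>
       (\<exists>F :: nat \<Rightarrow> complex \<times> complex \<Rightarrow> complex.
          (\<forall>n. bifree_R_transform_on (\<mu> n) \<alpha> \<beta> (F n)) \<and>
          (\<forall>p\<in>product_domain \<alpha> \<beta>. (\<lambda>n. of_nat (k n) * F n p) \<longlonglongrightarrow> R\<^sub>\<nu> p)))"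
    (is "?L \<longleftrightarrow> ?R")
proof
  assume ?L
  thus ?R by (rule bifree_infinitely_divisible_limit[OF assms(1-3)])
next
  assume ?R
  then obtain \<mu> k F where *: "\<forall>n. borel_prob (\<mu> n)" and k: "\<not> bdd_above (range k)"
    and conv: "weak_conv_m (\<lambda>n. free_conv_power (marginal1 (\<mu> n)) (k n)) (marginal1 \<nu>)"
      "weak_conv_m (\<lambda>n. free_conv_power (marginal2 (\<mu> n)) (k n)) (marginal2 \<nu>)"
    and **: "\<forall>n. bifree_R_transform_on (\<mu> n) \<alpha> \<beta> (F n)"
      "\<forall>p\<in>product_domain \<alpha> \<beta>. (\<lambda>n. of_nat (k n) * F n p) \<longlonglongrightarrow> R\<^sub>\<nu> p"
    by (elim exE conjE) (rule that)
  note \<mu> = *[rule_format] and F = **(1)[rule_format] and lim = **(2)[rule_format]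
  obtain s where s: "strict_mono s" and ks: "\<And>n. n \<le> k (s n)" by (rule strict_mono_unbounded[OF k]) blast
  show ?L unfolding bifree_infinitely_divisible_def
  proof (intro conjI allI impI)
    fix m :: nat assume m: "2 \<le> m"
    \<comment> \<open>The shift by m ensures m <= k (t n), so that k (t n) div m is
      positive.\<close>
    define t where "t n = s (n + m)" for n
    have t: "strict_mono t" using s unfolding t_def strict_mono_def by simp
    have kt: "m \<le> k (t n)" "n \<le> k (t n)" for n using ks[of "n + m"] by (auto simp: t_def)
    have top: "filterlim (\<lambda>n. k (t n)) at_top sequentially"
      by (rule filterlim_at_top_mono[OF filterlim_ident]) (simp add: kt)
    have m0: "0 < m" using m by simp
    obtain \<nu>' where "borel_prob \<nu>'" "bifree_R_transform_on \<nu>' \<alpha> \<beta> (\<lambda>p. R\<^sub>\<nu> p / of_nat m)"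
      by (rule limit_law_root[OF assms m0 \<mu> top kt(1) weak_conv_m_subseq[OF conv(1) t] weak_conv_m_subseq[OF conv(2) t] F
           LIMSEQ_subseq_LIMSEQ[OF lim t, unfolded o_def]]) blast+
    thus "\<exists>\<mu> F. borel_prob \<mu> \<and> bifree_R_transform_on \<mu> \<alpha> \<beta> F \<and> (\<forall>p\<in>product_domain \<alpha> \<beta>. R\<^sub>\<nu> p = of_nat m * F p)"
      using m by (intro exI[of _ \<nu>'] exI[of _ "\<lambda>p. R\<^sub>\<nu> p / of_nat m"]) auto
  qed (rule assms(4))
qed

end
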